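(* The adjunction $L_c^{\Delta[1]}\circ W_c\dashv N^c\circ R_c^{\Delta[1]}$ between simplicial sets and simplicial categories is canonically isomorphic to the adjunction $\mathfrak{C}\dashv N$ of Higher Topos Theory (rigidification and homotopy coherent nerve), in the sense that the functor $L_c^{\Delta[1]}\circ W_c:\mathsf{sSet}\to\mathsf{Cat}_\Delta$ is canonically isomorphic to $\mathfrak{C}$.
   Context: $\mathsf{Cat}_\Delta$ is the category of simplicially enriched categories, $\mathsf{Cat}_{\square_c}$ the category of categories enriched in cubical sets with connections. Cubical sets with connections. Let $\square^n=\{0<1\}^n$. The category $\square_c$ has objects $\square^n$, $n\in\mathbb{N}$, and morphisms the poset maps generated by $\delta^\epsilon_i:\square^n\to\square^{n+1}$ (insert $\epsilon\in\{0,1\}$ after the first $i$ coordinates), $\sigma_i:\square^n\to\square^{n-1}$ (delete the coordinate following the first $i$ ones), and $\gamma_i:\square^n\to\square^{n-1}$ (replace the two coordinates following the first $i$ ones by their maximum). It is monoidal with $\square^n\otimes\square^m=\square^{n+m}$. $\square_c\text{-}\mathsf{Set}$ is the category of presheaves on $\square_c$, with Day convolution; $\square_c[n]$ is the presheaf represented by $\square^n$. The adjunction $L_c^{\Delta[1]}\dashv R_c^{\Delta[1]}$. $L_c^{\Delta[1]}:\square_c\text{-}\mathsf{Set}\to\mathsf{sSet}$ is the cocontinuous strong monoidal functor (cartesian product on $\mathsf{sSet}$) sending $\square_c[n]$ to $\Delta[1]^{n}$, with $\delta^0,\delta^1,\sigma,\gamma$ sent to the two vertex inclusions, the projection $\Delta[1]\to\Delta[0]$,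 and the map $\Delta[1]\times\Delta[1]\to\Delta[1]$ induced by $\max$. Its right adjoint is $R_c^{\Delta[1]}(X)(n)=\hom_{\mathsf{sSet}}(\Delta[1]^n,X)$. The adjunction is monoidal and extends to an adjunction $\mathsf{Cat}_{\square_c}\rightleftarrows\mathsf{Cat}_\Delta$, with the same notation, by applying the functors to mapping objects. The adjunction $W_c\dashv N^c$. $W_n\in\mathsf{Cat}_{\square_c}$ has objects $0,\dots,n$, with $W_n(i,j)=\square_c[j-i-1]$ for $i<j$, $W_n(i,i)=\square_c[0]$, and $W_n(j,i)=\emptyset$ for $i<j$. For $i<j<k$ the composition is $$\square_c[j-i-1]\otimes\square_c[0]\otimes\square_c[k-j-1]\xrightarrow{\mathrm{Id}\otimes\delta^1\otimes\mathrm{Id}}\square_c[j-i-1]\otimes\square_c[1]\otimes\square_c[k-j-1]=\square_c[k-i-1].$$ Let $\delta^\Delta_i:[n]\to[n+1]$ be the injection omitting $i$ and $\sigma^\Delta_i:[n]\to[n-1]$ the surjection identifying $i$ and $i+1$. $n\mapsto W_n$ is a cosimplicial object of $\mathsf{Cat}_{\square_c}$: $\delta_i^\Delta$ acts on objects as $\delta_i^\Delta$ and on $W_n(j,k)$, $j<i\le k$ and $j<k$, by $\delta^0_{i-j-1}$; $\sigma_i^\Delta$ acts on objects as $\sigma_i^\Delta$, on $W_n(j,k)$ by $\gamma_{i-j-1}$ if $j<i$ and $i+1<k$, by $\sigma_0$ on $W_n(i,k)$ for $k>i+1$, and by $\sigma_{i-j-1}$ on $W_n(j,i+1)$ for $j<i$;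 in all remaining cases the map between mapping objects is the canonical one. $W_c:\mathsf{sSet}\to\mathsf{Cat}_{\square_c}$ is the left Kan extension of $n\mapsto W_n$ along the Yoneda embedding, and $N^c(\mathcal{C})_n=\hom_{\mathsf{Cat}_{\square_c}}(W_n,\mathcal{C})$. The adjunction $\mathfrak{C}\dashv N$. $\mathfrak{C}[n]$ is the simplicial category with objects $0,\dots,n$, with $\mathfrak{C}[n](i,j)=N(P_{i,j})$ for $i\le j$, the nerve of the poset (ordered by inclusion) of subsets $I\subseteq\{i,i+1,\dots,j\}$ containing $i$ and $j$, and $\mathfrak{C}[n](i,j)=\emptyset$ for $i>j$. Composition is induced by union of subsets, and a monotone map $\phi:[n]\to[m]$ acts by $I\mapsto\phi(I)$. $\mathfrak{C}:\mathsf{sSet}\to\mathsf{Cat}_\Delta$ is the left Kan extension of $n\mapsto\mathfrak{C}[n]$ and $N(\mathcal{C})_n=\hom_{\mathsf{Cat}_\Delta}(\mathfrak{C}[n],\mathcal{C})$. *)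

theory Defs
  imports "HOL-Library.FuncSet"
begin

section \<open>Presheaves on concrete index categories\<close>

text \<open>
  An index category has the natural numbers as objects; its arrows from \<open>m\<close> to \<open>n\<close> are
  extensional functions from \<open>pts m\<close> to \<open>pts n\<close>, composed by \<^const>\<open>compose\<close>.
  The components \<open>join\<close> and \<open>joinarr\<close> describe how dimensions and arrows behave under the
  monoidal product of presheaves: \<open>join p q r\<close> says that a \<open>p\<close>-cell \<open>a\<close> and a \<open>q\<close>-cell \<open>b\<close> have
  a pure tensor \<open>a \<otimes> b\<close> which is an \<open>r\<close>-cell, and \<open>joinarr p' p f q' q g h\<close> that
  \<open>f\<^sup>* a \<otimes> g\<^sup>* b = h\<^sup>* (a \<otimes> b)\<close> for \<open>f\<close> from \<open>p'\<close> to \<open>p\<close> and \<open>g\<close> from \<open>q'\<close> to \<open>q\<close>.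
  For simplicial sets (cartesian product) only cells of equal dimension are paired;
  for cubical sets (Day convolution) dimensions add up.
\<close>

record 'p site =
  pts :: "nat \<Rightarrow> 'p set"
  arr :: "nat \<Rightarrow> nat \<Rightarrow> ('p \<Rightarrow> 'p) set"
  join :: "nat \<Rightarrow> nat \<Rightarrow> nat \<Rightarrow> bool"
  joinarr :: "nat \<Rightarrow> nat \<Rightarrow> ('p \<Rightarrow> 'p) \<Rightarrow> nat \<Rightarrow> nat \<Rightarrow> ('p \<Rightarrow> 'p) \<Rightarrow> ('p \<Rightarrow> 'p) \<Rightarrow> bool"

text \<open>\<open>act X m n f\<close> is the action of the arrow \<open>f\<close> from \<open>m\<close> to \<open>n\<close>; it maps \<open>n\<close>-cells to \<open>m\<close>-cells.\<close>

record ('p, 'a) psh =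
  cells :: "nat \<Rightarrow> 'a set"
  act :: "nat \<Rightarrow> nat \<Rightarrow> ('p \<Rightarrow> 'p) \<Rightarrow> 'a \<Rightarrow> 'a"

definition presheaf :: "'p site \<Rightarrow> ('p, 'a) psh \<Rightarrow> bool" where
  "presheaf M X \<longleftrightarrow>
     (\<forall>m n. \<forall>f \<in> arr M m n. \<forall>x \<in> cells X n. act X m n f x \<in> cells X m) \<and>
     (\<forall>n. \<forall>x \<in> cells X n. act X n n (\<lambda>v \<in> pts M n. v) x = x) \<and>
     (\<forall>k m n. \<forall>g \<in> arr M k m. \<forall>f \<in> arr M m n. \<forall>x \<in> cells X n.
        act X k m g (act X m n f x) = act X k n (compose (pts M k) f g) x)"

text \<open>Morphisms are extensional, so that equality of functions is equality of morphisms.\<close>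

definition psh_map :: "'p site \<Rightarrow> ('p, 'a) psh \<Rightarrow> ('p, 'b) psh \<Rightarrow> (nat \<Rightarrow> 'a \<Rightarrow> 'b) \<Rightarrow> bool" where
  "psh_map M X Y \<phi> \<longleftrightarrow>
     (\<forall>n. \<phi> n \<in> cells X n \<rightarrow>\<^sub>E cells Y n) \<and>
     (\<forall>m n. \<forall>f \<in> arr M m n. \<forall>x \<in> cells X n. \<phi> m (act X m n f x) = act Y m n f (\<phi> n x))"

definition psh_id :: "('p, 'a) psh \<Rightarrow> nat \<Rightarrow> 'a \<Rightarrow> 'a" where
  "psh_id X n = (\<lambda>x \<in> cells X n. x)"

definition psh_comp :: "('p, 'a) psh \<Rightarrow> (nat \<Rightarrow> 'b \<Rightarrow> 'c) \<Rightarrow> (nat \<Rightarrow> 'a \<Rightarrow> 'b) \<Rightarrow> nat \<Rightarrow> 'a \<Rightarrow> 'c" where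
  "psh_comp X \<psi> \<phi> n = compose (cells X n) (\<psi> n) (\<phi> n)"

definition yo :: "'p site \<Rightarrow> nat \<Rightarrow> ('p, 'p \<Rightarrow> 'p) psh" where
  "yo M n = \<lparr>cells = (\<lambda>m. arr M m n), act = (\<lambda>k m f g. compose (pts M k) g f)\<rparr>"

definition empty_psh :: "('p, 'a) psh" where
  "empty_psh = \<lparr>cells = (\<lambda>n. {}), act = (\<lambda>m n f x. x)\<rparr>"

definition psh_prod :: "('p, 'a) psh \<Rightarrow> ('p, 'b) psh \<Rightarrow> ('p, 'a \<times> 'b) psh" where
  "psh_prod X Y = \<lparr>cells = (\<lambda>n. cells X n \<times> cells Y n),
                   act = (\<lambda>m n f (x, y). (act X m n f x, act Y m n f y))\<rparr>"

text \<open>The \<open>n\<close>-fold cartesian power; its cells are lists of length \<open>n\<close>.\<close>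

definition psh_pow :: "('p, 'a) psh \<Rightarrow> nat \<Rightarrow> ('p, 'a list) psh" where
  "psh_pow X n = \<lparr>cells = (\<lambda>k. {s. length s = n \<and> set s \<subseteq> cells X k}),
                  act = (\<lambda>j k f. map (act X j k f))\<rparr>"

text \<open>The class of \<open>x\<close> under the equivalence relation on \<open>S\<close> generated by \<open>R\<close>.\<close>

definition gen_class :: "'a set \<Rightarrow> ('a \<Rightarrow> 'a \<Rightarrow> bool) \<Rightarrow> 'a \<Rightarrow> 'a set" where
  "gen_class S R x = {y \<in> S. equivclp (\<lambda>u v. u \<in> S \<and> v \<in> S \<and> R u v) x y}"


section \<open>The simplex category and the cube category with connections\<close>

definition Delta :: "nat site" where
  "Delta = \<lparr>pts = (\<lambda>n. {0..n}),
            arr = (\<lambda>m n. {f \<in> {0..m} \<rightarrow>\<^sub>E {0..n}. mono_on {0..m} f}),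
            join = (\<lambda>p q r. p = q \<and> q = r),
            joinarr = (\<lambda>p' p f q' q g h. p' = q' \<and> p = q \<and> f = g \<and> h = f)\<rparr>"

definition faceD :: "nat \<Rightarrow> nat \<Rightarrow> nat" where
  "faceD i x = (if x < i then x else Suc x)"

definition degD :: "nat \<Rightarrow> nat \<Rightarrow> nat" where
  "degD i x = (if x \<le> i then x else x - 1)"

text \<open>
  The three kinds of generators, on lists of coordinates in an arbitrary type: insertion after the
  first \<open>i\<close> entries, deletion of the entry following them, and merging of the two entries following
  them by an operation \<open>mx\<close>. They are used both for vertices of cubes (lists of truth values,
  ordered by \<open>False < True\<close>) and for simplices of powers of the interval (lists of simplices).
\<close>

definition ins :: "nat \<Rightarrow> 'a \<Rightarrow> 'a list \<Rightarrow> 'a list" where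
  "ins i e v = take i v @ e # drop i v"

definition del :: "nat \<Rightarrow> 'a list \<Rightarrow> 'a list" where
  "del i v = take i v @ drop (Suc i) v"

definition conn :: "('a \<Rightarrow> 'a \<Rightarrow> 'a) \<Rightarrow> nat \<Rightarrow> 'a list \<Rightarrow> 'a list" where
  "conn mx i v = take i v @ mx (v ! i) (v ! Suc i) # drop (Suc (Suc i)) v"

definition cube :: "nat \<Rightarrow> bool list set" where
  "cube n = {v. length v = n}"

type_synonym cmap = "bool list \<Rightarrow> bool list"

inductive cube_arr :: "nat \<Rightarrow> nat \<Rightarrow> cmap \<Rightarrow> bool" where
  cube_id: "cube_arr n n (\<lambda>v \<in> cube n. v)"
| cube_face: "cube_arr m n f \<Longrightarrow> i \<le> n \<Longrightarrow> cube_arr m (Suc n) (compose (cube m) (ins i e) f)"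
| cube_deg: "cube_arr m (Suc n) f \<Longrightarrow> i \<le> n \<Longrightarrow> cube_arr m n (compose (cube m) (del i) f)"
| cube_conn: "cube_arr m (Suc (Suc n)) f \<Longrightarrow> i \<le> n \<Longrightarrow>
    cube_arr m (Suc n) (compose (cube m) (conn max i) f)"

definition tens_arr :: "nat \<Rightarrow> nat \<Rightarrow> cmap \<Rightarrow> cmap \<Rightarrow> cmap" where
  "tens_arr p q f g = (\<lambda>v \<in> cube (p + q). f (take p v) @ g (drop p v))"

definition Cube :: "bool list site" where
  "Cube = \<lparr>pts = cube,
           arr = (\<lambda>m n. {f. cube_arr m n f}),
           join = (\<lambda>p q r. r = p + q),
           joinarr = (\<lambda>p' p f q' q g h. h = tens_arr p' q' f g)\<rparr>"


section \<open>Day convolution of cubical sets\<close>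

text \<open>
  The coend of \<open>\<box>(k, p + q) \<times> A p \<times> B q\<close> over \<open>p\<close> and \<open>q\<close>; \<open>(p, q, f, a, b)\<close> represents the cell
  \<open>f\<^sup>* (a \<otimes> b)\<close>.
\<close>

type_synonym ('a, 'b) day_rep = "nat \<times> nat \<times> cmap \<times> 'a \<times> 'b"
type_synonym ('a, 'b) day_cell = "('a, 'b) day_rep set"
type_synonym 'a cset = "(bool list, 'a) psh"

definition day_reps :: "'a cset \<Rightarrow> 'b cset \<Rightarrow> nat \<Rightarrow> ('a, 'b) day_rep set" where
  "day_reps A B k = {(p, q, f, a, b). f \<in> arr Cube k (p + q) \<and> a \<in> cells A p \<and> b \<in> cells B q}"

inductive day_step :: "'a cset \<Rightarrow> 'b cset \<Rightarrow> nat \<Rightarrow> ('a, 'b) day_rep \<Rightarrow> ('a, 'b) day_rep \<Rightarrow> bool"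
  for A B k where
  "f \<in> arr Cube k (p' + q') \<Longrightarrow> g \<in> arr Cube p' p \<Longrightarrow> h \<in> arr Cube q' q \<Longrightarrow>
   a \<in> cells A p \<Longrightarrow> b \<in> cells B q \<Longrightarrow>
   day_step A B k (p', q', f, act A p' p g a, act B q' q h b)
                  (p, q, compose (cube k) (tens_arr p' q' g h) f, a, b)"

definition day_class :: "'a cset \<Rightarrow> 'b cset \<Rightarrow> nat \<Rightarrow> ('a, 'b) day_rep \<Rightarrow> ('a, 'b) day_cell" where
  "day_class A B k = gen_class (day_reps A B k) (day_step A B k)"

definition day :: "'a cset \<Rightarrow> 'b cset \<Rightarrow> ('a, 'b) day_cell cset" where
  "day A B = \<lparr>cells = (\<lambda>k. day_class A B k ` day_reps A B k),
              act = (\<lambda>j k g S. \<Union>(p, q, f, a, b) \<in> S. day_class A B j (p, q, compose (cube j) f g, a, b))\<rparr>"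

definition day_pure :: "'a cset \<Rightarrow> 'b cset \<Rightarrow> nat \<Rightarrow> nat \<Rightarrow> 'a \<Rightarrow> 'b \<Rightarrow> ('a, 'b) day_cell" where
  "day_pure A B p q a b = day_class A B (p + q) (p, q, \<lambda>v \<in> cube (p + q). v, a, b)"

text \<open>
  The value at an \<open>r\<close>-cell of a Day convolution of the map into \<open>X\<close> that sends
  \<open>a \<otimes> b\<close> to \<open>op p q a b\<close>.
\<close>

definition day_lift ::
  "'c cset \<Rightarrow> (nat \<Rightarrow> nat \<Rightarrow> 'a \<Rightarrow> 'b \<Rightarrow> 'c) \<Rightarrow> nat \<Rightarrow> ('a, 'b) day_cell \<Rightarrow> 'c" where
  "day_lift X op r S = the_elem ((\<lambda>(p, q, f, a, b). act X r (p + q) f (op p q a b)) ` S)"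

definition prod_pure :: "('p, 'a) psh \<Rightarrow> ('p, 'b) psh \<Rightarrow> nat \<Rightarrow> nat \<Rightarrow> 'a \<Rightarrow> 'b \<Rightarrow> 'a \<times> 'b" where
  "prod_pure A B p q a b = (a, b)"


section \<open>Enriched categories and functors\<close>

text \<open>
  Categories enriched in presheaves with respect to a monoidal product \<open>tens\<close> whose pure tensors
  are given by \<open>pure\<close>. Composition is a morphism from \<open>hom x y \<otimes> hom y z\<close> to \<open>hom x z\<close>. The unit
  object is the presheaf represented by \<open>0\<close> in both cases, so a unit is a \<open>0\<close>-cell. Since iterated
  products are generated by pure tensors, the associativity and unit diagrams, and
  compatibility of functors with composition, are stated on them.
\<close>

record ('p, 'o, 'a, 't) vcat =
  obj :: "'o set"
  hom :: "'o \<Rightarrow> 'o \<Rightarrow> ('p, 'a) psh"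
  vcomp :: "'o \<Rightarrow> 'o \<Rightarrow> 'o \<Rightarrow> nat \<Rightarrow> 't \<Rightarrow> 'a"
  ident :: "'o \<Rightarrow> 'a"

type_synonym ('p, 'a, 't) pure_tensor =
  "('p, 'a) psh \<Rightarrow> ('p, 'a) psh \<Rightarrow> nat \<Rightarrow> nat \<Rightarrow> 'a \<Rightarrow> 'a \<Rightarrow> 't"

text \<open>The composite of \<open>a\<close> in \<open>hom x y\<close> (dimension \<open>p\<close>) and \<open>b\<close> in \<open>hom y z\<close> (dimension \<open>q\<close>), an \<open>r\<close>-cell.\<close>

definition pcomp ::
  "('p, 'a, 't) pure_tensor \<Rightarrow> ('p, 'o, 'a, 't) vcat \<Rightarrow> 'o \<Rightarrow> 'o \<Rightarrow> 'o \<Rightarrow>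
   nat \<Rightarrow> nat \<Rightarrow> nat \<Rightarrow> 'a \<Rightarrow> 'a \<Rightarrow> 'a" where
  "pcomp pure C x y z p q r a b = vcomp C x y z r (pure (hom C x y) (hom C y z) p q a b)"

definition vcategory ::
  "'p site \<Rightarrow> (('p, 'a) psh \<Rightarrow> ('p, 'a) psh \<Rightarrow> ('p, 't) psh) \<Rightarrow> ('p, 'a, 't) pure_tensor \<Rightarrow>
   ('p, 'o, 'a, 't) vcat \<Rightarrow> bool" where
  "vcategory M tens pure C \<longleftrightarrow>
     (\<forall>x \<in> obj C. \<forall>y \<in> obj C. presheaf M (hom C x y)) \<and>
     (\<forall>x \<in> obj C. \<forall>y \<in> obj C. \<forall>z \<in> obj C.
        psh_map M (tens (hom C x y) (hom C y z)) (hom C x z) (vcomp C x y z)) \<and>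
     (\<forall>x \<in> obj C. ident C x \<in> cells (hom C x x) 0) \<and>
     (\<forall>w \<in> obj C. \<forall>x \<in> obj C. \<forall>y \<in> obj C. \<forall>z \<in> obj C. \<forall>p q r s s' t.
        join M p q s \<longrightarrow> join M s r t \<longrightarrow> join M q r s' \<longrightarrow> join M p s' t \<longrightarrow>
        (\<forall>a \<in> cells (hom C w x) p. \<forall>b \<in> cells (hom C x y) q. \<forall>c \<in> cells (hom C y z) r.
           pcomp pure C w y z s r t (pcomp pure C w x y p q s a b) c =
           pcomp pure C w x z p s' t a (pcomp pure C x y z q r s' b c))) \<and>
     (\<forall>x \<in> obj C. \<forall>y \<in> obj C. \<forall>d e. \<forall>f \<in> arr M e 0. \<forall>a \<in> cells (hom C x y) d.
        (join M e d d \<longrightarrow>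
           pcomp pure C x x y e d d (act (hom C x x) e 0 f (ident C x)) a = a) \<and>
        (join M d e d \<longrightarrow>
           pcomp pure C x y y d e d a (act (hom C y y) e 0 f (ident C y)) = a))"

type_synonym ('o, 'q, 'a, 'b) efun = "('o \<Rightarrow> 'q) \<times> ('o \<Rightarrow> 'o \<Rightarrow> nat \<Rightarrow> 'a \<Rightarrow> 'b)"

definition vfunctor ::
  "'p site \<Rightarrow> ('p, 'a, 't) pure_tensor \<Rightarrow> ('p, 'b, 'u) pure_tensor \<Rightarrow>
   ('p, 'o, 'a, 't) vcat \<Rightarrow> ('p, 'q, 'b, 'u) vcat \<Rightarrow> ('o, 'q, 'a, 'b) efun \<Rightarrow> bool" where
  "vfunctor M pureC pureD C D F \<longleftrightarrow>
     fst F \<in> obj C \<rightarrow>\<^sub>E obj D \<and>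
     (\<forall>x y. \<not> (x \<in> obj C \<and> y \<in> obj C) \<longrightarrow> snd F x y = undefined) \<and>
     (\<forall>x \<in> obj C. \<forall>y \<in> obj C. psh_map M (hom C x y) (hom D (fst F x) (fst F y)) (snd F x y)) \<and>
     (\<forall>x \<in> obj C. snd F x x 0 (ident C x) = ident D (fst F x)) \<and>
     (\<forall>x \<in> obj C. \<forall>y \<in> obj C. \<forall>z \<in> obj C. \<forall>p q r. join M p q r \<longrightarrow>
        (\<forall>a \<in> cells (hom C x y) p. \<forall>b \<in> cells (hom C y z) q.
           snd F x z r (pcomp pureC C x y z p q r a b) =
           pcomp pureD D (fst F x) (fst F y) (fst F z) p q r (snd F x y p a) (snd F y z q b)))"

definition mk_vf ::
  "('p, 'o, 'a, 't) vcat \<Rightarrow> ('o \<Rightarrow> 'q) \<Rightarrow> ('o \<Rightarrow> 'o \<Rightarrow> nat \<Rightarrow> 'a \<Rightarrow> 'b) \<Rightarrow> ('o, 'q, 'a, 'b) efun" where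
  "mk_vf C fo fm =
     (restrict fo (obj C),
      \<lambda>x y. if x \<in> obj C \<and> y \<in> obj C then (\<lambda>n. restrict (fm x y n) (cells (hom C x y) n)) else undefined)"

definition vf_id :: "('p, 'o, 'a, 't) vcat \<Rightarrow> ('o, 'o, 'a, 'a) efun" where
  "vf_id C = mk_vf C (\<lambda>x. x) (\<lambda>x y n c. c)"

definition vf_comp ::
  "('p, 'o, 'a, 't) vcat \<Rightarrow> ('q, 'r, 'b, 'c) efun \<Rightarrow> ('o, 'q, 'a, 'b) efun \<Rightarrow> ('o, 'r, 'a, 'c) efun" where
  "vf_comp C G F = mk_vf C (\<lambda>x. fst G (fst F x)) (\<lambda>x y n c. snd G (fst F x) (fst F y) n (snd F x y n c))"

type_synonym 'a sset = "(nat, 'a) psh"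
type_synonym ('o, 'a) scat = "(nat, 'o, 'a, 'a \<times> 'a) vcat"
type_synonym ('o, 'a) ccat = "(bool list, 'o, 'a, ('a, 'a) day_cell) vcat"

abbreviation simplicial_set :: "'a sset \<Rightarrow> bool" where
  "simplicial_set \<equiv> presheaf Delta"

abbreviation simplicial_map :: "'a sset \<Rightarrow> 'b sset \<Rightarrow> (nat \<Rightarrow> 'a \<Rightarrow> 'b) \<Rightarrow> bool" where
  "simplicial_map \<equiv> psh_map Delta"

definition simplicial_category :: "('o, 'a) scat \<Rightarrow> bool" where
  "simplicial_category C \<longleftrightarrow> vcategory Delta psh_prod prod_pure C"

definition cubical_category :: "('o, 'a) ccat \<Rightarrow> bool" where
  "cubical_category C \<longleftrightarrow> vcategory Cube day day_pure C"

definition simplicial_functor :: "('o, 'a) scat \<Rightarrow> ('q, 'b) scat \<Rightarrow> ('o, 'q, 'a, 'b) efun \<Rightarrow> bool" where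
  "simplicial_functor C D F \<longleftrightarrow> vfunctor Delta prod_pure prod_pure C D F"

definition cubical_functor :: "('o, 'a) ccat \<Rightarrow> ('q, 'b) ccat \<Rightarrow> ('o, 'q, 'a, 'b) efun \<Rightarrow> bool" where
  "cubical_functor C D F \<longleftrightarrow> vfunctor Cube day_pure day_pure C D F"


section \<open>Left Kan extension along the Yoneda embedding\<close>

text \<open>
  A cosimplicial enriched category is given by \<open>A n\<close> and \<open>Am n m \<theta>\<close>, the functor from \<open>A n\<close> to
  \<open>A m\<close> induced by \<open>\<theta>\<close>. Its left Kan extension sends a simplicial set \<open>X\<close> to the colimit of
  \<open>A n\<close> over the category of elements \<open>(n, x)\<close> of \<open>X\<close>. The colimit is the enriched category
  presented by a copy of \<open>A n\<close> for each \<open>n\<close>-simplex \<open>x\<close>, subject to identifying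
  the copy at \<open>\<theta>\<^sup>* y\<close> with its image under \<open>Am n m \<theta>\<close> in the copy at \<open>y\<close>: objects form the
  colimit of the object sets, cells are formal composites modulo the congruence \<open>keq\<close>.
\<close>

type_synonym ('x, 'o) kobj = "(nat \<times> 'x \<times> 'o) set"

definition kobj_reps :: "(nat \<Rightarrow> ('p, 'o, 'a, 't) vcat) \<Rightarrow> 'x sset \<Rightarrow> (nat \<times> 'x \<times> 'o) set" where
  "kobj_reps A X = {(n, x, i). x \<in> cells X n \<and> i \<in> obj (A n)}"

inductive kobj_step ::
  "(nat \<Rightarrow> ('p, 'o, 'a, 't) vcat) \<Rightarrow> (nat \<Rightarrow> nat \<Rightarrow> (nat \<Rightarrow> nat) \<Rightarrow> ('o, 'o, 'a, 'a) efun) \<Rightarrow>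
   'x sset \<Rightarrow> nat \<times> 'x \<times> 'o \<Rightarrow> nat \<times> 'x \<times> 'o \<Rightarrow> bool"
  for A Am X where
  "\<theta> \<in> arr Delta n m \<Longrightarrow> y \<in> cells X m \<Longrightarrow> i \<in> obj (A n) \<Longrightarrow>
   kobj_step A Am X (n, act X n m \<theta> y, i) (m, y, fst (Am n m \<theta>) i)"

definition kobj ::
  "(nat \<Rightarrow> ('p, 'o, 'a, 't) vcat) \<Rightarrow> (nat \<Rightarrow> nat \<Rightarrow> (nat \<Rightarrow> nat) \<Rightarrow> ('o, 'o, 'a, 'a) efun) \<Rightarrow>
   'x sset \<Rightarrow> nat \<times> 'x \<times> 'o \<Rightarrow> ('x, 'o) kobj" where
  "kobj A Am X = gen_class (kobj_reps A X) (kobj_step A Am X)"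

text \<open>
  \<open>Gen n x i j d c\<close> is the \<open>d\<close>-cell \<open>c\<close> of \<open>hom (A n) i j\<close> in the copy at \<open>x\<close>, and
  \<open>Act e d f t\<close> is the action of \<open>f\<close> from \<open>e\<close> to \<open>d\<close> on a \<open>d\<close>-cell.
\<close>

datatype ('p, 'x, 'o, 'a) kterm =
    Gen nat 'x 'o 'o nat 'a
  | Idt "('x, 'o) kobj"
  | Cmp "('p, 'x, 'o, 'a) kterm" "('p, 'x, 'o, 'a) kterm"
  | Act nat nat "'p \<Rightarrow> 'p" "('p, 'x, 'o, 'a) kterm"

text \<open>\<open>kcell M A Am X a b d t\<close>: \<open>t\<close> is a formal \<open>d\<close>-cell from \<open>a\<close> to \<open>b\<close>.\<close>

inductive kcell ::
  "'p site \<Rightarrow> (nat \<Rightarrow> ('p, 'o, 'a, 't) vcat) \<Rightarrow>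
   (nat \<Rightarrow> nat \<Rightarrow> (nat \<Rightarrow> nat) \<Rightarrow> ('o, 'o, 'a, 'a) efun) \<Rightarrow> 'x sset \<Rightarrow>
   ('x, 'o) kobj \<Rightarrow> ('x, 'o) kobj \<Rightarrow> nat \<Rightarrow> ('p, 'x, 'o, 'a) kterm \<Rightarrow> bool"
  for M A Am X where
  kcell_Gen: "x \<in> cells X n \<Longrightarrow> i \<in> obj (A n) \<Longrightarrow> j \<in> obj (A n) \<Longrightarrow> c \<in> cells (hom (A n) i j) d \<Longrightarrow>
    kcell M A Am X (kobj A Am X (n, x, i)) (kobj A Am X (n, x, j)) d (Gen n x i j d c)"
| kcell_Idt: "a \<in> kobj A Am X ` kobj_reps A X \<Longrightarrow> kcell M A Am X a a 0 (Idt a)"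
| kcell_Cmp: "kcell M A Am X a b p t \<Longrightarrow> kcell M A Am X b c q u \<Longrightarrow> join M p q r \<Longrightarrow>
    kcell M A Am X a c r (Cmp t u)"
| kcell_Act: "kcell M A Am X a b d t \<Longrightarrow> f \<in> arr M e d \<Longrightarrow> kcell M A Am X a b e (Act e d f t)"

inductive keq ::
  "'p site \<Rightarrow> ('p, 'a, 't) pure_tensor \<Rightarrow> (nat \<Rightarrow> ('p, 'o, 'a, 't) vcat) \<Rightarrow>
   (nat \<Rightarrow> nat \<Rightarrow> (nat \<Rightarrow> nat) \<Rightarrow> ('o, 'o, 'a, 'a) efun) \<Rightarrow> 'x sset \<Rightarrow>
   ('x, 'o) kobj \<Rightarrow> ('x, 'o) kobj \<Rightarrow> nat \<Rightarrow> ('p, 'x, 'o, 'a) kterm \<Rightarrow> ('p, 'x, 'o, 'a) kterm \<Rightarrow> bool"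
  for M pure A Am X where
  \<comment> \<open>congruence\<close>
  keq_refl: "kcell M A Am X a b d t \<Longrightarrow> keq M pure A Am X a b d t t"
| keq_sym: "keq M pure A Am X a b d t u \<Longrightarrow> keq M pure A Am X a b d u t"
| keq_trans: "keq M pure A Am X a b d t u \<Longrightarrow> keq M pure A Am X a b d u v \<Longrightarrow>
    keq M pure A Am X a b d t v"
| keq_Cmp: "keq M pure A Am X a b p t t' \<Longrightarrow> keq M pure A Am X b c q u u' \<Longrightarrow> join M p q r \<Longrightarrow>
    keq M pure A Am X a c r (Cmp t u) (Cmp t' u')"
| keq_Act: "keq M pure A Am X a b d t t' \<Longrightarrow> f \<in> arr M e d \<Longrightarrow>
    keq M pure A Am X a b e (Act e d f t) (Act e d f t')"
  \<comment> \<open>axioms of enriched categories\<close>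
| keq_act_id: "kcell M A Am X a b d t \<Longrightarrow> keq M pure A Am X a b d (Act d d (\<lambda>v \<in> pts M d. v) t) t"
| keq_act_act: "kcell M A Am X a b n t \<Longrightarrow> f \<in> arr M m n \<Longrightarrow> g \<in> arr M k m \<Longrightarrow>
    keq M pure A Am X a b k (Act k m g (Act m n f t)) (Act k n (compose (pts M k) f g) t)"
| keq_act_cmp: "kcell M A Am X a b p t \<Longrightarrow> kcell M A Am X b c q u \<Longrightarrow>
    f \<in> arr M p' p \<Longrightarrow> g \<in> arr M q' q \<Longrightarrow> h \<in> arr M r' r \<Longrightarrow>
    join M p q r \<Longrightarrow> join M p' q' r' \<Longrightarrow> joinarr M p' p f q' q g h \<Longrightarrow>
    keq M pure A Am X a c r' (Act r' r h (Cmp t u)) (Cmp (Act p' p f t) (Act q' q g u))"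
| keq_assoc: "kcell M A Am X a b p t \<Longrightarrow> kcell M A Am X b c q u \<Longrightarrow> kcell M A Am X c d r v \<Longrightarrow>
    join M p q s \<Longrightarrow> join M s r l \<Longrightarrow> join M q r s' \<Longrightarrow> join M p s' l \<Longrightarrow>
    keq M pure A Am X a d l (Cmp (Cmp t u) v) (Cmp t (Cmp u v))"
| keq_unit_left: "kcell M A Am X a b d t \<Longrightarrow> f \<in> arr M e 0 \<Longrightarrow> join M e d d \<Longrightarrow>
    keq M pure A Am X a b d (Cmp (Act e 0 f (Idt a)) t) t"
| keq_unit_right: "kcell M A Am X a b d t \<Longrightarrow> f \<in> arr M e 0 \<Longrightarrow> join M d e d \<Longrightarrow>
    keq M pure A Am X a b d (Cmp t (Act e 0 f (Idt b))) t"
  \<comment> \<open>the inclusion of each copy is an enriched functor\<close>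
| keq_gen_act: "x \<in> cells X n \<Longrightarrow> i \<in> obj (A n) \<Longrightarrow> j \<in> obj (A n) \<Longrightarrow>
    c \<in> cells (hom (A n) i j) d \<Longrightarrow> f \<in> arr M e d \<Longrightarrow>
    keq M pure A Am X (kobj A Am X (n, x, i)) (kobj A Am X (n, x, j)) e
      (Act e d f (Gen n x i j d c)) (Gen n x i j e (act (hom (A n) i j) e d f c))"
| keq_gen_cmp: "x \<in> cells X n \<Longrightarrow> i \<in> obj (A n) \<Longrightarrow> j \<in> obj (A n) \<Longrightarrow> k \<in> obj (A n) \<Longrightarrow>
    c \<in> cells (hom (A n) i j) p \<Longrightarrow> c' \<in> cells (hom (A n) j k) q \<Longrightarrow> join M p q r \<Longrightarrow>
    keq M pure A Am X (kobj A Am X (n, x, i)) (kobj A Am X (n, x, k)) r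
      (Cmp (Gen n x i j p c) (Gen n x j k q c')) (Gen n x i k r (pcomp pure (A n) i j k p q r c c'))"
| keq_gen_id: "x \<in> cells X n \<Longrightarrow> i \<in> obj (A n) \<Longrightarrow>
    keq M pure A Am X (kobj A Am X (n, x, i)) (kobj A Am X (n, x, i)) 0
      (Gen n x i i 0 (ident (A n) i)) (Idt (kobj A Am X (n, x, i)))"
  \<comment> \<open>the inclusions form a cocone\<close>
| keq_gen_diagram: "\<theta> \<in> arr Delta n m \<Longrightarrow> y \<in> cells X m \<Longrightarrow> i \<in> obj (A n) \<Longrightarrow> j \<in> obj (A n) \<Longrightarrow>
    c \<in> cells (hom (A n) i j) d \<Longrightarrow>
    keq M pure A Am X (kobj A Am X (m, y, fst (Am n m \<theta>) i)) (kobj A Am X (m, y, fst (Am n m \<theta>) j)) d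
      (Gen n (act X n m \<theta> y) i j d c)
      (Gen m y (fst (Am n m \<theta>) i) (fst (Am n m \<theta>) j) d (snd (Am n m \<theta>) i j d c))"

type_synonym ('p, 'x, 'o, 'a) khom = "('p, 'x, 'o, 'a) kterm set"

definition khom ::
  "'p site \<Rightarrow> ('p, 'a, 't) pure_tensor \<Rightarrow> (nat \<Rightarrow> ('p, 'o, 'a, 't) vcat) \<Rightarrow>
   (nat \<Rightarrow> nat \<Rightarrow> (nat \<Rightarrow> nat) \<Rightarrow> ('o, 'o, 'a, 'a) efun) \<Rightarrow> 'x sset \<Rightarrow>
   ('x, 'o) kobj \<Rightarrow> ('x, 'o) kobj \<Rightarrow> ('p, ('p, 'x, 'o, 'a) khom) psh" where
  "khom M pure A Am X a b =
     \<lparr>cells = (\<lambda>d. {Collect (keq M pure A Am X a b d t) | t. kcell M A Am X a b d t}),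
      act = (\<lambda>e d f S. \<Union>t \<in> S. Collect (keq M pure A Am X a b e (Act e d f t)))\<rparr>"

text \<open>
  Every cell of \<open>hom a b \<otimes> hom b c\<close> has the form \<open>h\<^sup>* (S \<otimes> T)\<close>; it is sent to the class of
  the term \<open>Act r s h (Cmp t u)\<close> with \<open>t\<close> and \<open>u\<close> representing \<open>S\<close> and \<open>T\<close>.
\<close>

definition kan ::
  "'p site \<Rightarrow> ('p, 'a, 't) pure_tensor \<Rightarrow>
   (('p, ('p, 'x, 'o, 'a) khom) psh \<Rightarrow> ('p, ('p, 'x, 'o, 'a) khom) psh \<Rightarrow> ('p, 'u) psh) \<Rightarrow>
   ('p, ('p, 'x, 'o, 'a) khom, 'u) pure_tensor \<Rightarrow>
   (nat \<Rightarrow> ('p, 'o, 'a, 't) vcat) \<Rightarrow> (nat \<Rightarrow> nat \<Rightarrow> (nat \<Rightarrow> nat) \<Rightarrow> ('o, 'o, 'a, 'a) efun) \<Rightarrow>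
   'x sset \<Rightarrow> ('p, ('x, 'o) kobj, ('p, 'x, 'o, 'a) khom, 'u) vcat" where
  "kan M pure tens' pure' A Am X =
     (let H = khom M pure A Am X in
      \<lparr>obj = kobj A Am X ` kobj_reps A X,
       hom = H,
       vcomp = (\<lambda>a b c r. \<lambda>\<tau> \<in> cells (tens' (H a b) (H b c)) r.
         \<Union>{Collect (keq M pure A Am X a c r (Act r s h (Cmp t u))) | p q s h S T t u.
             join M p q s \<and> h \<in> arr M r s \<and> S \<in> cells (H a b) p \<and> T \<in> cells (H b c) q \<and>
             t \<in> S \<and> u \<in> T \<and> \<tau> = act (tens' (H a b) (H b c)) r s h (pure' (H a b) (H b c) p q S T)}),
       ident = (\<lambda>a. Collect (keq M pure A Am X a a 0 (Idt a)))\<rparr>)"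

text \<open>The component at \<open>x\<close> of the colimit cocone.\<close>

definition kan_in ::
  "'p site \<Rightarrow> ('p, 'a, 't) pure_tensor \<Rightarrow> (nat \<Rightarrow> ('p, 'o, 'a, 't) vcat) \<Rightarrow>
   (nat \<Rightarrow> nat \<Rightarrow> (nat \<Rightarrow> nat) \<Rightarrow> ('o, 'o, 'a, 'a) efun) \<Rightarrow> 'x sset \<Rightarrow> nat \<Rightarrow> 'x \<Rightarrow>
   ('o, ('x, 'o) kobj, 'a, ('p, 'x, 'o, 'a) khom) efun" where
  "kan_in M pure A Am X n x =
     mk_vf (A n) (\<lambda>i. kobj A Am X (n, x, i))
       (\<lambda>i j d c. Collect (keq M pure A Am X (kobj A Am X (n, x, i)) (kobj A Am X (n, x, j)) d (Gen n x i j d c)))"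

text \<open>The functoriality of the left Kan extension along a simplicial map \<open>f\<close> from \<open>X\<close> to \<open>Y\<close>.\<close>

definition kobj_map ::
  "(nat \<Rightarrow> ('p, 'o, 'a, 't) vcat) \<Rightarrow> (nat \<Rightarrow> nat \<Rightarrow> (nat \<Rightarrow> nat) \<Rightarrow> ('o, 'o, 'a, 'a) efun) \<Rightarrow>
   'y sset \<Rightarrow> (nat \<Rightarrow> 'x \<Rightarrow> 'y) \<Rightarrow> ('x, 'o) kobj \<Rightarrow> ('y, 'o) kobj" where
  "kobj_map A Am Y f a = (\<Union>(n, x, i) \<in> a. kobj A Am Y (n, f n x, i))"

primrec kterm_map ::
  "(('x, 'o) kobj \<Rightarrow> ('y, 'o) kobj) \<Rightarrow> (nat \<Rightarrow> 'x \<Rightarrow> 'y) \<Rightarrow>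
   ('p, 'x, 'o, 'a) kterm \<Rightarrow> ('p, 'y, 'o, 'a) kterm" where
  "kterm_map g f (Gen n x i j d c) = Gen n (f n x) i j d c"
| "kterm_map g f (Idt a) = Idt (g a)"
| "kterm_map g f (Cmp t u) = Cmp (kterm_map g f t) (kterm_map g f u)"
| "kterm_map g f (Act e d h t) = Act e d h (kterm_map g f t)"

definition kan_map ::
  "'p site \<Rightarrow> ('p, 'a, 't) pure_tensor \<Rightarrow>
   (('p, ('p, 'x, 'o, 'a) khom) psh \<Rightarrow> ('p, ('p, 'x, 'o, 'a) khom) psh \<Rightarrow> ('p, 'u) psh) \<Rightarrow>
   ('p, ('p, 'x, 'o, 'a) khom, 'u) pure_tensor \<Rightarrow>
   (nat \<Rightarrow> ('p, 'o, 'a, 't) vcat) \<Rightarrow> (nat \<Rightarrow> nat \<Rightarrow> (nat \<Rightarrow> nat) \<Rightarrow> ('o, 'o, 'a, 'a) efun) \<Rightarrow>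
   'x sset \<Rightarrow> 'y sset \<Rightarrow> (nat \<Rightarrow> 'x \<Rightarrow> 'y) \<Rightarrow>
   (('x, 'o) kobj, ('y, 'o) kobj, ('p, 'x, 'o, 'a) khom, ('p, 'y, 'o, 'a) khom) efun" where
  "kan_map M pure tens' pure' A Am X Y f =
     (let g = kobj_map A Am Y f in
      mk_vf (kan M pure tens' pure' A Am X) g
        (\<lambda>a b d S. \<Union>t \<in> S. Collect (keq M pure A Am Y (g a) (g b) d (kterm_map g f t))))"

text \<open>
  A functor from the left Kan extension at \<open>X\<close> to \<open>C\<close> corresponds to the family of its
  restrictions along the cocone, a simplicial map from \<open>X\<close> to the nerve of \<open>C\<close>.
\<close>

definition nerve_transpose ::
  "'p site \<Rightarrow> ('p, 'a, 't) pure_tensor \<Rightarrow> (nat \<Rightarrow> ('p, 'o, 'a, 't) vcat) \<Rightarrow>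
   (nat \<Rightarrow> nat \<Rightarrow> (nat \<Rightarrow> nat) \<Rightarrow> ('o, 'o, 'a, 'a) efun) \<Rightarrow> 'x sset \<Rightarrow>
   (('x, 'o) kobj, 'q, ('p, 'x, 'o, 'a) khom, 'c) efun \<Rightarrow> nat \<Rightarrow> 'x \<Rightarrow> ('o, 'q, 'a, 'c) efun" where
  "nerve_transpose M pure A Am X G n = (\<lambda>x \<in> cells X n. vf_comp (A n) G (kan_in M pure A Am X n x))"


section \<open>The cosimplicial cubical category and its nerve\<close>

definition W_cat :: "nat \<Rightarrow> (nat, cmap) ccat" where
  "W_cat n =
     (let H = (\<lambda>i j. if i \<le> j then yo Cube (j - i - 1) else empty_psh) in
      \<lparr>obj = {0..n},
       hom = H,
       vcomp = (\<lambda>i j k r. \<lambda>\<tau> \<in> cells (day (H i j) (H j k)) r.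
         day_lift (H i k)
           (\<lambda>p q a b. if i < j \<and> j < k
                      then compose (cube (p + q)) (ins (j - i - 1) True) (tens_arr p q a b)
                      else tens_arr p q a b) r \<tau>),
       ident = (\<lambda>i. \<lambda>v \<in> cube 0. v)\<rparr>)"

definition W_face :: "nat \<Rightarrow> nat \<Rightarrow> (nat, nat, cmap, cmap) efun" where
  "W_face n i = mk_vf (W_cat n) (faceD i)
     (\<lambda>j k m c. if j < i \<and> i \<le> k \<and> j < k then compose (cube m) (ins (i - j - 1) False) c else c)"

definition W_deg :: "nat \<Rightarrow> nat \<Rightarrow> (nat, nat, cmap, cmap) efun" where
  "W_deg n i = mk_vf (W_cat n) (degD i)
     (\<lambda>j k m c.
        if j < i \<and> i + 1 < k then compose (cube m) (conn max (i - j - 1)) c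
        else if j = i \<and> i + 1 < k then compose (cube m) (del 0) c
        else if j < i \<and> k = i + 1 then compose (cube m) (del (i - j - 1)) c
        else c)"

text \<open>\<open>W_rel n m \<theta> F\<close>: \<open>\<theta>\<close> is a composite of cofaces and codegeneracies, and \<open>F\<close> the corresponding composite.\<close>

inductive W_rel :: "nat \<Rightarrow> nat \<Rightarrow> (nat \<Rightarrow> nat) \<Rightarrow> (nat, nat, cmap, cmap) efun \<Rightarrow> bool" where
  W_rel_id: "W_rel n n (\<lambda>x \<in> {0..n}. x) (vf_id (W_cat n))"
| W_rel_face: "W_rel n m \<theta> F \<Longrightarrow> i \<le> Suc m \<Longrightarrow>
    W_rel n (Suc m) (compose {0..n} (faceD i) \<theta>) (vf_comp (W_cat n) (W_face m i) F)"
| W_rel_deg: "W_rel n (Suc m) \<theta> F \<Longrightarrow> i \<le> m \<Longrightarrow>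
    W_rel n m (compose {0..n} (degD i) \<theta>) (vf_comp (W_cat n) (W_deg (Suc m) i) F)"

definition W_map :: "nat \<Rightarrow> nat \<Rightarrow> (nat \<Rightarrow> nat) \<Rightarrow> (nat, nat, cmap, cmap) efun" where
  "W_map n m \<theta> = (THE F. W_rel n m \<theta> F)"

type_synonym 'x w_obj = "('x, nat) kobj"
type_synonym 'x w_hom = "(bool list, 'x, nat, cmap) khom"

definition Wc :: "'x sset \<Rightarrow> ('x w_obj, 'x w_hom) ccat" where
  "Wc = kan Cube day_pure day day_pure W_cat W_map"

definition Wc_fun :: "'x sset \<Rightarrow> 'y sset \<Rightarrow> (nat \<Rightarrow> 'x \<Rightarrow> 'y) \<Rightarrow> ('x w_obj, 'y w_obj, 'x w_hom, 'y w_hom) efun" where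
  "Wc_fun = kan_map Cube day_pure day day_pure W_cat W_map"

definition Wc_in :: "'x sset \<Rightarrow> nat \<Rightarrow> 'x \<Rightarrow> (nat, 'x w_obj, cmap, 'x w_hom) efun" where
  "Wc_in = kan_in Cube day_pure W_cat W_map"

definition Nc :: "('o, 'a) ccat \<Rightarrow> (nat, 'o, cmap, 'a) efun sset" where
  "Nc C = \<lparr>cells = (\<lambda>n. {F. cubical_functor (W_cat n) C F}),
           act = (\<lambda>m n \<theta> F. vf_comp (W_cat m) F (W_map m n \<theta>))\<rparr>"

definition Nc_map ::
  "('o, 'a) ccat \<Rightarrow> ('o, 'q, 'a, 'b) efun \<Rightarrow> nat \<Rightarrow> (nat, 'o, cmap, 'a) efun \<Rightarrow> (nat, 'q, cmap, 'b) efun" where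
  "Nc_map C G n = (\<lambda>F \<in> cells (Nc C) n. vf_comp (W_cat n) G F)"


section \<open>The rigidification and the homotopy coherent nerve\<close>

definition path_poset :: "nat \<Rightarrow> nat \<Rightarrow> nat set set" where
  "path_poset i j = {I. I \<subseteq> {i..j} \<and> i \<in> I \<and> j \<in> I}"

definition poset_nerve :: "'s set set \<Rightarrow> (nat, nat \<Rightarrow> 's set) psh" where
  "poset_nerve P = \<lparr>cells = (\<lambda>k. {s \<in> {0..k} \<rightarrow>\<^sub>E P. mono_on {0..k} s}),
                    act = (\<lambda>j k f s. compose {0..j} s f)\<rparr>"

definition C_cat :: "nat \<Rightarrow> (nat, nat \<Rightarrow> nat set) scat" where
  "C_cat n =
     (let H = (\<lambda>i j. if i \<le> j then poset_nerve (path_poset i j) else empty_psh) in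
      \<lparr>obj = {0..n},
       hom = H,
       vcomp = (\<lambda>i j k d. \<lambda>(s, t) \<in> cells (psh_prod (H i j) (H j k)) d. \<lambda>p \<in> {0..d}. s p \<union> t p),
       ident = (\<lambda>i. \<lambda>p \<in> {0..0}. {i})\<rparr>)"

definition C_map :: "nat \<Rightarrow> nat \<Rightarrow> (nat \<Rightarrow> nat) \<Rightarrow> (nat, nat, nat \<Rightarrow> nat set, nat \<Rightarrow> nat set) efun" where
  "C_map n m \<theta> = mk_vf (C_cat n) \<theta> (\<lambda>i j d s. \<lambda>p \<in> {0..d}. \<theta> ` s p)"

type_synonym 'x c_obj = "('x, nat) kobj"
type_synonym 'x c_hom = "(nat, 'x, nat, nat \<Rightarrow> nat set) khom"

definition Rig :: "'x sset \<Rightarrow> ('x c_obj, 'x c_hom) scat" where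
  "Rig = kan Delta prod_pure psh_prod prod_pure C_cat C_map"

definition Rig_fun :: "'x sset \<Rightarrow> 'y sset \<Rightarrow> (nat \<Rightarrow> 'x \<Rightarrow> 'y) \<Rightarrow> ('x c_obj, 'y c_obj, 'x c_hom, 'y c_hom) efun" where
  "Rig_fun = kan_map Delta prod_pure psh_prod prod_pure C_cat C_map"

definition Rig_in :: "'x sset \<Rightarrow> nat \<Rightarrow> 'x \<Rightarrow> (nat, 'x c_obj, nat \<Rightarrow> nat set, 'x c_hom) efun" where
  "Rig_in = kan_in Delta prod_pure C_cat C_map"

definition Nhc :: "('o, 'a) scat \<Rightarrow> (nat, 'o, nat \<Rightarrow> nat set, 'a) efun sset" where
  "Nhc D = \<lparr>cells = (\<lambda>n. {F. simplicial_functor (C_cat n) D F}),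
          act = (\<lambda>m n \<theta> F. vf_comp (C_cat m) F (C_map m n \<theta>))\<rparr>"

definition Nhc_map ::
  "('o, 'a) scat \<Rightarrow> ('o, 'q, 'a, 'b) efun \<Rightarrow>
   nat \<Rightarrow> (nat, 'o, nat \<Rightarrow> nat set, 'a) efun \<Rightarrow> (nat, 'q, nat \<Rightarrow> nat set, 'b) efun" where
  "Nhc_map D G n = (\<lambda>F \<in> cells (Nhc D) n. vf_comp (C_cat n) G F)"


section \<open>Triangulation of cubical sets and its right adjoint\<close>

type_synonym isimp = "(nat \<Rightarrow> nat) list"

definition ipow :: "nat \<Rightarrow> isimp sset" where
  "ipow n = psh_pow (yo Delta 1) n"

text \<open>
  The monoidal functor from the cube category to simplicial sets sending \<open>n\<close> to \<open>ipow n\<close>,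
  determined by its values on generators: \<open>ipow_arr m n f \<phi>\<close> says that \<open>f\<close> is a composite of
  generators and \<open>\<phi>\<close> the corresponding composite of simplicial maps.
\<close>

inductive ipow_arr :: "nat \<Rightarrow> nat \<Rightarrow> cmap \<Rightarrow> (nat \<Rightarrow> isimp \<Rightarrow> isimp) \<Rightarrow> bool" where
  ipow_id: "ipow_arr n n (\<lambda>v \<in> cube n. v) (psh_id (ipow n))"
| ipow_face: "ipow_arr m n f \<phi> \<Longrightarrow> i \<le> n \<Longrightarrow>
    ipow_arr m (Suc n) (compose (cube m) (ins i e) f)
      (psh_comp (ipow m) (\<lambda>k. ins i (\<lambda>p \<in> {0..k}. if e then 1 else 0)) \<phi>)"
| ipow_deg: "ipow_arr m (Suc n) f \<phi> \<Longrightarrow> i \<le> n \<Longrightarrow>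
    ipow_arr m n (compose (cube m) (del i) f) (psh_comp (ipow m) (\<lambda>k. del i) \<phi>)"
| ipow_conn: "ipow_arr m (Suc (Suc n)) f \<phi> \<Longrightarrow> i \<le> n \<Longrightarrow>
    ipow_arr m (Suc n) (compose (cube m) (conn max i) f)
      (psh_comp (ipow m) (\<lambda>k. conn (\<lambda>u v. \<lambda>p \<in> {0..k}. max (u p) (v p)) i) \<phi>)"

definition ipow_map :: "nat \<Rightarrow> nat \<Rightarrow> cmap \<Rightarrow> nat \<Rightarrow> isimp \<Rightarrow> isimp" where
  "ipow_map m n f = (THE \<phi>. ipow_arr m n f \<phi>)"

text \<open>
  The cocontinuous extension along the Yoneda embedding: the coend of \<open>K m \<times> ipow m\<close> over \<open>m\<close>.
\<close>

type_synonym 'a Lc_cell = "(nat \<times> 'a \<times> isimp) set"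

definition Lc_reps :: "'a cset \<Rightarrow> nat \<Rightarrow> (nat \<times> 'a \<times> isimp) set" where
  "Lc_reps K k = {(m, x, s). x \<in> cells K m \<and> s \<in> cells (ipow m) k}"

inductive Lc_step :: "'a cset \<Rightarrow> nat \<Rightarrow> nat \<times> 'a \<times> isimp \<Rightarrow> nat \<times> 'a \<times> isimp \<Rightarrow> bool" for K k where
  "f \<in> arr Cube m n \<Longrightarrow> y \<in> cells K n \<Longrightarrow> s \<in> cells (ipow m) k \<Longrightarrow>
   Lc_step K k (m, act K m n f y, s) (n, y, ipow_map m n f k s)"

definition Lc_class :: "'a cset \<Rightarrow> nat \<Rightarrow> nat \<times> 'a \<times> isimp \<Rightarrow> 'a Lc_cell" where
  "Lc_class K k = gen_class (Lc_reps K k) (Lc_step K k)"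

definition Lc :: "'a cset \<Rightarrow> 'a Lc_cell sset" where
  "Lc K = \<lparr>cells = (\<lambda>k. Lc_class K k ` Lc_reps K k),
          act = (\<lambda>j k f S. \<Union>(m, x, s) \<in> S. Lc_class K j (m, x, act (ipow m) j k f s))\<rparr>"

definition Lc_map :: "'a cset \<Rightarrow> 'b cset \<Rightarrow> (nat \<Rightarrow> 'a \<Rightarrow> 'b) \<Rightarrow> nat \<Rightarrow> 'a Lc_cell \<Rightarrow> 'b Lc_cell" where
  "Lc_map K K' \<phi> k = (\<lambda>S \<in> cells (Lc K) k. \<Union>(m, x, s) \<in> S. Lc_class K' k (m, \<phi> m x, s))"

text \<open>The monoidal structure map from \<open>Lc A \<times> Lc B\<close> to \<open>Lc (A \<otimes> B)\<close>, given by the identification of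
  \<open>ipow m \<times> ipow n\<close> with \<open>ipow (m + n)\<close>.\<close>

definition Lc_mult :: "'a cset \<Rightarrow> 'b cset \<Rightarrow> nat \<Rightarrow> 'a Lc_cell \<times> 'b Lc_cell \<Rightarrow> ('a, 'b) day_cell Lc_cell" where
  "Lc_mult A B k = (\<lambda>(S, T) \<in> cells (psh_prod (Lc A) (Lc B)) k.
     \<Union>(m, a, s) \<in> S. \<Union>(n, b, t) \<in> T. Lc_class (day A B) k (m + n, day_pure A B m n a b, s @ t))"

definition Rc :: "'a sset \<Rightarrow> (nat \<Rightarrow> isimp \<Rightarrow> 'a) cset" where
  "Rc X = \<lparr>cells = (\<lambda>n. {g. simplicial_map (ipow n) X g}),
          act = (\<lambda>m n f g. psh_comp (ipow m) g (ipow_map m n f))\<rparr>"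

definition Rc_map :: "'a sset \<Rightarrow> (nat \<Rightarrow> 'a \<Rightarrow> 'b) \<Rightarrow> nat \<Rightarrow> (nat \<Rightarrow> isimp \<Rightarrow> 'a) \<Rightarrow> nat \<Rightarrow> isimp \<Rightarrow> 'b" where
  "Rc_map X \<phi> n = (\<lambda>g \<in> cells (Rc X) n. psh_comp (ipow n) \<phi> g)"

text \<open>The monoidal structure map from \<open>Rc A \<otimes> Rc B\<close> to \<open>Rc (A \<times> B)\<close>, the mate of the inverse of
  \<^const>\<open>Lc_mult\<close>: it sends \<open>f \<otimes> g\<close> to \<open>f \<times> g\<close>.\<close>

definition Rc_mult ::
  "'a sset \<Rightarrow> 'b sset \<Rightarrow> nat \<Rightarrow> (nat \<Rightarrow> isimp \<Rightarrow> 'a, nat \<Rightarrow> isimp \<Rightarrow> 'b) day_cell \<Rightarrow> nat \<Rightarrow> isimp \<Rightarrow> 'a \<times> 'b" where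
  "Rc_mult A B r = (\<lambda>\<tau> \<in> cells (day (Rc A) (Rc B)) r.
     day_lift (Rc (psh_prod A B))
       (\<lambda>p q f g k. \<lambda>s \<in> cells (ipow (p + q)) k. (f k (take p s), g k (drop p s))) r \<tau>)"

definition Lc_cat :: "('o, 'a) ccat \<Rightarrow> ('o, 'a Lc_cell) scat" where
  "Lc_cat C =
     \<lparr>obj = obj C,
      hom = (\<lambda>x y. Lc (hom C x y)),
      vcomp = (\<lambda>x y z.
        psh_comp (psh_prod (Lc (hom C x y)) (Lc (hom C y z)))
          (Lc_map (day (hom C x y) (hom C y z)) (hom C x z) (vcomp C x y z))
          (Lc_mult (hom C x y) (hom C y z))),
      ident = (\<lambda>x. Lc_class (hom C x x) 0 (0, ident C x, []))\<rparr>"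

definition Lc_fun :: "('o, 'a) ccat \<Rightarrow> ('q, 'b) ccat \<Rightarrow> ('o, 'q, 'a, 'b) efun \<Rightarrow> ('o, 'q, 'a Lc_cell, 'b Lc_cell) efun" where
  "Lc_fun C C' F = mk_vf (Lc_cat C) (fst F)
     (\<lambda>x y. Lc_map (hom C x y) (hom C' (fst F x) (fst F y)) (snd F x y))"

definition Rc_cat :: "('o, 'a) scat \<Rightarrow> ('o, nat \<Rightarrow> isimp \<Rightarrow> 'a) ccat" where
  "Rc_cat D =
     \<lparr>obj = obj D,
      hom = (\<lambda>x y. Rc (hom D x y)),
      vcomp = (\<lambda>x y z.
        psh_comp (day (Rc (hom D x y)) (Rc (hom D y z)))
          (Rc_map (psh_prod (hom D x y) (hom D y z)) (vcomp D x y z))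
          (Rc_mult (hom D x y) (hom D y z))),
      ident = (\<lambda>x k. \<lambda>s \<in> cells (ipow 0) k. act (hom D x x) k 0 (\<lambda>p \<in> {0..k}. 0) (ident D x))\<rparr>"

definition Rc_fun :: "('o, 'a) scat \<Rightarrow> ('o, 'q, 'a, 'b) efun \<Rightarrow> ('o, 'q, nat \<Rightarrow> isimp \<Rightarrow> 'a, nat \<Rightarrow> isimp \<Rightarrow> 'b) efun" where
  "Rc_fun D F = mk_vf (Rc_cat D) (fst F) (\<lambda>x y. Rc_map (hom D x y) (snd F x y))"

definition Lc_transpose ::
  "('o, 'a) ccat \<Rightarrow> ('o, 'q, 'a Lc_cell, 'b) efun \<Rightarrow> ('o, 'q, 'a, nat \<Rightarrow> isimp \<Rightarrow> 'b) efun" where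
  "Lc_transpose C F = mk_vf C (fst F)
     (\<lambda>x y m c k. \<lambda>s \<in> cells (ipow m) k. snd F x y k (Lc_class (hom C x y) k (m, c, s)))"


section \<open>Adjunctions between simplicial sets and simplicial categories\<close>

text \<open>
  The category of simplicial sets consists of the simplicial sets with cells in a type \<open>'x\<close>, the
  category of simplicial categories of those with objects in \<open>'o\<close> and cells in \<open>'b\<close>. The left
  adjoint takes values in simplicial categories over types \<open>'q\<close> and \<open>'c\<close>, the right adjoint in
  simplicial sets over a type \<open>'y\<close>. \<open>transp X D\<close> sends functors from \<open>lobj X\<close> to \<open>D\<close> to
  simplicial maps from \<open>X\<close> to \<open>robj D\<close>.
\<close>

record ('x, 'o, 'b, 'q, 'c, 'y) sadj =
  lobj :: "'x sset \<Rightarrow> ('q, 'c) scat"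
  lmap :: "'x sset \<Rightarrow> 'x sset \<Rightarrow> (nat \<Rightarrow> 'x \<Rightarrow> 'x) \<Rightarrow> ('q, 'q, 'c, 'c) efun"
  robj :: "('o, 'b) scat \<Rightarrow> 'y sset"
  rmap :: "('o, 'b) scat \<Rightarrow> ('o, 'b) scat \<Rightarrow> ('o, 'o, 'b, 'b) efun \<Rightarrow> nat \<Rightarrow> 'y \<Rightarrow> 'y"
  transp :: "'x sset \<Rightarrow> ('o, 'b) scat \<Rightarrow> ('q, 'o, 'c, 'b) efun \<Rightarrow> nat \<Rightarrow> 'x \<Rightarrow> 'y"

definition left_functor :: "('x, 'o, 'b, 'q, 'c, 'y) sadj \<Rightarrow> bool" where
  "left_functor P \<longleftrightarrow>
     (\<forall>X. simplicial_set X \<longrightarrow>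
        simplicial_category (lobj P X) \<and> lmap P X X (psh_id X) = vf_id (lobj P X)) \<and>
     (\<forall>X Y f. simplicial_set X \<longrightarrow> simplicial_set Y \<longrightarrow> simplicial_map X Y f \<longrightarrow>
        simplicial_functor (lobj P X) (lobj P Y) (lmap P X Y f)) \<and>
     (\<forall>X Y Z f g. simplicial_set X \<longrightarrow> simplicial_set Y \<longrightarrow> simplicial_set Z \<longrightarrow>
        simplicial_map X Y f \<longrightarrow> simplicial_map Y Z g \<longrightarrow>
        lmap P X Z (psh_comp X g f) = vf_comp (lobj P X) (lmap P Y Z g) (lmap P X Y f))"

definition right_functor :: "('x, 'o, 'b, 'q, 'c, 'y) sadj \<Rightarrow> bool" where
  "right_functor P \<longleftrightarrow>
     (\<forall>D. simplicial_category D \<longrightarrow>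
        simplicial_set (robj P D) \<and> rmap P D D (vf_id D) = psh_id (robj P D)) \<and>
     (\<forall>D E H. simplicial_category D \<longrightarrow> simplicial_category E \<longrightarrow> simplicial_functor D E H \<longrightarrow>
        simplicial_map (robj P D) (robj P E) (rmap P D E H)) \<and>
     (\<forall>C D E G H. simplicial_category C \<longrightarrow> simplicial_category D \<longrightarrow> simplicial_category E \<longrightarrow>
        simplicial_functor C D G \<longrightarrow> simplicial_functor D E H \<longrightarrow>
        rmap P C E (vf_comp C H G) = psh_comp (robj P C) (rmap P D E H) (rmap P C D G))"

definition adjunction :: "('x, 'o, 'b, 'q, 'c, 'y) sadj \<Rightarrow> bool" where
  "adjunction P \<longleftrightarrow>
     left_functor P \<and> right_functor P \<and>
     (\<forall>X D. simplicial_set X \<longrightarrow> simplicial_category D \<longrightarrow>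
        bij_betw (transp P X D)
          {F. simplicial_functor (lobj P X) D F} {g. simplicial_map X (robj P D) g}) \<and>
     (\<forall>X Y D f F. simplicial_set X \<longrightarrow> simplicial_set Y \<longrightarrow> simplicial_category D \<longrightarrow>
        simplicial_map X Y f \<longrightarrow> simplicial_functor (lobj P Y) D F \<longrightarrow>
        transp P X D (vf_comp (lobj P X) F (lmap P X Y f)) = psh_comp X (transp P Y D F) f) \<and>
     (\<forall>X D E F H. simplicial_set X \<longrightarrow> simplicial_category D \<longrightarrow> simplicial_category E \<longrightarrow>
        simplicial_functor (lobj P X) D F \<longrightarrow> simplicial_functor D E H \<longrightarrow>
        transp P X E (vf_comp (lobj P X) H F) = psh_comp X (rmap P D E H) (transp P X D F))"

definition scat_iso :: "('o, 'a) scat \<Rightarrow> ('q, 'b) scat \<Rightarrow> ('o, 'q, 'a, 'b) efun \<Rightarrow> bool" where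
  "scat_iso C D F \<longleftrightarrow> simplicial_functor C D F \<and>
     (\<exists>G. simplicial_functor D C G \<and> vf_comp C G F = vf_id C \<and> vf_comp D F G = vf_id D)"

definition sset_iso :: "'a sset \<Rightarrow> 'b sset \<Rightarrow> (nat \<Rightarrow> 'a \<Rightarrow> 'b) \<Rightarrow> bool" where
  "sset_iso X Y \<phi> \<longleftrightarrow> simplicial_map X Y \<phi> \<and>
     (\<exists>\<psi>. simplicial_map Y X \<psi> \<and> psh_comp X \<psi> \<phi> = psh_id X \<and> psh_comp Y \<phi> \<psi> = psh_id Y)"

definition left_nat_iso ::
  "('x, 'o, 'b, 'q, 'c, 'y) sadj \<Rightarrow> ('x, 'o, 'b, 'q2, 'c2, 'y2) sadj \<Rightarrow>
   ('x sset \<Rightarrow> ('q, 'q2, 'c, 'c2) efun) \<Rightarrow> bool" where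
  "left_nat_iso P Q \<Phi> \<longleftrightarrow>
     (\<forall>X. simplicial_set X \<longrightarrow> scat_iso (lobj P X) (lobj Q X) (\<Phi> X)) \<and>
     (\<forall>X Y f. simplicial_set X \<longrightarrow> simplicial_set Y \<longrightarrow> simplicial_map X Y f \<longrightarrow>
        vf_comp (lobj P X) (lmap Q X Y f) (\<Phi> X) = vf_comp (lobj P X) (\<Phi> Y) (lmap P X Y f))"

definition right_nat_iso ::
  "('x, 'o, 'b, 'q, 'c, 'y) sadj \<Rightarrow> ('x, 'o, 'b, 'q2, 'c2, 'y2) sadj \<Rightarrow>
   (('o, 'b) scat \<Rightarrow> nat \<Rightarrow> 'y2 \<Rightarrow> 'y) \<Rightarrow> bool" where
  "right_nat_iso P Q \<Psi> \<longleftrightarrow>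
     (\<forall>D. simplicial_category D \<longrightarrow> sset_iso (robj Q D) (robj P D) (\<Psi> D)) \<and>
     (\<forall>D E H. simplicial_category D \<longrightarrow> simplicial_category E \<longrightarrow> simplicial_functor D E H \<longrightarrow>
        psh_comp (robj Q D) (rmap P D E H) (\<Psi> D) = psh_comp (robj Q D) (\<Psi> E) (rmap Q D E H))"

text \<open>An isomorphism of adjunctions: natural isomorphisms of the left and the right adjoints
  which are mates of each other.\<close>

definition adjunction_iso ::
  "('x, 'o, 'b, 'q, 'c, 'y) sadj \<Rightarrow> ('x, 'o, 'b, 'q2, 'c2, 'y2) sadj \<Rightarrow>
   ('x sset \<Rightarrow> ('q, 'q2, 'c, 'c2) efun) \<Rightarrow> (('o, 'b) scat \<Rightarrow> nat \<Rightarrow> 'y2 \<Rightarrow> 'y) \<Rightarrow> bool" where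
  "adjunction_iso P Q \<Phi> \<Psi> \<longleftrightarrow>
     left_nat_iso P Q \<Phi> \<and> right_nat_iso P Q \<Psi> \<and>
     (\<forall>X D F. simplicial_set X \<longrightarrow> simplicial_category D \<longrightarrow> simplicial_functor (lobj Q X) D F \<longrightarrow>
        transp P X D (vf_comp (lobj P X) F (\<Phi> X)) = psh_comp X (\<Psi> D) (transp Q X D F))"

definition LW_adj ::
  "('x, 'o, 'b, 'x w_obj, 'x w_hom Lc_cell, (nat, 'o, cmap, nat \<Rightarrow> isimp \<Rightarrow> 'b) efun) sadj" where
  "LW_adj =
     \<lparr>lobj = (\<lambda>X. Lc_cat (Wc X)),
      lmap = (\<lambda>X Y f. Lc_fun (Wc X) (Wc Y) (Wc_fun X Y f)),
      robj = (\<lambda>D. Nc (Rc_cat D)),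
      rmap = (\<lambda>D E H. Nc_map (Rc_cat D) (Rc_fun D H)),
      transp = (\<lambda>X D F. nerve_transpose Cube day_pure W_cat W_map X (Lc_transpose (Wc X) F))\<rparr>"

definition CN_adj ::
  "('x, 'o, 'b, 'x c_obj, 'x c_hom, (nat, 'o, nat \<Rightarrow> nat set, 'b) efun) sadj" where
  "CN_adj =
     \<lparr>lobj = Rig,
      lmap = Rig_fun,
      robj = Nhc,
      rmap = (\<lambda>D E H. Nhc_map D H),
      transp = (\<lambda>X D F. nerve_transpose Delta prod_pure C_cat C_map X F)\<rparr>"

text \<open>
  The canonical comparison from \<open>Lc_cat (W_cat n)\<close> to \<open>C_cat n\<close>: a vertex of the cube of
  dimension \<open>j - i - 1\<close> corresponds to the subset of \<open>{i..j}\<close> containing \<open>i\<close>, \<open>j\<close> and those \<open>i + 1 + l\<close>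
  whose coordinate \<open>l\<close> is \<open>1\<close>. A simplex of \<open>Lc (yo Cube (j - i - 1))\<close> is represented by
  \<open>(m, a, s)\<close>; its vertex \<open>p\<close> is the image under \<open>a\<close> of the vertex \<open>p\<close> of \<open>s\<close>.
\<close>

definition cube_comparison :: "nat \<Rightarrow> (nat, nat, cmap Lc_cell, nat \<Rightarrow> nat set) efun" where
  "cube_comparison n = mk_vf (Lc_cat (W_cat n)) (\<lambda>i. i)
     (\<lambda>i j k S. the_elem ((\<lambda>(m, a, s). \<lambda>p \<in> {0..k}.
        {i, j} \<union> {i + 1 + l | l. l < j - i - 1 \<and> a (map (\<lambda>u. u p = 1) s) ! l}) ` S))"

end

theory Submission
  imports Defs
begin

text \<open>
  Both left adjoints are left Kan extensions along the Yoneda embedding, and triangulation commutes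
  with colimits because it has the right adjoint \<^const>\<open>Rc_cat\<close>. Hence \<open>Lc_cat (Wc X)\<close> is the colimit of
  the simplicial categories \<open>Lc_cat (W_cat n)\<close> over the simplices of \<open>X\<close>, and it suffices to compare
  these with \<open>C_cat n\<close>, compatibly with the cosimplicial structure. The comparison is an isomorphism
  because a cell of the triangulated cube has a unique representative over the identity of the cube, and
  because monotone sequences of vertices of the cube of dimension \<open>j - i - 1\<close> are the same as chains of
  subsets of \<open>{i..j}\<close> containing \<open>i\<close> and \<open>j\<close>. Under this bijection the structure maps of \<open>W_cat\<close> become
  unions and direct images of subsets, which is how all identities between them are verified.
\<close>

section \<open>Classes of generated equivalence relations\<close>

text \<open>Both Kan extensions are instances of one abstract construction, in which enriched
  categories are seen only through composites of pure tensors (\<open>pcat\<close>,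
  \<open>tensor\<close>), so the cartesian and the Day product are treated at once. The colimit is a
  quotient of formal terms: functors out of it are built by evaluating terms, and they agree once
  they agree on the cocone. The obstacle is well-definedness. \<open>W_map\<close> and
  \<open>ipow_map\<close> are definite descriptions over all ways of composing generators, so
  different decompositions of one map must give the same result. No simplicial or cubical relation
  is checked for this. Instead a faithful model shows the effect of a composite from the underlying
  map alone: simplices of powers of the interval are determined by their vertices
  (\<open>ipow_spec\<close>), cells of \<open>W_cat\<close> by subsets (\<open>W_image\<close>).
  Uniqueness is faithfulness of the model; existence for \<open>W_map\<close> is the generation of
  the simplex category. All functors are extensional, so categorical equality is HOL equality, and
  the inverse and the naturality of the left comparison follow from uniqueness of functors out of
  colimits.\<close>

lemma gen_class_refl: "x \<in> S \<Longrightarrow> x \<in> gen_class S R x"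
  by (simp add: gen_class_def equivclp_def)

lemma gen_class_step:
  assumes "x \<in> S" "y \<in> S" "R x y"
  shows "gen_class S R x = gen_class S R y"
proof -
  have "equivclp (\<lambda>u v. u \<in> S \<and> v \<in> S \<and> R u v) x y"
    using assms by (auto simp: equivclp_def symclp_def)
  then show ?thesis
    unfolding gen_class_def by (auto intro: equivclp_trans equivclp_sym)
qed

text \<open>Equality of values is itself an equivalence relation, so it suffices to check it on
  generating steps. The next two lemmas are the forms in which functions on classes are evaluated: a
  union for set-valued functions, \<open>the_elem\<close> otherwise.\<close>

lemma gen_class_const:
  assumes "\<And>u v. u \<in> S \<Longrightarrow> v \<in> S \<Longrightarrow> R u v \<Longrightarrow> h u = h v" and "y \<in> gen_class S R x"
  shows "h y = h x"
proof -
  have "equivclp (\<lambda>u v. u \<in> S \<and> v \<in> S \<and> R u v) x y"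
    using assms(2) by (simp add: gen_class_def)
  then show ?thesis
    by (induction rule: equivclp_induct) (use assms(1) in auto)
qed

lemma gen_class_UN:
  assumes "\<And>u v. u \<in> S \<Longrightarrow> v \<in> S \<Longrightarrow> R u v \<Longrightarrow> h u = h v" and "x \<in> S"
  shows "(\<Union>z \<in> gen_class S R x. h z) = h x"
  using gen_class_const[of S R h, OF assms(1)] gen_class_refl[OF assms(2), of R] by blast

lemma gen_class_the_elem:
  assumes "\<And>u v. u \<in> S \<Longrightarrow> v \<in> S \<Longrightarrow> R u v \<Longrightarrow> h u = h v" and "x \<in> S"
  shows "the_elem (h ` gen_class S R x) = h x"
proof -
  have "h ` gen_class S R x = {h x}"
    using gen_class_const[of S R h, OF assms(1)] gen_class_refl[OF assms(2), of R] by blast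
  then show ?thesis by simp
qed


section \<open>Presheaves and enriched functors\<close>

lemma presheafD:
  assumes "presheaf M X"
  shows "f \<in> arr M m n \<Longrightarrow> x \<in> cells X n \<Longrightarrow> act X m n f x \<in> cells X m"
    and "x \<in> cells X n \<Longrightarrow> act X n n (\<lambda>v \<in> pts M n. v) x = x"
    and "g \<in> arr M k m \<Longrightarrow> f \<in> arr M m n \<Longrightarrow> x \<in> cells X n \<Longrightarrow>
         act X k m g (act X m n f x) = act X k n (compose (pts M k) f g) x"
  using assms by (auto simp: presheaf_def)

lemma presheafI:
  assumes "\<And>m n f x. f \<in> arr M m n \<Longrightarrow> x \<in> cells X n \<Longrightarrow> act X m n f x \<in> cells X m"
    and "\<And>n x. x \<in> cells X n \<Longrightarrow> act X n n (\<lambda>v \<in> pts M n. v) x = x"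
    and "\<And>k m n f g x. g \<in> arr M k m \<Longrightarrow> f \<in> arr M m n \<Longrightarrow> x \<in> cells X n \<Longrightarrow>
         act X k m g (act X m n f x) = act X k n (compose (pts M k) f g) x"
  shows "presheaf M X"
  using assms by (auto simp: presheaf_def)

lemma psh_mapD:
  assumes "psh_map M X Y \<phi>"
  shows "x \<in> cells X n \<Longrightarrow> \<phi> n x \<in> cells Y n"
    and "\<phi> n \<in> extensional (cells X n)"
    and "f \<in> arr M m n \<Longrightarrow> x \<in> cells X n \<Longrightarrow> \<phi> m (act X m n f x) = act Y m n f (\<phi> n x)"
  using assms by (fastforce simp: psh_map_def PiE_def Pi_def)+

lemma psh_mapI:
  assumes "\<And>n x. x \<in> cells X n \<Longrightarrow> \<phi> n x \<in> cells Y n"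
    and "\<And>n. \<phi> n \<in> extensional (cells X n)"
    and "\<And>m n f x. f \<in> arr M m n \<Longrightarrow> x \<in> cells X n \<Longrightarrow> \<phi> m (act X m n f x) = act Y m n f (\<phi> n x)"
  shows "psh_map M X Y \<phi>"
  using assms by (auto simp: psh_map_def PiE_def)

lemma psh_comp_apply [simp]: "x \<in> cells X n \<Longrightarrow> psh_comp X \<psi> \<phi> n x = \<psi> n (\<phi> n x)"
  by (simp add: psh_comp_def compose_def)

lemma psh_comp_ext [simp]: "psh_comp X \<psi> \<phi> n \<in> extensional (cells X n)"
  by (simp add: psh_comp_def)

lemma psh_id_apply [simp]: "x \<in> cells X n \<Longrightarrow> psh_id X n x = x"
  by (simp add: psh_id_def)

lemma psh_id_ext [simp]: "psh_id X n \<in> extensional (cells X n)"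
  by (simp add: psh_id_def)

lemma psh_map_eqI:
  assumes "\<And>n. \<phi> n \<in> extensional (cells X n)" "\<And>n. \<psi> n \<in> extensional (cells X n)"
    and "\<And>n x. x \<in> cells X n \<Longrightarrow> \<phi> n x = \<psi> n x"
  shows "\<phi> = \<psi>"
  by (rule ext, rule extensionalityI[OF assms(1) assms(2)]) (rule assms(3))

lemma psh_map_comp:
  assumes "psh_map M X Y \<phi>" "psh_map M Y Z \<psi>" "presheaf M X"
  shows "psh_map M X Z (psh_comp X \<psi> \<phi>)"
  by (rule psh_mapI)
    (simp_all add: presheafD(1)[OF assms(3)] psh_mapD(1,3)[OF assms(1)] psh_mapD(1,3)[OF assms(2)])

lemma psh_map_id: "presheaf M X \<Longrightarrow> psh_map M X X (psh_id X)"
  by (rule psh_mapI) (simp_all add: presheafD(1))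

text \<open>The part of \<open>vfunctor\<close> that does not mention the codomain. With values
  fixed to \<open>undefined\<close> off the objects and cells, pointwise agreement becomes HOL
  equality; \<open>mk_vf\<close> and \<open>vf_comp\<close> satisfy it for arbitrary
  arguments.\<close>

definition vf_ext :: "('p, 'o, 'a, 't) vcat \<Rightarrow> ('o, 'q, 'a, 'b) efun \<Rightarrow> bool" where
  "vf_ext C F \<longleftrightarrow> fst F \<in> extensional (obj C) \<and>
     (\<forall>x y. \<not> (x \<in> obj C \<and> y \<in> obj C) \<longrightarrow> snd F x y = undefined) \<and>
     (\<forall>x \<in> obj C. \<forall>y \<in> obj C. \<forall>n. snd F x y n \<in> extensional (cells (hom C x y) n))"

lemma vf_eqI:
  assumes "vf_ext C F" "vf_ext C G"
    and "\<And>x. x \<in> obj C \<Longrightarrow> fst F x = fst G x"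
    and "\<And>x y n c. x \<in> obj C \<Longrightarrow> y \<in> obj C \<Longrightarrow> c \<in> cells (hom C x y) n \<Longrightarrow> snd F x y n c = snd G x y n c"
  shows "F = G"
proof (rule prod_eqI)
  show "fst F = fst G"
    by (rule extensionalityI[of _ "obj C"]) (use assms in \<open>auto simp: vf_ext_def\<close>)
  show "snd F = snd G"
  proof (intro ext)
    fix x y n c
    show "snd F x y n c = snd G x y n c"
    proof (cases "x \<in> obj C \<and> y \<in> obj C")
      case True
      then have "snd F x y n = snd G x y n"
        by (intro extensionalityI[of _ "cells (hom C x y) n"])
          (use assms in \<open>auto simp: vf_ext_def\<close>)
      then show ?thesis by simp
    next
      case False
      then show ?thesis using assms(1,2) by (simp add: vf_ext_def)
    qed
  qed
qed

lemma vf_ext_mk [simp]: "vf_ext C (mk_vf C fo fm)"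
  by (auto simp: vf_ext_def mk_vf_def)

lemma vf_ext_comp [simp]: "vf_ext C (vf_comp C G F)"
  by (simp add: vf_comp_def)

lemma vf_ext_id [simp]: "vf_ext C (vf_id C)"
  by (simp add: vf_id_def)

lemma fst_mk_vf [simp]: "x \<in> obj C \<Longrightarrow> fst (mk_vf C fo fm) x = fo x"
  by (simp add: mk_vf_def)

lemma snd_mk_vf [simp]:
  "x \<in> obj C \<Longrightarrow> y \<in> obj C \<Longrightarrow> c \<in> cells (hom C x y) n \<Longrightarrow> snd (mk_vf C fo fm) x y n c = fm x y n c"
  by (simp add: mk_vf_def)

lemma fst_vf_comp [simp]: "x \<in> obj C \<Longrightarrow> fst (vf_comp C G F) x = fst G (fst F x)"
  by (simp add: vf_comp_def)

lemma snd_vf_comp [simp]: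
  "x \<in> obj C \<Longrightarrow> y \<in> obj C \<Longrightarrow> c \<in> cells (hom C x y) n \<Longrightarrow>
   snd (vf_comp C G F) x y n c = snd G (fst F x) (fst F y) n (snd F x y n c)"
  by (simp add: vf_comp_def)

lemma fst_vf_id [simp]: "x \<in> obj C \<Longrightarrow> fst (vf_id C) x = x"
  by (simp add: vf_id_def)

lemma snd_vf_id [simp]:
  "x \<in> obj C \<Longrightarrow> y \<in> obj C \<Longrightarrow> c \<in> cells (hom C x y) n \<Longrightarrow> snd (vf_id C) x y n c = c"
  by (simp add: vf_id_def)

lemma vfunctorD:
  assumes "vfunctor M pC pD C D F"
  shows "x \<in> obj C \<Longrightarrow> fst F x \<in> obj D"
    and "x \<in> obj C \<Longrightarrow> y \<in> obj C \<Longrightarrow> psh_map M (hom C x y) (hom D (fst F x) (fst F y)) (snd F x y)"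
    and "x \<in> obj C \<Longrightarrow> y \<in> obj C \<Longrightarrow> c \<in> cells (hom C x y) n \<Longrightarrow>
         snd F x y n c \<in> cells (hom D (fst F x) (fst F y)) n"
    and "x \<in> obj C \<Longrightarrow> y \<in> obj C \<Longrightarrow> f \<in> arr M m n \<Longrightarrow> c \<in> cells (hom C x y) n \<Longrightarrow>
         snd F x y m (act (hom C x y) m n f c) = act (hom D (fst F x) (fst F y)) m n f (snd F x y n c)"
    and "x \<in> obj C \<Longrightarrow> snd F x x 0 (ident C x) = ident D (fst F x)"
    and "x \<in> obj C \<Longrightarrow> y \<in> obj C \<Longrightarrow> z \<in> obj C \<Longrightarrow> join M p q r \<Longrightarrow> a \<in> cells (hom C x y) p \<Longrightarrow>
         b \<in> cells (hom C y z) q \<Longrightarrow>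
         snd F x z r (pcomp pC C x y z p q r a b) =
         pcomp pD D (fst F x) (fst F y) (fst F z) p q r (snd F x y p a) (snd F y z q b)"
    and "vf_ext C F"
proof -
  show "x \<in> obj C \<Longrightarrow> fst F x \<in> obj D"
    using assms by (auto simp: vfunctor_def)
  show *: "psh_map M (hom C x y) (hom D (fst F x) (fst F y)) (snd F x y)"
    if "x \<in> obj C" "y \<in> obj C" for x y
    using assms that by (simp add: vfunctor_def)
  show "x \<in> obj C \<Longrightarrow> y \<in> obj C \<Longrightarrow> c \<in> cells (hom C x y) n \<Longrightarrow>
         snd F x y n c \<in> cells (hom D (fst F x) (fst F y)) n"
    using psh_mapD(1)[OF *] .
  show "x \<in> obj C \<Longrightarrow> y \<in> obj C \<Longrightarrow> f \<in> arr M m n \<Longrightarrow> c \<in> cells (hom C x y) n \<Longrightarrow>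
         snd F x y m (act (hom C x y) m n f c) = act (hom D (fst F x) (fst F y)) m n f (snd F x y n c)"
    using psh_mapD(3)[OF *] .
  show "x \<in> obj C \<Longrightarrow> snd F x x 0 (ident C x) = ident D (fst F x)"
    using assms by (simp add: vfunctor_def)
  show "x \<in> obj C \<Longrightarrow> y \<in> obj C \<Longrightarrow> z \<in> obj C \<Longrightarrow> join M p q r \<Longrightarrow> a \<in> cells (hom C x y) p \<Longrightarrow>
         b \<in> cells (hom C y z) q \<Longrightarrow>
         snd F x z r (pcomp pC C x y z p q r a b) =
         pcomp pD D (fst F x) (fst F y) (fst F z) p q r (snd F x y p a) (snd F y z q b)"
    using assms by (simp add: vfunctor_def)
  show "vf_ext C F"
    using assms psh_mapD(2)[OF *] by (auto simp: vf_ext_def vfunctor_def PiE_def)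
qed

lemma vfunctorI:
  assumes "vf_ext C F"
    and "\<And>x. x \<in> obj C \<Longrightarrow> fst F x \<in> obj D"
    and "\<And>x y c n. x \<in> obj C \<Longrightarrow> y \<in> obj C \<Longrightarrow> c \<in> cells (hom C x y) n \<Longrightarrow>
         snd F x y n c \<in> cells (hom D (fst F x) (fst F y)) n"
    and "\<And>x y f m n c. x \<in> obj C \<Longrightarrow> y \<in> obj C \<Longrightarrow> f \<in> arr M m n \<Longrightarrow> c \<in> cells (hom C x y) n \<Longrightarrow>
         snd F x y m (act (hom C x y) m n f c) = act (hom D (fst F x) (fst F y)) m n f (snd F x y n c)"
    and "\<And>x. x \<in> obj C \<Longrightarrow> snd F x x 0 (ident C x) = ident D (fst F x)"
    and "\<And>x y z p q r a b. x \<in> obj C \<Longrightarrow> y \<in> obj C \<Longrightarrow> z \<in> obj C \<Longrightarrow> join M p q r \<Longrightarrow>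
         a \<in> cells (hom C x y) p \<Longrightarrow> b \<in> cells (hom C y z) q \<Longrightarrow>
         snd F x z r (pcomp pC C x y z p q r a b) =
         pcomp pD D (fst F x) (fst F y) (fst F z) p q r (snd F x y p a) (snd F y z q b)"
  shows "vfunctor M pC pD C D F"
proof -
  have "psh_map M (hom C x y) (hom D (fst F x) (fst F y)) (snd F x y)"
    if "x \<in> obj C" "y \<in> obj C" for x y
    by (rule psh_mapI) (use assms that in \<open>auto simp: vf_ext_def\<close>)
  then show ?thesis
    using assms unfolding vfunctor_def vf_ext_def by (auto simp: PiE_def)
qed

text \<open>The hypothesis on \<open>F\<close> guarantees that its values lie in \<open>D\<close>,
  which is where the restricted composite \<open>vf_comp D H G\<close> computes.\<close>

lemma vf_comp_assoc:
  assumes "vfunctor M pC pD C D F"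
  shows "vf_comp C H (vf_comp C G F) = vf_comp C (vf_comp D H G) F"
  by (rule vf_eqI[of C]) (simp_all add: vfunctorD(1,3)[OF assms])

lemma vf_comp_id_right: "vf_ext C F \<Longrightarrow> vf_comp C F (vf_id C) = F"
  by (rule vf_eqI[of C]) simp_all

lemma vf_comp_id_left: "vfunctor M pC pD C D F \<Longrightarrow> vf_comp C (vf_id D) F = F"
  by (rule vf_eqI[of C]) (simp_all add: vfunctorD(1,3,7))


section \<open>Enriched categories in terms of pure tensors\<close>

text \<open>An enriched category as seen by pure tensors: \<open>vcomp\<close> enters only through
  \<open>pcomp\<close>, and its naturality becomes the bilinearity law \<open>pcomp_act\<close>. The
  monoidal product itself does not occur, so universal properties can be stated for codomains with
  any type of cells.\<close>

locale pcat =
  fixes M :: "'p site" and pure :: "('p, 'a, 't) pure_tensor" and C :: "('p, 'o, 'a, 't) vcat"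
  assumes hom_presheaf: "x \<in> obj C \<Longrightarrow> y \<in> obj C \<Longrightarrow> presheaf M (hom C x y)"
    and ident_in: "x \<in> obj C \<Longrightarrow> ident C x \<in> cells (hom C x x) 0"
    and pcomp_in: "x \<in> obj C \<Longrightarrow> y \<in> obj C \<Longrightarrow> z \<in> obj C \<Longrightarrow> join M p q r \<Longrightarrow>
      a \<in> cells (hom C x y) p \<Longrightarrow> b \<in> cells (hom C y z) q \<Longrightarrow>
      pcomp pure C x y z p q r a b \<in> cells (hom C x z) r"
    and pcomp_act: "x \<in> obj C \<Longrightarrow> y \<in> obj C \<Longrightarrow> z \<in> obj C \<Longrightarrow> join M p q r \<Longrightarrow> join M p' q' r' \<Longrightarrow>
      f \<in> arr M p' p \<Longrightarrow> g \<in> arr M q' q \<Longrightarrow> h \<in> arr M r' r \<Longrightarrow> joinarr M p' p f q' q g h \<Longrightarrow>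
      a \<in> cells (hom C x y) p \<Longrightarrow> b \<in> cells (hom C y z) q \<Longrightarrow>
      act (hom C x z) r' r h (pcomp pure C x y z p q r a b) =
      pcomp pure C x y z p' q' r' (act (hom C x y) p' p f a) (act (hom C y z) q' q g b)"
    and pcomp_assoc: "w \<in> obj C \<Longrightarrow> x \<in> obj C \<Longrightarrow> y \<in> obj C \<Longrightarrow> z \<in> obj C \<Longrightarrow>
      join M p q s \<Longrightarrow> join M s r t \<Longrightarrow> join M q r s' \<Longrightarrow> join M p s' t \<Longrightarrow>
      a \<in> cells (hom C w x) p \<Longrightarrow> b \<in> cells (hom C x y) q \<Longrightarrow> c \<in> cells (hom C y z) r \<Longrightarrow>
      pcomp pure C w y z s r t (pcomp pure C w x y p q s a b) c =
      pcomp pure C w x z p s' t a (pcomp pure C x y z q r s' b c)"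
    and unit_left: "x \<in> obj C \<Longrightarrow> y \<in> obj C \<Longrightarrow> f \<in> arr M e 0 \<Longrightarrow> a \<in> cells (hom C x y) d \<Longrightarrow>
      join M e d d \<Longrightarrow> pcomp pure C x x y e d d (act (hom C x x) e 0 f (ident C x)) a = a"
    and unit_right: "x \<in> obj C \<Longrightarrow> y \<in> obj C \<Longrightarrow> f \<in> arr M e 0 \<Longrightarrow> a \<in> cells (hom C x y) d \<Longrightarrow>
      join M d e d \<Longrightarrow> pcomp pure C x y y d e d a (act (hom C y y) e 0 f (ident C y)) = a"

lemma vfunctor_comp:
  assumes "pcat M pC C" "vfunctor M pC pD C D F" "vfunctor M pD pE D E G"
  shows "vfunctor M pC pE C E (vf_comp C G F)"
proof -
  interpret pcat M pC C by fact
  show ?thesis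
    by (rule vfunctorI)
      (simp_all add: vfunctorD(1,3-6)[OF assms(2)] vfunctorD(1,3-6)[OF assms(3)]
        presheafD(1)[OF hom_presheaf] pcomp_in ident_in)
qed

lemma vfunctor_id:
  assumes "pcat M pC C"
  shows "vfunctor M pC pC C C (vf_id C)"
proof -
  interpret pcat M pC C by fact
  show ?thesis
    by (rule vfunctorI) (simp_all add: presheafD(1)[OF hom_presheaf] pcomp_in ident_in)
qed

text \<open>A functor bijective on objects and on cells is an isomorphism: each law for the inverse
  may be checked after applying \<open>F\<close>, which is injective on cells.\<close>

lemma vfunctor_inverse:
  assumes "pcat M pC C" "vfunctor M pC pD C D F"
    and bo: "bij_betw (fst F) (obj C) (obj D)"
    and bc: "\<And>x y n. x \<in> obj C \<Longrightarrow> y \<in> obj C \<Longrightarrow>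
      bij_betw (snd F x y n) (cells (hom C x y) n) (cells (hom D (fst F x) (fst F y)) n)"
  obtains G where "vfunctor M pD pC D C G" "vf_comp C G F = vf_id C" "vf_comp D F G = vf_id D"
proof -
  interpret pcat M pC C by fact
  define go where "go = inv_into (obj C) (fst F)"
  define gm where "gm = (\<lambda>u v n. inv_into (cells (hom C (go u) (go v)) n) (snd F (go u) (go v) n))"
  define G where "G = mk_vf D go gm"
  have go: "go u \<in> obj C" "fst F (go u) = u" if "u \<in> obj D" for u
    unfolding go_def using that bij_betw_imp_surj_on[OF bo]
    by (auto intro: inv_into_into f_inv_into_f)
  have go': "go (fst F x) = x" if "x \<in> obj C" for x
    unfolding go_def using that bij_betw_imp_inj_on[OF bo] by simp
  have gm: "gm u v n c \<in> cells (hom C (go u) (go v)) n" "snd F (go u) (go v) n (gm u v n c) = c"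
    if "u \<in> obj D" "v \<in> obj D" "c \<in> cells (hom D u v) n" for u v n c
    unfolding gm_def using that bij_betw_imp_surj_on[OF bc[of "go u" "go v" n]] go
    by (metis inv_into_into, metis f_inv_into_f)
  have inj: "c = c'" if "snd F x y n c = snd F x y n c'" "x \<in> obj C" "y \<in> obj C"
    "c \<in> cells (hom C x y) n" "c' \<in> cells (hom C x y) n" for x y n c c'
    using that bij_betw_imp_inj_on[OF bc[of x y n]] by (auto dest: inj_onD)
  \<comment> \<open>Closure of the cells of \<open>D\<close> under the action is read off from
    \<open>C\<close> through \<open>F\<close>; identities and composites are treated the same way
    below.\<close>
  have inD: "act (hom D u v) m n f c \<in> cells (hom D u v) m"
    if "u \<in> obj D" "v \<in> obj D" "f \<in> arr M m n" "c \<in> cells (hom D u v) n" for u v m n f c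
    using vfunctorD(4)[OF assms(2), of "go u" "go v" f m n "gm u v n c"]
      vfunctorD(3)[OF assms(2), of "go u" "go v" "act (hom C (go u) (go v)) m n f (gm u v n c)" m]
      that go gm presheafD(1)[OF hom_presheaf] by metis
  have ident': "ident D u \<in> cells (hom D u u) 0" if "u \<in> obj D" for u
    using vfunctorD(5)[OF assms(2), of "go u"]
      vfunctorD(3)[OF assms(2), of "go u" "go u" "ident C (go u)" 0] that go ident_in by metis
  have pcomp': "pcomp pD D u v w p q r a b \<in> cells (hom D u w) r"
    if "u \<in> obj D" "v \<in> obj D" "w \<in> obj D" "join M p q r" "a \<in> cells (hom D u v) p"
      "b \<in> cells (hom D v w) q" for u v w p q r a b
    using vfunctorD(6)[OF assms(2), of "go u" "go v" "go w" p q r "gm u v p a" "gm v w q b"]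
      vfunctorD(3)[OF assms(2), of "go u" "go w"
        "pcomp pC C (go u) (go v) (go w) p q r (gm u v p a) (gm v w q b)" r]
      that go gm pcomp_in by metis
  have 1: "vfunctor M pD pC D C G"
  proof (rule vfunctorI)
    show "vf_ext D G" by (simp add: G_def)
    show "fst G u \<in> obj C" if "u \<in> obj D" for u using that go by (simp add: G_def)
    show "snd G u v n c \<in> cells (hom C (fst G u) (fst G v)) n"
      if "u \<in> obj D" "v \<in> obj D" "c \<in> cells (hom D u v) n" for u v n c
      using that gm by (simp add: G_def)
    show "snd G u v m (act (hom D u v) m n f c) =
        act (hom C (fst G u) (fst G v)) m n f (snd G u v n c)"
      if "u \<in> obj D" "v \<in> obj D" "f \<in> arr M m n" "c \<in> cells (hom D u v) n" for u v m n f c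
      using that inD gm go presheafD(1)[OF hom_presheaf] vfunctorD(4)[OF assms(2)]
      by (intro inj[of "go u" "go v" m]) (simp_all add: G_def)
    show "snd G u u 0 (ident D u) = ident C (fst G u)" if "u \<in> obj D" for u
      using that ident' gm go ident_in vfunctorD(5)[OF assms(2)]
      by (intro inj[of "go u" "go u" 0]) (simp_all add: G_def)
    show "snd G u w r (pcomp pD D u v w p q r a b) =
        pcomp pC C (fst G u) (fst G v) (fst G w) p q r (snd G u v p a) (snd G v w q b)"
      if "u \<in> obj D" "v \<in> obj D" "w \<in> obj D" "join M p q r" "a \<in> cells (hom D u v) p"
        "b \<in> cells (hom D v w) q" for u v w p q r a b
      using that pcomp' gm go pcomp_in vfunctorD(6)[OF assms(2)]
      by (intro inj[of "go u" "go w" r]) (simp_all add: G_def)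
  qed
  have 2: "vf_comp C G F = vf_id C"
  proof (rule vf_eqI[of C])
    fix x y n c assume *: "x \<in> obj C" "y \<in> obj C" "c \<in> cells (hom C x y) n"
    then have **: "fst F x \<in> obj D" "fst F y \<in> obj D"
        "snd F x y n c \<in> cells (hom D (fst F x) (fst F y)) n"
      using vfunctorD[OF assms(2)] by auto
    show "snd (vf_comp C G F) x y n c = snd (vf_id C) x y n c"
      using * ** gm[OF **] go'
      by (intro inj[of x y n]) (simp_all add: G_def)
  qed (simp_all add: G_def go' vfunctorD(1)[OF assms(2)])
  have 3: "vf_comp D F G = vf_id D"
    by (rule vf_eqI[of D]) (simp_all add: G_def go gm)
  from 1 2 3 that show thesis by blast
qed

text \<open>What the cartesian product and Day convolution have in common. \<open>tens_univ\<close>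
  is the existence half of the universal property for bilinear operations; uniqueness comes from
  \<open>tens_gen\<close>, every cell being a restricted pure tensor. The target \<open>X\<close>
  shares the cell type of \<open>A\<close> and \<open>B\<close> because an assumption cannot
  quantify over types; this suits composition, where all homs have one type.\<close>

locale tensor =
  fixes M :: "'p site"
    and tens :: "('p, 'a) psh \<Rightarrow> ('p, 'a) psh \<Rightarrow> ('p, 't) psh"
    and pure :: "('p, 'a, 't) pure_tensor"
  assumes tens_presheaf: "presheaf M A \<Longrightarrow> presheaf M B \<Longrightarrow> presheaf M (tens A B)"
    and pure_in: "presheaf M A \<Longrightarrow> presheaf M B \<Longrightarrow> join M p q r \<Longrightarrow> a \<in> cells A p \<Longrightarrow> b \<in> cells B q \<Longrightarrow>
      pure A B p q a b \<in> cells (tens A B) r"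
    and pure_act: "presheaf M A \<Longrightarrow> presheaf M B \<Longrightarrow> join M p q r \<Longrightarrow> join M p' q' r' \<Longrightarrow>
      f \<in> arr M p' p \<Longrightarrow> g \<in> arr M q' q \<Longrightarrow> h \<in> arr M r' r \<Longrightarrow> joinarr M p' p f q' q g h \<Longrightarrow>
      a \<in> cells A p \<Longrightarrow> b \<in> cells B q \<Longrightarrow>
      act (tens A B) r' r h (pure A B p q a b) = pure A B p' q' (act A p' p f a) (act B q' q g b)"
    and tens_gen: "presheaf M A \<Longrightarrow> presheaf M B \<Longrightarrow> \<tau> \<in> cells (tens A B) r \<Longrightarrow>
      \<exists>p q s h a b. join M p q s \<and> h \<in> arr M r s \<and> a \<in> cells A p \<and> b \<in> cells B q \<and>
        \<tau> = act (tens A B) r s h (pure A B p q a b)"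
    and tens_univ: "presheaf M A \<Longrightarrow> presheaf M B \<Longrightarrow> presheaf M X \<Longrightarrow>
      (\<And>p q r a b. join M p q r \<Longrightarrow> a \<in> cells A p \<Longrightarrow> b \<in> cells B q \<Longrightarrow>
        bil p q r a b \<in> cells (X :: ('p, 'a) psh) r) \<Longrightarrow>
      (\<And>p q r p' q' r' f g h a b. join M p q r \<Longrightarrow> join M p' q' r' \<Longrightarrow>
        f \<in> arr M p' p \<Longrightarrow> g \<in> arr M q' q \<Longrightarrow> h \<in> arr M r' r \<Longrightarrow> joinarr M p' p f q' q g h \<Longrightarrow>
        a \<in> cells A p \<Longrightarrow> b \<in> cells B q \<Longrightarrow>
        act X r' r h (bil p q r a b) = bil p' q' r' (act A p' p f a) (act B q' q g b)) \<Longrightarrow>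
      \<exists>\<phi>. psh_map M (tens A B) X \<phi> \<and>
        (\<forall>p q r a b. join M p q r \<longrightarrow> a \<in> cells A p \<longrightarrow> b \<in> cells B q \<longrightarrow>
           \<phi> r (pure A B p q a b) = bil p q r a b)"

lemma (in tensor) vcategory_pcat:
  assumes "vcategory M tens pure C"
  shows "pcat M pure C"
proof -
  have P: "presheaf M (hom C x y)" if "x \<in> obj C" "y \<in> obj C" for x y
    using assms that by (simp add: vcategory_def)
  have V: "psh_map M (tens (hom C x y) (hom C y z)) (hom C x z) (vcomp C x y z)"
    if "x \<in> obj C" "y \<in> obj C" "z \<in> obj C" for x y z
    using assms that by (simp add: vcategory_def)
  show ?thesis
  proof unfold_locales
    show "presheaf M (hom C x y)" if "x \<in> obj C" "y \<in> obj C" for x y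
      using P that .
    show "ident C x \<in> cells (hom C x x) 0" if "x \<in> obj C" for x
      using assms that by (simp add: vcategory_def)
    show "pcomp pure C x y z p q r a b \<in> cells (hom C x z) r"
      if "x \<in> obj C" "y \<in> obj C" "z \<in> obj C" "join M p q r"
        "a \<in> cells (hom C x y) p" "b \<in> cells (hom C y z) q" for x y z p q r a b
      unfolding pcomp_def using that by (intro psh_mapD(1)[OF V] pure_in P) simp_all
    show "act (hom C x z) r' r h (pcomp pure C x y z p q r a b) =
      pcomp pure C x y z p' q' r' (act (hom C x y) p' p f a) (act (hom C y z) q' q g b)"
      if "x \<in> obj C" "y \<in> obj C" "z \<in> obj C" "join M p q r" "join M p' q' r'"
        "f \<in> arr M p' p" "g \<in> arr M q' q" "h \<in> arr M r' r" "joinarr M p' p f q' q g h"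
        "a \<in> cells (hom C x y) p" "b \<in> cells (hom C y z) q" for x y z p q r p' q' r' f g h a b
      using that by (simp add: pcomp_def psh_mapD(3)[OF V, symmetric] pure_in P pure_act[symmetric])
    show "pcomp pure C w y z s r t (pcomp pure C w x y p q s a b) c =
      pcomp pure C w x z p s' t a (pcomp pure C x y z q r s' b c)"
      if "w \<in> obj C" "x \<in> obj C" "y \<in> obj C" "z \<in> obj C"
        "join M p q s" "join M s r t" "join M q r s'" "join M p s' t"
        "a \<in> cells (hom C w x) p" "b \<in> cells (hom C x y) q" "c \<in> cells (hom C y z) r"
      for w x y z p q s r t s' a b c
      using assms that unfolding vcategory_def by blast
    show "pcomp pure C x x y e d d (act (hom C x x) e 0 f (ident C x)) a = a"
      if "x \<in> obj C" "y \<in> obj C" "f \<in> arr M e 0" "a \<in> cells (hom C x y) d" "join M e d d"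
      for x y f e a d
      using assms that unfolding vcategory_def by blast
    show "pcomp pure C x y y d e d a (act (hom C y y) e 0 f (ident C y)) = a"
      if "x \<in> obj C" "y \<in> obj C" "f \<in> arr M e 0" "a \<in> cells (hom C x y) d" "join M d e d"
      for x y f e a d
      using assms that unfolding vcategory_def by blast
  qed
qed

lemma pcat_vcategory:
  assumes "pcat M pure C"
    and "\<And>x y z. x \<in> obj C \<Longrightarrow> y \<in> obj C \<Longrightarrow> z \<in> obj C \<Longrightarrow>
      psh_map M (tens (hom C x y) (hom C y z)) (hom C x z) (vcomp C x y z)"
  shows "vcategory M tens pure C"
proof -
  interpret pcat M pure C by fact
  show ?thesis
    unfolding vcategory_def
    by (intro conjI ballI allI impI hom_presheaf assms(2) ident_in pcomp_assoc unit_left unit_right)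
qed

section \<open>The universal property of the left Kan extension\<close>

locale wsite =
  fixes M :: "'p site"
  assumes id_arr: "(\<lambda>v \<in> pts M n. v) \<in> arr M n n"
    and comp_arr: "f \<in> arr M m n \<Longrightarrow> g \<in> arr M k m \<Longrightarrow> compose (pts M k) f g \<in> arr M k n"
    and join_fun: "join M p q r \<Longrightarrow> join M p q r' \<Longrightarrow> r = r'"

locale cosimp = wsite M
  for M :: "'p site" +
  fixes pure :: "('p, 'a, 't) pure_tensor"
    and A :: "nat \<Rightarrow> ('p, 'o, 'a, 't) vcat"
    and Am :: "nat \<Rightarrow> nat \<Rightarrow> (nat \<Rightarrow> nat) \<Rightarrow> ('o, 'o, 'a, 'a) efun"
  assumes A_cat: "pcat M pure (A n)"
    and Am_functor: "\<theta> \<in> arr Delta n m \<Longrightarrow> vfunctor M pure pure (A n) (A m) (Am n m \<theta>)"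
    and Am_id: "Am n n (\<lambda>x \<in> {0..n}. x) = vf_id (A n)"
    and Am_comp: "\<theta> \<in> arr Delta k n \<Longrightarrow> \<eta> \<in> arr Delta n m \<Longrightarrow>
      Am k m (compose {0..k} \<eta> \<theta>) = vf_comp (A k) (Am n m \<eta>) (Am k n \<theta>)"

text \<open>A composite \<open>Cmp t u\<close> records neither its middle object nor its dimension,
  but evaluation in another category needs both. They are recomputed from the term; the parameter
  \<open>k\<close> will be the class map \<open>kobj A Am X\<close>.\<close>

primrec ksrc :: "(nat \<times> 'x \<times> 'o \<Rightarrow> ('x, 'o) kobj) \<Rightarrow> ('p, 'x, 'o, 'a) kterm \<Rightarrow> ('x, 'o) kobj" where
  "ksrc k (Gen n x i j d c) = k (n, x, i)"
| "ksrc k (Idt a) = a"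
| "ksrc k (Cmp t u) = ksrc k t"
| "ksrc k (Act e d f t) = ksrc k t"

primrec ktgt :: "(nat \<times> 'x \<times> 'o \<Rightarrow> ('x, 'o) kobj) \<Rightarrow> ('p, 'x, 'o, 'a) kterm \<Rightarrow> ('x, 'o) kobj" where
  "ktgt k (Gen n x i j d c) = k (n, x, j)"
| "ktgt k (Idt a) = a"
| "ktgt k (Cmp t u) = ktgt k u"
| "ktgt k (Act e d f t) = ktgt k t"

primrec kdim :: "'p site \<Rightarrow> ('p, 'x, 'o, 'a) kterm \<Rightarrow> nat" where
  "kdim M (Gen n x i j d c) = d"
| "kdim M (Idt a) = 0"
| "kdim M (Cmp t u) = (THE r. join M (kdim M t) (kdim M u) r)"
| "kdim M (Act e d f t) = e"

text \<open>Evaluation is total on raw terms. On well-formed terms \<open>kcell_type\<close> shows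
  that the recomputed objects and dimensions are the intended ones, with \<open>join_fun\<close>
  resolving the definite description in \<open>kdim\<close>.\<close>

primrec kev ::
  "'p site \<Rightarrow> ('p, 'b, 'u) pure_tensor \<Rightarrow> ('p, 'q, 'b, 'u) vcat \<Rightarrow>
   (nat \<times> 'x \<times> 'o \<Rightarrow> ('x, 'o) kobj) \<Rightarrow> (('x, 'o) kobj \<Rightarrow> 'q) \<Rightarrow>
   (nat \<Rightarrow> 'x \<Rightarrow> ('o, 'q, 'a, 'b) efun) \<Rightarrow> ('p, 'x, 'o, 'a) kterm \<Rightarrow> 'b" where
  "kev M pD D k ob G (Gen n x i j d c) = snd (G n x) i j d c"
| "kev M pD D k ob G (Idt a) = ident D (ob a)"
| "kev M pD D k ob G (Cmp t u) = pcomp pD D (ob (ksrc k t)) (ob (ktgt k t)) (ob (ktgt k u))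
     (kdim M t) (kdim M u) (kdim M (Cmp t u)) (kev M pD D k ob G t) (kev M pD D k ob G u)"
| "kev M pD D k ob G (Act e d f t) =
     act (hom D (ob (ksrc k t)) (ob (ktgt k t))) e d f (kev M pD D k ob G t)"

locale kan_data = cosimp M pure A Am
  for M :: "'p site" and pure :: "('p, 'a, 't) pure_tensor"
    and A :: "nat \<Rightarrow> ('p, 'o, 'a, 't) vcat" and Am +
  fixes X :: "'x sset"
  assumes X_sset: "simplicial_set X"
begin

abbreviation "K \<equiv> kobj A Am X"
abbreviation "kc \<equiv> kcell M A Am X"
abbreviation "ke \<equiv> keq M pure A Am X"
abbreviation "E a b d t \<equiv> Collect (ke a b d t)"
abbreviation "H \<equiv> khom M pure A Am X"
abbreviation "obs \<equiv> K ` kobj_reps A X"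

lemma K_obj: "x \<in> cells X n \<Longrightarrow> i \<in> obj (A n) \<Longrightarrow> K (n, x, i) \<in> obs"
  by (auto simp: kobj_reps_def)

lemma K_step:
  assumes "\<theta> \<in> arr Delta n m" "y \<in> cells X m" "i \<in> obj (A n)"
  shows "K (n, act X n m \<theta> y, i) = K (m, y, fst (Am n m \<theta>) i)"
  unfolding kobj_def
  by (rule gen_class_step)
    (use assms in \<open>simp_all add: kobj_reps_def presheafD(1)[OF X_sset]
      vfunctorD(1)[OF Am_functor] kobj_step.intros\<close>)

lemma kcell_obj: "kc a b d t \<Longrightarrow> a \<in> obs \<and> b \<in> obs"
  by (induction rule: kcell.induct) (auto simp: kobj_reps_def)

lemma kcell_type: "kc a b d t \<Longrightarrow> ksrc K t = a \<and> ktgt K t = b \<and> kdim M t = d"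
proof (induction rule: kcell.induct)
  case (kcell_Cmp a b p t c q u r)
  then have "(THE r. join M p q r) = r"
    using join_fun by blast
  with kcell_Cmp show ?case by simp
qed simp_all

text \<open>The class \<open>E a b d t\<close> collects everything congruent to \<open>t\<close>, so
  typing has to be invariant under \<open>keq\<close>; then any element of a class can serve as its
  representative.\<close>

lemma keq_kcell: "ke a b d t u \<Longrightarrow> kc a b d t \<and> kc a b d u"
proof (induction rule: keq.induct)
  case (keq_Cmp a b p t t' c q u u' r)
  then show ?case by (blast intro: kcell_Cmp)
next
  case (keq_Act a b d t t' f e)
  then show ?case by (blast intro: kcell_Act)
next
  case (keq_act_cmp a b p t c q u f p' g q' h r' r)
  then show ?case by (blast intro: kcell_Cmp kcell_Act)
next
  case (keq_assoc a b p t c q u d r v s l s')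
  then show ?case by (blast intro: kcell_Cmp)
next
  case (keq_unit_left a b d t f e)
  then show ?case
    using kcell_obj[OF keq_unit_left(1)] by (blast intro: kcell_Cmp kcell_Act kcell_Idt)
next
  case (keq_unit_right a b d t f e)
  then show ?case
    using kcell_obj[OF keq_unit_right(1)] by (blast intro: kcell_Cmp kcell_Act kcell_Idt)
next
  case (keq_act_id a b d t)
  then show ?case by (blast intro: kcell_Act id_arr)
next
  case (keq_act_act a b n t f m g k)
  then show ?case by (blast intro: kcell_Act comp_arr)
next
  case (keq_gen_act x n i j c d f e)
  then show ?case
    by (blast intro: kcell_Act kcell_Gen presheafD(1) pcat.hom_presheaf A_cat)
next
  case (keq_gen_cmp x n i j k c p c' q r)
  then show ?case
    by (blast intro: kcell_Cmp kcell_Gen pcat.pcomp_in A_cat)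
next
  case (keq_gen_id x n i)
  then show ?case
    by (blast intro: kcell_Idt kcell_Gen pcat.ident_in A_cat K_obj)
next
  case (keq_gen_diagram \<theta> n m y i j c d)
  then have "kc (K (n, act X n m \<theta> y, i)) (K (n, act X n m \<theta> y, j)) d (Gen n (act X n m \<theta> y) i j d c)"
    by (intro kcell_Gen presheafD(1)[OF X_sset])
  with keq_gen_diagram show ?case
    by (simp add: K_step kcell_Gen vfunctorD(1,3)[OF Am_functor])
qed blast+

lemma E_eqI: "ke a b d t u \<Longrightarrow> E a b d t = E a b d u"
  by (auto intro: keq_sym keq_trans)

lemma E_self: "kc a b d t \<Longrightarrow> t \<in> E a b d t"
  by (simp add: keq_refl)

lemma cells_H: "cells (H a b) d = {E a b d t | t. kc a b d t}"
  by (simp add: khom_def)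

lemma E_cell: "kc a b d t \<Longrightarrow> E a b d t \<in> cells (H a b) d"
  by (auto simp: cells_H)

lemma H_cellE:
  assumes "S \<in> cells (H a b) d"
  obtains t where "kc a b d t" "S = E a b d t"
  using assms by (auto simp: cells_H)

lemma act_H:
  assumes "kc a b d t" "f \<in> arr M e d"
  shows "act (H a b) e d f (E a b d t) = E a b e (Act e d f t)"
proof -
  have "E a b e (Act e d f u) = E a b e (Act e d f t)" if "u \<in> E a b d t" for u
    using that assms by (intro E_eqI keq_Act) (auto intro: keq_sym)
  then have "(\<Union>u \<in> E a b d t. E a b e (Act e d f u)) = E a b e (Act e d f t)"
    using E_self[OF assms(1)] by (intro SUP_eq_const) blast+
  then show ?thesis
    by (simp add: khom_def)
qed

lemma H_presheaf: "presheaf M (H a b)"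
proof (rule presheafI)
  fix m n f S assume "f \<in> arr M m n" "S \<in> cells (H a b) n"
  then show "act (H a b) m n f S \<in> cells (H a b) m"
    by (auto elim!: H_cellE simp: act_H intro!: E_cell kcell_Act)
next
  fix n S assume "S \<in> cells (H a b) n"
  then show "act (H a b) n n (\<lambda>v \<in> pts M n. v) S = S"
    by (elim H_cellE) (simp only: act_H id_arr, intro E_eqI keq_act_id)
next
  fix k m n f g S assume *: "g \<in> arr M k m" "f \<in> arr M m n" "S \<in> cells (H a b) n"
  from *(3) show "act (H a b) k m g (act (H a b) m n f S) = act (H a b) k n (compose (pts M k) f g) S"
  proof (rule H_cellE)
    fix t assume t: "kc a b n t" "S = E a b n t"
    have "act (H a b) k m g (act (H a b) m n f S) = E a b k (Act k m g (Act m n f t))"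
      using t * by (simp only: act_H kcell_Act)
    also have "\<dots> = E a b k (Act k n (compose (pts M k) f g) t)"
      using t * by (intro E_eqI keq_act_act)
    also have "\<dots> = act (H a b) k n (compose (pts M k) f g) S"
      using t * by (simp only: act_H comp_arr)
    finally show ?thesis .
  qed
qed

end

locale kan_cat = kan_data M pure A Am X + tensor M tens' pure'
  for M :: "'p site" and pure :: "('p, 'a, 't) pure_tensor"
    and A :: "nat \<Rightarrow> ('p, 'o, 'a, 't) vcat" and Am and X :: "'x sset"
    and tens' :: "('p, ('p, 'x, 'o, 'a) khom) psh \<Rightarrow> ('p, ('p, 'x, 'o, 'a) khom) psh \<Rightarrow> ('p, 'u) psh"
    and pure' :: "('p, ('p, 'x, 'o, 'a) khom, 'u) pure_tensor"
begin

abbreviation "KX \<equiv> kan M pure tens' pure' A Am X"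
abbreviation "kin \<equiv> kan_in M pure A Am X"

lemma obj_kan: "obj KX = obs"
  by (simp add: kan_def Let_def)

lemma hom_kan: "hom KX = H"
  by (simp add: kan_def Let_def)

lemma ident_kan: "ident KX a = E a a 0 (Idt a)"
  by (simp add: kan_def Let_def)

text \<open>The composition in \<open>kan\<close> is a union over all presentations of a cell as a
  restricted pure tensor. Its well-definedness is obtained indirectly: \<open>tens_univ\<close>
  supplies a morphism \<phi> with the right values on pure tensors, and every presentation turns out
  to contribute the value of \<phi>.\<close>

lemma vcomp_kan:
  obtains \<phi> where "psh_map M (tens' (H a b) (H b c)) (H a c) \<phi>"
    "\<And>p q r t u. join M p q r \<Longrightarrow> kc a b p t \<Longrightarrow> kc b c q u \<Longrightarrow>
      \<phi> r (pure' (H a b) (H b c) p q (E a b p t) (E b c q u)) = E a c r (Cmp t u)"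
    "vcomp KX a b c = \<phi>"
proof -
  \<comment> \<open>Representatives are chosen so that an operation on classes can be handed to
    \<open>tens_univ\<close>; by \<open>keq_Cmp\<close> the result is independent of the choice
    (\<open>bil_E\<close>).\<close>
  define rp where "rp = (\<lambda>a b d S. SOME t. kc a b d t \<and> S = E a b d t)"
  have rp: "kc a b d (rp a b d S) \<and> S = E a b d (rp a b d S)" if "S \<in> cells (H a b) d" for a b d S
    unfolding rp_def by (rule someI_ex) (use that in \<open>auto simp: cells_H\<close>)
  define bil where "bil = (\<lambda>(p::nat) (q::nat) r S T. E a c r (Cmp (rp a b p S) (rp b c q T)))"
  have bil_E: "bil p q r (E a b p t) (E b c q u) = E a c r (Cmp t u)"
    if "join M p q r" "kc a b p t" "kc b c q u" for p q r t u
  proof -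
    have "ke a b p (rp a b p (E a b p t)) t"
      using rp[OF E_cell[OF that(2)]] E_self[OF that(2)] by auto
    moreover have "ke b c q (rp b c q (E b c q u)) u"
      using rp[OF E_cell[OF that(3)]] E_self[OF that(3)] by auto
    ultimately show ?thesis
      unfolding bil_def using that(1) by (intro E_eqI keq_Cmp)
  qed
  have 1: "bil p q r S T \<in> cells (H a c) r"
    if *: "join M p q r" "S \<in> cells (H a b) p" "T \<in> cells (H b c) q" for p q r S T
    using *(2,3) by (elim H_cellE) (simp add: bil_E *(1), rule E_cell, rule kcell_Cmp, (assumption | rule *(1))+)
  have 2: "act (H a c) r' r h (bil p q r S T) = bil p' q' r' (act (H a b) p' p f S) (act (H b c) q' q g T)"
    if *: "join M p q r" "join M p' q' r'" "f \<in> arr M p' p" "g \<in> arr M q' q" "h \<in> arr M r' r"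
      "joinarr M p' p f q' q g h" "S \<in> cells (H a b) p" "T \<in> cells (H b c) q"
    for p q r p' q' r' f g h S T
    using *(7,8)
  proof (elim H_cellE)
    fix t u assume t: "kc a b p t" "S = E a b p t" and u: "kc b c q u" "T = E b c q u"
    have "act (H a c) r' r h (bil p q r S T) = E a c r' (Act r' r h (Cmp t u))"
      using t u * by (simp only: bil_E act_H kcell_Cmp)
    also have "\<dots> = E a c r' (Cmp (Act p' p f t) (Act q' q g u))"
      using t u * by (intro E_eqI keq_act_cmp)
    also have "\<dots> = bil p' q' r' (act (H a b) p' p f S) (act (H b c) q' q g T)"
      using t u * by (simp only: bil_E act_H kcell_Act)
    finally show ?thesis .
  qed
  obtain \<phi> where \<phi>: "psh_map M (tens' (H a b) (H b c)) (H a c) \<phi>"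
    "\<And>p q r S T. join M p q r \<Longrightarrow> S \<in> cells (H a b) p \<Longrightarrow> T \<in> cells (H b c) q \<Longrightarrow>
      \<phi> r (pure' (H a b) (H b c) p q S T) = bil p q r S T"
    using tens_univ[of "H a b" "H b c" "H a c" bil, OF H_presheaf H_presheaf H_presheaf 1 2]
    by blast
  have 3: "\<phi> r (pure' (H a b) (H b c) p q (E a b p t) (E b c q u)) = E a c r (Cmp t u)"
    if "join M p q r" "kc a b p t" "kc b c q u" for p q r t u
    using \<phi>(2)[OF that(1) E_cell E_cell] that by (simp add: bil_E)
  have "vcomp KX a b c = \<phi>"
  proof (rule psh_map_eqI[of _ "tens' (H a b) (H b c)"])
    show "\<phi> n \<in> extensional (cells (tens' (H a b) (H b c)) n)" for n
      using psh_mapD(2)[OF \<phi>(1)] .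
    show "vcomp KX a b c n \<in> extensional (cells (tens' (H a b) (H b c)) n)" for n
      by (simp add: kan_def Let_def)
    fix r \<tau> assume \<tau>: "\<tau> \<in> cells (tens' (H a b) (H b c)) r"
    \<comment> \<open>Naturality of \<phi> moves the restriction along \<open>h\<close> outside,
      where the value on the pure tensor is known.\<close>
    have *: "E a c r (Act r s h (Cmp t u)) = \<phi> r \<tau>"
      if **: "join M p q s" "h \<in> arr M r s" "S \<in> cells (H a b) p" "T \<in> cells (H b c) q"
        "t \<in> S" "u \<in> T" "\<tau> = act (tens' (H a b) (H b c)) r s h (pure' (H a b) (H b c) p q S T)"
      for p q s h S T t u
    proof -
      have t: "kc a b p t" "S = E a b p t"
        using **(3,5) by (elim H_cellE; auto dest: keq_kcell intro: keq_sym keq_trans)+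
      have u: "kc b c q u" "T = E b c q u"
        using **(4,6) by (elim H_cellE; auto dest: keq_kcell intro: keq_sym keq_trans)+
      have "\<phi> r \<tau> = act (H a c) r s h (\<phi> s (pure' (H a b) (H b c) p q S T))"
        unfolding **(7) using ** by (intro psh_mapD(3)[OF \<phi>(1)] pure_in H_presheaf)
      also have "\<dots> = act (H a c) r s h (E a c s (Cmp t u))"
        using ** t u by (simp add: 3)
      also have "\<dots> = E a c r (Act r s h (Cmp t u))"
        using ** t u by (intro act_H kcell_Cmp)
      finally show ?thesis by simp
    qed
    \<comment> \<open>By \<open>tens_gen\<close> some presentation exists, so the family of classes
      is a singleton and not empty.\<close>
    obtain p q s h S T where ST: "join M p q s" "h \<in> arr M r s" "S \<in> cells (H a b) p"
        "T \<in> cells (H b c) q" "\<tau> = act (tens' (H a b) (H b c)) r s h (pure' (H a b) (H b c) p q S T)"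
      using tens_gen[OF H_presheaf H_presheaf \<tau>] by blast
    obtain t u where tu: "t \<in> S" "u \<in> T"
      using ST(3,4) by (elim H_cellE) (use E_self in blast)
    let ?Z = "{E a c r (Act r s h (Cmp t u)) | p q s h S T t u.
             join M p q s \<and> h \<in> arr M r s \<and> S \<in> cells (H a b) p \<and> T \<in> cells (H b c) q \<and>
             t \<in> S \<and> u \<in> T \<and> \<tau> = act (tens' (H a b) (H b c)) r s h (pure' (H a b) (H b c) p q S T)}"
    have "E a c r (Act r s h (Cmp t u)) \<in> ?Z"
      using ST tu by blast
    moreover have "z = \<phi> r \<tau>" if "z \<in> ?Z" for z
      using that * by blast
    ultimately have "?Z = {\<phi> r \<tau>}" by blast
    then have "\<Union> ?Z = \<phi> r \<tau>" by simp
    then show "vcomp KX a b c r \<tau> = \<phi> r \<tau>"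
      using \<tau> by (simp add: kan_def Let_def)
  qed
  with \<phi>(1) 3 that show thesis by blast
qed

lemma pcomp_kan:
  assumes "join M p q r" "kc a b p t" "kc b c q u"
  shows "pcomp pure' KX a b c p q r (E a b p t) (E b c q u) = E a c r (Cmp t u)"
proof -
  obtain \<phi> where "\<phi> r (pure' (H a b) (H b c) p q (E a b p t) (E b c q u)) = E a c r (Cmp t u)"
    "vcomp KX a b c = \<phi>"
    using vcomp_kan[of a b c] assms by metis
  then show ?thesis by (simp add: pcomp_def hom_kan)
qed

text \<open>Each axiom is one rule of \<open>keq\<close> read on classes:
  \<open>keq_act_cmp\<close>, \<open>keq_assoc\<close>, \<open>keq_unit_left\<close> and
  \<open>keq_unit_right\<close>, besides the presheaf rules already used for
  \<open>H_presheaf\<close>.\<close>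

lemma kan_pcat: "pcat M pure' KX"
proof unfold_locales
  show "presheaf M (hom KX a b)" for a b
    by (simp add: hom_kan H_presheaf)
  show "ident KX a \<in> cells (hom KX a a) 0" if "a \<in> obj KX" for a
    using that by (simp add: obj_kan hom_kan ident_kan) (intro E_cell kcell_Idt)
  show "pcomp pure' KX a b c p q r S T \<in> cells (hom KX a c) r"
    if "join M p q r" "S \<in> cells (hom KX a b) p" "T \<in> cells (hom KX b c) q" for a b c p q r S T
    using that(2,3) unfolding hom_kan
    by (elim H_cellE) (simp add: pcomp_kan that(1), rule E_cell, rule kcell_Cmp, (assumption | rule that(1))+)
  show "act (hom KX a c) r' r h (pcomp pure' KX a b c p q r S T) =
      pcomp pure' KX a b c p' q' r' (act (hom KX a b) p' p f S) (act (hom KX b c) q' q g T)"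
    if *: "join M p q r" "join M p' q' r'" "f \<in> arr M p' p" "g \<in> arr M q' q" "h \<in> arr M r' r"
      "joinarr M p' p f q' q g h" "S \<in> cells (hom KX a b) p" "T \<in> cells (hom KX b c) q"
    for a b c p q r p' q' r' f g h S T
    using *(7,8) unfolding hom_kan
    apply (elim H_cellE)
    apply (simp only: pcomp_kan *(1,2) act_H kcell_Act kcell_Cmp *(3-5))
    apply (rule E_eqI, rule keq_act_cmp[OF _ _ *(3-5,1,2,6)]; assumption)
    done
  show "pcomp pure' KX w y z s r t (pcomp pure' KX w x y p q s S T) U =
      pcomp pure' KX w x z p s' t S (pcomp pure' KX x y z q r s' T U)"
    if *: "join M p q s" "join M s r t" "join M q r s'" "join M p s' t"
      "S \<in> cells (hom KX w x) p" "T \<in> cells (hom KX x y) q" "U \<in> cells (hom KX y z) r"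
    for w x y z p q r s s' t S T U
    using *(5-7) unfolding hom_kan
    apply (elim H_cellE)
    apply (simp only: pcomp_kan *(1-4) kcell_Cmp[OF _ _ *(1)] kcell_Cmp[OF _ _ *(3)])
    apply (rule E_eqI, rule keq_assoc[OF _ _ _ *(1-4)]; assumption)
    done
  show "pcomp pure' KX a a b e d d (act (hom KX a a) e 0 f (ident KX a)) S = S"
    if *: "f \<in> arr M e 0" "S \<in> cells (hom KX a b) d" "join M e d d" for a b f e S d
    using *(2) unfolding hom_kan ident_kan
  proof (elim H_cellE)
    fix t assume t: "kc a b d t" "S = E a b d t"
    have I: "kc a a 0 (Idt a)" using kcell_obj[OF t(1)] by (auto intro: kcell_Idt)
    show "pcomp pure' KX a a b e d d (act (H a a) e 0 f (E a a 0 (Idt a))) S = S"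
      unfolding t act_H[OF I *(1)] pcomp_kan[OF *(3) kcell_Act[OF I *(1)] t(1)]
      using t * by (intro E_eqI keq_unit_left)
  qed
  show "pcomp pure' KX a b b d e d S (act (hom KX b b) e 0 f (ident KX b)) = S"
    if *: "f \<in> arr M e 0" "S \<in> cells (hom KX a b) d" "join M d e d" for a b f e S d
    using *(2) unfolding hom_kan ident_kan
  proof (elim H_cellE)
    fix t assume t: "kc a b d t" "S = E a b d t"
    have I: "kc b b 0 (Idt b)" using kcell_obj[OF t(1)] by (auto intro: kcell_Idt)
    show "pcomp pure' KX a b b d e d S (act (H b b) e 0 f (E b b 0 (Idt b))) = S"
      unfolding t act_H[OF I *(1)] pcomp_kan[OF *(3) t(1) kcell_Act[OF I *(1)]]
      using t * by (intro E_eqI keq_unit_right)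
  qed
qed

lemma kan_vcategory: "vcategory M tens' pure' KX"
  by (rule pcat_vcategory[OF kan_pcat]) (metis hom_kan vcomp_kan)

lemma fst_kin [simp]: "i \<in> obj (A n) \<Longrightarrow> fst (kin n x) i = K (n, x, i)"
  by (simp add: kan_in_def)

lemma snd_kin [simp]:
  "i \<in> obj (A n) \<Longrightarrow> j \<in> obj (A n) \<Longrightarrow> c \<in> cells (hom (A n) i j) d \<Longrightarrow>
   snd (kin n x) i j d c = E (K (n, x, i)) (K (n, x, j)) d (Gen n x i j d c)"
  by (simp add: kan_in_def)

text \<open>The rules \<open>keq_gen_act\<close>, \<open>keq_gen_cmp\<close> and
  \<open>keq_gen_id\<close> were imposed to make this true, just as \<open>keq_gen_diagram\<close>
  was imposed for the cocone condition.\<close>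

lemma kin_functor:
  assumes x: "x \<in> cells X n"
  shows "vfunctor M pure pure' (A n) KX (kin n x)"
proof (rule vfunctorI)
  interpret An: pcat M pure "A n" by (rule A_cat)
  show "vf_ext (A n) (kin n x)" by (simp add: kan_in_def)
  show "fst (kin n x) i \<in> obj KX" if "i \<in> obj (A n)" for i
    using x that by (simp add: obj_kan kobj_reps_def)
  show "snd (kin n x) i j d c \<in> cells (hom KX (fst (kin n x) i) (fst (kin n x) j)) d"
    if "i \<in> obj (A n)" "j \<in> obj (A n)" "c \<in> cells (hom (A n) i j) d" for i j c d
    using x that by (simp add: hom_kan) (intro E_cell kcell_Gen)
  show "snd (kin n x) i j e (act (hom (A n) i j) e d f c) =
       act (hom KX (fst (kin n x) i) (fst (kin n x) j)) e d f (snd (kin n x) i j d c)"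
    if "i \<in> obj (A n)" "j \<in> obj (A n)" "f \<in> arr M e d" "c \<in> cells (hom (A n) i j) d" for i j f e d c
  proof -
    have g: "kc (K (n, x, i)) (K (n, x, j)) d (Gen n x i j d c)"
      using x that by (intro kcell_Gen)
    show ?thesis
      using x that
      by (simp add: hom_kan presheafD(1)[OF An.hom_presheaf] act_H[OF g])
        (intro E_eqI keq_gen_act[THEN keq_sym])
  qed
  show "snd (kin n x) i i 0 (ident (A n) i) = ident KX (fst (kin n x) i)" if "i \<in> obj (A n)" for i
    using x that by (simp add: ident_kan An.ident_in) (intro E_eqI keq_gen_id)
  show "snd (kin n x) i k r (pcomp pure (A n) i j k p q r a b) =
       pcomp pure' KX (fst (kin n x) i) (fst (kin n x) j) (fst (kin n x) k) p q r
        (snd (kin n x) i j p a) (snd (kin n x) j k q b)"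
    if "i \<in> obj (A n)" "j \<in> obj (A n)" "k \<in> obj (A n)" "join M p q r"
      "a \<in> cells (hom (A n) i j) p" "b \<in> cells (hom (A n) j k) q" for i j k p q r a b
  proof -
    have "kc (K (n, x, i)) (K (n, x, j)) p (Gen n x i j p a)" "kc (K (n, x, j)) (K (n, x, k)) q (Gen n x j k q b)"
      using x that by (intro kcell_Gen; simp)+
    with x that show ?thesis
      by (simp add: An.pcomp_in pcomp_kan) (intro E_eqI keq_gen_cmp[THEN keq_sym])
  qed
qed

lemma kin_cocone:
  assumes "\<theta> \<in> arr Delta n m" "y \<in> cells X m"
  shows "kin n (act X n m \<theta> y) = vf_comp (A n) (kin m y) (Am n m \<theta>)"
proof (rule vf_eqI[of "A n"])
  show "vf_ext (A n) (kin n (act X n m \<theta> y))" by (simp add: kan_in_def)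
  fix i assume "i \<in> obj (A n)"
  then show "fst (kin n (act X n m \<theta> y)) i = fst (vf_comp (A n) (kin m y) (Am n m \<theta>)) i"
    using assms by (simp add: vfunctorD(1)[OF Am_functor] K_step)
next
  fix i j d c assume *: "i \<in> obj (A n)" "j \<in> obj (A n)" "c \<in> cells (hom (A n) i j) d"
  show "snd (kin n (act X n m \<theta> y)) i j d c = snd (vf_comp (A n) (kin m y) (Am n m \<theta>)) i j d c"
    using assms *
    by (simp add: vfunctorD(1,3)[OF Am_functor] K_step) (intro E_eqI keq_gen_diagram)
qed simp

text \<open>The uniqueness half of the universal property. Every cell is built from cells of the
  copies by identities, composition and the action, all of which a functor preserves, so induction
  over formal cells applies.\<close>

lemma kan_functor_eqI:
  assumes F: "vfunctor M pure' pD KX D F" "vfunctor M pure' pD KX D F'"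
    and eq: "\<And>n x. x \<in> cells X n \<Longrightarrow> vf_comp (A n) F (kin n x) = vf_comp (A n) F' (kin n x)"
  shows "F = F'"
proof (rule vf_eqI[of KX])
  have o: "fst F (K (n, x, i)) = fst F' (K (n, x, i))" if "x \<in> cells X n" "i \<in> obj (A n)" for n x i
    using arg_cong[OF eq[OF that(1)], of "\<lambda>G. fst G i"] that by simp
  then show ob: "fst F a = fst F' a" if "a \<in> obj KX" for a
    using that by (auto simp: obj_kan kobj_reps_def)
  have "snd F a b d (E a b d t) = snd F' a b d (E a b d t)" if "kc a b d t" for a b d t
    using that
  proof (induction rule: kcell.induct)
    case (kcell_Gen x n i j c d)
    then show ?case
      using arg_cong[OF eq[OF kcell_Gen(1)], of "\<lambda>G. snd G i j d c"] by simp
  next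
    case (kcell_Idt a)
    then have "a \<in> obj KX" by (simp add: obj_kan)
    then show ?case
      using vfunctorD(5)[OF F(1), of a] vfunctorD(5)[OF F(2), of a] ob by (simp add: ident_kan)
  next
    case (kcell_Cmp a b p t c q u r)
    then have *: "a \<in> obj KX" "b \<in> obj KX" "c \<in> obj KX"
      using kcell_obj by (auto simp: obj_kan)
    have **: "E a b p t \<in> cells (hom KX a b) p" "E b c q u \<in> cells (hom KX b c) q"
      using kcell_Cmp E_cell by (auto simp: hom_kan)
    show ?case
      using vfunctorD(6)[OF F(1) * kcell_Cmp(3) **] vfunctorD(6)[OF F(2) * kcell_Cmp(3) **]
        kcell_Cmp ob[OF *(1)] ob[OF *(2)] ob[OF *(3)]
      by (simp add: pcomp_kan)
  next
    case (kcell_Act a b d t f e)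
    then have *: "a \<in> obj KX" "b \<in> obj KX"
      using kcell_obj by (auto simp: obj_kan)
    have **: "E a b d t \<in> cells (hom KX a b) d"
      using kcell_Act E_cell by (auto simp: hom_kan)
    show ?case
      using vfunctorD(4)[OF F(1) * kcell_Act(2) **] vfunctorD(4)[OF F(2) * kcell_Act(2) **]
        kcell_Act ob[OF *(1)] ob[OF *(2)]
      by (simp add: hom_kan act_H)
  qed
  then show "snd F a b d S = snd F' a b d S" if "S \<in> cells (hom KX a b) d" for a b d S
    using that by (auto simp: hom_kan elim!: H_cellE)
qed (rule vfunctorD(7)[OF F(1)], rule vfunctorD(7)[OF F(2)])

end

text \<open>A functor out of the colimit evaluates formal composites in its codomain.\<close>

locale kan_cocone = kan_cat M pure A Am X tens' pure' + D: pcat M pD D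
  for M :: "'p site" and pure :: "('p, 'a, 't) pure_tensor"
    and A :: "nat \<Rightarrow> ('p, 'o, 'a, 't) vcat" and Am and X :: "'x sset"
    and tens' :: "('p, ('p, 'x, 'o, 'a) khom) psh \<Rightarrow> ('p, ('p, 'x, 'o, 'a) khom) psh \<Rightarrow> ('p, 'u) psh"
    and pure' :: "('p, ('p, 'x, 'o, 'a) khom, 'u) pure_tensor"
    and pD :: "('p, 'b, 'v) pure_tensor" and D :: "('p, 'q, 'b, 'v) vcat" +
  fixes G :: "nat \<Rightarrow> 'x \<Rightarrow> ('o, 'q, 'a, 'b) efun"
  assumes G_functor: "x \<in> cells X n \<Longrightarrow> vfunctor M pure pD (A n) D (G n x)"
    and G_cocone: "\<theta> \<in> arr Delta n m \<Longrightarrow> y \<in> cells X m \<Longrightarrow>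
      G n (act X n m \<theta> y) = vf_comp (A n) (G m y) (Am n m \<theta>)"
begin

definition "ko a = the_elem ((\<lambda>(n, x, i). fst (G n x) i) ` a)"
abbreviation "ev \<equiv> kev M pD D K ko G"
definition "lift = mk_vf KX ko (\<lambda>a b d S. the_elem (ev ` S))"

lemma ko_K: "x \<in> cells X n \<Longrightarrow> i \<in> obj (A n) \<Longrightarrow> ko (K (n, x, i)) = fst (G n x) i"
  unfolding ko_def kobj_def
  by (subst gen_class_the_elem) (auto simp: kobj_reps_def G_cocone elim!: kobj_step.cases)

lemma ko_obj: "a \<in> obs \<Longrightarrow> ko a \<in> obj D"
  by (auto simp: ko_K kobj_reps_def vfunctorD(1)[OF G_functor])

lemma ev_in: "kc a b d t \<Longrightarrow> ev t \<in> cells (hom D (ko a) (ko b)) d"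
proof (induction rule: kcell.induct)
  case (kcell_Cmp a b p t c q u r)
  then show ?case
    using kcell_type[OF kcell_Cmp(1)] kcell_type[OF kcell_Cmp(2)]
      kcell_type[OF kcell.kcell_Cmp[OF kcell_Cmp(1-3)]]
      kcell_obj[OF kcell_Cmp(1)] kcell_obj[OF kcell_Cmp(2)]
    by (simp add: D.pcomp_in ko_obj)
next
  case (kcell_Act a b d t f e)
  then show ?case
    using kcell_type[OF kcell_Act(1)] kcell_obj[OF kcell_Act(1)]
    by (simp add: presheafD(1)[OF D.hom_presheaf] ko_obj)
qed (simp_all add: ko_K vfunctorD(3)[OF G_functor] D.ident_in ko_obj)

lemma ev_Cmp: "kc a b p t \<Longrightarrow> kc b c q u \<Longrightarrow> join M p q r \<Longrightarrow>
    ev (Cmp t u) = pcomp pD D (ko a) (ko b) (ko c) p q r (ev t) (ev u)"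
  using kcell_type[of a b p t] kcell_type[of b c q u] kcell_type[OF kcell_Cmp[of M A Am X a b p t c q u r]]
  by simp

lemma ev_Gen: "ev (Gen n x i j d c) = snd (G n x) i j d c"
  by simp

lemma ev_Idt: "ev (Idt a) = ident D (ko a)"
  by simp

lemma ev_Act: "kc a b d t \<Longrightarrow> ev (Act e d f t) = act (hom D (ko a) (ko b)) e d f (ev t)"
  using kcell_type[of a b d t] by simp

text \<open>Soundness of the congruence. The category rules hold by the axioms of \<open>D\<close>,
  the generator rules because each \<open>G n x\<close> is a functor, and
  \<open>keq_gen_diagram\<close> because these functors form a cocone.\<close>

lemma ev_eq: "ke a b d t u \<Longrightarrow> ev t = ev u"
proof (induction rule: keq.induct)
  case (keq_Cmp a b p t t' c q u u' r)
  then show ?case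
    by (metis ev_Cmp keq_kcell)
next
  case (keq_Act a b d t t' f e)
  then show ?case
    by (metis ev_Act keq_kcell)
next
  case (keq_act_id a b d t)
  then show ?case
    by (simp only: ev_Act presheafD(2)[OF D.hom_presheaf] ko_obj kcell_obj ev_in)
next
  case (keq_act_act a b n t f m g k)
  then show ?case
    by (simp only: ev_Act[OF kcell_Act] ev_Act presheafD(3)[OF D.hom_presheaf] ko_obj kcell_obj ev_in)
next
  case (keq_act_cmp a b p t c q u f p' g q' h r' r)
  then have "ko a \<in> obj D" "ko b \<in> obj D" "ko c \<in> obj D"
    by (simp_all only: ko_obj kcell_obj)
  with keq_act_cmp show ?case
    by (simp only: ev_Act[OF kcell_Cmp] ev_Cmp[OF kcell_Act kcell_Act] ev_Act ev_Cmp ev_in D.pcomp_act)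
next
  case (keq_assoc a b p t c q u d r v s l s')
  then have *: "ko a \<in> obj D" "ko b \<in> obj D" "ko c \<in> obj D" "ko d \<in> obj D"
    by (simp_all only: ko_obj kcell_obj)
  have "ev (Cmp (Cmp t u) v) = pcomp pD D (ko a) (ko c) (ko d) s r l
      (pcomp pD D (ko a) (ko b) (ko c) p q s (ev t) (ev u)) (ev v)"
    using keq_assoc by (simp only: ev_Cmp[OF kcell_Cmp[OF _ _ keq_assoc(4)]] ev_Cmp[OF _ _ keq_assoc(4)])
  also have "\<dots> = pcomp pD D (ko a) (ko b) (ko d) p s' l (ev t)
      (pcomp pD D (ko b) (ko c) (ko d) q r s' (ev u) (ev v))"
    using keq_assoc * by (intro D.pcomp_assoc ev_in)
  also have "\<dots> = ev (Cmp t (Cmp u v))"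
    using keq_assoc by (simp only: ev_Cmp[OF _ kcell_Cmp[OF _ _ keq_assoc(6)]] ev_Cmp[OF _ _ keq_assoc(6)])
  finally show ?case .
next
  case (keq_unit_left a b d t f e)
  then have *: "a \<in> obs" "b \<in> obs" using kcell_obj by blast+
  with keq_unit_left show ?case
    by (simp only: ev_Cmp[OF kcell_Act[OF kcell_Idt]] ev_Act[OF kcell_Idt] ev_Idt D.unit_left ko_obj ev_in)
next
  case (keq_unit_right a b d t f e)
  then have *: "a \<in> obs" "b \<in> obs" using kcell_obj by blast+
  with keq_unit_right show ?case
    by (simp only: ev_Cmp[OF _ kcell_Act[OF kcell_Idt]] ev_Act[OF kcell_Idt] ev_Idt D.unit_right ko_obj ev_in)
next
  case (keq_gen_act x n i j c d f e)
  then show ?case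
    by (simp add: ko_K vfunctorD(4)[OF G_functor])
next
  case (keq_gen_cmp x n i j k c p c' q r)
  then show ?case
    by (simp only: ev_Cmp[OF kcell_Gen kcell_Gen] ev_Gen ko_K vfunctorD(6)[OF G_functor])
next
  case (keq_gen_id x n i)
  then show ?case
    by (simp add: ko_K vfunctorD(5)[OF G_functor])
next
  case (keq_gen_diagram \<theta> n m y i j c d)
  then show ?case
    by (simp add: G_cocone)
qed simp_all

lemma fst_lift: "a \<in> obs \<Longrightarrow> fst lift a = ko a"
  by (simp add: lift_def obj_kan)

lemma snd_lift:
  assumes "kc a b d t"
  shows "snd lift a b d (E a b d t) = ev t"
proof -
  have "ev u = ev t" if "u \<in> E a b d t" for u
    using ev_eq[of a b d t u] that by simp
  then have "ev ` E a b d t = {ev t}"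
    using E_self[OF assms] by blast
  then show ?thesis
    using kcell_obj[OF assms] E_cell[OF assms] by (simp only: lift_def obj_kan hom_kan snd_mk_vf the_elem_eq)
qed

lemma lift_functor: "vfunctor M pure' pD KX D lift"
proof (rule vfunctorI)
  show "vf_ext KX lift" by (simp add: lift_def)
  show "fst lift a \<in> obj D" if "a \<in> obj KX" for a
    using that unfolding obj_kan by (simp only: fst_lift ko_obj)
  show "snd lift a b n S \<in> cells (hom D (fst lift a) (fst lift b)) n"
    if "a \<in> obj KX" "b \<in> obj KX" "S \<in> cells (hom KX a b) n" for a b S n
    using that unfolding obj_kan hom_kan by (elim H_cellE) (simp only: fst_lift snd_lift ev_in)
  show "snd lift a b m (act (hom KX a b) m n f S) =
       act (hom D (fst lift a) (fst lift b)) m n f (snd lift a b n S)"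
    if "a \<in> obj KX" "b \<in> obj KX" "f \<in> arr M m n" "S \<in> cells (hom KX a b) n" for a b f m n S
    using that unfolding obj_kan hom_kan
    by (elim H_cellE) (simp only: fst_lift act_H snd_lift kcell_Act ev_Act)
  show "snd lift a a 0 (ident KX a) = ident D (fst lift a)" if "a \<in> obj KX" for a
    using that unfolding obj_kan ident_kan by (simp only: fst_lift snd_lift kcell_Idt ev_Idt)
  show "snd lift a c r (pcomp pure' KX a b c p q r S T) =
       pcomp pD D (fst lift a) (fst lift b) (fst lift c) p q r (snd lift a b p S) (snd lift b c q T)"
    if "a \<in> obj KX" "b \<in> obj KX" "c \<in> obj KX" "join M p q r"
      "S \<in> cells (hom KX a b) p" "T \<in> cells (hom KX b c) q" for a b c p q r S T
    using that unfolding obj_kan hom_kan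
    by (elim H_cellE) (simp only: fst_lift pcomp_kan snd_lift kcell_Cmp ev_Cmp)
qed

lemma lift_kin:
  assumes "x \<in> cells X n"
  shows "vf_comp (A n) lift (kin n x) = G n x"
proof (rule vf_eqI[of "A n"])
  show "vf_ext (A n) (G n x)" using vfunctorD(7)[OF G_functor[OF assms]] .
  show "fst (vf_comp (A n) lift (kin n x)) i = fst (G n x) i" if "i \<in> obj (A n)" for i
    using that assms by (simp add: fst_lift ko_K kobj_reps_def)
  show "snd (vf_comp (A n) lift (kin n x)) i j d c = snd (G n x) i j d c"
    if "i \<in> obj (A n)" "j \<in> obj (A n)" "c \<in> cells (hom (A n) i j) d" for i j d c
    using that assms by (simp add: snd_lift kcell_Gen)
qed simp

end

section \<open>Nerves, and the left Kan extension as their left adjoint\<close>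

definition nerve ::
  "'p site \<Rightarrow> ('p, 'a, 't) pure_tensor \<Rightarrow> ('p, 'b, 'u) pure_tensor \<Rightarrow> (nat \<Rightarrow> ('p, 'o, 'a, 't) vcat) \<Rightarrow>
   (nat \<Rightarrow> nat \<Rightarrow> (nat \<Rightarrow> nat) \<Rightarrow> ('o, 'o, 'a, 'a) efun) \<Rightarrow> ('p, 'q, 'b, 'u) vcat \<Rightarrow>
   ('o, 'q, 'a, 'b) efun sset" where
  "nerve M pure pC A Am C = \<lparr>cells = (\<lambda>n. {F. vfunctor M pure pC (A n) C F}),
                             act = (\<lambda>m n \<theta> F. vf_comp (A m) F (Am m n \<theta>))\<rparr>"

definition nerve_map ::
  "'p site \<Rightarrow> ('p, 'a, 't) pure_tensor \<Rightarrow> ('p, 'b, 'u) pure_tensor \<Rightarrow> (nat \<Rightarrow> ('p, 'o, 'a, 't) vcat) \<Rightarrow>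
   (nat \<Rightarrow> nat \<Rightarrow> (nat \<Rightarrow> nat) \<Rightarrow> ('o, 'o, 'a, 'a) efun) \<Rightarrow> ('p, 'q, 'b, 'u) vcat \<Rightarrow>
   ('q, 'r, 'b, 'c) efun \<Rightarrow> nat \<Rightarrow> ('o, 'q, 'a, 'b) efun \<Rightarrow> ('o, 'r, 'a, 'c) efun" where
  "nerve_map M pure pC A Am C G n = (\<lambda>F \<in> cells (nerve M pure pC A Am C) n. vf_comp (A n) G F)"

lemma cells_nerve: "F \<in> cells (nerve M pure pC A Am C) n \<longleftrightarrow> vfunctor M pure pC (A n) C F"
  by (simp add: nerve_def)

context cosimp
begin

lemma nerve_sset: "simplicial_set (nerve M pure pC A Am C)"
proof (rule presheafI)
  fix k m n f g F
  assume *: "g \<in> arr Delta k m" "f \<in> arr Delta m n" "F \<in> cells (nerve M pure pC A Am C) n"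
  have "pts Delta k = {0..k}" by (simp add: Delta_def)
  then show "act (nerve M pure pC A Am C) k m g (act (nerve M pure pC A Am C) m n f F) =
        act (nerve M pure pC A Am C) k n (compose (pts Delta k) f g) F"
    using * by (simp add: nerve_def Am_comp vf_comp_assoc[OF Am_functor[OF *(1)]])
qed (auto simp: nerve_def Delta_def Am_id intro: vfunctor_comp[OF A_cat Am_functor, unfolded Delta_def]
    vf_comp_id_right vfunctorD(7))

lemma nerve_map_psh:
  assumes "vfunctor M pC pD C D G"
  shows "simplicial_map (nerve M pure pC A Am C) (nerve M pure pD A Am D) (nerve_map M pure pC A Am C G)"
proof (rule psh_mapI)
  fix m n f F assume *: "f \<in> arr Delta m n" "F \<in> cells (nerve M pure pC A Am C) n"
  then show "nerve_map M pure pC A Am C G m (act (nerve M pure pC A Am C) m n f F) =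
       act (nerve M pure pD A Am D) m n f (nerve_map M pure pC A Am C G n F)"
    using presheafD(1)[OF nerve_sset *]
    by (simp add: nerve_map_def) (simp add: nerve_def vf_comp_assoc[OF Am_functor])
qed (auto simp: nerve_def nerve_map_def intro: vfunctor_comp[OF A_cat _ assms])

lemma nerve_map_id: "nerve_map M pure pC A Am C (vf_id C) = psh_id (nerve M pure pC A Am C)"
  by (rule psh_map_eqI[of _ "nerve M pure pC A Am C"])
    (auto simp: nerve_map_def cells_nerve intro: vf_comp_id_left)

lemma nerve_map_comp:
  assumes "vfunctor M pB pC B C G"
  shows "nerve_map M pure pB A Am B (vf_comp B H G) =
    psh_comp (nerve M pure pB A Am B) (nerve_map M pure pC A Am C H) (nerve_map M pure pB A Am B G)"
  by (rule psh_map_eqI[of _ "nerve M pure pB A Am B"])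
    (auto simp: nerve_map_def cells_nerve vfunctor_comp[OF A_cat _ assms] vf_comp_assoc)

end

context kan_cat
begin

abbreviation "tr \<equiv> nerve_transpose M pure A Am X"

lemma tr_apply: "x \<in> cells X n \<Longrightarrow> tr F n x = vf_comp (A n) F (kin n x)"
  by (simp add: nerve_transpose_def)

lemma tr_ext: "tr F n \<in> extensional (cells X n)"
  by (simp add: nerve_transpose_def)

lemma tr_map:
  assumes "vfunctor M pure' pD KX D F"
  shows "simplicial_map X (nerve M pure pD A Am D) (tr F)"
proof (rule psh_mapI)
  fix n x assume "x \<in> cells X n"
  then show "tr F n x \<in> cells (nerve M pure pD A Am D) n"
    using vfunctor_comp[OF A_cat kin_functor assms] by (simp add: nerve_def tr_apply)
next
  fix m n f x assume "f \<in> arr Delta m n" "x \<in> cells X n"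
  then show "tr F m (act X m n f x) = act (nerve M pure pD A Am D) m n f (tr F n x)"
    by (simp add: nerve_def tr_apply presheafD(1)[OF X_sset] kin_cocone vf_comp_assoc[OF Am_functor])
qed (rule tr_ext)

text \<open>A simplicial map from \<open>X\<close> to the nerve is literally a cocone of functors
  from the copies \<open>A n\<close>: its values are the components and its naturality is the cocone
  condition. Injectivity is uniqueness, surjectivity is \<open>lift\<close>.\<close>

lemma tr_bij:
  assumes D: "pcat M pD D"
  shows "bij_betw tr {F. vfunctor M pure' pD KX D F} {g. simplicial_map X (nerve M pure pD A Am D) g}"
  unfolding bij_betw_def
proof (intro conjI)
  show "inj_on tr {F. vfunctor M pure' pD KX D F}"
  proof (rule inj_onI)
    fix F F' assume *: "F \<in> {F. vfunctor M pure' pD KX D F}" "F' \<in> {F. vfunctor M pure' pD KX D F}"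
      "tr F = tr F'"
    have "vf_comp (A n) F (kin n x) = vf_comp (A n) F' (kin n x)" if "x \<in> cells X n" for n x
      using fun_cong[OF fun_cong[OF *(3)], of n x] that by (simp add: tr_apply)
    with * show "F = F'"
      using kan_functor_eqI[of pD D F F'] by simp
  qed
  show "tr ` {F. vfunctor M pure' pD KX D F} = {g. simplicial_map X (nerve M pure pD A Am D) g}"
  proof (intro subset_antisym subsetI)
    fix g assume "g \<in> {g. simplicial_map X (nerve M pure pD A Am D) g}"
    then have g: "simplicial_map X (nerve M pure pD A Am D) g" by simp
    interpret kan_cocone M pure A Am X tens' pure' pD D g
      by (intro kan_cocone.intro kan_cocone_axioms.intro kan_cat_axioms D)
        (use psh_mapD(1,3)[OF g] in \<open>auto simp: nerve_def\<close>)
    have "tr lift = g"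
      by (rule psh_map_eqI[of _ X]) (simp_all add: tr_ext tr_apply lift_kin psh_mapD(2)[OF g])
    then show "g \<in> tr ` {F. vfunctor M pure' pD KX D F}"
      using lift_functor by (intro image_eqI[of g tr lift]) simp_all
  qed (auto intro: tr_map)
qed

lemma tr_post:
  assumes F: "vfunctor M pure' pD KX D F"
  shows "tr (vf_comp KX J F) = psh_comp X (nerve_map M pure pD A Am D J) (tr F)"
proof (rule psh_map_eqI[of _ X])
  fix n x assume "x \<in> cells X n"
  then show "tr (vf_comp KX J F) n x = psh_comp X (nerve_map M pure pD A Am D J) (tr F) n x"
    using psh_mapD(1)[OF tr_map[OF F]]
    by (simp add: nerve_map_def tr_apply vf_comp_assoc[OF kin_functor, symmetric])
qed (simp_all add: tr_ext)

end

section \<open>Functoriality of the left Kan extension\<close>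

locale kan_pair =
  KX: kan_cat M pure A Am X tens' pure' + KY: kan_cat M pure A Am Y tens'' pure''
  for M :: "'p site" and pure :: "('p, 'a, 't) pure_tensor"
    and A :: "nat \<Rightarrow> ('p, 'o, 'a, 't) vcat" and Am and X :: "'x sset"
    and tens' :: "('p, ('p, 'x, 'o, 'a) khom) psh \<Rightarrow> ('p, ('p, 'x, 'o, 'a) khom) psh \<Rightarrow> ('p, 'u) psh"
    and pure' :: "('p, ('p, 'x, 'o, 'a) khom, 'u) pure_tensor"
    and Y :: "'y sset"
    and tens'' :: "('p, ('p, 'y, 'o, 'a) khom) psh \<Rightarrow> ('p, ('p, 'y, 'o, 'a) khom) psh \<Rightarrow> ('p, 'v) psh"
    and pure'' :: "('p, ('p, 'y, 'o, 'a) khom, 'v) pure_tensor" +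
  fixes f :: "nat \<Rightarrow> 'x \<Rightarrow> 'y"
  assumes f: "simplicial_map X Y f"
begin

abbreviation "km \<equiv> kan_map M pure tens' pure' A Am X Y f"
abbreviation "fo \<equiv> kobj_map A Am Y f"
abbreviation "ft \<equiv> kterm_map fo f"

text \<open>The cocone that induces the functor of \<open>f\<close>. The map \<open>kan_map\<close>,
  defined by renaming labels in terms, is identified with the lift of this cocone in
  \<open>km_lift\<close>, so its properties come from the universal property instead of from
  terms.\<close>

sublocale kan_cocone M pure A Am X tens' pure' pure'' KY.KX "\<lambda>n x. KY.kin n (f n x)"
proof (intro kan_cocone.intro kan_cocone_axioms.intro KX.kan_cat_axioms KY.kan_pcat)
  show "vfunctor M pure pure'' (A n) KY.KX (KY.kin n (f n x))" if "x \<in> cells X n" for n x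
    by (intro KY.kin_functor psh_mapD(1)[OF f] that)
  show "KY.kin n (f n (act X n m \<theta> y)) = vf_comp (A n) (KY.kin m (f m y)) (Am n m \<theta>)"
    if "\<theta> \<in> arr Delta n m" "y \<in> cells X m" for \<theta> n m y
    using that by (simp add: psh_mapD(1,3)[OF f] KY.kin_cocone)
qed

lemma fo_K:
  assumes "x \<in> cells X n" "i \<in> obj (A n)"
  shows "fo (KX.K (n, x, i)) = KY.K (n, f n x, i)"
proof -
  have "(\<Union>(n, x, i) \<in> KX.K (n, x, i). KY.K (n, f n x, i)) = KY.K (n, f n x, i)"
    unfolding kobj_def[of A Am X]
    by (subst gen_class_UN)
      (use assms in \<open>auto simp: kobj_reps_def psh_mapD[OF f] KY.K_step elim!: kobj_step.cases\<close>)
  then show ?thesis by (simp add: kobj_map_def)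
qed

lemma fo_ko: "a \<in> KX.obs \<Longrightarrow> fo a = ko a"
  by (auto simp: kobj_reps_def fo_K ko_K)

lemma ft_ev:
  "KX.kc a b d t \<Longrightarrow> KY.kc (fo a) (fo b) d (ft t) \<and> ev t = KY.E (fo a) (fo b) d (ft t)"
proof (induction rule: kcell.induct)
  case (kcell_Gen x n i j c d)
  then show ?case
    by (simp add: fo_K kcell.kcell_Gen psh_mapD(1)[OF f])
next
  case (kcell_Idt a)
  have "fo a \<in> KY.obs"
    using kcell_Idt by (auto simp: kobj_reps_def fo_K psh_mapD(1)[OF f])
  then show ?case
    using kcell_Idt by (simp add: kcell.kcell_Idt KY.ident_kan fo_ko)
next
  case (kcell_Cmp a b p t c q u r)
  then have "KY.kc (fo a) (fo c) r (ft (Cmp t u))"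
    using kcell.kcell_Cmp by fastforce
  moreover have "a \<in> KX.obs" "b \<in> KX.obs" "c \<in> KX.obs"
    using KX.kcell_obj kcell_Cmp by blast+
  ultimately show ?case
    using kcell_Cmp by (simp del: kev.simps add: ev_Cmp fo_ko KY.pcomp_kan)
next
  case (kcell_Act a b d t h e)
  then have "KY.kc (fo a) (fo b) e (ft (Act e d h t))"
    using kcell.kcell_Act by fastforce
  moreover have "a \<in> KX.obs" "b \<in> KX.obs"
    using KX.kcell_obj kcell_Act by blast+
  ultimately show ?case
    using kcell_Act by (simp del: kev.simps add: ev_Act fo_ko KY.hom_kan KY.act_H)
qed

lemma km_lift: "km = lift"
proof (rule vf_eqI[of KX.KX])
  show "vf_ext KX.KX km" "vf_ext KX.KX lift"
    by (simp_all add: kan_map_def Let_def lift_def)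
  show o: "fst km a = fst lift a" if "a \<in> obj KX.KX" for a
    using that by (simp add: kan_map_def Let_def fst_lift KX.obj_kan fo_ko)
  show "snd km a b d S = snd lift a b d S"
    if "a \<in> obj KX.KX" "b \<in> obj KX.KX" "S \<in> cells (hom KX.KX a b) d" for a b d S
    using that(3) unfolding KX.hom_kan
  proof (rule KX.H_cellE)
    fix t assume t: "KX.kc a b d t" "S = KX.E a b d t"
    have "KY.E (fo a) (fo b) d (ft u) = ev t" if "u \<in> S" for u
      using that t ft_ev[of a b d u] KX.keq_kcell[of a b d t u] ev_eq[of a b d t u] by auto
    then have "(\<Union>u \<in> S. KY.E (fo a) (fo b) d (ft u)) = ev t"
      using t KX.E_self[OF t(1)] by (intro SUP_eq_const) blast+
    then show ?thesis
      using that t by (simp add: kan_map_def Let_def snd_lift)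
  qed
qed

lemma km_functor: "vfunctor M pure' pure'' KX.KX KY.KX km"
  unfolding km_lift by (rule lift_functor)

lemma km_kin: "x \<in> cells X n \<Longrightarrow> vf_comp (A n) km (KX.kin n x) = KY.kin n (f n x)"
  unfolding km_lift by (rule lift_kin)

lemma tr_pre:
  assumes F: "vfunctor M pure'' pD KY.KX D F"
  shows "KX.tr (vf_comp KX.KX F km) = psh_comp X (KY.tr F) f"
proof (rule psh_map_eqI[of _ X])
  fix n x assume "x \<in> cells X n"
  then show "KX.tr (vf_comp KX.KX F km) n x = psh_comp X (KY.tr F) f n x"
    by (simp add: KX.tr_apply KY.tr_apply psh_mapD(1)[OF f] km_kin
        vf_comp_assoc[OF KX.kin_functor, symmetric])
qed (simp_all add: KX.tr_ext)

end

text \<open>Here and for composites the functor laws follow from uniqueness: both sides have the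
  same restrictions along the cocone.\<close>

lemma (in kan_cat) kan_map_id: "kan_map M pure tens' pure' A Am X X (psh_id X) = vf_id KX"
proof -
  interpret P: kan_pair M pure A Am X tens' pure' X tens' pure' "psh_id X"
    by (intro kan_pair.intro kan_pair_axioms.intro kan_cat_axioms psh_map_id X_sset)
  show ?thesis
    by (rule kan_functor_eqI[OF P.km_functor vfunctor_id[OF kan_pcat]])
      (simp add: P.km_kin vf_comp_id_left[OF kin_functor])
qed

lemma kan_map_comp:
  assumes "kan_pair M pure A Am X tens' pure' Y tens'' pure'' f"
    and "kan_pair M pure A Am Y tens'' pure'' Z tens3 pure3 g"
  shows "kan_map M pure tens' pure' A Am X Z (psh_comp X g f) =
    vf_comp (kan M pure tens' pure' A Am X)
      (kan_map M pure tens'' pure'' A Am Y Z g) (kan_map M pure tens' pure' A Am X Y f)"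
proof -
  interpret f: kan_pair M pure A Am X tens' pure' Y tens'' pure'' f by fact
  interpret g: kan_pair M pure A Am Y tens'' pure'' Z tens3 pure3 g by fact
  interpret gf: kan_pair M pure A Am X tens' pure' Z tens3 pure3 "psh_comp X g f"
    by (intro kan_pair.intro kan_pair_axioms.intro f.KX.kan_cat_axioms g.KY.kan_cat_axioms
        psh_map_comp[OF f.f g.f] f.KX.X_sset)
  show ?thesis
    by (rule f.KX.kan_functor_eqI[OF gf.km_functor vfunctor_comp[OF f.KX.kan_pcat f.km_functor g.km_functor]])
      (simp add: gf.km_kin f.km_kin g.km_kin psh_mapD(1)[OF f.f]
        vf_comp_assoc[OF f.KX.kin_functor, symmetric])
qed

section \<open>The simplex category and the cube category\<close>

text \<open>
  As a simplification rule, \<open>restrict_apply\<close>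
  also rewrites eta-expanded restrictions, replacing arrows by conditionals.
\<close>

declare restrict_apply [simp del] restrict_apply' [simp] compose_eq [simp]

lemma pts_Delta [simp]: "pts Delta n = {0..n}" by (simp add: Delta_def)
lemma join_Delta [simp]: "join Delta p q r \<longleftrightarrow> p = q \<and> q = r" by (simp add: Delta_def)
lemma joinarr_Delta [simp]:
  "joinarr Delta p' p f q' q g h \<longleftrightarrow> p' = q' \<and> p = q \<and> f = g \<and> h = f" by (simp add: Delta_def)
lemma arr_Delta: "f \<in> arr Delta m n \<longleftrightarrow> f \<in> {0..m} \<rightarrow>\<^sub>E {0..n} \<and> mono_on {0..m} f"
  by (simp add: Delta_def)

lemma arr_DeltaD:
  assumes "f \<in> arr Delta m n"
  shows "x \<le> m \<Longrightarrow> f x \<le> n" and "x \<le> y \<Longrightarrow> y \<le> m \<Longrightarrow> f x \<le> f y"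
    and "f \<in> extensional {0..m}"
  using assms by (auto simp: arr_Delta PiE_def Pi_def mono_on_def)

lemma arr_DeltaI:
  assumes "\<And>x. x \<le> m \<Longrightarrow> f x \<le> n" "\<And>x y. x \<le> y \<Longrightarrow> y \<le> m \<Longrightarrow> f x \<le> f y" "f \<in> extensional {0..m}"
  shows "f \<in> arr Delta m n"
  using assms by (auto simp: arr_Delta PiE_def Pi_def mono_on_def)

lemma pts_Cube [simp]: "pts Cube n = cube n" by (simp add: Cube_def)
lemma join_Cube [simp]: "join Cube p q r \<longleftrightarrow> r = p + q" by (simp add: Cube_def)
lemma joinarr_Cube [simp]: "joinarr Cube p' p f q' q g h \<longleftrightarrow> h = tens_arr p' q' f g"
  by (simp add: Cube_def)
lemma arr_Cube [simp]: "f \<in> arr Cube m n \<longleftrightarrow> cube_arr m n f" by (simp add: Cube_def)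

lemma cube_iff [simp]: "v \<in> cube n \<longleftrightarrow> length v = n" by (simp add: cube_def)

lemma length_ins: "i \<le> length v \<Longrightarrow> length (ins i e v) = Suc (length v)"
  by (simp add: ins_def)

lemma length_del: "i < length v \<Longrightarrow> length (del i v) = length v - 1"
  by (simp add: del_def)

lemma length_conn: "Suc i < length v \<Longrightarrow> length (conn mx i v) = length v - 1"
  by (simp add: conn_def)

lemma cube_arr_in: "cube_arr m n f \<Longrightarrow> f \<in> cube m \<rightarrow>\<^sub>E cube n"
  by (induction rule: cube_arr.induct)
    (auto simp: PiE_def Pi_def compose_def extensional_def restrict_apply length_ins length_del length_conn)

lemma cube_arr_length: "cube_arr m n f \<Longrightarrow> length v = m \<Longrightarrow> length (f v) = n"
  using cube_arr_in by fastforce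

lemma cube_arr_Pi: "cube_arr m n f \<Longrightarrow> f \<in> cube m \<rightarrow> cube n"
  using cube_arr_in by (auto simp: PiE_def)

lemma cube_arr_extD: "cube_arr m n f \<Longrightarrow> f \<in> extensional (cube m)"
  using cube_arr_in by (auto simp: PiE_def)

lemma cube_arr_eqI:
  assumes "cube_arr m n f" "cube_arr m n' g" "\<And>v. length v = m \<Longrightarrow> f v = g v"
  shows "f = g"
  using assms by (intro extensionalityI[of _ "cube m"]) (auto simp: cube_arr_extD)

lemma compose_id_right: "cube_arr m n f \<Longrightarrow> compose (cube m) f (\<lambda>v \<in> cube m. v) = f"
  by (rule compose_Id[OF cube_arr_Pi cube_arr_extD])

lemma compose_id_left: "cube_arr m n f \<Longrightarrow> compose (cube m) (\<lambda>v \<in> cube n. v) f = f"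
  by (rule Id_compose[OF cube_arr_Pi cube_arr_extD])

lemma cube_arr_comp:
  "cube_arr m n g \<Longrightarrow> cube_arr k m f \<Longrightarrow> cube_arr k n (compose (cube k) g f)"
proof (induction rule: cube_arr.induct)
  case (cube_id n)
  then show ?case by (simp only: compose_id_left)
next
  case (cube_face m n g i e)
  then show ?case by (metis compose_assoc cube_arr_Pi cube_arr.cube_face)
next
  case (cube_deg m n g i)
  then show ?case by (metis compose_assoc cube_arr_Pi cube_arr.cube_deg)
next
  case (cube_conn m n g i)
  then show ?case by (metis compose_assoc cube_arr_Pi cube_arr.cube_conn)
qed

lemma conn_mono:
  assumes "list_all2 (\<longrightarrow>) u (v :: bool list)" "Suc i < length u"
  shows "list_all2 (\<longrightarrow>) (conn max i u) (conn max i v)"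
proof -
  have "max (u ! i) (u ! Suc i) \<longrightarrow> max (v ! i) (v ! Suc i)"
    using assms by (auto simp: list_all2_conv_all_nth max_def)
  then show ?thesis
    using assms(1) unfolding conn_def
    by (auto intro!: list_all2_appendI list_all2_takeI list_all2_dropI)
qed

text \<open>\<open>list_all2 (\<longrightarrow>)\<close> is the product order of the cube.
  Monotonicity is what later turns simplices of the cube into chains of subsets.\<close>

lemma cube_arr_mono:
  "cube_arr m n f \<Longrightarrow> length u = m \<Longrightarrow> length v = m \<Longrightarrow> list_all2 (\<longrightarrow>) u v \<Longrightarrow>
   list_all2 (\<longrightarrow>) (f u) (f v)"
proof (induction rule: cube_arr.induct)
  case (cube_face m n f i e)
  then show ?case
    by (auto simp: ins_def intro!: list_all2_appendI list_all2_takeI list_all2_dropI)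
next
  case (cube_deg m n f i)
  then show ?case
    by (auto simp: del_def intro!: list_all2_appendI list_all2_takeI list_all2_dropI)
next
  case (cube_conn m n f i)
  have "list_all2 (\<longrightarrow>) (conn max i (f u)) (conn max i (f v))"
    by (rule conn_mono)
      (use cube_conn cube_arr_length[OF cube_conn(1), of u] in simp_all)
  with cube_conn show ?case by simp
qed simp

lemma ins_append:
  "ins (length u + i) e (u @ w) = u @ ins i e w"
  "i \<le> length u \<Longrightarrow> ins i e (u @ w) = ins i e u @ w"
  by (simp_all add: ins_def)

lemma del_append:
  "del (length u + i) (u @ w) = u @ del i w"
  "i < length u \<Longrightarrow> del i (u @ w) = del i u @ w"
  by (simp_all add: del_def)

lemma conn_append:
  "conn mx (length u + i) (u @ w) = u @ conn mx i w"
  "Suc i < length u \<Longrightarrow> conn mx i (u @ w) = conn mx i u @ w"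
  using nth_append_length_plus[of u w i] nth_append_length_plus[of u w "Suc i"]
  by (simp_all add: conn_def nth_append)

lemma ins_append_take: "p \<le> length v \<Longrightarrow> ins (p + i) e (take p v @ w) = take p v @ ins i e w"
  using ins_append(1)[of "take p v" i e w] by (simp add: min_absorb2)

lemma del_append_take: "p \<le> length v \<Longrightarrow> del (p + i) (take p v @ w) = take p v @ del i w"
  using del_append(1)[of "take p v" i w] by (simp add: min_absorb2)

lemma conn_append_take:
  "p \<le> length v \<Longrightarrow> conn mx (p + i) (take p v @ w) = take p v @ conn mx i w"
  using conn_append(1)[of mx "take p v" i w] by (simp add: min_absorb2)

lemma tens_arr_apply: "length v = p + q \<Longrightarrow> tens_arr p q f g v = f (take p v) @ g (drop p v)"
  by (simp add: tens_arr_def)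

lemma tens_id: "tens_arr p q (\<lambda>v \<in> cube p. v) (\<lambda>v \<in> cube q. v) = (\<lambda>v \<in> cube (p + q). v)"
  by (auto simp: tens_arr_def fun_eq_iff restrict_apply)

text \<open>Tensoring with an identity on the left shifts the index of every generator by
  \<open>p\<close>; tensoring on the right (\<open>tens_left\<close>) keeps it.\<close>

lemma tens_right:
  "cube_arr m n f \<Longrightarrow> cube_arr (p + m) (p + n) (tens_arr p m (\<lambda>v \<in> cube p. v) f)"
proof (induction rule: cube_arr.induct)
  case (cube_id n)
  show ?case unfolding tens_id by (rule cube_arr.cube_id)
next
  case (cube_face m n f i e)
  have "tens_arr p m (\<lambda>v \<in> cube p. v) (compose (cube m) (ins i e) f) =
      compose (cube (p + m)) (ins (p + i) e) (tens_arr p m (\<lambda>v \<in> cube p. v) f)"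
    by (auto simp: tens_arr_def compose_def fun_eq_iff restrict_apply ins_append_take)
  with cube_arr.cube_face[OF cube_face(3), of "p + i" e] cube_face(2) show ?case by simp
next
  case (cube_deg m n f i)
  have "tens_arr p m (\<lambda>v \<in> cube p. v) (compose (cube m) (del i) f) =
      compose (cube (p + m)) (del (p + i)) (tens_arr p m (\<lambda>v \<in> cube p. v) f)"
    by (auto simp: tens_arr_def compose_def fun_eq_iff restrict_apply del_append_take)
  with cube_arr.cube_deg[of "p + m" "p + n" _ "p + i"] cube_deg show ?case by simp
next
  case (cube_conn m n f i)
  have "tens_arr p m (\<lambda>v \<in> cube p. v) (compose (cube m) (conn max i) f) =
      compose (cube (p + m)) (conn max (p + i)) (tens_arr p m (\<lambda>v \<in> cube p. v) f)"
    by (auto simp: tens_arr_def compose_def fun_eq_iff restrict_apply conn_append_take)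
  with cube_arr.cube_conn[of "p + m" "p + n" _ "p + i"] cube_conn show ?case by simp
qed

lemma tens_left:
  "cube_arr m n f \<Longrightarrow> cube_arr (m + p) (n + p) (tens_arr m p f (\<lambda>v \<in> cube p. v))"
proof (induction rule: cube_arr.induct)
  case (cube_id n)
  show ?case unfolding tens_id by (rule cube_arr.cube_id)
next
  case (cube_face m n f i e)
  have "tens_arr m p (compose (cube m) (ins i e) f) (\<lambda>v \<in> cube p. v) =
      compose (cube (m + p)) (ins i e) (tens_arr m p f (\<lambda>v \<in> cube p. v))"
    using cube_face(2) cube_arr_length[OF cube_face(1)]
    by (auto simp: tens_arr_def compose_def fun_eq_iff restrict_apply ins_append)
  with cube_arr.cube_face[OF cube_face(3), of i e] cube_face(2) show ?case by simp
next
  case (cube_deg m n f i)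
  have "tens_arr m p (compose (cube m) (del i) f) (\<lambda>v \<in> cube p. v) =
      compose (cube (m + p)) (del i) (tens_arr m p f (\<lambda>v \<in> cube p. v))"
    using cube_deg(2) cube_arr_length[OF cube_deg(1)]
    by (auto simp: tens_arr_def compose_def fun_eq_iff restrict_apply del_append)
  with cube_arr.cube_deg[of "m + p" "n + p" _ i] cube_deg show ?case by simp
next
  case (cube_conn m n f i)
  have "tens_arr m p (compose (cube m) (conn max i) f) (\<lambda>v \<in> cube p. v) =
      compose (cube (m + p)) (conn max i) (tens_arr m p f (\<lambda>v \<in> cube p. v))"
    using cube_conn(2) cube_arr_length[OF cube_conn(1)]
    by (auto simp: tens_arr_def compose_def fun_eq_iff restrict_apply conn_append)
  with cube_arr.cube_conn[of "m + p" "n + p" _ i] cube_conn show ?case by simp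
qed

text \<open>The tensor factors as \<open>f\<close> next to an identity after an identity next to
  \<open>g\<close>. Since arrows are generated one generator at a time, each factor is handled by
  its own induction.\<close>

lemma cube_arr_tens:
  assumes "cube_arr m m' f" "cube_arr n n' g"
  shows "cube_arr (m + n) (m' + n') (tens_arr m n f g)"
proof -
  have "tens_arr m n f g =
      compose (cube (m + n)) (tens_arr m n' f (\<lambda>v \<in> cube n'. v)) (tens_arr m n (\<lambda>v \<in> cube m. v) g)"
    using cube_arr_length[OF assms(2)] by (auto simp: tens_arr_def compose_def fun_eq_iff restrict_apply)
  with cube_arr_comp[OF tens_left[OF assms(1), of n'] tens_right[OF assms(2), of m]] show ?thesis
    by simp
qed

section \<open>The two sites, and the cartesian product as a tensor\<close>

lemma wsite_Delta: "wsite Delta"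
proof
  show "compose (pts Delta k) f g \<in> arr Delta k n" if "f \<in> arr Delta m n" "g \<in> arr Delta k m" for m n k f g
    using that by (intro arr_DeltaI) (auto simp: compose_def arr_DeltaD)
qed (auto intro: arr_DeltaI)

lemma wsite_Cube: "wsite Cube"
  by standard (simp_all add: cube_arr.cube_id cube_arr_comp)

lemma presheaf_prod:
  assumes "presheaf M A" "presheaf M B"
  shows "presheaf M (psh_prod A B)"
  by (rule presheafI) (auto simp: psh_prod_def presheafD[OF assms(1)] presheafD[OF assms(2)])

lemma tensor_prod: "tensor Delta psh_prod prod_pure"
proof
  fix A B :: "(nat, 'b) psh" and r \<tau>
  assume *: "presheaf Delta A" "presheaf Delta B" "\<tau> \<in> cells (psh_prod A B) r"
  from *(3) obtain a b where "\<tau> = (a, b)" "a \<in> cells A r" "b \<in> cells B r"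
    by (auto simp: psh_prod_def)
  \<comment> \<open>A cell of the cartesian product is already a pure tensor, so the identity arrow
    presents it.\<close>
  moreover have "\<tau> = act (psh_prod A B) r r (\<lambda>v \<in> pts Delta r. v) \<tau>"
    using presheafD(2)[OF presheaf_prod[OF *(1,2)] *(3)] by simp
  ultimately show "\<exists>p q s h a b. join Delta p q s \<and> h \<in> arr Delta r s \<and> a \<in> cells A p \<and> b \<in> cells B q \<and>
        \<tau> = act (psh_prod A B) r s h (prod_pure A B p q a b)"
    using wsite.id_arr[OF wsite_Delta, of r]
    by (intro exI[of _ r] exI[of _ "\<lambda>v \<in> pts Delta r. v"] exI[of _ a] exI[of _ b])
      (simp add: prod_pure_def)
next
  fix A B X :: "(nat, 'b) psh" and bil :: "nat \<Rightarrow> nat \<Rightarrow> nat \<Rightarrow> 'b \<Rightarrow> 'b \<Rightarrow> 'b"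
  assume *: "\<And>p q r a b. join Delta p q r \<Longrightarrow> a \<in> cells A p \<Longrightarrow> b \<in> cells B q \<Longrightarrow> bil p q r a b \<in> cells X r"
    "\<And>p q r p' q' r' f g h a b. join Delta p q r \<Longrightarrow> join Delta p' q' r' \<Longrightarrow>
        f \<in> arr Delta p' p \<Longrightarrow> g \<in> arr Delta q' q \<Longrightarrow> h \<in> arr Delta r' r \<Longrightarrow> joinarr Delta p' p f q' q g h \<Longrightarrow>
        a \<in> cells A p \<Longrightarrow> b \<in> cells B q \<Longrightarrow>
        act X r' r h (bil p q r a b) = bil p' q' r' (act A p' p f a) (act B q' q g b)"
    and P: "presheaf Delta A" "presheaf Delta B"
  define \<phi> where "\<phi> = (\<lambda>r. \<lambda>(a, b) \<in> cells (psh_prod A B) r. bil r r r a b)"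
  have "psh_map Delta (psh_prod A B) X \<phi>"
    by (rule psh_mapI)
      (use * presheafD(1)[OF P(1)] presheafD(1)[OF P(2)] in \<open>auto simp: psh_prod_def \<phi>_def\<close>)
  moreover have "\<phi> r (prod_pure A B p q a b) = bil p q r a b"
    if "join Delta p q r" "a \<in> cells A p" "b \<in> cells B q" for p q r a b
    using that by (simp add: \<phi>_def prod_pure_def psh_prod_def)
  ultimately show "\<exists>\<phi>. psh_map Delta (psh_prod A B) X \<phi> \<and>
        (\<forall>p q r a b. join Delta p q r \<longrightarrow> a \<in> cells A p \<longrightarrow> b \<in> cells B q \<longrightarrow>
           \<phi> r (prod_pure A B p q a b) = bil p q r a b)" by blast
qed (auto simp: psh_prod_def prod_pure_def presheaf_prod[unfolded psh_prod_def])


section \<open>Day convolution\<close>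

context
  fixes A :: "'a cset" and B :: "'b cset"
  assumes A: "presheaf Cube A" and B: "presheaf Cube B"
begin

lemma day_class_step:
  assumes "cube_arr k (p' + q') f" "cube_arr p' p g" "cube_arr q' q h" "a \<in> cells A p" "b \<in> cells B q"
  shows "day_class A B k (p', q', f, act A p' p g a, act B q' q h b) =
    day_class A B k (p, q, compose (cube k) (tens_arr p' q' g h) f, a, b)"
  unfolding day_class_def
  using assms presheafD(1)[OF A] presheafD(1)[OF B]
  by (intro gen_class_step day_step.intros) (auto simp: day_reps_def intro: cube_arr_comp cube_arr_tens)

lemma day_cells: "cells (day A B) k = day_class A B k ` day_reps A B k"
  by (simp add: day_def)

lemma day_cellE:
  assumes "\<tau> \<in> cells (day A B) k"
  obtains p q f a b where "\<tau> = day_class A B k (p, q, f, a, b)"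
    "cube_arr k (p + q) f" "a \<in> cells A p" "b \<in> cells B q"
  using assms by (auto simp: day_cells day_reps_def)

lemma day_class_in:
  "cube_arr k (p + q) f \<Longrightarrow> a \<in> cells A p \<Longrightarrow> b \<in> cells B q \<Longrightarrow>
   day_class A B k (p, q, f, a, b) \<in> cells (day A B) k"
  by (auto simp: day_cells day_reps_def)

lemma day_act:
  assumes "cube_arr k (p + q) f" "a \<in> cells A p" "b \<in> cells B q" "cube_arr j k g"
  shows "act (day A B) j k g (day_class A B k (p, q, f, a, b)) =
    day_class A B j (p, q, compose (cube j) f g, a, b)"
proof -
  let ?h = "\<lambda>(p, q, f, a, b). day_class A B j (p, q, compose (cube j) f g, a, b)"
  have "?h u = ?h v" if "day_step A B k u v" for u v
    using that
  proof cases
    case (1 f p' q' g' p h q a b)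
    have "compose (cube j) (compose (cube k) (tens_arr p' q' g' h) f) g =
        compose (cube j) (tens_arr p' q' g' h) (compose (cube j) f g)"
      using cube_arr_in[OF assms(4)] by (auto simp: compose_def fun_eq_iff restrict_apply)
    with 1 assms(4) show ?thesis
      by (simp add: day_class_step cube_arr_comp)
  qed
  then have "(\<Union>u \<in> day_class A B k (p, q, f, a, b). ?h u) = ?h (p, q, f, a, b)"
    unfolding day_class_def[of A B k] using assms
    by (intro gen_class_UN) (auto simp: day_reps_def)
  then show ?thesis by (simp add: day_def)
qed

lemma presheaf_day: "presheaf Cube (day A B)"
proof (rule presheafI)
  show "act (day A B) m n f \<tau> \<in> cells (day A B) m" if "f \<in> arr Cube m n" "\<tau> \<in> cells (day A B) n" for m n f \<tau>
    using that by (elim day_cellE) (simp add: day_act day_class_in cube_arr_comp)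
  show "act (day A B) n n (\<lambda>v \<in> pts Cube n. v) \<tau> = \<tau>" if "\<tau> \<in> cells (day A B) n" for n \<tau>
    using that by (elim day_cellE) (simp add: day_act cube_arr.cube_id compose_id_right)
  show "act (day A B) k m g (act (day A B) m n f \<tau>) = act (day A B) k n (compose (pts Cube k) f g) \<tau>"
    if "g \<in> arr Cube k m" "f \<in> arr Cube m n" "\<tau> \<in> cells (day A B) n" for k m n f g \<tau>
    using that(3)
  proof (rule day_cellE)
    fix p q h a b assume "\<tau> = day_class A B n (p, q, h, a, b)"
      "cube_arr n (p + q) h" "a \<in> cells A p" "b \<in> cells B q"
    moreover have "compose (cube k) (compose (cube m) h f) g = compose (cube k) h (compose (cube k) f g)"
      using that cube_arr_in[of k m g] by (auto simp: compose_def fun_eq_iff restrict_apply)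
    ultimately show ?thesis
      using that by (simp add: day_act cube_arr_comp)
  qed
qed

lemma day_pure_in:
  "a \<in> cells A p \<Longrightarrow> b \<in> cells B q \<Longrightarrow> day_pure A B p q a b \<in> cells (day A B) (p + q)"
  unfolding day_pure_def by (intro day_class_in cube_arr.cube_id)

lemma day_pure_act:
  assumes "cube_arr p' p f" "cube_arr q' q g" "a \<in> cells A p" "b \<in> cells B q"
  shows "act (day A B) (p' + q') (p + q) (tens_arr p' q' f g) (day_pure A B p q a b) =
    day_pure A B p' q' (act A p' p f a) (act B q' q g b)"
proof -
  have t: "cube_arr (p' + q') (p + q) (tens_arr p' q' f g)"
    using assms by (intro cube_arr_tens)
  show ?thesis
    using assms
    by (simp add: day_pure_def day_act t cube_arr.cube_id day_class_step
        compose_id_left[OF t] compose_id_right[OF t])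
qed

lemma day_class_pure:
  assumes "cube_arr k (p + q) f" "a \<in> cells A p" "b \<in> cells B q"
  shows "day_class A B k (p, q, f, a, b) = act (day A B) k (p + q) f (day_pure A B p q a b)"
  using assms
  by (simp add: day_pure_def day_act cube_arr.cube_id compose_id_left[OF assms(1)])

context
  fixes X :: "'c cset" and bil
  assumes X: "presheaf Cube X"
    and bil_in: "\<And>p q a b. a \<in> cells A p \<Longrightarrow> b \<in> cells B q \<Longrightarrow> bil p q a b \<in> cells X (p + q)"
    and bil_act: "\<And>p q p' q' f g a b. cube_arr p' p f \<Longrightarrow> cube_arr q' q g \<Longrightarrow>
      a \<in> cells A p \<Longrightarrow> b \<in> cells B q \<Longrightarrow>
      act X (p' + q') (p + q) (tens_arr p' q' f g) (bil p q a b) =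
      bil p' q' (act A p' p f a) (act B q' q g b)"
begin

text \<open>A \<open>day_step\<close> moves arrows acting on \<open>a\<close> and \<open>b\<close>
  into the arrow in front, and \<open>bil_act\<close> says that the value is insensitive to this.
  The cell type of \<open>X\<close> is free here, unlike in \<open>tensor\<close>, because the
  structure map \<open>Rc_mult\<close> changes it.\<close>

lemma day_lift_class:
  assumes "cube_arr r (p + q) f" "a \<in> cells A p" "b \<in> cells B q"
  shows "day_lift X bil r (day_class A B r (p, q, f, a, b)) = act X r (p + q) f (bil p q a b)"
proof -
  let ?h = "\<lambda>(p, q, f, a, b). act X r (p + q) f (bil p q a b)"
  have "?h u = ?h v" if "day_step A B r u v" for u v
    using that
    by cases (simp add: bil_act[symmetric] presheafD(3)[OF X] bil_in cube_arr_tens)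
  then have "the_elem (?h ` day_class A B r (p, q, f, a, b)) = ?h (p, q, f, a, b)"
    unfolding day_class_def using assms by (intro gen_class_the_elem) (auto simp: day_reps_def)
  then show ?thesis by (simp add: day_lift_def)
qed

lemma day_lift_pure:
  "a \<in> cells A p \<Longrightarrow> b \<in> cells B q \<Longrightarrow> day_lift X bil (p + q) (day_pure A B p q a b) = bil p q a b"
  using presheafD(2)[OF X bil_in] by (simp add: day_pure_def day_lift_class cube_arr.cube_id)

lemma day_lift_map:
  "psh_map Cube (day A B) X (\<lambda>r. \<lambda>\<tau> \<in> cells (day A B) r. day_lift X bil r \<tau>)"
proof (rule psh_mapI)
  fix n \<tau> assume "\<tau> \<in> cells (day A B) n"
  then show "(\<lambda>\<tau> \<in> cells (day A B) n. day_lift X bil n \<tau>) \<tau> \<in> cells X n"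
    by (auto elim!: day_cellE simp: day_class_in day_lift_class intro!: presheafD(1)[OF X] bil_in)
next
  fix m n f \<tau> assume "f \<in> arr Cube m n" "\<tau> \<in> cells (day A B) n"
  then show "(\<lambda>\<tau> \<in> cells (day A B) m. day_lift X bil m \<tau>) (act (day A B) m n f \<tau>) =
      act X m n f ((\<lambda>\<tau> \<in> cells (day A B) n. day_lift X bil n \<tau>) \<tau>)"
    by (auto elim!: day_cellE simp: day_class_in day_lift_class day_act cube_arr_comp
        presheafD(3)[OF X] bil_in)
qed simp

end

end

lemma tensor_day: "tensor Cube day day_pure"
proof
  fix A B X :: "(bool list, 'b) psh" and bil :: "nat \<Rightarrow> nat \<Rightarrow> nat \<Rightarrow> 'b \<Rightarrow> 'b \<Rightarrow> 'b"
  assume *: "\<And>p q r a b. join Cube p q r \<Longrightarrow> a \<in> cells A p \<Longrightarrow> b \<in> cells B q \<Longrightarrow> bil p q r a b \<in> cells X r"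
    "\<And>p q r p' q' r' f g h a b. join Cube p q r \<Longrightarrow> join Cube p' q' r' \<Longrightarrow>
        f \<in> arr Cube p' p \<Longrightarrow> g \<in> arr Cube q' q \<Longrightarrow> h \<in> arr Cube r' r \<Longrightarrow> joinarr Cube p' p f q' q g h \<Longrightarrow>
        a \<in> cells A p \<Longrightarrow> b \<in> cells B q \<Longrightarrow>
        act X r' r h (bil p q r a b) = bil p' q' r' (act A p' p f a) (act B q' q g b)"
    and P: "presheaf Cube A" "presheaf Cube B" "presheaf Cube X"
  let ?bil = "\<lambda>p q a b. bil p q (p + q) a b"
  let ?\<phi> = "\<lambda>r. \<lambda>\<tau> \<in> cells (day A B) r. day_lift X ?bil r \<tau>"
  have 1: "bil p q (p + q) a b \<in> cells X (p + q)" if "a \<in> cells A p" "b \<in> cells B q" for p q a b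
    using that by (intro *(1)) simp_all
  have 2: "act X (p' + q') (p + q) (tens_arr p' q' f g) (?bil p q a b) =
      ?bil p' q' (act A p' p f a) (act B q' q g b)"
    if "cube_arr p' p f" "cube_arr q' q g" "a \<in> cells A p" "b \<in> cells B q" for p q p' q' f g a b
    using that by (intro *(2)) (simp_all add: cube_arr_tens)
  have "psh_map Cube (day A B) X ?\<phi>"
    by (rule day_lift_map[OF P 1 2])
  moreover have "?\<phi> r (day_pure A B p q a b) = bil p q r a b"
    if "join Cube p q r" "a \<in> cells A p" "b \<in> cells B q" for p q r a b
    using that by (simp add: day_lift_pure[OF P 1 2] day_pure_in P)
  ultimately show "\<exists>\<phi>. psh_map Cube (day A B) X \<phi> \<and>
        (\<forall>p q r a b. join Cube p q r \<longrightarrow> a \<in> cells A p \<longrightarrow> b \<in> cells B q \<longrightarrow>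
           \<phi> r (day_pure A B p q a b) = bil p q r a b)" by blast
next
  fix A B :: "(bool list, 'b) psh" and r \<tau>
  assume P: "presheaf Cube A" "presheaf Cube B" and \<tau>: "\<tau> \<in> cells (day A B) r"
  obtain p q f a b where "\<tau> = day_class A B r (p, q, f, a, b)"
    "cube_arr r (p + q) f" "a \<in> cells A p" "b \<in> cells B q"
    using day_cellE[OF P \<tau>] .
  then show "\<exists>p q s h a b. join Cube p q s \<and> h \<in> arr Cube r s \<and> a \<in> cells A p \<and> b \<in> cells B q \<and>
        \<tau> = act (day A B) r s h (day_pure A B p q a b)"
    using day_class_pure[OF P] by (auto intro!: exI)
qed (simp_all add: presheaf_day day_pure_in day_pure_act)


section \<open>Powers of the interval\<close>

text \<open>Vertex \<open>p\<close> of a simplex of a power of the interval, as a vertex of the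
  cube. The power is the nerve of the poset cube: simplices are determined by their vertices
  (\<open>ipow_eqI\<close>), and every monotone sequence of vertices occurs
  (\<open>ipow_of_in\<close>, \<open>vert_ipow_of\<close>).\<close>

definition vert :: "isimp \<Rightarrow> nat \<Rightarrow> bool list" where
  "vert s p = map (\<lambda>u. u p = 1) s"

definition ipow_of :: "nat \<Rightarrow> nat \<Rightarrow> (nat \<Rightarrow> bool list) \<Rightarrow> isimp" where
  "ipow_of n k w = map (\<lambda>l. \<lambda>p \<in> {0..k}. if w p ! l then 1 else 0) [0..<n]"

lemma cells_ipow: "s \<in> cells (ipow n) k \<longleftrightarrow> length s = n \<and> set s \<subseteq> arr Delta k 1"
  by (simp add: ipow_def psh_pow_def yo_def)

lemma act_ipow: "act (ipow n) j k f s = map (\<lambda>u. compose {0..j} u f) s"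
  by (simp add: ipow_def psh_pow_def yo_def)

lemma length_vert [simp]: "length (vert s p) = length s"
  by (simp add: vert_def)

lemma vert_append: "vert (s @ t) p = vert s p @ vert t p"
  by (simp add: vert_def)

lemma ipow_length: "s \<in> cells (ipow n) k \<Longrightarrow> length s = n"
  by (simp add: cells_ipow)

lemma ipow_eqI:
  assumes s: "s \<in> cells (ipow n) k" and t: "t \<in> cells (ipow n) k"
    and v: "\<And>p. p \<le> k \<Longrightarrow> vert s p = vert t p"
  shows "s = t"
proof (rule nth_equalityI)
  show "length s = length t" using s t by (simp add: cells_ipow)
  fix l assume l: "l < length s"
  then have *: "s ! l \<in> arr Delta k 1" "t ! l \<in> arr Delta k 1"
    using s t by (auto simp: cells_ipow)
  show "s ! l = t ! l"
  proof (rule extensionalityI[of _ "{0..k}"])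
    fix p assume "p \<in> {0..k}"
    then have "(s ! l) p \<le> 1" "(t ! l) p \<le> 1" "(s ! l) p = 1 \<longleftrightarrow> (t ! l) p = 1"
      using arr_DeltaD(1)[OF *(1), of p] arr_DeltaD(1)[OF *(2), of p]
        arg_cong[OF v[of p], of "\<lambda>z. z ! l"] l s t by (auto simp: vert_def cells_ipow)
    then show "(s ! l) p = (t ! l) p" by linarith
  qed (use * in \<open>simp_all add: arr_DeltaD\<close>)
qed

lemma vert_mono:
  assumes "s \<in> cells (ipow n) k" "p \<le> q" "q \<le> k"
  shows "list_all2 (\<longrightarrow>) (vert s p) (vert s q)"
proof -
  have "u q = 1" if "u \<in> set s" "u p = 1" for u
  proof -
    have "u \<in> arr Delta k 1" using that assms by (auto simp: cells_ipow)
    then show ?thesis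
      using that assms arr_DeltaD(1)[of u k 1 q] arr_DeltaD(2)[of u k 1 p q] by simp
  qed
  then show ?thesis by (auto simp: vert_def list_all2_conv_all_nth)
qed

lemma ipow_of_in:
  assumes "\<And>p. p \<le> k \<Longrightarrow> length (w p) = n"
    and "\<And>p q. p \<le> q \<Longrightarrow> q \<le> k \<Longrightarrow> list_all2 (\<longrightarrow>) (w p) (w q)"
  shows "ipow_of n k w \<in> cells (ipow n) k"
proof -
  have "w q ! l" if "l < n" "p \<le> q" "q \<le> k" "w p ! l" for l p q
    using that assms(1)[of p] assms(2)[of p q] by (auto simp: list_all2_conv_all_nth)
  then show ?thesis
    by (auto simp: ipow_of_def cells_ipow intro!: arr_DeltaI)
qed

lemma vert_ipow_of: "p \<le> k \<Longrightarrow> length (w p) = n \<Longrightarrow> vert (ipow_of n k w) p = w p"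
  by (rule nth_equalityI) (auto simp: vert_def ipow_of_def)

lemma ipow_append:
  "s \<in> cells (ipow m) k \<Longrightarrow> t \<in> cells (ipow n) k \<Longrightarrow> s @ t \<in> cells (ipow (m + n)) k"
  by (simp add: cells_ipow)

lemma ipow_take_drop:
  assumes "s \<in> cells (ipow (m + n)) k"
  shows "take m s \<in> cells (ipow m) k" "drop m s \<in> cells (ipow n) k"
  using assms set_take_subset[of m s] set_drop_subset[of m s] by (auto simp: cells_ipow)

lemma vert_act: "p \<le> j \<Longrightarrow> vert (act (ipow n) j k f s) p = vert s (f p)"
  by (simp add: vert_def act_ipow compose_def)

lemma ipow_presheaf: "presheaf Delta (ipow n)"
proof (rule presheafI)
  show in_ipow: "act (ipow n) m k f s \<in> cells (ipow n) m" if "f \<in> arr Delta m k" "s \<in> cells (ipow n) k" for m k f s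
    using that wsite.comp_arr[OF wsite_Delta] by (fastforce simp: cells_ipow act_ipow)
  show "act (ipow n) k k (\<lambda>v \<in> pts Delta k. v) s = s" if "s \<in> cells (ipow n) k" for k s
    using that in_ipow[OF wsite.id_arr[OF wsite_Delta] that]
    by (intro ipow_eqI[of _ n k]) (simp_all add: vert_act)
  show "act (ipow n) j k g (act (ipow n) k l f s) = act (ipow n) j l (compose (pts Delta j) f g) s"
    if *: "g \<in> arr Delta j k" "f \<in> arr Delta k l" "s \<in> cells (ipow n) l" for j k l f g s
    using that arr_DeltaD(1)[OF *(1)] wsite.comp_arr[OF wsite_Delta *(2,1)]
    by (intro ipow_eqI[of _ n j]) (simp_all add: vert_act in_ipow compose_def)
qed

text \<open>The specification that makes the definite description in \<open>ipow_map\<close>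
  succeed. Every derivation of \<open>ipow_arr\<close> acts on vertices through \<open>f\<close>,
  and a map of powers is determined by its effect on vertices; so all decompositions of
  \<open>f\<close> into generators yield the same simplicial map.\<close>

definition ipow_spec :: "nat \<Rightarrow> nat \<Rightarrow> cmap \<Rightarrow> (nat \<Rightarrow> isimp \<Rightarrow> isimp) \<Rightarrow> bool" where
  "ipow_spec m n f \<phi> \<longleftrightarrow> cube_arr m n f \<and> (\<forall>k. \<phi> k \<in> extensional (cells (ipow m) k)) \<and>
     (\<forall>k. \<forall>s \<in> cells (ipow m) k. \<phi> k s \<in> cells (ipow n) k \<and>
        (\<forall>p \<le> k. vert (\<phi> k s) p = f (vert s p)))"

lemma arr_Delta_const: "e \<le> n \<Longrightarrow> (\<lambda>p \<in> {0..k}. e) \<in> arr Delta k n"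
  by (rule arr_DeltaI) auto

lemma arr_Delta_max:
  assumes "u \<in> arr Delta k n" "v \<in> arr Delta k n"
  shows "(\<lambda>p \<in> {0..k}. max (u p) (v p)) \<in> arr Delta k n"
proof (rule arr_DeltaI)
  fix x y assume "x \<le> y" "y \<le> k"
  then show "(\<lambda>p \<in> {0..k}. max (u p) (v p)) x \<le> (\<lambda>p \<in> {0..k}. max (u p) (v p)) y"
    using arr_DeltaD(2)[OF assms(1)] arr_DeltaD(2)[OF assms(2)]
    by (simp del: max.bounded_iff) (rule max.mono)
qed (use arr_DeltaD(1)[OF assms(1)] arr_DeltaD(1)[OF assms(2)] in auto)

lemma ipow_arr_spec: "ipow_arr m n f \<phi> \<Longrightarrow> ipow_spec m n f \<phi>"
proof (induction rule: ipow_arr.induct)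
  case (ipow_id n)
  then show ?case
    by (auto simp: ipow_spec_def cube_arr.cube_id ipow_length)
next
  case (ipow_face m n f \<phi> i e)
  have "ins i (\<lambda>p \<in> {0..k}. if e then 1 else 0) s \<in> cells (ipow (Suc n)) k"
    if "s \<in> cells (ipow n) k" for k s
    using that ipow_face(2) set_take_subset[of i s] set_drop_subset[of i s]
    by (auto simp: cells_ipow length_ins) (auto simp: ins_def arr_Delta_const)
  moreover have "vert (ins i (\<lambda>p \<in> {0..k}. if e then 1 else 0) s) p = ins i e (vert s p)"
    if "p \<le> k" for s k p
    using that by (auto simp: ins_def vert_def take_map drop_map)
  ultimately show ?case
    using ipow_face by (auto simp: ipow_spec_def cube_arr.cube_face ipow_length)
next
  case (ipow_deg m n f \<phi> i)
  have "del i s \<in> cells (ipow n) k" if "s \<in> cells (ipow (Suc n)) k" for k s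
    using that ipow_deg(2) set_take_subset[of i s] set_drop_subset[of "Suc i" s]
    by (auto simp: cells_ipow length_del) (auto simp: del_def)
  moreover have "vert (del i s) p = del i (vert s p)" for s p
    by (auto simp: del_def vert_def take_map drop_map)
  ultimately show ?case
    using ipow_deg by (auto simp: ipow_spec_def cube_arr.cube_deg ipow_length)
next
  case (ipow_conn m n f \<phi> i)
  let ?mx = "\<lambda>k u v. \<lambda>p \<in> {0..k}. max (u p) (v p)"
  have "conn (?mx k) i s \<in> cells (ipow (Suc n)) k" if "s \<in> cells (ipow (Suc (Suc n))) k" for k s
  proof -
    have "s ! i \<in> arr Delta k 1" "s ! Suc i \<in> arr Delta k 1"
      using that ipow_conn(2) by (auto simp: cells_ipow)
    then show ?thesis
      using that ipow_conn(2) set_take_subset[of i s] set_drop_subset[of "Suc (Suc i)" s]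
      by (auto simp: cells_ipow length_conn) (auto simp: conn_def arr_Delta_max)
  qed
  moreover have "vert (conn (?mx k) i s) p = conn max i (vert s p)"
    if "p \<le> k" "s \<in> cells (ipow (Suc (Suc n))) k" for s k p
  proof -
    have *: "s ! i \<in> arr Delta k 1" "s ! Suc i \<in> arr Delta k 1" "Suc i < length s"
      using that ipow_conn(2) by (auto simp: cells_ipow)
    \<comment> \<open>For values bounded by 1, the maximum of numbers matches the maximum of truth
      values.\<close>
    have "(max ((s ! i) p) ((s ! Suc i) p) = 1) = max ((s ! i) p = 1) ((s ! Suc i) p = 1)"
      using arr_DeltaD(1)[OF *(1) that(1)] arr_DeltaD(1)[OF *(2) that(1)]
      by (cases "(s ! i) p = 1"; cases "(s ! Suc i) p = 1") auto
    then show ?thesis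
      using *(3) that(1) by (simp add: conn_def vert_def take_map drop_map)
  qed
  ultimately show ?case
    using ipow_conn by (auto simp: ipow_spec_def cube_arr.cube_conn ipow_length)
qed

lemma ipow_arr_ex: "cube_arr m n f \<Longrightarrow> \<exists>\<phi>. ipow_arr m n f \<phi>"
  by (induction rule: cube_arr.induct) (blast intro: ipow_arr.intros)+

lemma ipow_spec_unique:
  assumes "ipow_spec m n f \<phi>" "ipow_spec m n f \<psi>"
  shows "\<phi> = \<psi>"
proof (rule psh_map_eqI[of _ "ipow m"])
  show "\<phi> k s = \<psi> k s" if "s \<in> cells (ipow m) k" for k s
    using assms that by (intro ipow_eqI[of _ n k]) (auto simp: ipow_spec_def)
qed (use assms in \<open>auto simp: ipow_spec_def\<close>)

lemma ipow_map_spec: "cube_arr m n f \<Longrightarrow> ipow_spec m n f (ipow_map m n f)"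
  unfolding ipow_map_def
  by (metis ipow_arr_ex ipow_arr_spec ipow_spec_unique theI')

lemma ipow_map_in: "cube_arr m n f \<Longrightarrow> s \<in> cells (ipow m) k \<Longrightarrow> ipow_map m n f k s \<in> cells (ipow n) k"
  and ipow_map_vert: "cube_arr m n f \<Longrightarrow> s \<in> cells (ipow m) k \<Longrightarrow> p \<le> k \<Longrightarrow>
    vert (ipow_map m n f k s) p = f (vert s p)"
  and ipow_map_ext: "cube_arr m n f \<Longrightarrow> ipow_map m n f k \<in> extensional (cells (ipow m) k)"
  using ipow_map_spec by (auto simp: ipow_spec_def)

lemma ipow_map_psh:
  assumes "cube_arr m n f"
  shows "psh_map Delta (ipow m) (ipow n) (ipow_map m n f)"
proof (rule psh_mapI)
  fix j k g s assume *: "g \<in> arr Delta j k" "s \<in> cells (ipow m) k"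
  then show "ipow_map m n f j (act (ipow m) j k g s) = act (ipow n) j k g (ipow_map m n f k s)"
    using assms
    by (intro ipow_eqI[of _ n j])
      (simp_all add: ipow_map_in ipow_map_vert vert_act presheafD(1)[OF ipow_presheaf] arr_DeltaD)
qed (use assms in \<open>simp_all add: ipow_map_in ipow_map_ext\<close>)

lemma ipow_map_id: "s \<in> cells (ipow n) k \<Longrightarrow> ipow_map n n (\<lambda>v \<in> cube n. v) k s = s"
  by (rule ipow_eqI[of _ n k]) (simp_all add: ipow_map_in ipow_map_vert cube_arr.cube_id ipow_length)

lemma ipow_map_comp:
  assumes "cube_arr m n g" "cube_arr l m f" "s \<in> cells (ipow l) k"
  shows "ipow_map m n g k (ipow_map l m f k s) = ipow_map l n (compose (cube l) g f) k s"
  using assms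
  by (intro ipow_eqI[of _ n k])
    (simp_all add: ipow_map_in ipow_map_vert cube_arr_comp ipow_length)

lemma ipow_map_tens:
  assumes "cube_arr m m' f" "cube_arr n n' g" "s \<in> cells (ipow m) k" "t \<in> cells (ipow n) k"
  shows "ipow_map (m + n) (m' + n') (tens_arr m n f g) k (s @ t) =
    ipow_map m m' f k s @ ipow_map n n' g k t"
  using assms
  by (intro ipow_eqI[of _ "m' + n'" k])
    (simp_all add: ipow_map_in ipow_append ipow_map_vert cube_arr_tens vert_append tens_arr_apply ipow_length)

section \<open>Triangulation\<close>

abbreviation "sfun \<equiv> vfunctor Delta prod_pure prod_pure"
abbreviation "cfun \<equiv> vfunctor Cube day_pure day_pure"
abbreviation "scategory \<equiv> vcategory Delta psh_prod prod_pure"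
abbreviation "ccategory \<equiv> vcategory Cube day day_pure"

lemma nil_in_ipow: "[] \<in> cells (ipow 0) k"
  by (simp add: cells_ipow)

lemma vcategory_vcomp:
  assumes "vcategory M tens pure C" "x \<in> obj C" "y \<in> obj C" "z \<in> obj C"
  shows "psh_map M (tens (hom C x y) (hom C y z)) (hom C x z) (vcomp C x y z)"
  using assms(1)[unfolded vcategory_def, THEN conjunct2, THEN conjunct1] assms(2-4) by simp

context
  fixes K :: "'a cset"
  assumes K: "presheaf Cube K"
begin

lemma Lc_class_step:
  assumes "cube_arr m n f" "y \<in> cells K n" "s \<in> cells (ipow m) k"
  shows "Lc_class K k (m, act K m n f y, s) = Lc_class K k (n, y, ipow_map m n f k s)"
  unfolding Lc_class_def
  using assms presheafD(1)[OF K]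
  by (intro gen_class_step Lc_step.intros) (auto simp: Lc_reps_def ipow_map_in)

lemma Lc_class_in:
  "x \<in> cells K m \<Longrightarrow> s \<in> cells (ipow m) k \<Longrightarrow> Lc_class K k (m, x, s) \<in> cells (Lc K) k"
  by (auto simp: Lc_def Lc_reps_def)

lemma Lc_cellE:
  assumes "S \<in> cells (Lc K) k"
  obtains m x s where "S = Lc_class K k (m, x, s)" "x \<in> cells K m" "s \<in> cells (ipow m) k"
  using assms by (auto simp: Lc_def Lc_reps_def)

context
  fixes h :: "nat \<times> 'a \<times> isimp \<Rightarrow> 'c" and k m x s
  assumes h: "\<And>m n f y s. cube_arr m n f \<Longrightarrow> y \<in> cells K n \<Longrightarrow> s \<in> cells (ipow m) k \<Longrightarrow>
      h (m, act K m n f y, s) = h (n, y, ipow_map m n f k s)"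
    and x: "x \<in> cells K m" and s: "s \<in> cells (ipow m) k"
begin

lemma Lc_step_const: "Lc_step K k u v \<Longrightarrow> h u = h v"
  by (auto elim!: Lc_step.cases intro: h)

text \<open>A function of representatives descends to the coend when it cannot tell whether a cube
  arrow acts on the cell or on the simplex.\<close>

lemma Lc_the_elem: "the_elem (h ` Lc_class K k (m, x, s)) = h (m, x, s)"
  unfolding Lc_class_def using Lc_step_const x s
  by (intro gen_class_the_elem) (auto simp: Lc_reps_def)

end

lemma Lc_UN:
  assumes h: "\<And>m n f y s. cube_arr m n f \<Longrightarrow> y \<in> cells K n \<Longrightarrow> s \<in> cells (ipow m) k \<Longrightarrow>
      h (m, act K m n f y, s) = h (n, y, ipow_map m n f k s)"
    and "x \<in> cells K m" "s \<in> cells (ipow m) k"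
  shows "(\<Union>u \<in> Lc_class K k (m, x, s). h u) = h (m, x, s)"
  unfolding Lc_class_def using Lc_step_const[of k h, OF h] assms(2,3)
  by (intro gen_class_UN) (auto simp: Lc_reps_def)

lemma Lc_act:
  assumes "x \<in> cells K m" "s \<in> cells (ipow m) k" "f \<in> arr Delta j k"
  shows "act (Lc K) j k f (Lc_class K k (m, x, s)) = Lc_class K j (m, x, act (ipow m) j k f s)"
proof -
  have "(\<Union>(m, x, s) \<in> Lc_class K k (m, x, s). Lc_class K j (m, x, act (ipow m) j k f s)) =
      (\<lambda>(m, x, s). Lc_class K j (m, x, act (ipow m) j k f s)) (m, x, s)"
    using assms
    by (intro Lc_UN) (simp_all add: Lc_class_step presheafD(1)[OF ipow_presheaf]
        psh_mapD(3)[OF ipow_map_psh])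
  then show ?thesis by (simp add: Lc_def)
qed

lemma Lc_presheaf: "presheaf Delta (Lc K)"
proof (rule presheafI)
  show "act (Lc K) m n f S \<in> cells (Lc K) m" if "f \<in> arr Delta m n" "S \<in> cells (Lc K) n" for m n f S
    using that by (elim Lc_cellE) (simp add: Lc_act Lc_class_in presheafD(1)[OF ipow_presheaf])
  show "act (Lc K) n n (\<lambda>v \<in> pts Delta n. v) S = S" if "S \<in> cells (Lc K) n" for n S
    using that wsite.id_arr[OF wsite_Delta, of n] presheafD(2)[OF ipow_presheaf]
    by (elim Lc_cellE) (simp add: Lc_act)
  show "act (Lc K) k m g (act (Lc K) m n f S) = act (Lc K) k n (compose (pts Delta k) f g) S"
    if "g \<in> arr Delta k m" "f \<in> arr Delta m n" "S \<in> cells (Lc K) n" for k m n f g S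
    using that wsite.comp_arr[OF wsite_Delta that(2,1)] presheafD(3)[OF ipow_presheaf that(1,2)]
    by (elim Lc_cellE) (simp add: Lc_act presheafD(1)[OF ipow_presheaf])
qed

lemma Lc_map_class:
  assumes "psh_map Cube K K' \<phi>" "presheaf Cube K'" "x \<in> cells K m" "s \<in> cells (ipow m) k"
  shows "Lc_map K K' \<phi> k (Lc_class K k (m, x, s)) = Lc_class K' k (m, \<phi> m x, s)"
proof -
  have st: "Lc_class K' k (m, act K' m n f y, s) = Lc_class K' k (n, y, ipow_map m n f k s)"
    if "cube_arr m n f" "y \<in> cells K' n" "s \<in> cells (ipow m) k" for m n f y s
    unfolding Lc_class_def using that presheafD(1)[OF assms(2)]
    by (intro gen_class_step Lc_step.intros) (auto simp: Lc_reps_def ipow_map_in)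
  have "(\<Union>(m, x, s) \<in> Lc_class K k (m, x, s). Lc_class K' k (m, \<phi> m x, s)) =
      (\<lambda>(m, x, s). Lc_class K' k (m, \<phi> m x, s)) (m, x, s)"
    using assms(3,4) by (intro Lc_UN) (simp_all add: psh_mapD(1,3)[OF assms(1)] st)
  then show ?thesis using assms(3,4) by (simp add: Lc_map_def Lc_class_in)
qed

end

text \<open>Independence of representatives is checked in each variable separately: an arrow acting
  in one factor is tensored with the identity of the other (\<open>st1\<close>, \<open>st2\<close>).
  The nested union then collapses from the inside.\<close>

lemma Lc_mult_class:
  assumes A: "presheaf Cube A" and B: "presheaf Cube B"
    and "a \<in> cells A m" "s \<in> cells (ipow m) k" "b \<in> cells B n" "t \<in> cells (ipow n) k"
  shows "Lc_mult A B k (Lc_class A k (m, a, s), Lc_class B k (n, b, t)) =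
    Lc_class (day A B) k (m + n, day_pure A B m n a b, s @ t)"
proof -
  let ?h = "\<lambda>(m, a, s) (n, b, t). Lc_class (day A B) k (m + n, day_pure A B m n a b, s @ t)"
  have st1: "?h (m, act A m m' f a, s) (n, b, t) = ?h (m', a, ipow_map m m' f k s) (n, b, t)"
    if *: "cube_arr m m' f" "a \<in> cells A m'" "s \<in> cells (ipow m) k"
      "b \<in> cells B n" "t \<in> cells (ipow n) k" for m m' f a s n b t
    using Lc_class_step[OF presheaf_day[OF A B] cube_arr_tens[OF *(1) cube_id[of n]]
        day_pure_in[OF A B *(2,4)] ipow_append[OF *(3,5)]] *
    by (simp add: day_pure_act[OF A B] cube_arr.cube_id presheafD(2)[OF B, simplified]
        ipow_map_tens ipow_map_id)
  have st2: "?h (m, a, s) (n, act B n n' f b, t) = ?h (m, a, s) (n', b, ipow_map n n' f k t)"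
    if *: "cube_arr n n' f" "b \<in> cells B n'" "t \<in> cells (ipow n) k"
      "a \<in> cells A m" "s \<in> cells (ipow m) k" for n n' f a s m b t
    using Lc_class_step[OF presheaf_day[OF A B] cube_arr_tens[OF cube_id[of m] *(1)]
        day_pure_in[OF A B *(4,2)] ipow_append[OF *(5,3)]] *
    by (simp add: day_pure_act[OF A B] cube_arr.cube_id presheafD(2)[OF A, simplified]
        ipow_map_tens ipow_map_id)
  have inner: "(\<Union>v \<in> Lc_class B k (n, b, t). ?h (m, a, s) v) = ?h (m, a, s) (n, b, t)"
    if "a \<in> cells A m" "s \<in> cells (ipow m) k" for m a s
    by (rule Lc_UN[OF B _ assms(5,6)]) (use st2 that in simp)
  have "(\<Union>u \<in> Lc_class A k (m, a, s). \<Union>v \<in> Lc_class B k (n, b, t). ?h u v) =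
      (\<Union>v \<in> Lc_class B k (n, b, t). ?h (m, a, s) v)"
    by (rule Lc_UN[OF A _ assms(3,4)])
      (use st1 assms(5,6) in \<open>simp only: inner presheafD(1)[OF A] arr_Cube ipow_map_in\<close>)
  also have "\<dots> = ?h (m, a, s) (n, b, t)"
    using inner assms(3,4) by blast
  finally show ?thesis
    using assms by (simp add: Lc_mult_def psh_prod_def Lc_class_in case_prod_unfold)
qed

section \<open>Change of base along triangulation\<close>

lemma obj_Lc_cat: "obj (Lc_cat C) = obj C"
  and hom_Lc_cat: "hom (Lc_cat C) x y = Lc (hom C x y)"
  and ident_Lc_cat: "ident (Lc_cat C) x = Lc_class (hom C x x) 0 (0, ident C x, [])"
  by (simp_all add: Lc_cat_def)

lemma fst_Lc_fun: "x \<in> obj C \<Longrightarrow> fst (Lc_fun C C' F) x = fst F x"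
  by (simp add: Lc_fun_def obj_Lc_cat)

context
  fixes C :: "('o, 'a) ccat"
  assumes C: "ccategory C"
begin

interpretation C: pcat Cube day_pure C
  by (rule tensor.vcategory_pcat[OF tensor_day C])

lemma Lc_cat_cellE:
  assumes "x \<in> obj (Lc_cat C)" "y \<in> obj (Lc_cat C)" "S \<in> cells (hom (Lc_cat C) x y) k"
  obtains m a s where "S = Lc_class (hom C x y) k (m, a, s)" "a \<in> cells (hom C x y) m" "s \<in> cells (ipow m) k"
  using Lc_cellE[OF C.hom_presheaf[of x y], of S k] assms by (auto simp: obj_Lc_cat hom_Lc_cat)

lemma Lc_class_in_cat:
  assumes "x \<in> obj C" "y \<in> obj C" "c \<in> cells (hom C x y) m" "s \<in> cells (ipow m) k"
  shows "Lc_class (hom C x y) k (m, c, s) \<in> cells (hom (Lc_cat C) x y) k"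
  using assms by (simp add: hom_Lc_cat Lc_class_in[OF C.hom_presheaf])

text \<open>Cubical parts are composed in \<open>C\<close> and simplices are concatenated,
  \<open>s @ t\<close> being the identification of a product of powers with a power. Associativity
  and unit laws of \<open>Lc_cat C\<close> thereby reduce to those of \<open>C\<close> and of
  lists.\<close>

lemma vcomp_Lc_cat:
  assumes "x \<in> obj C" "y \<in> obj C" "z \<in> obj C"
    and "a \<in> cells (hom C x y) m" "s \<in> cells (ipow m) k" "b \<in> cells (hom C y z) n" "t \<in> cells (ipow n) k"
  shows "vcomp (Lc_cat C) x y z k
      (Lc_class (hom C x y) k (m, a, s), Lc_class (hom C y z) k (n, b, t)) =
    Lc_class (hom C x z) k (m + n, pcomp day_pure C x y z m n (m + n) a b, s @ t)"
proof -
  have V: "psh_map Cube (day (hom C x y) (hom C y z)) (hom C x z) (vcomp C x y z)"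
    by (rule vcategory_vcomp[OF C assms(1-3)])
  show ?thesis
    using assms
    by (simp add: Lc_cat_def psh_prod_def Lc_class_in C.hom_presheaf Lc_mult_class pcomp_def
        Lc_map_class[OF presheaf_day V] day_pure_in ipow_append)
qed

lemma pcomp_Lc_cat:
  assumes "x \<in> obj C" "y \<in> obj C" "z \<in> obj C"
    and "a \<in> cells (hom C x y) m" "s \<in> cells (ipow m) k" "b \<in> cells (hom C y z) n" "t \<in> cells (ipow n) k"
  shows "pcomp prod_pure (Lc_cat C) x y z k k k
      (Lc_class (hom C x y) k (m, a, s)) (Lc_class (hom C y z) k (n, b, t)) =
    Lc_class (hom C x z) k (m + n, pcomp day_pure C x y z m n (m + n) a b, s @ t)"
  using vcomp_Lc_cat[OF assms] by (simp add: pcomp_def prod_pure_def)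

lemma Lc_cat_vcomp_map:
  assumes o: "x \<in> obj C" "y \<in> obj C" "z \<in> obj C"
  shows "psh_map Delta (psh_prod (Lc (hom C x y)) (Lc (hom C y z))) (Lc (hom C x z)) (vcomp (Lc_cat C) x y z)"
proof (rule psh_mapI)
  show "vcomp (Lc_cat C) x y z n \<in> extensional (cells (psh_prod (Lc (hom C x y)) (Lc (hom C y z))) n)" for n
    by (simp add: Lc_cat_def)
  fix k \<tau> assume "\<tau> \<in> cells (psh_prod (Lc (hom C x y)) (Lc (hom C y z))) k"
  then obtain S T where ST: "\<tau> = (S, T)" "S \<in> cells (Lc (hom C x y)) k" "T \<in> cells (Lc (hom C y z)) k"
    by (auto simp: psh_prod_def)
  obtain m a s where S: "S = Lc_class (hom C x y) k (m, a, s)" "a \<in> cells (hom C x y) m" "s \<in> cells (ipow m) k"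
    using Lc_cellE[OF C.hom_presheaf[OF o(1,2)] ST(2)] .
  obtain n b t where T: "T = Lc_class (hom C y z) k (n, b, t)" "b \<in> cells (hom C y z) n" "t \<in> cells (ipow n) k"
    using Lc_cellE[OF C.hom_presheaf[OF o(2,3)] ST(3)] .
  show "vcomp (Lc_cat C) x y z k \<tau> \<in> cells (Lc (hom C x z)) k"
    using o S T ST(1) by (simp add: vcomp_Lc_cat Lc_class_in C.hom_presheaf C.pcomp_in ipow_append)
  fix j f assume f: "f \<in> arr Delta j k"
  have "act (ipow m) j k f s @ act (ipow n) j k f t = act (ipow (m + n)) j k f (s @ t)"
    by (simp add: act_ipow)
  then show "vcomp (Lc_cat C) x y z j (act (psh_prod (Lc (hom C x y)) (Lc (hom C y z))) j k f \<tau>) =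
      act (Lc (hom C x z)) j k f (vcomp (Lc_cat C) x y z k \<tau>)"
    using o S T ST(1) f
    by (simp add: psh_prod_def Lc_act C.hom_presheaf vcomp_Lc_cat C.pcomp_in ipow_append
        presheafD(1)[OF ipow_presheaf])
qed

text \<open>The zeroth power of the interval is a point in every dimension, so degenerate identities
  are still represented by the empty list.\<close>

lemma act_ident_Lc_cat:
  assumes "x \<in> obj C" "f \<in> arr Delta k 0"
  shows "act (Lc (hom C x x)) k 0 f (ident (Lc_cat C) x) = Lc_class (hom C x x) k (0, ident C x, [])"
  using assms by (simp add: ident_Lc_cat Lc_act C.hom_presheaf C.ident_in nil_in_ipow) (simp add: act_ipow)

lemma pcat_Lc_cat: "pcat Delta prod_pure (Lc_cat C)"
proof unfold_locales
  note [simp] = obj_Lc_cat hom_Lc_cat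
  show "presheaf Delta (hom (Lc_cat C) x y)" if "x \<in> obj (Lc_cat C)" "y \<in> obj (Lc_cat C)" for x y
    using that by (simp add: Lc_presheaf C.hom_presheaf)
  show "ident (Lc_cat C) x \<in> cells (hom (Lc_cat C) x x) 0" if "x \<in> obj (Lc_cat C)" for x
    using that by (simp add: ident_Lc_cat Lc_class_in C.hom_presheaf C.ident_in nil_in_ipow)
  show "pcomp prod_pure (Lc_cat C) x y z p q r a b \<in> cells (hom (Lc_cat C) x z) r"
    if "x \<in> obj (Lc_cat C)" "y \<in> obj (Lc_cat C)" "z \<in> obj (Lc_cat C)" "join Delta p q r"
      "a \<in> cells (hom (Lc_cat C) x y) p" "b \<in> cells (hom (Lc_cat C) y z) q" for x y z p q r a b
    using that psh_mapD(1)[OF Lc_cat_vcomp_map, of x y z "(a, b)" r]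
    by (simp add: pcomp_def prod_pure_def psh_prod_def)
  show "act (hom (Lc_cat C) x z) r' r h (pcomp prod_pure (Lc_cat C) x y z p q r a b) =
      pcomp prod_pure (Lc_cat C) x y z p' q' r' (act (hom (Lc_cat C) x y) p' p f a)
        (act (hom (Lc_cat C) y z) q' q g b)"
    if "x \<in> obj (Lc_cat C)" "y \<in> obj (Lc_cat C)" "z \<in> obj (Lc_cat C)" "join Delta p q r"
      "join Delta p' q' r'" "f \<in> arr Delta p' p" "g \<in> arr Delta q' q" "h \<in> arr Delta r' r"
      "joinarr Delta p' p f q' q g h"
      "a \<in> cells (hom (Lc_cat C) x y) p" "b \<in> cells (hom (Lc_cat C) y z) q"
    for x y z p q r p' q' r' f g h a b
    using that psh_mapD(3)[OF Lc_cat_vcomp_map, of x y z h r' r "(a, b)"]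
    by (simp add: pcomp_def prod_pure_def psh_prod_def)
  show "pcomp prod_pure (Lc_cat C) w y z s r t (pcomp prod_pure (Lc_cat C) w x y p q s a b) c =
      pcomp prod_pure (Lc_cat C) w x z p s' t a (pcomp prod_pure (Lc_cat C) x y z q r s' b c)"
    if "w \<in> obj (Lc_cat C)" "x \<in> obj (Lc_cat C)" "y \<in> obj (Lc_cat C)" "z \<in> obj (Lc_cat C)"
      "join Delta p q s" "join Delta s r t" "join Delta q r s'" "join Delta p s' t"
      "a \<in> cells (hom (Lc_cat C) w x) p" "b \<in> cells (hom (Lc_cat C) x y) q"
      "c \<in> cells (hom (Lc_cat C) y z) r"
    for w x y z p q r s s' t a b c
  proof -
    note prm = that
    have *: "w \<in> obj C" "x \<in> obj C" "y \<in> obj C" "z \<in> obj C" "p = t" "q = t" "r = t" "s = t" "s' = t"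
      using that by simp_all
    obtain l a' u where a: "a = Lc_class (hom C w x) t (l, a', u)" "a' \<in> cells (hom C w x) l" "u \<in> cells (ipow l) t"
      using Lc_cellE[OF C.hom_presheaf[OF *(1,2)]] prm(9) * by (metis hom_Lc_cat)
    obtain m b' v where b: "b = Lc_class (hom C x y) t (m, b', v)" "b' \<in> cells (hom C x y) m" "v \<in> cells (ipow m) t"
      using Lc_cellE[OF C.hom_presheaf[OF *(2,3)]] prm(10) * by (metis hom_Lc_cat)
    obtain n c' z' where c: "c = Lc_class (hom C y z) t (n, c', z')" "c' \<in> cells (hom C y z) n" "z' \<in> cells (ipow n) t"
      using Lc_cellE[OF C.hom_presheaf[OF *(3,4)]] prm(11) * by (metis hom_Lc_cat)
    have "pcomp day_pure C w y z (l + m) n (l + m + n) (pcomp day_pure C w x y l m (l + m) a' b') c' =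
        pcomp day_pure C w x z l (m + n) (l + m + n) a' (pcomp day_pure C x y z m n (m + n) b' c')"
      using * a b c by (intro C.pcomp_assoc) simp_all
    with * a b c show ?thesis
      by (simp add: pcomp_Lc_cat C.pcomp_in ipow_append add.assoc)
  qed
  show "pcomp prod_pure (Lc_cat C) x x y e d d (act (hom (Lc_cat C) x x) e 0 f (ident (Lc_cat C) x)) a = a"
    if "x \<in> obj (Lc_cat C)" "y \<in> obj (Lc_cat C)" "f \<in> arr Delta e 0" "a \<in> cells (hom (Lc_cat C) x y) d"
      "join Delta e d d" for x y f e a d
  proof -
    note prm = that
    have *: "x \<in> obj C" "y \<in> obj C" "e = d" using that(1,2) that(5)[unfolded join_Delta, THEN conjunct1] by simp_all
    obtain m a' s where a: "a = Lc_class (hom C x y) d (m, a', s)" "a' \<in> cells (hom C x y) m" "s \<in> cells (ipow m) d"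
      using Lc_cellE[OF C.hom_presheaf[OF *(1,2)]] prm(4) by (metis hom_Lc_cat)
    have "pcomp day_pure C x x y 0 m m (ident C x) a' = a'"
      using C.unit_left[OF *(1,2) _ a(2), of "\<lambda>v \<in> cube 0. v" 0]
        presheafD(2)[OF C.hom_presheaf[OF *(1,1)] C.ident_in[OF *(1)]] by (simp add: cube_arr.cube_id)
    then show ?thesis
      using * a prm(3) pcomp_Lc_cat[OF *(1,1,2) C.ident_in[OF *(1)] nil_in_ipow a(2,3)]
      by (simp add: act_ident_Lc_cat)
  qed
  show "pcomp prod_pure (Lc_cat C) x y y d e d a (act (hom (Lc_cat C) y y) e 0 f (ident (Lc_cat C) y)) = a"
    if "x \<in> obj (Lc_cat C)" "y \<in> obj (Lc_cat C)" "f \<in> arr Delta e 0" "a \<in> cells (hom (Lc_cat C) x y) d"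
      "join Delta d e d" for x y f e a d
  proof -
    note prm = that
    have *: "x \<in> obj C" "y \<in> obj C" "e = d" using that(1,2) that(5)[unfolded join_Delta, THEN conjunct1] by simp_all
    obtain m a' s where a: "a = Lc_class (hom C x y) d (m, a', s)" "a' \<in> cells (hom C x y) m" "s \<in> cells (ipow m) d"
      using Lc_cellE[OF C.hom_presheaf[OF *(1,2)]] prm(4) by (metis hom_Lc_cat)
    have "pcomp day_pure C x y y m 0 m a' (ident C y) = a'"
      using C.unit_right[OF *(1,2) _ a(2), of "\<lambda>v \<in> cube 0. v" 0]
        presheafD(2)[OF C.hom_presheaf[OF *(2,2)] C.ident_in[OF *(2)]] by (simp add: cube_arr.cube_id)
    then show ?thesis
      using * a prm(3) pcomp_Lc_cat[OF *(1,2,2) a(2,3) C.ident_in[OF *(2)] nil_in_ipow]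
      by (simp add: act_ident_Lc_cat)
  qed
qed

lemma vcategory_Lc_cat: "scategory (Lc_cat C)"
  by (rule pcat_vcategory[OF pcat_Lc_cat]) (simp add: obj_Lc_cat hom_Lc_cat Lc_cat_vcomp_map)

end

section \<open>Triangulation of enriched functors\<close>

context
  fixes C :: "('o, 'a) ccat" and C' :: "('q, 'b) ccat"
  assumes C: "ccategory C" and C': "ccategory C'"
begin

interpretation C: pcat Cube day_pure C
  by (rule tensor.vcategory_pcat[OF tensor_day C])
interpretation C': pcat Cube day_pure C'
  by (rule tensor.vcategory_pcat[OF tensor_day C'])

lemma snd_Lc_fun:
  assumes "cfun C C' F" "x \<in> obj C" "y \<in> obj C"
    and "c \<in> cells (hom C x y) m" "s \<in> cells (ipow m) k"
  shows "snd (Lc_fun C C' F) x y k (Lc_class (hom C x y) k (m, c, s)) =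
    Lc_class (hom C' (fst F x) (fst F y)) k (m, snd F x y m c, s)"
  using assms
  by (simp add: Lc_fun_def obj_Lc_cat hom_Lc_cat Lc_class_in C.hom_presheaf
      Lc_map_class[OF _ vfunctorD(2)[OF assms(1)]] C'.hom_presheaf vfunctorD(1)[OF assms(1)])

lemma Lc_fun_functor:
  assumes F: "cfun C C' F"
  shows "sfun (Lc_cat C) (Lc_cat C') (Lc_fun C C' F)"
proof (rule vfunctorI)
  note [simp] = obj_Lc_cat hom_Lc_cat
    fst_Lc_fun snd_Lc_fun[OF F] vfunctorD(1,3)[OF F]
  show "vf_ext (Lc_cat C) (Lc_fun C C' F)" by (simp add: Lc_fun_def)
  show "fst (Lc_fun C C' F) x \<in> obj (Lc_cat C')" if "x \<in> obj (Lc_cat C)" for x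
    using that by simp
  show "snd (Lc_fun C C' F) x y n S \<in> cells (hom (Lc_cat C') (fst (Lc_fun C C' F) x) (fst (Lc_fun C C' F) y)) n"
    if "x \<in> obj (Lc_cat C)" "y \<in> obj (Lc_cat C)" "S \<in> cells (hom (Lc_cat C) x y) n" for x y S n
    by (rule Lc_cat_cellE[OF C that]) (use that in \<open>simp add: Lc_class_in C'.hom_presheaf\<close>)
  show "snd (Lc_fun C C' F) x y m (act (hom (Lc_cat C) x y) m n f S) =
      act (hom (Lc_cat C') (fst (Lc_fun C C' F) x) (fst (Lc_fun C C' F) y)) m n f (snd (Lc_fun C C' F) x y n S)"
    if "x \<in> obj (Lc_cat C)" "y \<in> obj (Lc_cat C)" "f \<in> arr Delta m n" "S \<in> cells (hom (Lc_cat C) x y) n"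
    for x y f m n S
    by (rule Lc_cat_cellE[OF C that(1,2,4)])
      (use that in \<open>simp add: Lc_act C.hom_presheaf C'.hom_presheaf presheafD(1)[OF ipow_presheaf]\<close>)
  show "snd (Lc_fun C C' F) x x 0 (ident (Lc_cat C) x) = ident (Lc_cat C') (fst (Lc_fun C C' F) x)"
    if "x \<in> obj (Lc_cat C)" for x
    using that by (simp add: ident_Lc_cat C.ident_in nil_in_ipow vfunctorD(5)[OF F])
  show "snd (Lc_fun C C' F) x z r (pcomp prod_pure (Lc_cat C) x y z p q r S T) =
      pcomp prod_pure (Lc_cat C') (fst (Lc_fun C C' F) x) (fst (Lc_fun C C' F) y) (fst (Lc_fun C C' F) z)
        p q r (snd (Lc_fun C C' F) x y p S) (snd (Lc_fun C C' F) y z q T)"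
    if "x \<in> obj (Lc_cat C)" "y \<in> obj (Lc_cat C)" "z \<in> obj (Lc_cat C)" "join Delta p q r"
      "S \<in> cells (hom (Lc_cat C) x y) p" "T \<in> cells (hom (Lc_cat C) y z) q" for x y z p q r S T
  proof -
    note prm = that
    have *: "x \<in> obj C" "y \<in> obj C" "z \<in> obj C" "p = r" "q = r" using that by simp_all
    obtain m a s where S: "S = Lc_class (hom C x y) r (m, a, s)" "a \<in> cells (hom C x y) m" "s \<in> cells (ipow m) r"
      using Lc_cellE[OF C.hom_presheaf[OF *(1,2)]] prm(5) * by (metis hom_Lc_cat)
    obtain n b t where T: "T = Lc_class (hom C y z) r (n, b, t)" "b \<in> cells (hom C y z) n" "t \<in> cells (ipow n) r"
      using Lc_cellE[OF C.hom_presheaf[OF *(2,3)]] prm(6) * by (metis hom_Lc_cat)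
    show ?thesis
      using * S T by (simp add: pcomp_Lc_cat[OF C] pcomp_Lc_cat[OF C'] C.pcomp_in ipow_append vfunctorD(6)[OF F])
  qed
qed

end

lemma Lc_fun_id:
  assumes C: "ccategory C"
  shows "Lc_fun C C (vf_id C) = vf_id (Lc_cat C)"
proof (rule vf_eqI[of "Lc_cat C"])
  interpret C: pcat Cube day_pure C by (rule tensor.vcategory_pcat[OF tensor_day C])
  show "vf_ext (Lc_cat C) (Lc_fun C C (vf_id C))" by (simp add: Lc_fun_def)
  show "fst (Lc_fun C C (vf_id C)) x = fst (vf_id (Lc_cat C)) x" if "x \<in> obj (Lc_cat C)" for x
    using that by (simp add: fst_Lc_fun obj_Lc_cat)
  show "snd (Lc_fun C C (vf_id C)) x y n c = snd (vf_id (Lc_cat C)) x y n c"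
    if "x \<in> obj (Lc_cat C)" "y \<in> obj (Lc_cat C)" "c \<in> cells (hom (Lc_cat C) x y) n" for x y n c
    by (rule Lc_cat_cellE[OF C that])
      (use that in \<open>simp add: obj_Lc_cat hom_Lc_cat Lc_class_in C.hom_presheaf
        snd_Lc_fun[OF C C vfunctor_id[OF C.pcat_axioms]]\<close>)
qed simp

lemma Lc_fun_comp:
  assumes C: "ccategory C" and C': "ccategory C'"
    and C'': "ccategory C''"
    and F: "cfun C C' F" and G: "cfun C' C'' G"
  shows "Lc_fun C C'' (vf_comp C G F) = vf_comp (Lc_cat C) (Lc_fun C' C'' G) (Lc_fun C C' F)"
proof (rule vf_eqI[of "Lc_cat C"])
  interpret C: pcat Cube day_pure C by (rule tensor.vcategory_pcat[OF tensor_day C])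
  show "vf_ext (Lc_cat C) (Lc_fun C C'' (vf_comp C G F))" by (simp add: Lc_fun_def)
  note [simp] = obj_Lc_cat hom_Lc_cat fst_Lc_fun fst_Lc_fun vfunctorD(1,3)[OF F]
    snd_Lc_fun[OF C C' F] snd_Lc_fun[OF C' C'' G]
    snd_Lc_fun[OF C C'' vfunctor_comp[OF C.pcat_axioms F G]] Lc_class_in C.hom_presheaf
  show "fst (Lc_fun C C'' (vf_comp C G F)) x = fst (vf_comp (Lc_cat C) (Lc_fun C' C'' G) (Lc_fun C C' F)) x"
    if "x \<in> obj (Lc_cat C)" for x using that by simp
  show "snd (Lc_fun C C'' (vf_comp C G F)) x y n c =
      snd (vf_comp (Lc_cat C) (Lc_fun C' C'' G) (Lc_fun C C' F)) x y n c"
    if "x \<in> obj (Lc_cat C)" "y \<in> obj (Lc_cat C)" "c \<in> cells (hom (Lc_cat C) x y) n" for x y n c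
    by (rule Lc_cat_cellE[OF C that]) (use that in simp)
qed simp

section \<open>The right adjoint of triangulation\<close>

lemma cells_Rc: "g \<in> cells (Rc X) n \<longleftrightarrow> psh_map Delta (ipow n) X g"
  by (simp add: Rc_def)

lemma act_Rc: "act (Rc X) m n f g = psh_comp (ipow m) g (ipow_map m n f)"
  by (simp add: Rc_def)

lemma Rc_eqI:
  assumes "g \<in> cells (Rc X) n" "h \<in> cells (Rc X) n"
    and "\<And>k s. s \<in> cells (ipow n) k \<Longrightarrow> g k s = h k s"
  shows "g = h"
  using assms psh_mapD(2) unfolding cells_Rc by (intro psh_map_eqI[of g "ipow n" h]) blast+

lemma Rc_presheaf: "presheaf Cube (Rc X)"
proof (rule presheafI)
  show in_Rc: "act (Rc X) m n f g \<in> cells (Rc X) m" if "f \<in> arr Cube m n" "g \<in> cells (Rc X) n" for m n f g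
    using that psh_map_comp[OF ipow_map_psh _ ipow_presheaf] by (simp add: cells_Rc act_Rc)
  show "act (Rc X) n n (\<lambda>v \<in> pts Cube n. v) g = g" if "g \<in> cells (Rc X) n" for n g
    using that in_Rc[OF wsite.id_arr[OF wsite_Cube] that]
    by (intro Rc_eqI[of _ X n]) (simp_all add: act_Rc ipow_map_id)
  show "act (Rc X) k m g (act (Rc X) m n f h) = act (Rc X) k n (compose (pts Cube k) f g) h"
    if "g \<in> arr Cube k m" "f \<in> arr Cube m n" "h \<in> cells (Rc X) n" for k m n f g h
    using that in_Rc cube_arr_comp
    by (intro Rc_eqI[of _ X k]) (simp_all add: act_Rc ipow_map_in ipow_map_comp)
qed

lemma Rc_map_apply:
  "g \<in> cells (Rc X) n \<Longrightarrow> s \<in> cells (ipow n) k \<Longrightarrow> Rc_map X \<phi> n g k s = \<phi> k (g k s)"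
  by (simp add: Rc_map_def)

lemma Rc_map_psh:
  assumes "psh_map Delta X Y \<phi>"
  shows "psh_map Cube (Rc X) (Rc Y) (Rc_map X \<phi>)"
proof (rule psh_mapI)
  show in_Rc: "Rc_map X \<phi> n g \<in> cells (Rc Y) n" if "g \<in> cells (Rc X) n" for n g
    using that psh_map_comp[OF _ assms ipow_presheaf] by (simp add: Rc_map_def cells_Rc)
  show "Rc_map X \<phi> n \<in> extensional (cells (Rc X) n)" for n
    by (simp add: Rc_map_def)
  show "Rc_map X \<phi> m (act (Rc X) m n f g) = act (Rc Y) m n f (Rc_map X \<phi> n g)"
    if "f \<in> arr Cube m n" "g \<in> cells (Rc X) n" for m n f g
  proof (rule Rc_eqI[of _ Y m])
    note a = presheafD(1)[OF Rc_presheaf that]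
    show "Rc_map X \<phi> m (act (Rc X) m n f g) \<in> cells (Rc Y) m" by (rule in_Rc[OF a])
    show "act (Rc Y) m n f (Rc_map X \<phi> n g) \<in> cells (Rc Y) m"
      by (rule presheafD(1)[OF Rc_presheaf that(1) in_Rc[OF that(2)]])
    fix k s assume "s \<in> cells (ipow m) k"
    then show "Rc_map X \<phi> m (act (Rc X) m n f g) k s = act (Rc Y) m n f (Rc_map X \<phi> n g) k s"
      using that by (simp add: Rc_map_apply[OF a]) (simp add: act_Rc Rc_map_apply ipow_map_in)
  qed
qed

text \<open>The bilinear operation occurring inside \<open>Rc_mult\<close>: the product of two maps
  after splitting a power of the interval into its first \<open>p\<close> and last \<open>q\<close>
  factors.\<close>

definition Rc_pair ::
  "nat \<Rightarrow> nat \<Rightarrow> (nat \<Rightarrow> isimp \<Rightarrow> 'a) \<Rightarrow> (nat \<Rightarrow> isimp \<Rightarrow> 'b) \<Rightarrow> nat \<Rightarrow> isimp \<Rightarrow> 'a \<times> 'b" where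
  "Rc_pair p q f g k = (\<lambda>s \<in> cells (ipow (p + q)) k. (f k (take p s), g k (drop p s)))"

context
  fixes A :: "'a sset" and B :: "'b sset"
begin

lemma Rc_pair_in:
  assumes "f \<in> cells (Rc A) p" "g \<in> cells (Rc B) q"
  shows "Rc_pair p q f g \<in> cells (Rc (psh_prod A B)) (p + q)"
  unfolding cells_Rc
proof (rule psh_mapI)
  have f: "psh_map Delta (ipow p) A f" and g: "psh_map Delta (ipow q) B g"
    using assms by (simp_all add: cells_Rc)
  show "Rc_pair p q f g k s \<in> cells (psh_prod A B) k" if "s \<in> cells (ipow (p + q)) k" for k s
    using that ipow_take_drop[OF that] psh_mapD(1)[OF f] psh_mapD(1)[OF g]
    by (simp add: Rc_pair_def psh_prod_def)
  show "Rc_pair p q f g j (act (ipow (p + q)) j k h s) = act (psh_prod A B) j k h (Rc_pair p q f g k s)"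
    if "h \<in> arr Delta j k" "s \<in> cells (ipow (p + q)) k" for j k h s
  proof -
    have "take p (act (ipow (p + q)) j k h s) = act (ipow p) j k h (take p s)"
      "drop p (act (ipow (p + q)) j k h s) = act (ipow q) j k h (drop p s)"
      by (simp_all add: act_ipow take_map drop_map)
    then show ?thesis
      using that ipow_take_drop[OF that(2)] presheafD(1)[OF ipow_presheaf that]
      by (simp add: Rc_pair_def psh_prod_def psh_mapD(3)[OF f] psh_mapD(3)[OF g])
  qed
qed (simp add: Rc_pair_def)

lemma Rc_pair_act:
  assumes "cube_arr p' p f" "cube_arr q' q g" "u \<in> cells (Rc A) p" "v \<in> cells (Rc B) q"
  shows "act (Rc (psh_prod A B)) (p' + q') (p + q) (tens_arr p' q' f g) (Rc_pair p q u v) =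
    Rc_pair p' q' (act (Rc A) p' p f u) (act (Rc B) q' q g v)"
proof (rule Rc_eqI)
  show "act (Rc (psh_prod A B)) (p' + q') (p + q) (tens_arr p' q' f g) (Rc_pair p q u v)
      \<in> cells (Rc (psh_prod A B)) (p' + q')"
    using assms by (intro presheafD(1)[OF Rc_presheaf]) (simp_all add: cube_arr_tens Rc_pair_in)
  show "Rc_pair p' q' (act (Rc A) p' p f u) (act (Rc B) q' q g v) \<in> cells (Rc (psh_prod A B)) (p' + q')"
    using assms by (intro Rc_pair_in presheafD(1)[OF Rc_presheaf]) simp_all
  fix k s assume s: "s \<in> cells (ipow (p' + q')) k"
  have "ipow_map (p' + q') (p + q) (tens_arr p' q' f g) k s =
      ipow_map p' p f k (take p' s) @ ipow_map q' q g k (drop p' s)"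
    using ipow_map_tens[OF assms(1,2) ipow_take_drop[OF s]] by simp
  moreover have "ipow_map p' p f k (take p' s) \<in> cells (ipow p) k" "ipow_map q' q g k (drop p' s) \<in> cells (ipow q) k"
    using assms ipow_take_drop[OF s] by (simp_all add: ipow_map_in)
  ultimately show "act (Rc (psh_prod A B)) (p' + q') (p + q) (tens_arr p' q' f g) (Rc_pair p q u v) k s =
      Rc_pair p' q' (act (Rc A) p' p f u) (act (Rc B) q' q g v) k s"
    using s ipow_take_drop[OF s] by (simp add: act_Rc Rc_pair_def ipow_append ipow_length)
qed

lemma Rc_mult_eq: "Rc_mult A B r = (\<lambda>\<tau> \<in> cells (day (Rc A) (Rc B)) r. day_lift (Rc (psh_prod A B)) Rc_pair r \<tau>)"
  unfolding Rc_mult_def Rc_pair_def[abs_def] by (rule refl)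

lemma Rc_mult_psh: "psh_map Cube (day (Rc A) (Rc B)) (Rc (psh_prod A B)) (Rc_mult A B)"
  unfolding Rc_mult_eq[abs_def]
  by (rule day_lift_map) (rule Rc_presheaf Rc_pair_in Rc_pair_act; assumption)+

lemma Rc_mult_pure:
  "f \<in> cells (Rc A) p \<Longrightarrow> g \<in> cells (Rc B) q \<Longrightarrow>
   Rc_mult A B (p + q) (day_pure (Rc A) (Rc B) p q f g) = Rc_pair p q f g"
  by (simp add: Rc_mult_eq day_pure_in Rc_presheaf, rule day_lift_pure)
    ((rule Rc_presheaf Rc_pair_in Rc_pair_act)?; assumption)+

end

section \<open>Change of base along the right adjoint\<close>

lemma obj_Rc_cat: "obj (Rc_cat D) = obj D"
  and hom_Rc_cat: "hom (Rc_cat D) x y = Rc (hom D x y)"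
  by (simp_all add: Rc_cat_def)

lemma ident_Rc_cat:
  "ident (Rc_cat D) x k = (\<lambda>s \<in> cells (ipow 0) k. act (hom D x x) k 0 (\<lambda>p \<in> {0..k}. 0) (ident D x))"
  by (simp add: Rc_cat_def)

lemma fst_Rc_fun: "x \<in> obj D \<Longrightarrow> fst (Rc_fun D F) x = fst F x"
  by (simp add: Rc_fun_def obj_Rc_cat)

lemma snd_Rc_fun:
  "x \<in> obj D \<Longrightarrow> y \<in> obj D \<Longrightarrow> g \<in> cells (Rc (hom D x y)) n \<Longrightarrow>
   snd (Rc_fun D F) x y n g = Rc_map (hom D x y) (snd F x y) n g"
  by (simp add: Rc_fun_def obj_Rc_cat hom_Rc_cat)

context
  fixes D :: "('o, 'a) scat"
  assumes D: "scategory D"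
begin

interpretation D: pcat Delta prod_pure D
  by (rule tensor.vcategory_pcat[OF tensor_prod D])

lemma vcomp_Rc_cat_map:
  assumes o: "x \<in> obj D" "y \<in> obj D" "z \<in> obj D"
  shows "psh_map Cube (day (Rc (hom D x y)) (Rc (hom D y z))) (Rc (hom D x z)) (vcomp (Rc_cat D) x y z)"
proof -
  have "psh_map Delta (psh_prod (hom D x y) (hom D y z)) (hom D x z) (vcomp D x y z)"
    by (rule vcategory_vcomp[OF D o])
  then have "psh_map Cube (day (Rc (hom D x y)) (Rc (hom D y z))) (Rc (hom D x z))
      (psh_comp (day (Rc (hom D x y)) (Rc (hom D y z)))
        (Rc_map (psh_prod (hom D x y) (hom D y z)) (vcomp D x y z)) (Rc_mult (hom D x y) (hom D y z)))"
    by (intro psh_map_comp[OF Rc_mult_psh Rc_map_psh] presheaf_day Rc_presheaf)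
  then show ?thesis by (simp add: Rc_cat_def)
qed

lemma pcomp_Rc_cat_in:
  assumes "x \<in> obj D" "y \<in> obj D" "z \<in> obj D"
    and "f \<in> cells (Rc (hom D x y)) p" "g \<in> cells (Rc (hom D y z)) q"
  shows "pcomp day_pure (Rc_cat D) x y z p q (p + q) f g \<in> cells (Rc (hom D x z)) (p + q)"
  unfolding pcomp_def hom_Rc_cat
  by (intro psh_mapD(1)[OF vcomp_Rc_cat_map] day_pure_in Rc_presheaf assms)

text \<open>Composition is pointwise in \<open>D\<close> after splitting the simplex. Associativity
  for \<open>Rc_cat\<close> thus reduces to that of \<open>D\<close>, because cutting a list into
  three does not depend on the order of the cuts.\<close>

lemma pcomp_Rc_cat:
  assumes "x \<in> obj D" "y \<in> obj D" "z \<in> obj D"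
    and "f \<in> cells (Rc (hom D x y)) p" "g \<in> cells (Rc (hom D y z)) q" "s \<in> cells (ipow (p + q)) k"
  shows "pcomp day_pure (Rc_cat D) x y z p q (p + q) f g k s =
    pcomp prod_pure D x y z k k k (f k (take p s)) (g k (drop p s))"
proof -
  have *: "day_pure (Rc (hom D x y)) (Rc (hom D y z)) p q f g
      \<in> cells (day (Rc (hom D x y)) (Rc (hom D y z))) (p + q)"
    by (intro day_pure_in Rc_presheaf assms)
  show ?thesis
    unfolding pcomp_def prod_pure_def hom_Rc_cat
    using assms Rc_pair_in[OF assms(4,5)]
    by (simp add: Rc_cat_def * Rc_mult_pure Rc_map_apply) (simp add: Rc_pair_def)
qed

lemma ident_Rc_cat_in:
  assumes x: "x \<in> obj D"
  shows "ident (Rc_cat D) x \<in> cells (Rc (hom D x x)) 0"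
  unfolding cells_Rc
proof (rule psh_mapI)
  show "ident (Rc_cat D) x n s \<in> cells (hom D x x) n" if "s \<in> cells (ipow 0) n" for n s
    using that x by (simp add: ident_Rc_cat presheafD(1)[OF D.hom_presheaf] arr_Delta_const D.ident_in)
  show "ident (Rc_cat D) x m (act (ipow 0) m n f s) = act (hom D x x) m n f (ident (Rc_cat D) x n s)"
    if "f \<in> arr Delta m n" "s \<in> cells (ipow 0) n" for m n f s
  proof -
    have "compose {0..m} (\<lambda>p \<in> {0..n}. 0) f = (\<lambda>p \<in> {0..m}. 0::nat)"
      using arr_DeltaD(1)[OF that(1)] by (auto simp: fun_eq_iff compose_def restrict_apply)
    then show ?thesis
      using that x by (simp add: ident_Rc_cat presheafD(1)[OF ipow_presheaf]
          presheafD(3)[OF D.hom_presheaf] arr_Delta_const D.ident_in)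
  qed
qed (simp add: ident_Rc_cat)

lemma pcat_Rc_cat: "pcat Cube day_pure (Rc_cat D)"
proof unfold_locales
  note [simp] = obj_Rc_cat hom_Rc_cat
  show "presheaf Cube (hom (Rc_cat D) x y)" for x y by (simp add: Rc_presheaf)
  show "ident (Rc_cat D) x \<in> cells (hom (Rc_cat D) x x) 0" if "x \<in> obj (Rc_cat D)" for x
    using that by (simp add: ident_Rc_cat_in)
  show "pcomp day_pure (Rc_cat D) x y z p q r a b \<in> cells (hom (Rc_cat D) x z) r"
    if "x \<in> obj (Rc_cat D)" "y \<in> obj (Rc_cat D)" "z \<in> obj (Rc_cat D)" "join Cube p q r"
      "a \<in> cells (hom (Rc_cat D) x y) p" "b \<in> cells (hom (Rc_cat D) y z) q" for x y z p q r a b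
    using that by (simp add: pcomp_Rc_cat_in)
  show "act (hom (Rc_cat D) x z) r' r h (pcomp day_pure (Rc_cat D) x y z p q r a b) =
      pcomp day_pure (Rc_cat D) x y z p' q' r' (act (hom (Rc_cat D) x y) p' p f a)
        (act (hom (Rc_cat D) y z) q' q g b)"
    if "x \<in> obj (Rc_cat D)" "y \<in> obj (Rc_cat D)" "z \<in> obj (Rc_cat D)" "join Cube p q r"
      "join Cube p' q' r'" "f \<in> arr Cube p' p" "g \<in> arr Cube q' q" "h \<in> arr Cube r' r"
      "joinarr Cube p' p f q' q g h"
      "a \<in> cells (hom (Rc_cat D) x y) p" "b \<in> cells (hom (Rc_cat D) y z) q"
    for x y z p q r p' q' r' f g h a b
    using that by (simp add: pcomp_def psh_mapD(3)[OF vcomp_Rc_cat_map, symmetric] day_pure_in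
        Rc_presheaf day_pure_act)
  show "pcomp day_pure (Rc_cat D) w y z s r t (pcomp day_pure (Rc_cat D) w x y p q s a b) c =
      pcomp day_pure (Rc_cat D) w x z p s' t a (pcomp day_pure (Rc_cat D) x y z q r s' b c)"
    if prm: "w \<in> obj (Rc_cat D)" "x \<in> obj (Rc_cat D)" "y \<in> obj (Rc_cat D)" "z \<in> obj (Rc_cat D)"
      "join Cube p q s" "join Cube s r t" "join Cube q r s'" "join Cube p s' t"
      "a \<in> cells (hom (Rc_cat D) w x) p" "b \<in> cells (hom (Rc_cat D) x y) q"
      "c \<in> cells (hom (Rc_cat D) y z) r"
    for w x y z p q r s s' t a b c
  proof (rule Rc_eqI[of _ "hom D w z" t])
    have *: "w \<in> obj D" "x \<in> obj D" "y \<in> obj D" "z \<in> obj D" using prm(1-4) by simp_all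
    have abc: "a \<in> cells (Rc (hom D w x)) p" "b \<in> cells (Rc (hom D x y)) q" "c \<in> cells (Rc (hom D y z)) r"
      using prm(9-11) by simp_all
    note ab = pcomp_Rc_cat_in[OF *(1,2,3) abc(1,2)]
    note bc = pcomp_Rc_cat_in[OF *(2,3,4) abc(2,3)]
    have e: "s = p + q" "s' = q + r" "t = p + q + r" using prm(5-7) by simp_all
    show "pcomp day_pure (Rc_cat D) w y z s r t (pcomp day_pure (Rc_cat D) w x y p q s a b) c
        \<in> cells (Rc (hom D w z)) t"
      using pcomp_Rc_cat_in[OF *(1,3,4) ab abc(3)] by (simp add: e)
    show "pcomp day_pure (Rc_cat D) w x z p s' t a (pcomp day_pure (Rc_cat D) x y z q r s' b c)
        \<in> cells (Rc (hom D w z)) t"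
      using pcomp_Rc_cat_in[OF *(1,2,4) abc(1) bc] by (simp add: e add.assoc)
    fix k u assume "u \<in> cells (ipow t) k"
    then have u: "u \<in> cells (ipow (p + q + r)) k" "u \<in> cells (ipow (p + (q + r))) k"
      by (simp_all add: e add.assoc)
    have cells: "a k (take p u) \<in> cells (hom D w x) k" "b k (take q (drop p u)) \<in> cells (hom D x y) k"
      "c k (drop q (drop p u)) \<in> cells (hom D y z) k"
      using abc ipow_take_drop[OF u(2)] ipow_take_drop[OF ipow_take_drop(2)[OF u(2)]]
      by (auto simp: cells_Rc dest: psh_mapD(1))
    have cut: "drop p (take (p + q) u) = take q (drop p u)" "drop (p + q) u = drop q (drop p u)"
      by (simp_all add: take_drop add.commute)
    have "pcomp day_pure (Rc_cat D) w y z s r t (pcomp day_pure (Rc_cat D) w x y p q s a b) c k u =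
        pcomp prod_pure D w y z k k k
          (pcomp prod_pure D w x y k k k (a k (take p u)) (b k (take q (drop p u)))) (c k (drop q (drop p u)))"
      using ipow_take_drop(1)[OF u(1)] cut
      by (simp add: e pcomp_Rc_cat[OF *(1,3,4) ab abc(3) u(1)] pcomp_Rc_cat[OF *(1,2,3) abc(1,2)])
    also have "\<dots> = pcomp prod_pure D w x z k k k (a k (take p u))
          (pcomp prod_pure D x y z k k k (b k (take q (drop p u))) (c k (drop q (drop p u))))"
      using * cells by (intro D.pcomp_assoc) simp_all
    also have "\<dots> = pcomp day_pure (Rc_cat D) w x z p s' t a (pcomp day_pure (Rc_cat D) x y z q r s' b c) k u"
      using pcomp_Rc_cat[OF *(1,2,4) abc(1) bc u(2)]
        pcomp_Rc_cat[OF *(2,3,4) abc(2,3) ipow_take_drop(2)[OF u(2)]]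
      by (simp add: e add.assoc)
    finally show "pcomp day_pure (Rc_cat D) w y z s r t (pcomp day_pure (Rc_cat D) w x y p q s a b) c k u =
        pcomp day_pure (Rc_cat D) w x z p s' t a (pcomp day_pure (Rc_cat D) x y z q r s' b c) k u" .
  qed
  \<comment> \<open>The unit laws involve an arrow from \<open>e\<close> to 0 with
    \<open>join Cube e d d\<close>, which forces \<open>e\<close> to be 0; and the only endomorphism
    of the one-point cube is the identity.\<close>
  have id0: "act (hom (Rc_cat D) x x) 0 0 f (ident (Rc_cat D) x) = ident (Rc_cat D) x"
    if "x \<in> obj D" "f \<in> arr Cube 0 0" for x f
  proof -
    have "f = (\<lambda>v \<in> cube 0. v)"
      using that cube_arr_length[of 0 0 f]
      by (intro cube_arr_eqI[of 0 0 f 0]) (auto simp: cube_arr.cube_id)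
    then show ?thesis
      using presheafD(2)[OF Rc_presheaf ident_Rc_cat_in[OF that(1)]] by simp
  qed
  show "pcomp day_pure (Rc_cat D) x x y e d d (act (hom (Rc_cat D) x x) e 0 f (ident (Rc_cat D) x)) a = a"
    if prm: "x \<in> obj (Rc_cat D)" "y \<in> obj (Rc_cat D)" "f \<in> arr Cube e 0" "a \<in> cells (hom (Rc_cat D) x y) d"
      "join Cube e d d" for x y f e a d
  proof -
    have *: "x \<in> obj D" "y \<in> obj D" "e = 0" "a \<in> cells (Rc (hom D x y)) d" using prm by simp_all
    have "pcomp day_pure (Rc_cat D) x x y 0 d (0 + d) (ident (Rc_cat D) x) a = a"
    proof (rule Rc_eqI[of _ "hom D x y" d])
      show "pcomp day_pure (Rc_cat D) x x y 0 d (0 + d) (ident (Rc_cat D) x) a \<in> cells (Rc (hom D x y)) d"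
        using pcomp_Rc_cat_in[OF *(1,1,2) ident_Rc_cat_in[OF *(1)] *(4)] by simp
      fix k s assume s: "s \<in> cells (ipow d) k"
      have "a k s \<in> cells (hom D x y) k" using *(4) s by (auto simp: cells_Rc dest: psh_mapD(1))
      then show "pcomp day_pure (Rc_cat D) x x y 0 d (0 + d) (ident (Rc_cat D) x) a k s = a k s"
        using s pcomp_Rc_cat[OF *(1,1,2) ident_Rc_cat_in[OF *(1)] *(4), of s k] *
        by (simp add: nil_in_ipow ident_Rc_cat D.unit_left arr_Delta_const)
    qed (rule *(4))
    then show ?thesis using * prm(3) id0 by simp
  qed
  show "pcomp day_pure (Rc_cat D) x y y d e d a (act (hom (Rc_cat D) y y) e 0 f (ident (Rc_cat D) y)) = a"
    if prm: "x \<in> obj (Rc_cat D)" "y \<in> obj (Rc_cat D)" "f \<in> arr Cube e 0" "a \<in> cells (hom (Rc_cat D) x y) d"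
      "join Cube d e d" for x y f e a d
  proof -
    have *: "x \<in> obj D" "y \<in> obj D" "e = 0" "a \<in> cells (Rc (hom D x y)) d" using prm by simp_all
    have "pcomp day_pure (Rc_cat D) x y y d 0 (d + 0) a (ident (Rc_cat D) y) = a"
    proof (rule Rc_eqI[of _ "hom D x y" d])
      show "pcomp day_pure (Rc_cat D) x y y d 0 (d + 0) a (ident (Rc_cat D) y) \<in> cells (Rc (hom D x y)) d"
        using pcomp_Rc_cat_in[OF *(1,2,2,4) ident_Rc_cat_in[OF *(2)]] by simp
      fix k s assume s: "s \<in> cells (ipow d) k"
      have "a k s \<in> cells (hom D x y) k" using *(4) s by (auto simp: cells_Rc dest: psh_mapD(1))
      then show "pcomp day_pure (Rc_cat D) x y y d 0 (d + 0) a (ident (Rc_cat D) y) k s = a k s"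
        using s pcomp_Rc_cat[OF *(1,2,2,4) ident_Rc_cat_in[OF *(2)], of s k] *
        by (simp add: nil_in_ipow ident_Rc_cat D.unit_right arr_Delta_const ipow_length)
    qed (rule *(4))
    then show ?thesis using * prm(3) id0 by simp
  qed
qed

end

section \<open>The right adjoint on enriched functors\<close>

lemma Rc_fun_functor:
  assumes D: "scategory D" and E: "scategory E"
    and F: "sfun D E F"
  shows "cfun (Rc_cat D) (Rc_cat E) (Rc_fun D F)"
proof (rule vfunctorI)
  interpret D: pcat Delta prod_pure D by (rule tensor.vcategory_pcat[OF tensor_prod D])
  interpret E: pcat Delta prod_pure E by (rule tensor.vcategory_pcat[OF tensor_prod E])
  note [simp] = obj_Rc_cat hom_Rc_cat
    fst_Rc_fun snd_Rc_fun vfunctorD(1)[OF F]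
  have R: "psh_map Cube (Rc (hom D x y)) (Rc (hom E (fst F x) (fst F y))) (Rc_map (hom D x y) (snd F x y))"
    if "x \<in> obj D" "y \<in> obj D" for x y
    using that by (intro Rc_map_psh vfunctorD(2)[OF F])
  show "vf_ext (Rc_cat D) (Rc_fun D F)" by (simp add: Rc_fun_def)
  show "fst (Rc_fun D F) x \<in> obj (Rc_cat E)" if "x \<in> obj (Rc_cat D)" for x
    using that by simp
  show "snd (Rc_fun D F) x y n c \<in> cells (hom (Rc_cat E) (fst (Rc_fun D F) x) (fst (Rc_fun D F) y)) n"
    if "x \<in> obj (Rc_cat D)" "y \<in> obj (Rc_cat D)" "c \<in> cells (hom (Rc_cat D) x y) n" for x y c n
    using that psh_mapD(1)[OF R] by simp
  show "snd (Rc_fun D F) x y m (act (hom (Rc_cat D) x y) m n f c) =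
      act (hom (Rc_cat E) (fst (Rc_fun D F) x) (fst (Rc_fun D F) y)) m n f (snd (Rc_fun D F) x y n c)"
    if "x \<in> obj (Rc_cat D)" "y \<in> obj (Rc_cat D)" "f \<in> arr Cube m n" "c \<in> cells (hom (Rc_cat D) x y) n"
    for x y f m n c
  proof -
    have "act (Rc (hom D x y)) m n f c \<in> cells (Rc (hom D x y)) m"
      by (rule presheafD(1)[OF Rc_presheaf]) (use that in simp_all)
    then show ?thesis using that psh_mapD(3)[OF R] by simp
  qed
  show "snd (Rc_fun D F) x x 0 (ident (Rc_cat D) x) = ident (Rc_cat E) (fst (Rc_fun D F) x)"
    if "x \<in> obj (Rc_cat D)" for x
  proof -
    have x: "x \<in> obj D" using that by simp
    have "Rc_map (hom D x x) (snd F x x) 0 (ident (Rc_cat D) x) = ident (Rc_cat E) (fst F x)"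
      using x psh_mapD(1)[OF R[OF x x] ident_Rc_cat_in[OF D x]]
      by (intro Rc_eqI[of _ "hom E (fst F x) (fst F x)" 0])
        (simp_all add: ident_Rc_cat_in[OF E] Rc_map_apply[OF ident_Rc_cat_in[OF D x]] ident_Rc_cat vfunctorD(4,5)[OF F] arr_Delta_const D.ident_in)
    then show ?thesis using x by (simp add: ident_Rc_cat_in[OF D])
  qed
  show "snd (Rc_fun D F) x z r (pcomp day_pure (Rc_cat D) x y z p q r a b) =
      pcomp day_pure (Rc_cat E) (fst (Rc_fun D F) x) (fst (Rc_fun D F) y) (fst (Rc_fun D F) z)
        p q r (snd (Rc_fun D F) x y p a) (snd (Rc_fun D F) y z q b)"
    if prm: "x \<in> obj (Rc_cat D)" "y \<in> obj (Rc_cat D)" "z \<in> obj (Rc_cat D)" "join Cube p q r"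
      "a \<in> cells (hom (Rc_cat D) x y) p" "b \<in> cells (hom (Rc_cat D) y z) q" for x y z p q r a b
  proof -
    have o: "x \<in> obj D" "y \<in> obj D" "z \<in> obj D"
      and ab: "a \<in> cells (Rc (hom D x y)) p" "b \<in> cells (Rc (hom D y z)) q" and r: "r = p + q"
      using prm by simp_all
    note o' = o[THEN vfunctorD(1)[OF F]]
    note c = pcomp_Rc_cat_in[OF D o ab]
    note ab' = psh_mapD(1)[OF R[OF o(1,2)] ab(1)] psh_mapD(1)[OF R[OF o(2,3)] ab(2)]
    have "Rc_map (hom D x z) (snd F x z) (p + q) (pcomp day_pure (Rc_cat D) x y z p q (p + q) a b) =
        pcomp day_pure (Rc_cat E) (fst F x) (fst F y) (fst F z) p q (p + q)
          (Rc_map (hom D x y) (snd F x y) p a) (Rc_map (hom D y z) (snd F y z) q b)"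
    proof (rule Rc_eqI)
      show "Rc_map (hom D x z) (snd F x z) (p + q) (pcomp day_pure (Rc_cat D) x y z p q (p + q) a b)
          \<in> cells (Rc (hom E (fst F x) (fst F z))) (p + q)"
        by (rule psh_mapD(1)[OF R[OF o(1,3)] c])
      show "pcomp day_pure (Rc_cat E) (fst F x) (fst F y) (fst F z) p q (p + q)
          (Rc_map (hom D x y) (snd F x y) p a) (Rc_map (hom D y z) (snd F y z) q b)
          \<in> cells (Rc (hom E (fst F x) (fst F z))) (p + q)"
        by (rule pcomp_Rc_cat_in[OF E o' ab'])
      fix k s assume s: "s \<in> cells (ipow (p + q)) k"
      have "a k (take p s) \<in> cells (hom D x y) k" "b k (drop p s) \<in> cells (hom D y z) k"
        using ab ipow_take_drop[OF s] by (auto simp: cells_Rc dest: psh_mapD(1))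
      then show "Rc_map (hom D x z) (snd F x z) (p + q) (pcomp day_pure (Rc_cat D) x y z p q (p + q) a b) k s =
        pcomp day_pure (Rc_cat E) (fst F x) (fst F y) (fst F z) p q (p + q)
          (Rc_map (hom D x y) (snd F x y) p a) (Rc_map (hom D y z) (snd F y z) q b) k s"
        using s o ipow_take_drop[OF s]
        by (simp add: Rc_map_apply[OF c s] pcomp_Rc_cat[OF D o ab s] pcomp_Rc_cat[OF E o' ab' s]
            Rc_map_apply[OF ab(1)] Rc_map_apply[OF ab(2)] vfunctorD(6)[OF F])
    qed
    then show ?thesis using o ab c by (simp add: r)
  qed
qed

lemma Rc_fun_id:
  assumes D: "scategory D"
  shows "Rc_fun D (vf_id D) = vf_id (Rc_cat D)"
proof (rule vf_eqI[of "Rc_cat D"])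
  show "vf_ext (Rc_cat D) (Rc_fun D (vf_id D))" by (simp add: Rc_fun_def)
  show "fst (Rc_fun D (vf_id D)) x = fst (vf_id (Rc_cat D)) x" if "x \<in> obj (Rc_cat D)" for x
    using that by (simp add: fst_Rc_fun obj_Rc_cat)
  show "snd (Rc_fun D (vf_id D)) x y n c = snd (vf_id (Rc_cat D)) x y n c"
    if prm: "x \<in> obj (Rc_cat D)" "y \<in> obj (Rc_cat D)" "c \<in> cells (hom (Rc_cat D) x y) n" for x y n c
  proof -
    have o: "x \<in> obj D" "y \<in> obj D" and c: "c \<in> cells (Rc (hom D x y)) n"
      using prm by (simp_all add: obj_Rc_cat hom_Rc_cat)
    have g: "psh_map Delta (ipow n) (hom D x y) c" using c by (simp add: cells_Rc)
    have "Rc_map (hom D x y) (snd (vf_id D) x y) n c = c"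
      using c o by (intro psh_map_eqI[of _ "ipow n"])
        (simp_all add: Rc_map_apply psh_mapD(1,2)[OF g], simp add: Rc_map_def)
    then show ?thesis using prm o c by (simp add: snd_Rc_fun)
  qed
qed simp

lemma Rc_fun_comp:
  assumes D: "scategory D" and E: "scategory E"
    and F: "sfun D E F"
  shows "Rc_fun D (vf_comp D G F) = vf_comp (Rc_cat D) (Rc_fun E G) (Rc_fun D F)"
proof (rule vf_eqI[of "Rc_cat D"])
  show "vf_ext (Rc_cat D) (Rc_fun D (vf_comp D G F))" by (simp add: Rc_fun_def)
  show "fst (Rc_fun D (vf_comp D G F)) x = fst (vf_comp (Rc_cat D) (Rc_fun E G) (Rc_fun D F)) x"
    if "x \<in> obj (Rc_cat D)" for x
    using that by (simp add: fst_Rc_fun fst_Rc_fun obj_Rc_cat vfunctorD(1)[OF F])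
  show "snd (Rc_fun D (vf_comp D G F)) x y n c = snd (vf_comp (Rc_cat D) (Rc_fun E G) (Rc_fun D F)) x y n c"
    if prm: "x \<in> obj (Rc_cat D)" "y \<in> obj (Rc_cat D)" "c \<in> cells (hom (Rc_cat D) x y) n" for x y n c
  proof -
    have o: "x \<in> obj D" "y \<in> obj D" and c: "c \<in> cells (Rc (hom D x y)) n"
      using prm by (simp_all add: obj_Rc_cat hom_Rc_cat)
    have g: "psh_map Delta (ipow n) (hom D x y) c" using c by (simp add: cells_Rc)
    note c' = psh_mapD(1)[OF Rc_map_psh[OF vfunctorD(2)[OF F o]] c]
    have "Rc_map (hom D x y) (snd (vf_comp D G F) x y) n c =
        Rc_map (hom E (fst F x) (fst F y)) (snd G (fst F x) (fst F y)) n (Rc_map (hom D x y) (snd F x y) n c)"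
      using c o c' by (intro psh_map_eqI[of _ "ipow n"])
        (simp_all add: Rc_map_apply psh_mapD(1)[OF g], simp_all add: Rc_map_def)
    then show ?thesis
      using prm o c c' by (simp add: snd_Rc_fun snd_Rc_fun fst_Rc_fun vfunctorD(1)[OF F])
  qed
qed simp

section \<open>Transposition between the two changes of base\<close>

lemma fst_Lc_transpose: "x \<in> obj C \<Longrightarrow> fst (Lc_transpose C F) x = fst F x"
  by (simp add: Lc_transpose_def)

lemma snd_Lc_transpose:
  "x \<in> obj C \<Longrightarrow> y \<in> obj C \<Longrightarrow> c \<in> cells (hom C x y) m \<Longrightarrow> s \<in> cells (ipow m) k \<Longrightarrow>
   snd (Lc_transpose C F) x y m c k s = snd F x y k (Lc_class (hom C x y) k (m, c, s))"
  by (simp add: Lc_transpose_def)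

lemma snd_Lc_transpose_ext:
  "x \<in> obj C \<Longrightarrow> y \<in> obj C \<Longrightarrow> c \<in> cells (hom C x y) m \<Longrightarrow>
   snd (Lc_transpose C F) x y m c k \<in> extensional (cells (ipow m) k)"
  by (simp add: Lc_transpose_def)

lemma vf_ext_Lc_transpose: "vf_ext C (Lc_transpose C F)"
  by (simp add: Lc_transpose_def)

text \<open>Every simplex of a triangulation has a representative \<open>(m, a, s)\<close>, and the
  transpose evaluated at \<open>a\<close> and \<open>s\<close> records exactly the value
  there.\<close>

lemma Lc_functor_eqI:
  assumes C: "ccategory C"
    and "vf_ext (Lc_cat C) F" "vf_ext (Lc_cat C) F'" "Lc_transpose C F = Lc_transpose C F'"
  shows "F = F'"
proof (rule vf_eqI[OF assms(2,3)])
  show "fst F x = fst F' x" if "x \<in> obj (Lc_cat C)" for x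
    using arg_cong[OF assms(4), of "\<lambda>G. fst G x"] that by (simp add: fst_Lc_transpose obj_Lc_cat)
  show "snd F x y k S = snd F' x y k S"
    if "x \<in> obj (Lc_cat C)" "y \<in> obj (Lc_cat C)" "S \<in> cells (hom (Lc_cat C) x y) k" for x y k S
  proof (rule Lc_cat_cellE[OF C that])
    fix m a s assume "S = Lc_class (hom C x y) k (m, a, s)" "a \<in> cells (hom C x y) m" "s \<in> cells (ipow m) k"
    then show ?thesis
      using arg_cong[OF assms(4), of "\<lambda>G. snd G x y m a k s"] that
      by (simp add: snd_Lc_transpose obj_Lc_cat)
  qed
qed

context
  fixes C :: "('o, 'a) ccat" and D :: "('q, 'b) scat"
  assumes C: "ccategory C" and D: "scategory D"
begin

interpretation C: pcat Cube day_pure C by (rule tensor.vcategory_pcat[OF tensor_day C])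
interpretation LC: pcat Delta prod_pure "Lc_cat C" by (rule pcat_Lc_cat[OF C])
interpretation D: pcat Delta prod_pure D by (rule tensor.vcategory_pcat[OF tensor_prod D])

lemma snd_Lc_transpose_in:
  assumes F: "sfun (Lc_cat C) D F"
    and o: "x \<in> obj C" "y \<in> obj C" and c: "c \<in> cells (hom C x y) m"
  shows "snd (Lc_transpose C F) x y m c \<in> cells (Rc (hom D (fst F x) (fst F y))) m"
  unfolding cells_Rc
proof (rule psh_mapI)
  have o': "x \<in> obj (Lc_cat C)" "y \<in> obj (Lc_cat C)" using o by (simp_all add: obj_Lc_cat)
  show "snd (Lc_transpose C F) x y m c k s \<in> cells (hom D (fst F x) (fst F y)) k"
    if "s \<in> cells (ipow m) k" for k s
    using vfunctorD(3)[OF F o' Lc_class_in_cat[OF C o c that]] o c that by (simp add: snd_Lc_transpose)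
  show "snd (Lc_transpose C F) x y m c j (act (ipow m) j k f s) =
      act (hom D (fst F x) (fst F y)) j k f (snd (Lc_transpose C F) x y m c k s)"
    if "f \<in> arr Delta j k" "s \<in> cells (ipow m) k" for j k f s
    using vfunctorD(4)[OF F o' that(1) Lc_class_in_cat[OF C o c that(2)]] o c that
    by (simp add: snd_Lc_transpose presheafD(1)[OF ipow_presheaf] hom_Lc_cat Lc_act[OF C.hom_presheaf])
qed (rule snd_Lc_transpose_ext[OF o c])

lemma Lc_transpose_functor:
  assumes F: "sfun (Lc_cat C) D F"
  shows "cfun C (Rc_cat D) (Lc_transpose C F)"
proof (rule vfunctorI)
  note [simp] = obj_Lc_cat obj_Rc_cat hom_Rc_cat fst_Lc_transpose
  note F1 = vfunctorD(1)[OF F, simplified]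
  show "vf_ext C (Lc_transpose C F)" by (rule vf_ext_Lc_transpose)
  show "fst (Lc_transpose C F) x \<in> obj (Rc_cat D)" if "x \<in> obj C" for x
    using that F1 by simp
  show "snd (Lc_transpose C F) x y n c
      \<in> cells (hom (Rc_cat D) (fst (Lc_transpose C F) x) (fst (Lc_transpose C F) y)) n"
    if "x \<in> obj C" "y \<in> obj C" "c \<in> cells (hom C x y) n" for x y c n
    using that snd_Lc_transpose_in[OF F] by simp
  show "snd (Lc_transpose C F) x y m (act (hom C x y) m n f c) =
      act (hom (Rc_cat D) (fst (Lc_transpose C F) x) (fst (Lc_transpose C F) y)) m n f
        (snd (Lc_transpose C F) x y n c)"
    if o: "x \<in> obj C" "y \<in> obj C" and f: "f \<in> arr Cube m n" and c: "c \<in> cells (hom C x y) n" for x y f m n c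
  proof -
    note c' = presheafD(1)[OF C.hom_presheaf[OF o] f c]
    have "snd (Lc_transpose C F) x y m (act (hom C x y) m n f c) =
        act (Rc (hom D (fst F x) (fst F y))) m n f (snd (Lc_transpose C F) x y n c)"
    proof (rule Rc_eqI[OF snd_Lc_transpose_in[OF F o c'] presheafD(1)[OF Rc_presheaf f snd_Lc_transpose_in[OF F o c]]])
      fix k s assume "s \<in> cells (ipow m) k"
      then show "snd (Lc_transpose C F) x y m (act (hom C x y) m n f c) k s =
          act (Rc (hom D (fst F x) (fst F y))) m n f (snd (Lc_transpose C F) x y n c) k s"
        using o f c c'
        by (simp add: act_Rc snd_Lc_transpose ipow_map_in Lc_class_step[OF C.hom_presheaf])
    qed
    then show ?thesis using o by simp
  qed
  show "snd (Lc_transpose C F) x x 0 (ident C x) = ident (Rc_cat D) (fst (Lc_transpose C F) x)"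
    if o: "x \<in> obj C" for x
  proof -
    have "snd (Lc_transpose C F) x x 0 (ident C x) = ident (Rc_cat D) (fst F x)"
    proof (rule Rc_eqI[OF snd_Lc_transpose_in[OF F o o C.ident_in[OF o]] ident_Rc_cat_in[OF D F1[OF o]]])
      fix k s assume s: "s \<in> cells (ipow 0) k"
      then have "s = []" by (simp add: cells_ipow)
      then show "snd (Lc_transpose C F) x x 0 (ident C x) k s = ident (Rc_cat D) (fst F x) k s"
        using s vfunctorD(4)[OF F _ _ arr_Delta_const[of 0 0 k] LC.ident_in, of x] o
          act_ident_Lc_cat[OF C o arr_Delta_const[of 0 0 k]] vfunctorD(5)[OF F, of x]
        by (simp add: snd_Lc_transpose C.ident_in ident_Rc_cat hom_Lc_cat)
    qed
    then show ?thesis using o by simp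
  qed
  show "snd (Lc_transpose C F) x z r (pcomp day_pure C x y z p q r a b) =
      pcomp day_pure (Rc_cat D) (fst (Lc_transpose C F) x) (fst (Lc_transpose C F) y)
        (fst (Lc_transpose C F) z) p q r (snd (Lc_transpose C F) x y p a) (snd (Lc_transpose C F) y z q b)"
    if o: "x \<in> obj C" "y \<in> obj C" "z \<in> obj C" and r: "join Cube p q r"
      and a: "a \<in> cells (hom C x y) p" and b: "b \<in> cells (hom C y z) q" for x y z p q r a b
  proof -
    note ab = C.pcomp_in[OF o r a b]
    note a' = snd_Lc_transpose_in[OF F o(1,2) a] and b' = snd_Lc_transpose_in[OF F o(2,3) b]
    have r': "r = p + q" using r by simp
    have "snd (Lc_transpose C F) x z r (pcomp day_pure C x y z p q r a b) =
        pcomp day_pure (Rc_cat D) (fst F x) (fst F y) (fst F z) p q r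
          (snd (Lc_transpose C F) x y p a) (snd (Lc_transpose C F) y z q b)"
    proof (rule Rc_eqI[OF snd_Lc_transpose_in[OF F o(1,3) ab]])
      show "pcomp day_pure (Rc_cat D) (fst F x) (fst F y) (fst F z) p q r
          (snd (Lc_transpose C F) x y p a) (snd (Lc_transpose C F) y z q b)
          \<in> cells (Rc (hom D (fst F x) (fst F z))) r"
        using pcomp_Rc_cat_in[OF D o[THEN F1] a' b'] r' by simp
      fix k s assume s: "s \<in> cells (ipow r) k"
      then have td: "take p s \<in> cells (ipow p) k" "drop p s \<in> cells (ipow q) k"
        using ipow_take_drop r' by auto
      show "snd (Lc_transpose C F) x z r (pcomp day_pure C x y z p q r a b) k s =
          pcomp day_pure (Rc_cat D) (fst F x) (fst F y) (fst F z) p q r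
            (snd (Lc_transpose C F) x y p a) (snd (Lc_transpose C F) y z q b) k s"
        using s td o r' a b ab
          vfunctorD(6)[OF F, of x y z k k k, OF _ _ _ _ Lc_class_in_cat[OF C o(1,2) a td(1)]
            Lc_class_in_cat[OF C o(2,3) b td(2)]]
        by (simp add: pcomp_Rc_cat[OF D o[THEN F1] a' b'] snd_Lc_transpose pcomp_Lc_cat[OF C])
    qed
    then show ?thesis using o by simp
  qed
qed

text \<open>The preimage sends the class of \<open>(m, c, s)\<close> to \<open>G\<close> of
  \<open>c\<close> evaluated at \<open>s\<close>. This respects the coend relation because the
  action on \<open>Rc\<close> is precomposition with \<open>ipow_map\<close>, so compatibility of
  \<open>G\<close> with cubical actions is exactly what is required.\<close>

lemma Lc_transpose_surj:
  assumes G: "cfun C (Rc_cat D) G"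
  obtains F where "sfun (Lc_cat C) D F" "Lc_transpose C F = G"
proof -
  define F where "F = mk_vf (Lc_cat C) (fst G)
      (\<lambda>x y k S. the_elem ((\<lambda>(m, c, s). snd G x y m c k s) ` S))"
  note [simp] = obj_Lc_cat
  note G1 = vfunctorD(1)[OF G, unfolded obj_Rc_cat]
  have G_in: "snd G x y m c \<in> cells (Rc (hom D (fst G x) (fst G y))) m"
    if "x \<in> obj C" "y \<in> obj C" "c \<in> cells (hom C x y) m" for x y m c
    using vfunctorD(3)[OF G that] by (simp add: hom_Rc_cat)
  have G_psh: "psh_map Delta (ipow m) (hom D (fst G x) (fst G y)) (snd G x y m c)"
    if "x \<in> obj C" "y \<in> obj C" "c \<in> cells (hom C x y) m" for x y m c
    using G_in[OF that] by (simp add: cells_Rc)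
  have F0: "fst F x = fst G x" if "x \<in> obj C" for x
    using that by (simp add: F_def)
  have F1: "snd F x y k (Lc_class (hom C x y) k (m, c, s)) = snd G x y m c k s"
    if o: "x \<in> obj C" "y \<in> obj C" and c: "c \<in> cells (hom C x y) m" and s: "s \<in> cells (ipow m) k" for x y k m c s
  proof -
    have "the_elem ((\<lambda>(m, c, s). snd G x y m c k s) ` Lc_class (hom C x y) k (m, c, s)) =
        (\<lambda>(m, c, s). snd G x y m c k s) (m, c, s)"
    proof (rule Lc_the_elem[OF C.hom_presheaf[OF o] _ c s])
      fix m n f y' t assume *: "cube_arr m n f" "y' \<in> cells (hom C x y) n" "t \<in> cells (ipow m) k"
      then show "(\<lambda>(m, c, s). snd G x y m c k s) (m, act (hom C x y) m n f y', t) =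
          (\<lambda>(m, c, s). snd G x y m c k s) (n, y', ipow_map m n f k t)"
        using vfunctorD(4)[OF G o, of f m n y'] by (simp add: hom_Rc_cat act_Rc)
    qed
    then show ?thesis
      using o Lc_class_in_cat[OF C o c s] by (simp add: F_def)
  qed
  have "sfun (Lc_cat C) D F"
  proof (rule vfunctorI)
    show "vf_ext (Lc_cat C) F" by (simp add: F_def)
    show "fst F x \<in> obj D" if "x \<in> obj (Lc_cat C)" for x using that G1 by (simp add: F0)
    show "snd F x y k S \<in> cells (hom D (fst F x) (fst F y)) k"
      if "x \<in> obj (Lc_cat C)" "y \<in> obj (Lc_cat C)" "S \<in> cells (hom (Lc_cat C) x y) k" for x y S k
      by (rule Lc_cat_cellE[OF C that]) (use that psh_mapD(1)[OF G_psh] in \<open>simp add: F0 F1\<close>)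
    show "snd F x y j (act (hom (Lc_cat C) x y) j k f S) = act (hom D (fst F x) (fst F y)) j k f (snd F x y k S)"
      if "x \<in> obj (Lc_cat C)" "y \<in> obj (Lc_cat C)" "f \<in> arr Delta j k" "S \<in> cells (hom (Lc_cat C) x y) k"
      for x y f j k S
      by (rule Lc_cat_cellE[OF C that(1,2,4)])
        (use that psh_mapD(3)[OF G_psh] in \<open>simp add: F0 F1 hom_Lc_cat Lc_act[OF C.hom_presheaf]
            presheafD(1)[OF ipow_presheaf]\<close>)
    show "snd F x x 0 (ident (Lc_cat C) x) = ident D (fst F x)" if "x \<in> obj (Lc_cat C)" for x
    proof -
      have x: "x \<in> obj C" using that by simp
      \<comment> \<open>In dimension 0 the constant map in \<open>ident_Rc_cat\<close> is the
        identity arrow, so evaluating an identity of \<open>Rc_cat D\<close> at the empty list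
        returns the identity of \<open>D\<close>.\<close>
      have "(\<lambda>p \<in> {0..0}. 0) = (\<lambda>v \<in> pts Delta 0. v)" by (auto simp: fun_eq_iff restrict_apply)
      then have "ident (Rc_cat D) (fst G x) 0 [] = ident D (fst G x)"
        using presheafD(2)[OF D.hom_presheaf D.ident_in, of "fst G x"] G1[OF x] nil_in_ipow[of 0]
        by (simp add: ident_Rc_cat)
      then show ?thesis
        using x vfunctorD(5)[OF G x] nil_in_ipow[of 0]
        by (simp add: ident_Lc_cat F0 F1 C.ident_in)
    qed
    show "snd F x z r (pcomp prod_pure (Lc_cat C) x y z p q r S T) =
        pcomp prod_pure D (fst F x) (fst F y) (fst F z) p q r (snd F x y p S) (snd F y z q T)"
      if "x \<in> obj (Lc_cat C)" "y \<in> obj (Lc_cat C)" "z \<in> obj (Lc_cat C)" "join Delta p q r"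
        "S \<in> cells (hom (Lc_cat C) x y) p" "T \<in> cells (hom (Lc_cat C) y z) q" for x y z p q r S T
      using that(5,6)
    proof (elim Lc_cat_cellE[OF C that(1,2)] Lc_cat_cellE[OF C that(2,3)])
      have o: "x \<in> obj C" "y \<in> obj C" "z \<in> obj C" and pq: "p = r" "q = r" using that(1-4) by simp_all
      fix m a s n b t
      assume S: "S = Lc_class (hom C x y) p (m, a, s)" "a \<in> cells (hom C x y) m" "s \<in> cells (ipow m) p"
        and T: "T = Lc_class (hom C y z) q (n, b, t)" "b \<in> cells (hom C y z) n" "t \<in> cells (ipow n) q"
      have st: "s \<in> cells (ipow m) r" "t \<in> cells (ipow n) r" "s @ t \<in> cells (ipow (m + n)) r"
        using S T pq ipow_append by auto
      have len: "length s = m" using S(3) by (rule ipow_length)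
      have "snd G x z (m + n) (pcomp day_pure C x y z m n (m + n) a b) r (s @ t) =
          pcomp prod_pure D (fst G x) (fst G y) (fst G z) r r r (snd G x y m a r s) (snd G y z n b r t)"
        using vfunctorD(6)[OF G o _ S(2) T(2), of "m + n"]
          pcomp_Rc_cat[OF D o[THEN G1] G_in[OF o(1,2) S(2)] G_in[OF o(2,3) T(2)] st(3)] len
        by simp
      then show ?thesis
        using S T st o pq by (simp add: pcomp_Lc_cat[OF C] F0 F1 C.pcomp_in)
    qed
  qed
  moreover have "Lc_transpose C F = G"
  proof (rule vf_eqI[OF vf_ext_Lc_transpose vfunctorD(7)[OF G]])
    show "fst (Lc_transpose C F) x = fst G x" if "x \<in> obj C" for x
      using that by (simp add: fst_Lc_transpose F0)
    show "snd (Lc_transpose C F) x y m c = snd G x y m c"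
      if "x \<in> obj C" "y \<in> obj C" "c \<in> cells (hom C x y) m" for x y m c
      by (rule psh_map_eqI[OF snd_Lc_transpose_ext[OF that] psh_mapD(2)[OF G_psh[OF that]]])
        (use that in \<open>simp add: snd_Lc_transpose F1\<close>)
  qed
  ultimately show thesis using that by blast
qed

lemma Lc_transpose_bij:
  "bij_betw (Lc_transpose C) {F. sfun (Lc_cat C) D F}
     {G. cfun C (Rc_cat D) G}"
  unfolding bij_betw_def
proof (intro conjI subset_antisym subsetI)
  show "inj_on (Lc_transpose C) {F. sfun (Lc_cat C) D F}"
    by (rule inj_onI, rule Lc_functor_eqI[OF C]) (simp_all only: mem_Collect_eq vfunctorD(7))
  show "G \<in> Lc_transpose C ` {F. sfun (Lc_cat C) D F}"
    if "G \<in> {G. cfun C (Rc_cat D) G}" for G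
    using that Lc_transpose_surj[of G] by blast
qed (use Lc_transpose_functor in auto)

end

lemma Lc_transpose_pre:
  assumes C: "ccategory C" and C': "ccategory C'"
    and H: "cfun C C' H"
  shows "Lc_transpose C (vf_comp (Lc_cat C) F (Lc_fun C C' H)) = vf_comp C (Lc_transpose C' F) H"
proof (rule vf_eqI[OF vf_ext_Lc_transpose])
  interpret C: pcat Cube day_pure C by (rule tensor.vcategory_pcat[OF tensor_day C])
  note [simp] = fst_Lc_transpose snd_Lc_transpose obj_Lc_cat fst_Lc_fun
    vfunctorD(1,3)[OF H] hom_Lc_cat Lc_class_in[OF C.hom_presheaf] snd_Lc_fun[OF C C' H]
  show "fst (Lc_transpose C (vf_comp (Lc_cat C) F (Lc_fun C C' H))) x = fst (vf_comp C (Lc_transpose C' F) H) x"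
    if "x \<in> obj C" for x using that by simp
  show "snd (Lc_transpose C (vf_comp (Lc_cat C) F (Lc_fun C C' H))) x y m c =
      snd (vf_comp C (Lc_transpose C' F) H) x y m c"
    if "x \<in> obj C" "y \<in> obj C" "c \<in> cells (hom C x y) m" for x y m c
    by (rule psh_map_eqI[OF snd_Lc_transpose_ext[OF that]])
      (use that in \<open>simp_all add: snd_Lc_transpose_ext\<close>)
qed simp

lemma Lc_transpose_post:
  assumes C: "ccategory C" and D: "scategory D"
    and F: "sfun (Lc_cat C) D F"
  shows "Lc_transpose C (vf_comp (Lc_cat C) J F) = vf_comp C (Rc_fun D J) (Lc_transpose C F)"
proof (rule vf_eqI[OF vf_ext_Lc_transpose])
  interpret C: pcat Cube day_pure C by (rule tensor.vcategory_pcat[OF tensor_day C])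
  note F1 = vfunctorD(1)[OF F, unfolded obj_Lc_cat]
  note [simp] = fst_Lc_transpose snd_Lc_transpose obj_Lc_cat fst_Rc_fun
    hom_Lc_cat Lc_class_in[OF C.hom_presheaf] snd_Rc_fun F1
    snd_Lc_transpose_in[OF C D F] Rc_map_apply
  show "fst (Lc_transpose C (vf_comp (Lc_cat C) J F)) x = fst (vf_comp C (Rc_fun D J) (Lc_transpose C F)) x"
    if "x \<in> obj C" for x using that by simp
  show "snd (Lc_transpose C (vf_comp (Lc_cat C) J F)) x y m c =
      snd (vf_comp C (Rc_fun D J) (Lc_transpose C F)) x y m c"
    if "x \<in> obj C" "y \<in> obj C" "c \<in> cells (hom C x y) m" for x y m c
    by (rule psh_map_eqI[OF snd_Lc_transpose_ext[OF that]])
      (use that in simp_all, simp add: Rc_map_def)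
qed simp

section \<open>Vertices of cubes as subsets of an interval\<close>

text \<open>The subset used in \<open>cube_comparison\<close>: coordinate \<open>l\<close> decides
  about the interior point i + 1 + l, while the endpoints always belong. For i = j truncated
  subtraction makes the cube a point, which corresponds to the singleton. The inverse is
  \<open>unsub\<close>.\<close>

definition sub :: "nat \<Rightarrow> nat \<Rightarrow> bool list \<Rightarrow> nat set" where
  "sub i j v = {i, j} \<union> {i + 1 + l | l. l < j - i - 1 \<and> v ! l}"

definition unsub :: "nat \<Rightarrow> nat \<Rightarrow> nat set \<Rightarrow> bool list" where
  "unsub i j I = map (\<lambda>l. i + 1 + l \<in> I) [0..<j - i - 1]"

lemma sub_iff: "x \<in> sub i j v \<longleftrightarrow> x = i \<or> x = j \<or> (i < x \<and> x < j \<and> v ! (x - Suc i))"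
proof -
  have "(\<exists>l. x = i + 1 + l \<and> l < j - Suc i \<and> v ! l) \<longleftrightarrow> i < x \<and> x < j \<and> v ! (x - Suc i)"
  proof
    assume "i < x \<and> x < j \<and> v ! (x - Suc i)"
    then show "\<exists>l. x = i + 1 + l \<and> l < j - Suc i \<and> v ! l"
      by (intro exI[of _ "x - Suc i"]) auto
  qed auto
  then show ?thesis by (auto simp: sub_def)
qed

lemma sub_inj:
  assumes "sub i j v = sub i j w" "length v = j - Suc i" "length w = j - Suc i"
  shows "v = w"
proof (rule nth_equalityI)
  fix l assume "l < length v"
  then have "i + 1 + l \<noteq> i" "i + 1 + l \<noteq> j" "i + 1 + l < j" "i + 1 + l - Suc i = l"
    using assms(2) by auto
  then show "v ! l = w ! l"
    using arg_cong[OF assms(1), of "\<lambda>S. i + 1 + l \<in> S"] by (simp add: sub_iff)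
qed (simp add: assms)

lemma length_unsub [simp]: "length (unsub i j I) = j - Suc i"
  by (simp add: unsub_def)

lemma nth_unsub: "l < j - Suc i \<Longrightarrow> unsub i j I ! l \<longleftrightarrow> i + 1 + l \<in> I"
  by (simp add: unsub_def)

lemma sub_unsub:
  assumes "I \<in> path_poset i j"
  shows "sub i j (unsub i j I) = I"
proof (rule set_eqI)
  fix x
  have "x \<in> I \<Longrightarrow> i \<le> x \<and> x \<le> j" "i \<in> I" "j \<in> I"
    using assms by (auto simp: path_poset_def)
  moreover have "unsub i j I ! (x - Suc i) \<longleftrightarrow> x \<in> I" if "i < x" "x < j"
  proof -
    have "x - Suc i < j - Suc i" "i + 1 + (x - Suc i) = x" using that by linarith+
    then show ?thesis using nth_unsub[of "x - Suc i" j i I] by simp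
  qed
  ultimately show "x \<in> sub i j (unsub i j I) \<longleftrightarrow> x \<in> I"
    unfolding sub_iff by (metis nat_less_le)
qed

lemma sub_path: "i \<le> j \<Longrightarrow> sub i j v \<in> path_poset i j"
  by (auto simp: path_poset_def sub_iff)

lemma sub_refl [simp]: "sub i i v = {i}"
  by (auto simp: sub_iff)

lemma sub_mono: "list_all2 (\<longrightarrow>) v w \<Longrightarrow> length v = j - Suc i \<Longrightarrow> sub i j v \<subseteq> sub i j w"
  by (auto simp: sub_iff list_all2_conv_all_nth)

lemma unsub_mono: "I \<subseteq> J \<Longrightarrow> list_all2 (\<longrightarrow>) (unsub i j I) (unsub i j J)"
  by (auto simp: unsub_def list_all2_conv_all_nth)

lemma nth_ins: "i \<le> length v \<Longrightarrow> ins i e v ! q = (if q < i then v ! q else if q = i then e else v ! (q - 1))"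
  by (auto simp: ins_def nth_append nth_Cons')

lemma nth_del: "i < length v \<Longrightarrow> del i v ! q = (if q < i then v ! q else v ! Suc q)"
  by (auto simp: del_def nth_append min_def)

lemma nth_conn:
  "Suc i < length v \<Longrightarrow> conn mx i v ! q =
   (if q < i then v ! q else if q = i then mx (v ! i) (v ! Suc i) else v ! Suc q)"
  by (auto simp: conn_def nth_append nth_Cons')

text \<open>The coordinate numbered j - i - 1 of the larger cube belongs to the point
  \<open>j\<close>; inserting True there accounts for \<open>j\<close> lying in the union, and the
  remaining coordinates fall to the left or the right of it.\<close>

lemma sub_ins:
  assumes "i < j" "j < k" "length u = j - Suc i" "length w = k - Suc j"
  shows "sub i k (ins (j - Suc i) True (u @ w)) = sub i j u \<union> sub j k w"
proof (rule set_eqI)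
  fix x
  have *: "j - Suc i \<le> length (u @ w)" using assms by simp
  consider "x \<le> i" | "i < x" "x < j" | "x = j" | "j < x" "x < k" | "k \<le> x" by linarith
  then show "x \<in> sub i k (ins (j - Suc i) True (u @ w)) \<longleftrightarrow> x \<in> sub i j u \<union> sub j k w"
  proof cases
    case 4
    \<comment> \<open>To the right of \<open>j\<close> the index drops by one for the inserted
      coordinate and then by the length of \<open>u\<close>, which leaves the coordinate of
      \<open>x\<close> in \<open>w\<close>.\<close>
    then have "x - Suc i - 1 - (j - Suc i) = x - Suc j" "\<not> x - Suc i < j - Suc i" "x - Suc i \<noteq> j - Suc i"
      "\<not> x - Suc i - 1 < j - Suc i"
      using assms(1) by linarith+
    then show ?thesis using 4 assms by (simp add: sub_iff nth_ins[OF *] nth_append)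
  qed (use assms in \<open>auto simp: sub_iff nth_ins[OF *] nth_append\<close>)
qed

text \<open>When \<open>j\<close> is one of the outer endpoints, one of the two lists is empty and
  \<open>j\<close> belongs to the subset anyway, so no coordinate has to be inserted.\<close>

lemma sub_append:
  assumes "i \<le> j" "j \<le> k" "length u = j - Suc i" "length w = k - Suc j" "i = j \<or> j = k"
  shows "sub i k (u @ w) = sub i j u \<union> sub j k w"
  using assms by (auto simp: sub_iff)

text \<open>\<open>degD i\<close> is a left inverse of \<open>faceD i\<close>, and the image of
  \<open>faceD i\<close> misses exactly \<open>i\<close>. Membership in a direct image thus becomes
  a test without existential quantifier, suited to comparison with \<open>sub_iff\<close>.\<close>

lemma faceD_image: "x \<in> faceD i ` S \<longleftrightarrow> x \<noteq> i \<and> degD i x \<in> S"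
proof
  assume "x \<noteq> i \<and> degD i x \<in> S"
  moreover then have "x = faceD i (degD i x)" by (auto simp: faceD_def degD_def)
  ultimately show "x \<in> faceD i ` S" by blast
next
  assume "x \<in> faceD i ` S"
  then obtain y where "x = faceD i y" "y \<in> S" by blast
  moreover have "faceD i y \<noteq> i" "degD i (faceD i y) = y" by (auto simp: faceD_def degD_def)
  ultimately show "x \<noteq> i \<and> degD i x \<in> S" by simp
qed

lemma degD_image: "x \<in> degD i ` S \<longleftrightarrow> (x \<le> i \<and> x \<in> S) \<or> (i \<le> x \<and> Suc x \<in> S)"
proof
  assume "(x \<le> i \<and> x \<in> S) \<or> (i \<le> x \<and> Suc x \<in> S)"
  then show "x \<in> degD i ` S"
  proof
    assume "x \<le> i \<and> x \<in> S"
    then show ?thesis by (intro image_eqI[of _ _ x]) (auto simp: degD_def)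
  next
    assume "i \<le> x \<and> Suc x \<in> S"
    then show ?thesis by (intro image_eqI[of _ _ "Suc x"]) (auto simp: degD_def)
  qed
qed (auto simp: degD_def)

text \<open>A coface omits \<open>i\<close>. If \<open>i\<close> becomes an interior point, its new
  coordinate must therefore be False; it is the one numbered i - j - 1.\<close>

lemma sub_face_ins:
  assumes "j < i" "i \<le> k" "length u = k - Suc j"
  shows "sub j (Suc k) (ins (i - Suc j) False u) = faceD i ` sub j k u"
proof (rule set_eqI)
  fix x
  have *: "i - Suc j \<le> length u" using assms by simp
  consider "x < i" | "x = i" | "i < x" by linarith
  then show "x \<in> sub j (Suc k) (ins (i - Suc j) False u) \<longleftrightarrow> x \<in> faceD i ` sub j k u"
  proof cases
    case 1
    then have "j < x \<Longrightarrow> x - Suc j < i - Suc j" by linarith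
    with 1 show ?thesis using assms unfolding faceD_image
      by (auto simp: sub_iff nth_ins[OF *] degD_def)
  next
    case 2
    then show ?thesis using assms unfolding faceD_image
      by (auto simp: sub_iff nth_ins[OF *] degD_def)
  next
    case 3
    then have "\<not> x - Suc j < i - Suc j" "x - Suc j \<noteq> i - Suc j" "x - Suc j - 1 = x - 1 - j - 1"
      using assms by linarith+
    with 3 show ?thesis using assms unfolding faceD_image
      by (auto simp: sub_iff nth_ins[OF *] degD_def)
  qed
qed

lemma sub_face:
  assumes "\<not> (j < i \<and> i \<le> k)" "j \<le> k"
  shows "sub (faceD i j) (faceD i k) u = faceD i ` sub j k u"
proof (rule set_eqI)
  fix x
  have "x - 1 - Suc j = x - Suc j - 1" by simp
  then show "x \<in> sub (faceD i j) (faceD i k) u \<longleftrightarrow> x \<in> faceD i ` sub j k u"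
    using assms unfolding faceD_image by (auto simp: sub_iff faceD_def degD_def)
qed

text \<open>Both \<open>i\<close> and its successor are interior points here. Their common image
  belongs to the direct image iff one of them belongs to the subset, which is why a maximum
  appears.\<close>

lemma sub_deg_conn:
  assumes "j < i" "i + 1 < k" "length u = k - Suc j"
  shows "sub j (k - 1) (conn max (i - Suc j) u) = degD i ` sub j k u"
proof (rule set_eqI)
  fix x
  have *: "Suc (i - Suc j) < length u" using assms by simp
  have m: "max a b \<longleftrightarrow> a \<or> b" for a b :: bool by (auto simp: max_def)
  have s: "Suc (i - Suc j) = i - j" using assms by simp
  consider "x < i" | "x = i" | "i < x" by linarith
  then show "x \<in> sub j (k - 1) (conn max (i - Suc j) u) \<longleftrightarrow> x \<in> degD i ` sub j k u"
  proof cases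
    case 1
    then have "j < x \<Longrightarrow> x - Suc j < i - Suc j" by linarith
    with 1 show ?thesis using assms unfolding degD_image
      by (auto simp: sub_iff nth_conn[OF *])
  next
    case 2
    then show ?thesis using assms unfolding degD_image
      by (auto simp: sub_iff nth_conn[OF *] m s)
  next
    case 3
    then have "\<not> x - Suc j < i - Suc j" "x - Suc j \<noteq> i - Suc j" "Suc (x - Suc j) = Suc x - Suc j"
      using assms by linarith+
    with 3 show ?thesis using assms unfolding degD_image
      by (auto simp: sub_iff nth_conn[OF *])
  qed
qed

text \<open>The successor of the left endpoint is collapsed onto that endpoint, which belongs to
  every subset; its coordinate, the first one, carries no more information and is deleted.\<close>

lemma sub_deg_del_left:
  assumes "i + 1 < k" "length u = k - Suc i"
  shows "sub i (k - 1) (del 0 u) = degD i ` sub i k u"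
proof (rule set_eqI)
  fix x
  show "x \<in> sub i (k - 1) (del 0 u) \<longleftrightarrow> x \<in> degD i ` sub i k u"
  proof (cases "i < x")
    case True
    then have "Suc (x - Suc i) = Suc x - Suc i" by linarith
    with True show ?thesis using assms unfolding degD_image
      by (auto simp: sub_iff nth_del)
  qed (use assms in \<open>auto simp: degD_image sub_iff nth_del\<close>)
qed

text \<open>Mirror image of the previous case: \<open>i\<close> is collapsed onto the right
  endpoint, and the coordinate deleted is the last one.\<close>

lemma sub_deg_del_right:
  assumes "j < i" "length u = i - j"
  shows "sub j i (del (i - Suc j) u) = degD i ` sub j (i + 1) u"
proof (rule set_eqI)
  fix x
  have *: "i - Suc j < length u" using assms by simp
  have "j < x \<Longrightarrow> x < i \<Longrightarrow> x - Suc j < i - Suc j" by linarith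
  then show "x \<in> sub j i (del (i - Suc j) u) \<longleftrightarrow> x \<in> degD i ` sub j (i + 1) u"
    using assms unfolding degD_image by (auto simp: sub_iff nth_del[OF *])
qed

text \<open>In these cases no interior point is merged with another point of the interval, or the
  interval has no interior points at all; the coordinates are only renumbered.\<close>

lemma sub_deg:
  assumes "i < j \<or> k \<le> i \<or> j = k \<or> (j = i \<and> k = i + 1)" "j \<le> k"
  shows "sub (degD i j) (degD i k) u = degD i ` sub j k u"
proof (rule set_eqI)
  fix x
  show "x \<in> sub (degD i j) (degD i k) u \<longleftrightarrow> x \<in> degD i ` sub j k u"
  proof (cases "i < j")
    case True
    then have "x - Suc (j - 1) = Suc x - Suc j" by simp
    with True show ?thesis using assms unfolding degD_image by (auto simp: sub_iff degD_def)
  next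
    case False
    then show ?thesis using assms unfolding degD_image by (auto simp: sub_iff degD_def)
  qed
qed

section \<open>The cosimplicial cubical category\<close>

lemma yo_presheaf:
  assumes "wsite M" "\<And>m n f. f \<in> arr M m n \<Longrightarrow> f \<in> pts M m \<rightarrow>\<^sub>E pts M n"
  shows "presheaf M (yo M n)"
proof (rule presheafI)
  show "act (yo M n) k l f x \<in> cells (yo M n) k" if "f \<in> arr M k l" "x \<in> cells (yo M n) l" for k l f x
    using that wsite.comp_arr[OF assms(1)] by (simp add: yo_def)
  show "act (yo M n) k k (\<lambda>v \<in> pts M k. v) x = x" if "x \<in> cells (yo M n) k" for k x
    using assms(2)[of x k n] that compose_Id[of x "pts M k" "pts M n"] by (simp add: yo_def PiE_def)
  show "act (yo M n) j k g (act (yo M n) k l f x) = act (yo M n) j l (compose (pts M j) f g) x"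
    if "g \<in> arr M j k" "f \<in> arr M k l" "x \<in> cells (yo M n) l" for j k l g f x
    using assms(2)[OF that(1)] by (auto simp: yo_def compose_def fun_eq_iff restrict_apply)
qed

lemma empty_presheaf: "presheaf M empty_psh"
  by (rule presheafI) (simp_all add: empty_psh_def)

lemma obj_W [simp]: "i \<in> obj (W_cat n) \<longleftrightarrow> i \<le> n"
  by (simp add: W_cat_def Let_def)

lemma hom_W: "hom (W_cat n) i j = (if i \<le> j then yo Cube (j - Suc i) else empty_psh)"
  by (simp add: W_cat_def Let_def)

lemma cells_W [simp]: "c \<in> cells (hom (W_cat n) i j) d \<longleftrightarrow> i \<le> j \<and> cube_arr d (j - Suc i) c"
  by (simp add: hom_W yo_def empty_psh_def)

lemma act_W: "i \<le> j \<Longrightarrow> act (hom (W_cat n) i j) e d f c = compose (cube e) c f"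
  by (simp add: hom_W yo_def)

lemma ident_W: "ident (W_cat n) i = (\<lambda>v \<in> cube 0. v)"
  by (simp add: W_cat_def Let_def)

lemma hom_W_presheaf: "presheaf Cube (hom (W_cat n) i j)"
  using yo_presheaf[OF wsite_Cube] cube_arr_in by (simp add: hom_W empty_presheaf)

definition W_mult :: "nat \<Rightarrow> nat \<Rightarrow> nat \<Rightarrow> nat \<Rightarrow> nat \<Rightarrow> cmap \<Rightarrow> cmap \<Rightarrow> cmap" where
  "W_mult i j k p q a b = (if i < j \<and> j < k
     then compose (cube (p + q)) (ins (j - i - 1) True) (tens_arr p q a b) else tens_arr p q a b)"

text \<open>Faithfulness of the subset model, from \<open>sub_inj\<close> at every vertex. It turns
  equations between cube maps into equations between sets.\<close>

lemma W_eqI: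
  assumes "cube_arr d (j - Suc i) c" "cube_arr d (j - Suc i) c'"
    and "\<And>v. length v = d \<Longrightarrow> sub i j (c v) = sub i j (c' v)"
  shows "c = c'"
  using assms sub_inj cube_arr_length by (intro cube_arr_eqI[OF assms(1,2)]) blast

lemma W_mult_arr:
  assumes "i \<le> j" "j \<le> k" "cube_arr p (j - Suc i) a" "cube_arr q (k - Suc j) b"
  shows "cube_arr (p + q) (k - Suc i) (W_mult i j k p q a b)"
proof (cases "i < j \<and> j < k")
  case True
  then have "Suc ((j - Suc i) + (k - Suc j)) = k - Suc i" by linarith
  with True show ?thesis
    using cube_face[OF cube_arr_tens[OF assms(3,4)] le_add1, of True] by (simp add: W_mult_def)
next
  case False
  then have "(j - Suc i) + (k - Suc j) = k - Suc i" using assms(1,2) by linarith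
  with False show ?thesis
    using cube_arr_tens[OF assms(3,4)] by (auto simp: W_mult_def)
qed

text \<open>Both branches of \<open>W_mult\<close> obey the same formula: in the generic case the
  inserted True supplies the point \<open>j\<close>, and otherwise \<open>j\<close> is an endpoint
  of the whole interval.\<close>

lemma sub_W_mult:
  assumes "i \<le> j" "j \<le> k" "cube_arr p (j - Suc i) a" "cube_arr q (k - Suc j) b" "length v = p + q"
  shows "sub i k (W_mult i j k p q a b v) = sub i j (a (take p v)) \<union> sub j k (b (drop p v))"
proof -
  have l: "length (a (take p v)) = j - Suc i" "length (b (drop p v)) = k - Suc j"
    using assms cube_arr_length by simp_all
  show ?thesis
  proof (cases "i < j \<and> j < k")
    case True
    then show ?thesis using sub_ins[OF _ _ l] assms(5) by (simp add: W_mult_def tens_arr_apply)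
  next
    case False
    then show ?thesis using sub_append[OF assms(1,2) l] assms(1,2,5)
      by (auto simp: W_mult_def tens_arr_apply)
  qed
qed

lemma vcomp_W: "vcomp (W_cat n) i j k r =
    (\<lambda>\<tau> \<in> cells (day (hom (W_cat n) i j) (hom (W_cat n) j k)) r. day_lift (hom (W_cat n) i k) (W_mult i j k) r \<tau>)"
  unfolding hom_W W_mult_def[abs_def] by (simp add: W_cat_def Let_def)

lemma W_mult_in:
  assumes "a \<in> cells (hom (W_cat n) i j) p" "b \<in> cells (hom (W_cat n) j k) q"
  shows "W_mult i j k p q a b \<in> cells (hom (W_cat n) i k) (p + q)"
  using assms by (auto intro: W_mult_arr)

lemma W_mult_act:
  assumes "cube_arr p' p f" "cube_arr q' q g"
    and "a \<in> cells (hom (W_cat n) i j) p" "b \<in> cells (hom (W_cat n) j k) q"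
  shows "act (hom (W_cat n) i k) (p' + q') (p + q) (tens_arr p' q' f g) (W_mult i j k p q a b) =
    W_mult i j k p' q' (act (hom (W_cat n) i j) p' p f a) (act (hom (W_cat n) j k) q' q g b)"
proof -
  have o: "i \<le> j" "j \<le> k" "i \<le> k" and ab: "cube_arr p (j - Suc i) a" "cube_arr q (k - Suc j) b"
    using assms by auto
  have "compose (cube (p' + q')) (W_mult i j k p q a b) (tens_arr p' q' f g) =
      W_mult i j k p' q' (compose (cube p') a f) (compose (cube q') b g)"
  proof (rule W_eqI)
    show "cube_arr (p' + q') (k - Suc i) (compose (cube (p' + q')) (W_mult i j k p q a b) (tens_arr p' q' f g))"
      by (intro cube_arr_comp[OF W_mult_arr[OF o(1,2) ab] cube_arr_tens] assms)
    show "cube_arr (p' + q') (k - Suc i) (W_mult i j k p' q' (compose (cube p') a f) (compose (cube q') b g))"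
      by (intro W_mult_arr o cube_arr_comp[OF ab(1) assms(1)] cube_arr_comp[OF ab(2) assms(2)])
    fix v :: "bool list" assume v: "length v = p' + q'"
    then show "sub i k (compose (cube (p' + q')) (W_mult i j k p q a b) (tens_arr p' q' f g) v) =
        sub i k (W_mult i j k p' q' (compose (cube p') a f) (compose (cube q') b g) v)"
      using o ab assms(1,2) cube_arr_length[OF assms(1)] cube_arr_length[OF assms(2)]
      by (simp add: sub_W_mult cube_arr_comp tens_arr_apply)
  qed
  then show ?thesis by (simp add: act_W o)
qed

lemma vcomp_W_map:
  "psh_map Cube (day (hom (W_cat n) i j) (hom (W_cat n) j k)) (hom (W_cat n) i k) (vcomp (W_cat n) i j k)"
  unfolding vcomp_W[abs_def]
  by (rule day_lift_map) (rule hom_W_presheaf W_mult_in W_mult_act; assumption)+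

lemma pcomp_W:
  assumes "i \<le> j" "j \<le> k" "cube_arr p (j - Suc i) a" "cube_arr q (k - Suc j) b"
  shows "pcomp day_pure (W_cat n) i j k p q (p + q) a b = W_mult i j k p q a b"
proof -
  have ab: "a \<in> cells (hom (W_cat n) i j) p" "b \<in> cells (hom (W_cat n) j k) q"
    using assms by auto
  have "day_lift (hom (W_cat n) i k) (W_mult i j k) (p + q)
      (day_pure (hom (W_cat n) i j) (hom (W_cat n) j k) p q a b) = W_mult i j k p q a b"
    by (rule day_lift_pure) ((rule hom_W_presheaf W_mult_in W_mult_act ab)?; assumption?)+
  then show ?thesis
    by (simp only: pcomp_def vcomp_W restrict_apply' day_pure_in[OF hom_W_presheaf hom_W_presheaf ab])
qed

lemma pcomp_W_arr:
  assumes "i \<le> j" "j \<le> k" "cube_arr p (j - Suc i) a" "cube_arr q (k - Suc j) b"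
  shows "cube_arr (p + q) (k - Suc i) (pcomp day_pure (W_cat n) i j k p q (p + q) a b)"
  unfolding pcomp_W[OF assms] by (rule W_mult_arr[OF assms])

lemma sub_pcomp_W:
  assumes "i \<le> j" "j \<le> k" "cube_arr p (j - Suc i) a" "cube_arr q (k - Suc j) b" "length v = p + q"
  shows "sub i k (pcomp day_pure (W_cat n) i j k p q (p + q) a b v) =
    sub i j (a (take p v)) \<union> sub j k (b (drop p v))"
  unfolding pcomp_W[OF assms(1-4)] by (rule sub_W_mult[OF assms])

text \<open>Seen through \<open>sub\<close>, associativity is that of union, and the unit laws say
  that an endpoint already belongs to the subset.\<close>

lemma pcat_W: "pcat Cube day_pure (W_cat n)"
proof unfold_locales
  show "presheaf Cube (hom (W_cat n) i j)" for i j by (rule hom_W_presheaf)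
  show "ident (W_cat n) i \<in> cells (hom (W_cat n) i i) 0" for i
    by (simp add: ident_W cube_id)
  show "pcomp day_pure (W_cat n) x y z p q r a b \<in> cells (hom (W_cat n) x z) r"
    if "join Cube p q r" "a \<in> cells (hom (W_cat n) x y) p" "b \<in> cells (hom (W_cat n) y z) q"
    for x y z p q r a b
    using that by (auto intro: pcomp_W_arr)
  show "act (hom (W_cat n) x z) r' r h (pcomp day_pure (W_cat n) x y z p q r a b) =
      pcomp day_pure (W_cat n) x y z p' q' r' (act (hom (W_cat n) x y) p' p f a) (act (hom (W_cat n) y z) q' q g b)"
    if "join Cube p q r" "join Cube p' q' r'" "f \<in> arr Cube p' p" "g \<in> arr Cube q' q" "h \<in> arr Cube r' r"
      "joinarr Cube p' p f q' q g h" "a \<in> cells (hom (W_cat n) x y) p" "b \<in> cells (hom (W_cat n) y z) q"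
    for x y z p q r p' q' r' f g h a b
  proof -
    have o: "x \<le> y" "y \<le> z" and ab: "cube_arr p (y - Suc x) a" "cube_arr q (z - Suc y) b"
      and fg: "cube_arr p' p f" "cube_arr q' q g" and e: "r = p + q" "r' = p' + q'" "h = tens_arr p' q' f g"
      using that by auto
    show ?thesis
      using o ab W_mult_act[OF fg that(7,8)] pcomp_W[OF o cube_arr_comp[OF ab(1) fg(1)] cube_arr_comp[OF ab(2) fg(2)]]
      by (simp add: e pcomp_W act_W)
  qed
  show "pcomp day_pure (W_cat n) w y z s r t (pcomp day_pure (W_cat n) w x y p q s a b) c =
      pcomp day_pure (W_cat n) w x z p s' t a (pcomp day_pure (W_cat n) x y z q r s' b c)"
    if prm: "join Cube p q s" "join Cube s r t" "join Cube q r s'" "join Cube p s' t"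
      "a \<in> cells (hom (W_cat n) w x) p" "b \<in> cells (hom (W_cat n) x y) q" "c \<in> cells (hom (W_cat n) y z) r"
    for w x y z p q r s s' t a b c
  proof (rule W_eqI[of t z w])
    have o: "w \<le> x" "x \<le> y" "y \<le> z" "w \<le> y" "x \<le> z" and e: "s = p + q" "s' = q + r" "t = p + q + r"
      and abc: "cube_arr p (x - Suc w) a" "cube_arr q (y - Suc x) b" "cube_arr r (z - Suc y) c"
      using prm by auto
    note ab = pcomp_W_arr[OF o(1,2) abc(1,2)] and bc = pcomp_W_arr[OF o(2,3) abc(2,3)]
    show "cube_arr t (z - Suc w) (pcomp day_pure (W_cat n) w y z s r t (pcomp day_pure (W_cat n) w x y p q s a b) c)"
      using pcomp_W_arr[OF o(4,3) ab abc(3)] by (simp add: e)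
    show "cube_arr t (z - Suc w) (pcomp day_pure (W_cat n) w x z p s' t a (pcomp day_pure (W_cat n) x y z q r s' b c))"
      using pcomp_W_arr[OF o(1,5) abc(1) bc] by (simp add: e add.assoc)
    fix v :: "bool list" assume v: "length v = t"
    have cut: "drop p (take (p + q) v) = take q (drop p v)" "drop (p + q) v = drop q (drop p v)"
      by (simp_all add: take_drop add.commute)
    have "sub w z (pcomp day_pure (W_cat n) w y z s r t (pcomp day_pure (W_cat n) w x y p q s a b) c v) =
        sub w x (a (take p v)) \<union> sub x y (b (take q (drop p v))) \<union> sub y z (c (drop q (drop p v)))"
      using v cut
      by (simp add: e sub_pcomp_W[OF o(4,3) ab abc(3)] sub_pcomp_W[OF o(1,2) abc(1,2)])
    moreover have "sub w z (pcomp day_pure (W_cat n) w x z p s' t a (pcomp day_pure (W_cat n) x y z q r s' b c) v) =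
        sub w x (a (take p v)) \<union> (sub x y (b (take q (drop p v))) \<union> sub y z (c (drop q (drop p v))))"
      using v by (simp add: e add.assoc sub_pcomp_W[OF o(1,5) abc(1) bc] sub_pcomp_W[OF o(2,3) abc(2,3)])
    ultimately show "sub w z (pcomp day_pure (W_cat n) w y z s r t (pcomp day_pure (W_cat n) w x y p q s a b) c v) =
        sub w z (pcomp day_pure (W_cat n) w x z p s' t a (pcomp day_pure (W_cat n) x y z q r s' b c) v)"
      by (simp add: Un_assoc)
  qed
  show "pcomp day_pure (W_cat n) x x y e d d (act (hom (W_cat n) x x) e 0 f (ident (W_cat n) x)) a = a"
    if prm: "f \<in> arr Cube e 0" "a \<in> cells (hom (W_cat n) x y) d" "join Cube e d d" for x y f e a d
  proof -
    have o: "x \<le> y" "cube_arr d (y - Suc x) a" and e: "e = 0" using prm by auto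
    have i: "cube_arr 0 (x - Suc x) (compose (cube 0) (\<lambda>v \<in> cube 0. v) f)"
      using prm(1) e by (simp add: compose_id_left)
    have "pcomp day_pure (W_cat n) x x y 0 d (0 + d) (compose (cube 0) (\<lambda>v \<in> cube 0. v) f) a = a"
    proof (rule W_eqI[OF _ o(2)])
      show "cube_arr d (y - Suc x) (pcomp day_pure (W_cat n) x x y 0 d (0 + d) (compose (cube 0) (\<lambda>v \<in> cube 0. v) f) a)"
        using pcomp_W_arr[OF _ o(1) i o(2)] by simp
      show "sub x y (pcomp day_pure (W_cat n) x x y 0 d (0 + d) (compose (cube 0) (\<lambda>v \<in> cube 0. v) f) a v) =
          sub x y (a v)" if "length v = d" for v
        using sub_pcomp_W[OF _ o(1) i o(2), of v n] that by (auto simp: sub_iff)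
    qed
    then show ?thesis by (simp add: e act_W ident_W)
  qed
  show "pcomp day_pure (W_cat n) x y y d e d a (act (hom (W_cat n) y y) e 0 f (ident (W_cat n) y)) = a"
    if prm: "f \<in> arr Cube e 0" "a \<in> cells (hom (W_cat n) x y) d" "join Cube d e d" for x y f e a d
  proof -
    have o: "x \<le> y" "cube_arr d (y - Suc x) a" and e: "e = 0" using prm by auto
    have i: "cube_arr 0 (y - Suc y) (compose (cube 0) (\<lambda>v \<in> cube 0. v) f)"
      using prm(1) e by (simp add: compose_id_left)
    have "pcomp day_pure (W_cat n) x y y d 0 (d + 0) a (compose (cube 0) (\<lambda>v \<in> cube 0. v) f) = a"
    proof (rule W_eqI[OF _ o(2)])
      show "cube_arr d (y - Suc x) (pcomp day_pure (W_cat n) x y y d 0 (d + 0) a (compose (cube 0) (\<lambda>v \<in> cube 0. v) f))"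
        using pcomp_W_arr[OF o(1) _ o(2) i] by simp
      show "sub x y (pcomp day_pure (W_cat n) x y y d 0 (d + 0) a (compose (cube 0) (\<lambda>v \<in> cube 0. v) f) v) =
          sub x y (a v)" if "length v = d" for v
        using sub_pcomp_W[OF o(1) _ o(2) i, of v n] that by (auto simp: sub_iff)
    qed
    then show ?thesis by (simp add: e act_W ident_W)
  qed
qed

lemma vcategory_W: "ccategory (W_cat n)"
  by (rule pcat_vcategory[OF pcat_W vcomp_W_map])

text \<open>The specification that replaces the cosimplicial identities: the functor acts on subsets
  by direct image along \<theta>. Cofaces and codegeneracies satisfy it, composites inherit it, and
  at most one functor has it; hence the definite description in \<open>W_map\<close> does not depend
  on the decomposition of \<theta>.\<close>

definition W_image :: "nat \<Rightarrow> nat \<Rightarrow> (nat \<Rightarrow> nat) \<Rightarrow> (nat, nat, cmap, cmap) efun \<Rightarrow> bool" where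
  "W_image n m \<theta> F \<longleftrightarrow> cfun (W_cat n) (W_cat m) F \<and>
     (\<forall>i \<le> n. fst F i = \<theta> i) \<and>
     (\<forall>i j d c v. i \<le> j \<longrightarrow> j \<le> n \<longrightarrow> cube_arr d (j - Suc i) c \<longrightarrow> length v = d \<longrightarrow>
        sub (\<theta> i) (\<theta> j) (snd F i j d c v) = \<theta> ` sub i j (c v))"

text \<open>The functor laws need no separate check. Once the subsets are known,
  \<open>W_eqI\<close> yields compatibility with the action and with identities, and compatibility
  with composition is the fact that direct images preserve unions.\<close>

lemma W_imageI:
  assumes ext: "vf_ext (W_cat n) F"
    and ob: "\<And>i. i \<le> n \<Longrightarrow> fst F i = \<theta> i" "\<And>i. i \<le> n \<Longrightarrow> \<theta> i \<le> m"
    and mono: "\<And>i j. i \<le> j \<Longrightarrow> j \<le> n \<Longrightarrow> \<theta> i \<le> \<theta> j"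
    and arr: "\<And>i j d c. i \<le> j \<Longrightarrow> j \<le> n \<Longrightarrow> cube_arr d (j - Suc i) c \<Longrightarrow>
      cube_arr d (\<theta> j - Suc (\<theta> i)) (snd F i j d c)"
    and sub: "\<And>i j d c v. i \<le> j \<Longrightarrow> j \<le> n \<Longrightarrow> cube_arr d (j - Suc i) c \<Longrightarrow> length v = d \<Longrightarrow>
      sub (\<theta> i) (\<theta> j) (snd F i j d c v) = \<theta> ` sub i j (c v)"
  shows "W_image n m \<theta> F"
proof -
  have "cfun (W_cat n) (W_cat m) F"
  proof (rule vfunctorI[OF ext])
    show "fst F x \<in> obj (W_cat m)" if "x \<in> obj (W_cat n)" for x
      using that ob by simp
    show "snd F x y d c \<in> cells (hom (W_cat m) (fst F x) (fst F y)) d"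
      if "x \<in> obj (W_cat n)" "y \<in> obj (W_cat n)" "c \<in> cells (hom (W_cat n) x y) d" for x y c d
      using that ob mono arr by simp
    show "snd F x y e (act (hom (W_cat n) x y) e d f c) =
        act (hom (W_cat m) (fst F x) (fst F y)) e d f (snd F x y d c)"
      if "x \<in> obj (W_cat n)" "y \<in> obj (W_cat n)" "f \<in> arr Cube e d" "c \<in> cells (hom (W_cat n) x y) d"
      for x y f e d c
    proof -
      have o: "x \<le> y" "y \<le> n" "x \<le> n" "cube_arr d (y - Suc x) c" "cube_arr e d f" using that by auto
      have "snd F x y e (compose (cube e) c f) = compose (cube e) (snd F x y d c) f"
        using o cube_arr_length[OF o(5)] cube_arr_comp[OF arr[OF o(1,2,4)] o(5)]
        by (intro W_eqI[of e "\<theta> y" "\<theta> x"]) (simp_all add: arr sub cube_arr_comp)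
      then show ?thesis using o by (simp add: act_W ob mono)
    qed
    show "snd F x x 0 (ident (W_cat n) x) = ident (W_cat m) (fst F x)" if "x \<in> obj (W_cat n)" for x
      using that arr[of x x 0 "\<lambda>v \<in> cube 0. v"]
      by (intro W_eqI[of 0 "\<theta> x" "\<theta> x"]) (simp_all add: ident_W cube_id)
    show "snd F x z r (pcomp day_pure (W_cat n) x y z p q r a b) =
        pcomp day_pure (W_cat m) (fst F x) (fst F y) (fst F z) p q r (snd F x y p a) (snd F y z q b)"
      if "x \<in> obj (W_cat n)" "y \<in> obj (W_cat n)" "z \<in> obj (W_cat n)" "join Cube p q r"
        "a \<in> cells (hom (W_cat n) x y) p" "b \<in> cells (hom (W_cat n) y z) q" for x y z p q r a b
    proof -
      have o: "x \<le> y" "y \<le> z" "x \<le> z" "x \<le> n" "y \<le> n" "z \<le> n" and r: "r = p + q"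
        and ab: "cube_arr p (y - Suc x) a" "cube_arr q (z - Suc y) b"
        using that by auto
      note F_ab = arr[OF o(1,5) ab(1)] arr[OF o(2,6) ab(2)]
      note pc = pcomp_W_arr[OF o(1,2) ab, of n]
      have "snd F x z (p + q) (pcomp day_pure (W_cat n) x y z p q (p + q) a b) =
          pcomp day_pure (W_cat m) (\<theta> x) (\<theta> y) (\<theta> z) p q (p + q) (snd F x y p a) (snd F y z q b)"
      proof (rule W_eqI)
        show "cube_arr (p + q) (\<theta> z - Suc (\<theta> x)) (snd F x z (p + q) (pcomp day_pure (W_cat n) x y z p q (p + q) a b))"
          by (rule arr[OF o(3,6) pc])
        show "cube_arr (p + q) (\<theta> z - Suc (\<theta> x))
            (pcomp day_pure (W_cat m) (\<theta> x) (\<theta> y) (\<theta> z) p q (p + q) (snd F x y p a) (snd F y z q b))"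
          by (rule pcomp_W_arr[OF mono[OF o(1,5)] mono[OF o(2,6)] F_ab])
        show "sub (\<theta> x) (\<theta> z) (snd F x z (p + q) (pcomp day_pure (W_cat n) x y z p q (p + q) a b) v) =
            sub (\<theta> x) (\<theta> z) (pcomp day_pure (W_cat m) (\<theta> x) (\<theta> y) (\<theta> z) p q (p + q)
              (snd F x y p a) (snd F y z q b) v)" if "length v = p + q" for v
          using that sub_pcomp_W[OF mono[OF o(1,5)] mono[OF o(2,6)] F_ab that, of m]
            sub_pcomp_W[OF o(1,2) ab that, of n] sub[OF o(3,6) pc that]
            sub[OF o(1,5) ab(1), of "take p v"] sub[OF o(2,6) ab(2), of "drop p v"]
          by (simp add: image_Un)
      qed
      then show ?thesis using o r by (simp add: ob)
    qed
  qed
  then show ?thesis using ob sub by (auto simp: W_image_def)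
qed

lemma W_image_unique:
  assumes "W_image n m \<theta> F" "W_image n m \<theta> G"
  shows "F = G"
proof -
  have F: "cfun (W_cat n) (W_cat m) F"
    and G: "cfun (W_cat n) (W_cat m) G"
    using assms by (auto simp: W_image_def)
  show ?thesis
  proof (rule vf_eqI[OF vfunctorD(7)[OF F] vfunctorD(7)[OF G]])
    show ob: "fst F x = fst G x" if "x \<in> obj (W_cat n)" for x
      using assms that by (simp add: W_image_def)
    show "snd F x y d c = snd G x y d c"
      if "x \<in> obj (W_cat n)" "y \<in> obj (W_cat n)" "c \<in> cells (hom (W_cat n) x y) d" for x y d c
      using that vfunctorD(3)[OF F that] vfunctorD(3)[OF G that] assms
      by (intro W_eqI[of d "\<theta> y" "\<theta> x"]) (simp_all add: W_image_def)
  qed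
qed

lemma W_image_id: "W_image n n (\<lambda>x \<in> {0..n}. x) (vf_id (W_cat n))"
proof -
  have "(\<lambda>x \<in> {0..n}. x) ` sub i j v = sub i j v" if "i \<le> j" "j \<le> n" for i j v
  proof -
    have "(\<lambda>x \<in> {0..n}. x) ` sub i j v = (\<lambda>x. x) ` sub i j v"
      using that by (intro image_cong) (auto simp: sub_iff)
    then show ?thesis by simp
  qed
  then show ?thesis by (intro W_imageI) simp_all
qed

lemma W_image_comp:
  assumes F: "W_image n m \<theta> F" and G: "W_image m k \<eta> G"
  shows "W_image n k (compose {0..n} \<eta> \<theta>) (vf_comp (W_cat n) G F)"
proof -
  have F': "cfun (W_cat n) (W_cat m) F" and F0: "\<And>i. i \<le> n \<Longrightarrow> fst F i = \<theta> i"
    and G': "cfun (W_cat m) (W_cat k) G" and G0: "\<And>i. i \<le> m \<Longrightarrow> fst G i = \<eta> i"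
    using F G by (auto simp: W_image_def)
  have m: "\<theta> i \<le> m" if "i \<le> n" for i
    using vfunctorD(1)[OF F', of i] that by (simp add: F0)
  have c: "\<theta> i \<le> \<theta> j \<and> cube_arr d (\<theta> j - Suc (\<theta> i)) (snd F i j d c)"
    if "i \<le> j" "j \<le> n" "cube_arr d (j - Suc i) c" for i j d c
    using vfunctorD(3)[OF F', of i j c d] that by (simp add: F0)
  have img: "compose {0..n} \<eta> \<theta> ` sub i j v = \<eta> ` \<theta> ` sub i j v" if "i \<le> j" "j \<le> n" for i j v
  proof -
    have "sub i j v \<subseteq> {0..n}" using that by (auto simp: sub_iff)
    then show ?thesis unfolding image_image by (intro image_cong) auto
  qed
  show ?thesis
    unfolding W_image_def
  proof (intro conjI allI impI)
    show "cfun (W_cat n) (W_cat k) (vf_comp (W_cat n) G F)"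
      by (rule vfunctor_comp[OF pcat_W F' G'])
    show "fst (vf_comp (W_cat n) G F) i = compose {0..n} \<eta> \<theta> i" if "i \<le> n" for i
      using that m by (simp add: F0 G0)
    show "sub (compose {0..n} \<eta> \<theta> i) (compose {0..n} \<eta> \<theta> j) (snd (vf_comp (W_cat n) G F) i j d c v) =
        compose {0..n} \<eta> \<theta> ` sub i j (c v)"
      if "i \<le> j" "j \<le> n" "cube_arr d (j - Suc i) c" "length v = d" for i j d c v
      using that c[OF that(1-3)] m F G by (simp add: F0 img W_image_def)
  qed
qed

lemma W_image_face:
  assumes "i \<le> Suc m"
  shows "W_image m (Suc m) (faceD i) (W_face m i)"
proof (rule W_imageI)
  show "vf_ext (W_cat m) (W_face m i)" by (simp add: W_face_def)
  show "fst (W_face m i) j = faceD i j" if "j \<le> m" for j using that by (simp add: W_face_def)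
  show "faceD i j \<le> Suc m" if "j \<le> m" for j using that by (simp add: faceD_def)
  show "faceD i j \<le> faceD i k" if "j \<le> k" for j k using that by (simp add: faceD_def)
  show "cube_arr d (faceD i k - Suc (faceD i j)) (snd (W_face m i) j k d c)"
    if "j \<le> k" "k \<le> m" "cube_arr d (k - Suc j) c" for j k d c
  proof (cases "j < i \<and> i \<le> k")
    case True
    then have "Suc k - Suc j = Suc (k - Suc j)" "i - Suc j \<le> k - Suc j" by linarith+
    with True show ?thesis
      using that cube_face[OF that(3), of "i - Suc j" False] by (simp add: W_face_def faceD_def)
  next
    case False
    then have "faceD i k - Suc (faceD i j) = k - Suc j" using that(1) by (auto simp: faceD_def)
    moreover have "snd (W_face m i) j k d c = c" using False that by (auto simp: W_face_def)
    ultimately show ?thesis using that(3) by simp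
  qed
  show "sub (faceD i j) (faceD i k) (snd (W_face m i) j k d c v) = faceD i ` sub j k (c v)"
    if "j \<le> k" "k \<le> m" "cube_arr d (k - Suc j) c" "length v = d" for j k d c v
  proof (cases "j < i \<and> i \<le> k")
    case True
    then show ?thesis
      using that sub_face_ins[of j i k "c v"] cube_arr_length[OF that(3,4)]
      by (simp add: W_face_def faceD_def[of i j] faceD_def[of i k])
  next
    case False
    moreover have "snd (W_face m i) j k d c = c" using False that by (auto simp: W_face_def)
    ultimately show ?thesis using sub_face[OF _ that(1)] by simp
  qed
qed

lemma W_image_deg:
  assumes "i \<le> m"
  shows "W_image (Suc m) m (degD i) (W_deg (Suc m) i)"
proof (rule W_imageI)
  show "vf_ext (W_cat (Suc m)) (W_deg (Suc m) i)" by (simp add: W_deg_def)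
  show "fst (W_deg (Suc m) i) j = degD i j" if "j \<le> Suc m" for j using that by (simp add: W_deg_def)
  show "degD i j \<le> m" if "j \<le> Suc m" for j using that assms by (auto simp: degD_def)
  show "degD i j \<le> degD i k" if "j \<le> k" for j k using that by (auto simp: degD_def)
  \<comment> \<open>The first three cases are those in which \<open>W_deg\<close> changes the cube;
    the last one collects all others.\<close>
  have cs: "(j < i \<and> i + 1 < k) \<or> (j = i \<and> i + 1 < k) \<or> (j < i \<and> k = i + 1) \<or>
      (i < j \<or> k \<le> i \<or> j = k \<or> (j = i \<and> k = i + 1))" if "j \<le> k" for j k
    using that by linarith
  have triv: "snd (W_deg (Suc m) i) j k d c = c \<and> degD i k - Suc (degD i j) = k - Suc j"
    if "j \<le> k" "k \<le> Suc m" "cube_arr d (k - Suc j) c" "i < j \<or> k \<le> i \<or> j = k \<or> (j = i \<and> k = i + 1)" for j k d c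
    using that by (auto simp: W_deg_def degD_def)
  show "cube_arr d (degD i k - Suc (degD i j)) (snd (W_deg (Suc m) i) j k d c)"
    if "j \<le> k" "k \<le> Suc m" "cube_arr d (k - Suc j) c" for j k d c
    using cs[OF that(1)]
  proof (elim disjE)
    assume *: "j < i \<and> i + 1 < k"
    \<comment> \<open>With two interior points to merge, the cube has dimension (k - j - 3) + 2;
      this is the shape that the connection rule asks for.\<close>
    then have "k - Suc j = Suc (Suc (k - (j + 3)))" "k - Suc (Suc j) = Suc (k - (j + 3))"
      "i - Suc j \<le> k - (j + 3)" by linarith+
    then show ?thesis
      using * that cube_conn[of d "k - (j + 3)" c "i - Suc j"] by (simp add: W_deg_def degD_def)
  next
    assume *: "j = i \<and> i + 1 < k"
    then have "k - Suc i = Suc (k - i - 2)" "k - 1 - i - 1 = k - i - 2" by linarith+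
    then show ?thesis
      using * that cube_deg[of d "k - i - 2" c 0] by (simp add: W_deg_def degD_def)
  next
    assume *: "j < i \<and> k = i + 1"
    then have "k - Suc j = Suc (i - Suc j)" by linarith
    then show ?thesis
      using * that cube_deg[of d "i - Suc j" c "i - Suc j"] by (simp add: W_deg_def degD_def)
  qed (use triv[OF that] that(3) in simp_all)
  show "sub (degD i j) (degD i k) (snd (W_deg (Suc m) i) j k d c v) = degD i ` sub j k (c v)"
    if "j \<le> k" "k \<le> Suc m" "cube_arr d (k - Suc j) c" "length v = d" for j k d c v
    using cs[OF that(1)]
  proof (elim disjE)
    assume *: "j < i \<and> i + 1 < k"
    then show ?thesis
      using that sub_deg_conn[of j i k "c v"] cube_arr_length[OF that(3,4)]
      by (simp add: W_deg_def degD_def[of i i] degD_def[of i "Suc i"] degD_def[of i j] degD_def[of i k])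
  next
    assume *: "j = i \<and> i + 1 < k"
    then show ?thesis
      using that sub_deg_del_left[of i k "c v"] cube_arr_length[OF that(3,4)]
      by (simp add: W_deg_def degD_def[of i i] degD_def[of i "Suc i"] degD_def[of i j] degD_def[of i k])
  next
    assume *: "j < i \<and> k = i + 1"
    then show ?thesis
      using that sub_deg_del_right[of j i "c v"] cube_arr_length[OF that(3,4)]
      by (simp add: W_deg_def degD_def[of i i] degD_def[of i "Suc i"] degD_def[of i j] degD_def[of i k])
  qed (use triv[OF that(1-3)] sub_deg[OF _ that(1)] in simp_all)
qed

lemma W_rel_image: "W_rel n m \<theta> F \<Longrightarrow> W_image n m \<theta> F"
proof (induction rule: W_rel.induct)
  case (W_rel_id n)
  show ?case by (rule W_image_id)
next
  case (W_rel_face n m \<theta> F i)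
  then show ?case by (intro W_image_comp[OF _ W_image_face])
next
  case (W_rel_deg n m \<theta> F i)
  then show ?case by (intro W_image_comp[OF _ W_image_deg])
qed

lemma W_rel_arr: "W_rel n m \<theta> F \<Longrightarrow> \<theta> \<in> arr Delta n m"
proof (induction rule: W_rel.induct)
  case (W_rel_id n)
  show ?case using wsite.id_arr[OF wsite_Delta, of n] by simp
next
  case (W_rel_face n m \<theta> F i)
  show ?case
  proof (rule arr_DeltaI)
    show "compose {0..n} (faceD i) \<theta> x \<le> Suc m" if "x \<le> n" for x
      using arr_DeltaD(1)[OF W_rel_face(3) that] that by (auto simp: faceD_def)
    show "compose {0..n} (faceD i) \<theta> x \<le> compose {0..n} (faceD i) \<theta> y" if "x \<le> y" "y \<le> n" for x y
      using arr_DeltaD(2)[OF W_rel_face(3) that] that by (auto simp: faceD_def)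
  qed simp
next
  case (W_rel_deg n m \<theta> F i)
  show ?case
  proof (rule arr_DeltaI)
    show "compose {0..n} (degD i) \<theta> x \<le> m" if "x \<le> n" for x
      using arr_DeltaD(1)[OF W_rel_deg(3) that] that W_rel_deg(2) by (auto simp: degD_def)
    show "compose {0..n} (degD i) \<theta> x \<le> compose {0..n} (degD i) \<theta> y" if "x \<le> y" "y \<le> n" for x y
      using arr_DeltaD(2)[OF W_rel_deg(3) that] that by (auto simp: degD_def)
  qed simp
qed

section \<open>Generation of the simplex category by cofaces and codegeneracies\<close>

lemma arr_Delta_eqI:
  assumes "f \<in> arr Delta n m" "g \<in> extensional {0..n}" "\<And>x. x \<le> n \<Longrightarrow> f x = g x"
  shows "f = g"
  using assms arr_DeltaD(3)[OF assms(1)] by (intro extensionalityI[of f "{0..n}" g]) auto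

text \<open>The rules of \<open>W_rel\<close> only postcompose generators, whereas a degenerate map
  has to be factored with its codegeneracy applied first; closure under composition bridges
  this.\<close>

lemma W_rel_comp:
  "W_rel m k \<eta> G \<Longrightarrow> W_rel n m \<theta> F \<Longrightarrow> \<exists>H. W_rel n k (compose {0..n} \<eta> \<theta>) H"
proof (induction rule: W_rel.induct)
  case (W_rel_id m)
  have "\<theta> = compose {0..n} (\<lambda>x \<in> {0..m}. x) \<theta>"
    using W_rel_arr[OF W_rel_id] by (intro arr_Delta_eqI[of \<theta> n m]) (auto simp: arr_DeltaD)
  with W_rel_id show ?case by metis
next
  case (W_rel_face m k \<eta> G i)
  have "compose {0..n} (faceD i) (compose {0..n} \<eta> \<theta>) = compose {0..n} (compose {0..m} (faceD i) \<eta>) \<theta>"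
    using arr_DeltaD(1)[OF W_rel_arr[OF W_rel_face(4)]] by (auto simp: compose_def fun_eq_iff restrict_apply)
  with W_rel_face show ?case by (metis W_rel.W_rel_face)
next
  case (W_rel_deg m k \<eta> G i)
  have "compose {0..n} (degD i) (compose {0..n} \<eta> \<theta>) = compose {0..n} (compose {0..m} (degD i) \<eta>) \<theta>"
    using arr_DeltaD(1)[OF W_rel_arr[OF W_rel_deg(4)]] by (auto simp: compose_def fun_eq_iff restrict_apply)
  with W_rel_deg show ?case by (metis W_rel.W_rel_deg)
qed

text \<open>Repeated neighbouring values call for a codegeneracy, an omitted value for a coface. A
  map fixing all points omits \<open>m\<close> unless n = m; for a map without repetitions, the
  least point that is not fixed is omitted.\<close>

lemma arr_Delta_cases:
  assumes "\<theta> \<in> arr Delta n m"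
  obtains (degenerate) i where "i < n" "\<theta> i = \<theta> (Suc i)"
  | (identity) "n = m" "\<theta> = (\<lambda>x \<in> {0..n}. x)"
  | (face) k where "k \<le> m" "\<And>x. x \<le> n \<Longrightarrow> \<theta> x \<noteq> k"
proof -
  consider (a) "\<exists>i<n. \<theta> i = \<theta> (Suc i)" | (b) "\<forall>x\<le>n. \<theta> x = x"
    | (c) "\<forall>i<n. \<theta> i \<noteq> \<theta> (Suc i)" "\<exists>x\<le>n. \<theta> x \<noteq> x" by blast
  then show thesis
  proof cases
    case a
    then show ?thesis using degenerate by blast
  next
    case b
    then have "n \<le> m" using arr_DeltaD(1)[OF assms, of n] by simp
    moreover have "\<theta> = (\<lambda>x \<in> {0..n}. x)" using b by (intro arr_Delta_eqI[OF assms]) auto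
    moreover have "\<theta> x \<noteq> m" if "n \<noteq> m" "x \<le> n" for x using that b \<open>n \<le> m\<close> by simp
    ultimately show ?thesis using identity face by blast
  next
    case c
    \<comment> \<open>Below the least moved point \<open>k\<close> the map is the identity. Absence
      of repetitions then forces \<theta> k > k, and monotonicity excludes the value
      \<open>k\<close> from there on.\<close>
    define k where "k = (LEAST x. x \<le> n \<and> \<theta> x \<noteq> x)"
    have k: "k \<le> n" "\<theta> k \<noteq> k" using c(2) LeastI_ex[of "\<lambda>x. x \<le> n \<and> \<theta> x \<noteq> x"] by (auto simp: k_def)
    have low: "\<theta> x = x" if "x < k" for x
      using not_less_Least[of x "\<lambda>x. x \<le> n \<and> \<theta> x \<noteq> x"] that k(1) by (auto simp: k_def)
    have "k < \<theta> k"
    proof (cases k)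
      case (Suc l)
      have "\<theta> l = l" using low[of l] Suc by simp
      moreover have "\<theta> l \<le> \<theta> k" using arr_DeltaD(2)[OF assms, of l k] k Suc by simp
      moreover have "\<theta> l \<noteq> \<theta> k" using c(1) k(1) Suc by (metis Suc_le_lessD)
      ultimately show ?thesis using k(2) Suc by linarith
    qed (use k in simp)
    moreover have "\<theta> x \<noteq> k" if "x \<le> n" for x
    proof (cases "x < k")
      case False
      then have "\<theta> k \<le> \<theta> x" using arr_DeltaD(2)[OF assms, of k x] that by simp
      then show ?thesis using \<open>k < \<theta> k\<close> by simp
    qed (use low[of x] in simp)
    moreover have "k \<le> m" using \<open>k < \<theta> k\<close> arr_DeltaD(1)[OF assms k(1)] by simp
    ultimately show ?thesis using face by blast
  qed
qed

text \<open>Induction on n + m. A codegeneracy split off on the right lowers \<open>n\<close>, a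
  coface split off on the left lowers \<open>m\<close>.\<close>

lemma W_rel_ex: "\<theta> \<in> arr Delta n m \<Longrightarrow> \<exists>F. W_rel n m \<theta> F"
proof (induction "n + m" arbitrary: n m \<theta> rule: less_induct)
  case less
  note \<theta> = less.prems
  show ?case
    using \<theta>
  proof (cases rule: arr_Delta_cases)
    case (degenerate i)
    then obtain n' where n: "n = Suc n'" by (cases n) auto
    \<comment> \<open>Restriction along \<open>faceD i\<close>, a section of \<open>degD i\<close>.
      The section skips \<open>i\<close> in favour of its successor, where \<theta> takes the same
      value, so composing back with \<open>degD i\<close> recovers \<theta>.\<close>
    define \<theta>' where "\<theta>' = (\<lambda>x \<in> {0..n'}. \<theta> (faceD i x))"
    have \<theta>': "\<theta>' \<in> arr Delta n' m"
    proof (rule arr_DeltaI)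
      show "\<theta>' x \<le> m" if "x \<le> n'" for x
        using that n arr_DeltaD(1)[OF \<theta>, of "faceD i x"] by (simp add: \<theta>'_def faceD_def)
      show "\<theta>' x \<le> \<theta>' y" if "x \<le> y" "y \<le> n'" for x y
        using that n arr_DeltaD(2)[OF \<theta>, of "faceD i x" "faceD i y"] by (simp add: \<theta>'_def faceD_def)
    qed (simp add: \<theta>'_def)
    have "n' + m < n + m" using n by simp
    from less.hyps[OF this \<theta>'] obtain F where F: "W_rel n' m \<theta>' F" by blast
    have d: "W_rel n n' (compose {0..n} (degD i) (\<lambda>x \<in> {0..n}. x)) (vf_comp (W_cat n) (W_deg (Suc n') i) (vf_id (W_cat n)))"
      using W_rel_deg[of n n' "\<lambda>x \<in> {0..n}. x" "vf_id (W_cat n)" i] W_rel_id[of n] degenerate(1) n by simp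
    have "\<theta> = compose {0..n} \<theta>' (compose {0..n} (degD i) (\<lambda>x \<in> {0..n}. x))"
    proof (rule arr_Delta_eqI[OF \<theta>])
      fix x assume x: "x \<le> n"
      then have "degD i x \<le> n'" using n degenerate(1) by (auto simp: degD_def)
      moreover have "\<theta> (faceD i (degD i x)) = \<theta> x"
        using degenerate(2) by (cases "x = i") (auto simp: faceD_def degD_def)
      ultimately show "\<theta> x = compose {0..n} \<theta>' (compose {0..n} (degD i) (\<lambda>x \<in> {0..n}. x)) x"
        using x by (simp add: \<theta>'_def)
    qed simp
    then show ?thesis using W_rel_comp[OF F d] by metis
  next
    case identity
    then show ?thesis using W_rel_id by metis
  next
    case (face k)
    have "m \<noteq> 0" using face(1) face(2)[of 0] arr_DeltaD(1)[OF \<theta>, of 0] by auto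
    then obtain m' where m: "m = Suc m'" by (cases m) auto
    define \<theta>' where "\<theta>' = (\<lambda>x \<in> {0..n}. degD k (\<theta> x))"
    have \<theta>': "\<theta>' \<in> arr Delta n m'"
    proof (rule arr_DeltaI)
      show "\<theta>' x \<le> m'" if "x \<le> n" for x
        using that face(1) face(2)[OF that] m arr_DeltaD(1)[OF \<theta> that] by (auto simp: \<theta>'_def degD_def)
      show "\<theta>' x \<le> \<theta>' y" if "x \<le> y" "y \<le> n" for x y
        using that arr_DeltaD(2)[OF \<theta> that] by (auto simp: \<theta>'_def degD_def)
    qed (simp add: \<theta>'_def)
    have "n + m' < n + m" using m by simp
    from less.hyps[OF this \<theta>'] obtain F where F: "W_rel n m' \<theta>' F" by blast
    have "\<theta> = compose {0..n} (faceD k) \<theta>'"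
      using face(2) by (intro arr_Delta_eqI[OF \<theta>]) (auto simp: \<theta>'_def faceD_def degD_def)
    then show ?thesis using W_rel_face[OF F, of k] face(1) m by metis
  qed
qed

lemma W_map_image:
  assumes "\<theta> \<in> arr Delta n m"
  shows "W_image n m \<theta> (W_map n m \<theta>)"
proof -
  obtain F where F: "W_rel n m \<theta> F" using W_rel_ex[OF assms] by blast
  have "W_map n m \<theta> = F"
    unfolding W_map_def using F W_image_unique W_rel_image by (intro the_equality) blast+
  then show ?thesis using W_rel_image[OF F] by simp
qed

text \<open>The cosimplicial identities hold by \<open>W_image_unique\<close>: the functors to be
  compared have the same description by direct images.\<close>

lemma cosimp_W: "cosimp Cube day_pure W_cat W_map"
proof (intro cosimp.intro cosimp_axioms.intro wsite_Cube pcat_W)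
    show "cfun (W_cat n) (W_cat m) (W_map n m \<theta>)" if "\<theta> \<in> arr Delta n m" for \<theta> n m
      using W_map_image[OF that] by (simp add: W_image_def)
    show "W_map n n (\<lambda>x \<in> {0..n}. x) = vf_id (W_cat n)" for n
      using W_image_unique[OF W_map_image W_image_id] wsite.id_arr[OF wsite_Delta, of n] by simp
    show "W_map k m (compose {0..k} \<eta> \<theta>) = vf_comp (W_cat k) (W_map n m \<eta>) (W_map k n \<theta>)"
      if "\<theta> \<in> arr Delta k n" "\<eta> \<in> arr Delta n m" for \<theta> k n \<eta> m
      using W_image_unique[OF W_map_image W_image_comp[OF W_map_image[OF that(1)] W_map_image[OF that(2)]]]
        wsite.comp_arr[OF wsite_Delta that(2,1)] by simp
qed


section \<open>The cosimplicial simplicial category\<close>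

lemma obj_C [simp]: "i \<in> obj (C_cat n) \<longleftrightarrow> i \<le> n"
  by (simp add: C_cat_def Let_def)

lemma hom_C: "hom (C_cat n) i j = (if i \<le> j then poset_nerve (path_poset i j) else empty_psh)"
  by (simp add: C_cat_def Let_def)

lemma cells_C: "s \<in> cells (hom (C_cat n) i j) k \<longleftrightarrow>
    i \<le> j \<and> s \<in> extensional {0..k} \<and> (\<forall>p \<le> k. s p \<in> path_poset i j) \<and>
    (\<forall>p q. p \<le> q \<longrightarrow> q \<le> k \<longrightarrow> s p \<subseteq> s q)"
proof -
  have "mono_on {0..k} s \<longleftrightarrow> (\<forall>p q. p \<le> q \<longrightarrow> q \<le> k \<longrightarrow> s p \<subseteq> s q)"
    unfolding mono_on_def by (metis atLeastAtMost_iff order_trans zero_le)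
  then show ?thesis by (auto simp: hom_C poset_nerve_def empty_psh_def PiE_def Pi_def)
qed

lemma act_C: "i \<le> j \<Longrightarrow> act (hom (C_cat n) i j) e d f s = compose {0..e} s f"
  by (simp add: hom_C poset_nerve_def)

lemma ident_C: "ident (C_cat n) i = (\<lambda>p \<in> {0..0}. {i})"
  by (simp add: C_cat_def Let_def)

lemma hom_C_presheaf: "presheaf Delta (hom (C_cat n) i j)"
proof (rule presheafI)
  show "act (hom (C_cat n) i j) k l f s \<in> cells (hom (C_cat n) i j) k"
    if "f \<in> arr Delta k l" "s \<in> cells (hom (C_cat n) i j) l" for k l f s
    using that(2) arr_DeltaD(1,2)[OF that(1)] by (auto simp: cells_C act_C)
  show "act (hom (C_cat n) i j) k k (\<lambda>v \<in> pts Delta k. v) s = s"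
    if "s \<in> cells (hom (C_cat n) i j) k" for k s
    using that by (intro extensionalityI[of _ "{0..k}"]) (auto simp: cells_C act_C)
  show "act (hom (C_cat n) i j) l k g (act (hom (C_cat n) i j) k m f s) =
      act (hom (C_cat n) i j) l m (compose (pts Delta l) f g) s"
    if "g \<in> arr Delta l k" "f \<in> arr Delta k m" "s \<in> cells (hom (C_cat n) i j) m" for l k m f g s
    using that(3) arr_DeltaD(1)[OF that(1)]
    by (intro extensionalityI[of _ "{0..l}"]) (auto simp: cells_C act_C)
qed

lemma path_poset_Un: "I \<in> path_poset i j \<Longrightarrow> J \<in> path_poset j k \<Longrightarrow> I \<union> J \<in> path_poset i k"
  by (fastforce simp: path_poset_def)

lemma vcomp_C: "s \<in> cells (hom (C_cat n) i j) d \<Longrightarrow> t \<in> cells (hom (C_cat n) j k) d \<Longrightarrow>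
    vcomp (C_cat n) i j k d (s, t) = (\<lambda>p \<in> {0..d}. s p \<union> t p)"
  by (simp add: C_cat_def Let_def psh_prod_def)

lemma pcomp_C: "s \<in> cells (hom (C_cat n) i j) d \<Longrightarrow> t \<in> cells (hom (C_cat n) j k) d \<Longrightarrow>
    pcomp prod_pure (C_cat n) i j k d d d s t = (\<lambda>p \<in> {0..d}. s p \<union> t p)"
  by (simp add: pcomp_def prod_pure_def vcomp_C)

lemma union_C:
  assumes s: "s \<in> cells (hom (C_cat n) i j) d" and t: "t \<in> cells (hom (C_cat n) j k) d"
  shows "(\<lambda>p \<in> {0..d}. s p \<union> t p) \<in> cells (hom (C_cat n) i k) d"
proof -
  have "s p \<union> t p \<subseteq> s q \<union> t q" if "p \<le> q" "q \<le> d" for p q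
  proof -
    have "s p \<subseteq> s q" "t p \<subseteq> t q" using that s t by (simp_all add: cells_C)
    then show ?thesis by blast
  qed
  moreover have "s p \<union> t p \<in> path_poset i k" if "p \<le> d" for p
    using that s t path_poset_Un by (auto simp: cells_C)
  ultimately show ?thesis using s t by (auto simp: cells_C)
qed

lemma vcomp_C_map:
  "psh_map Delta (psh_prod (hom (C_cat n) i j) (hom (C_cat n) j k)) (hom (C_cat n) i k) (vcomp (C_cat n) i j k)"
proof (rule psh_mapI)
  show "vcomp (C_cat n) i j k d \<in> extensional (cells (psh_prod (hom (C_cat n) i j) (hom (C_cat n) j k)) d)" for d
    by (simp add: C_cat_def Let_def)
  fix d \<tau> assume "\<tau> \<in> cells (psh_prod (hom (C_cat n) i j) (hom (C_cat n) j k)) d"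
  then obtain s t where \<tau>: "\<tau> = (s, t)" and st: "s \<in> cells (hom (C_cat n) i j) d" "t \<in> cells (hom (C_cat n) j k) d"
    by (auto simp: psh_prod_def)
  show "vcomp (C_cat n) i j k d \<tau> \<in> cells (hom (C_cat n) i k) d"
    using st by (simp add: \<tau> vcomp_C union_C)
  fix e f assume f: "f \<in> arr Delta e d"
  have o: "i \<le> j" "j \<le> k" "i \<le> k" using st by (auto simp: cells_C)
  have "(\<lambda>p \<in> {0..e}. compose {0..e} s f p \<union> compose {0..e} t f p) = compose {0..e} (\<lambda>p \<in> {0..d}. s p \<union> t p) f"
    using arr_DeltaD(1)[OF f] by (intro extensionalityI[of _ "{0..e}"]) auto
  then show "vcomp (C_cat n) i j k e (act (psh_prod (hom (C_cat n) i j) (hom (C_cat n) j k)) e d f \<tau>) =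
      act (hom (C_cat n) i k) e d f (vcomp (C_cat n) i j k d \<tau>)"
    using st presheafD(1)[OF hom_C_presheaf f st(1)] presheafD(1)[OF hom_C_presheaf f st(2)] o
    by (simp add: \<tau> psh_prod_def vcomp_C act_C)
qed

lemma pcat_C: "pcat Delta prod_pure (C_cat n)"
proof unfold_locales
  show "presheaf Delta (hom (C_cat n) i j)" for i j by (rule hom_C_presheaf)
  show "ident (C_cat n) i \<in> cells (hom (C_cat n) i i) 0" for i
    by (simp add: ident_C cells_C path_poset_def)
  show "pcomp prod_pure (C_cat n) x y z p q r a b \<in> cells (hom (C_cat n) x z) r"
    if "join Delta p q r" "a \<in> cells (hom (C_cat n) x y) p" "b \<in> cells (hom (C_cat n) y z) q" for x y z p q r a b
    using that by (simp add: pcomp_C union_C)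
  show "act (hom (C_cat n) x z) r' r h (pcomp prod_pure (C_cat n) x y z p q r a b) =
      pcomp prod_pure (C_cat n) x y z p' q' r' (act (hom (C_cat n) x y) p' p f a) (act (hom (C_cat n) y z) q' q g b)"
    if "join Delta p q r" "join Delta p' q' r'" "f \<in> arr Delta p' p" "g \<in> arr Delta q' q" "h \<in> arr Delta r' r"
      "joinarr Delta p' p f q' q g h" "a \<in> cells (hom (C_cat n) x y) p" "b \<in> cells (hom (C_cat n) y z) q"
    for x y z p q r p' q' r' f g h a b
    using that psh_mapD(3)[OF vcomp_C_map, of h r' r "(a, b)" n x y z]
    by (simp add: pcomp_def prod_pure_def psh_prod_def)
  show "pcomp prod_pure (C_cat n) w y z s r t (pcomp prod_pure (C_cat n) w x y p q s a b) c =
      pcomp prod_pure (C_cat n) w x z p s' t a (pcomp prod_pure (C_cat n) x y z q r s' b c)"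
    if prm: "join Delta p q s" "join Delta s r t" "join Delta q r s'" "join Delta p s' t"
      "a \<in> cells (hom (C_cat n) w x) p" "b \<in> cells (hom (C_cat n) x y) q" "c \<in> cells (hom (C_cat n) y z) r"
    for w x y z p q r s s' t a b c
  proof -
    have e: "p = t" "q = t" "r = t" "s = t" "s' = t" using prm(1-4) by simp_all
    have abc: "a \<in> cells (hom (C_cat n) w x) t" "b \<in> cells (hom (C_cat n) x y) t" "c \<in> cells (hom (C_cat n) y z) t"
      using prm(5-7) e by simp_all
    show ?thesis
      using abc unfolding e
      by (simp add: pcomp_C union_C Un_assoc cong: restrict_cong)
  qed
  show "pcomp prod_pure (C_cat n) x x y e d d (act (hom (C_cat n) x x) e 0 f (ident (C_cat n) x)) a = a"
    if prm: "x \<in> obj (C_cat n)" "f \<in> arr Delta e 0" "a \<in> cells (hom (C_cat n) x y) d" "join Delta e d d" for x y f e a d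
  proof -
    have e: "e = d" using prm(4)[unfolded join_Delta] by blast
    have i: "act (hom (C_cat n) x x) d 0 f (ident (C_cat n) x) \<in> cells (hom (C_cat n) x x) d"
      using prm(2) e by (intro presheafD(1)[OF hom_C_presheaf]) (simp_all add: ident_C cells_C path_poset_def)
    have "(\<lambda>p \<in> {0..d}. act (hom (C_cat n) x x) d 0 f (ident (C_cat n) x) p \<union> a p) = a"
      using prm(3) arr_DeltaD(1)[OF prm(2)[unfolded e]]
      by (intro extensionalityI[of _ "{0..d}"]) (auto simp: act_C ident_C cells_C path_poset_def)
    then show ?thesis using prm(3) i by (simp add: e pcomp_C)
  qed
  show "pcomp prod_pure (C_cat n) x y y d e d a (act (hom (C_cat n) y y) e 0 f (ident (C_cat n) y)) = a"
    if prm: "x \<in> obj (C_cat n)" "f \<in> arr Delta e 0" "a \<in> cells (hom (C_cat n) x y) d" "join Delta d e d" for x y f e a d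
  proof -
    have e: "e = d" using prm(4)[unfolded join_Delta] by blast
    have i: "act (hom (C_cat n) y y) d 0 f (ident (C_cat n) y) \<in> cells (hom (C_cat n) y y) d"
      using prm(2) e by (intro presheafD(1)[OF hom_C_presheaf]) (simp_all add: ident_C cells_C path_poset_def)
    have "(\<lambda>p \<in> {0..d}. a p \<union> act (hom (C_cat n) y y) d 0 f (ident (C_cat n) y) p) = a"
      using prm(3) arr_DeltaD(1)[OF prm(2)[unfolded e]]
      by (intro extensionalityI[of _ "{0..d}"]) (auto simp: act_C ident_C cells_C path_poset_def)
    then show ?thesis using prm(3) i by (simp add: e pcomp_C)
  qed
qed

lemma fst_C_map: "i \<le> n \<Longrightarrow> fst (C_map n m \<theta>) i = \<theta> i"
  by (simp add: C_map_def)

lemma snd_C_map: "i \<le> n \<Longrightarrow> j \<le> n \<Longrightarrow> s \<in> cells (hom (C_cat n) i j) d \<Longrightarrow>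
    snd (C_map n m \<theta>) i j d s = (\<lambda>p \<in> {0..d}. \<theta> ` s p)"
  by (simp add: C_map_def)

lemma C_map_functor:
  assumes "\<theta> \<in> arr Delta n m"
  shows "sfun (C_cat n) (C_cat m) (C_map n m \<theta>)"
proof (rule vfunctorI)
  have img: "\<theta> ` I \<in> path_poset (\<theta> i) (\<theta> j)" if "I \<in> path_poset i j" "j \<le> n" for I i j
  proof -
    have "\<theta> i \<le> \<theta> x \<and> \<theta> x \<le> \<theta> j" if "x \<in> I" for x
      using that \<open>I \<in> _\<close> \<open>j \<le> n\<close> by (auto simp: path_poset_def intro!: arr_DeltaD(2)[OF assms])
    then show ?thesis using that by (auto simp: path_poset_def)
  qed
  note [simp] = fst_C_map snd_C_map
  show "vf_ext (C_cat n) (C_map n m \<theta>)" by (simp add: C_map_def)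
  show "fst (C_map n m \<theta>) x \<in> obj (C_cat m)" if "x \<in> obj (C_cat n)" for x
    using that arr_DeltaD(1)[OF assms] by simp
  show "snd (C_map n m \<theta>) x y d c \<in> cells (hom (C_cat m) (fst (C_map n m \<theta>) x) (fst (C_map n m \<theta>) y)) d"
    if "x \<in> obj (C_cat n)" "y \<in> obj (C_cat n)" "c \<in> cells (hom (C_cat n) x y) d" for x y c d
  proof -
    have "\<theta> ` c p \<subseteq> \<theta> ` c q" if "p \<le> q" "q \<le> d" for p q
      using that \<open>c \<in> _\<close> by (intro image_mono) (simp add: cells_C)
    then show ?thesis
      using that img arr_DeltaD(2)[OF assms, of x y] by (simp add: cells_C)
  qed
  show "snd (C_map n m \<theta>) x y e (act (hom (C_cat n) x y) e d f c) =
      act (hom (C_cat m) (fst (C_map n m \<theta>) x) (fst (C_map n m \<theta>) y)) e d f (snd (C_map n m \<theta>) x y d c)"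
    if "x \<in> obj (C_cat n)" "y \<in> obj (C_cat n)" "f \<in> arr Delta e d" "c \<in> cells (hom (C_cat n) x y) d" for x y f e d c
  proof -
    have o: "x \<le> y" "\<theta> x \<le> \<theta> y" using that arr_DeltaD(2)[OF assms, of x y] by (auto simp: cells_C)
    have "(\<lambda>p \<in> {0..e}. \<theta> ` compose {0..e} c f p) = compose {0..e} (\<lambda>p \<in> {0..d}. \<theta> ` c p) f"
      using arr_DeltaD(1)[OF that(3)] by (intro extensionalityI[of _ "{0..e}"]) auto
    then show ?thesis
      using that o presheafD(1)[OF hom_C_presheaf that(3,4)] by (simp add: act_C)
  qed
  show "snd (C_map n m \<theta>) x x 0 (ident (C_cat n) x) = ident (C_cat m) (fst (C_map n m \<theta>) x)" if "x \<in> obj (C_cat n)" for x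
    using that pcat.ident_in[OF pcat_C that] by (simp add: ident_C cong: restrict_cong)
  show "snd (C_map n m \<theta>) x z r (pcomp prod_pure (C_cat n) x y z p q r a b) =
      pcomp prod_pure (C_cat m) (fst (C_map n m \<theta>) x) (fst (C_map n m \<theta>) y) (fst (C_map n m \<theta>) z) p q r
        (snd (C_map n m \<theta>) x y p a) (snd (C_map n m \<theta>) y z q b)"
    if o: "x \<in> obj (C_cat n)" "y \<in> obj (C_cat n)" "z \<in> obj (C_cat n)" and "join Delta p q r"
      "a \<in> cells (hom (C_cat n) x y) p" "b \<in> cells (hom (C_cat n) y z) q" for x y z p q r a b
  proof -
    have e: "p = r" "q = r" using \<open>join Delta p q r\<close> by simp_all
    have ab: "a \<in> cells (hom (C_cat n) x y) r" "b \<in> cells (hom (C_cat n) y z) r" using that e by simp_all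
    have cell: "(\<lambda>p \<in> {0..r}. \<theta> ` c p) \<in> cells (hom (C_cat m) (\<theta> x) (\<theta> y)) r"
      if "x \<le> n" "y \<le> n" "c \<in> cells (hom (C_cat n) x y) r" for x y c
    proof -
      have "\<theta> ` c p \<subseteq> \<theta> ` c q" if "p \<le> q" "q \<le> r" for p q
        using that \<open>c \<in> _\<close> by (intro image_mono) (simp add: cells_C)
      then show ?thesis
        using that img arr_DeltaD(2)[OF assms, of x y] by (simp add: cells_C)
    qed
    show ?thesis
      using ab o unfolding e
      by (simp add: pcomp_C union_C cell image_Un cong: restrict_cong)
  qed
qed

lemma cosimp_C: "cosimp Delta prod_pure C_cat C_map"
proof (intro cosimp.intro cosimp_axioms.intro wsite_Delta pcat_C)
    show "sfun (C_cat n) (C_cat m) (C_map n m \<theta>)" if "\<theta> \<in> arr Delta n m" for \<theta> n m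
      by (rule C_map_functor[OF that])
    \<comment> \<open>Subsets occurring in a hom lie below its right endpoint, hence inside the
      domain on which the restricted monotone maps compute.\<close>
    have le: "x \<le> n" if "s \<in> cells (hom (C_cat n) i j) d" "j \<le> n" "p \<le> d" "x \<in> s p" for n i j d s p x
      using that by (fastforce simp: cells_C path_poset_def)
    show "C_map n n (\<lambda>x \<in> {0..n}. x) = vf_id (C_cat n)" for n
    proof (rule vf_eqI[of "C_cat n"])
      show "snd (C_map n n (\<lambda>x \<in> {0..n}. x)) i j d s = snd (vf_id (C_cat n)) i j d s"
        if "i \<in> obj (C_cat n)" "j \<in> obj (C_cat n)" "s \<in> cells (hom (C_cat n) i j) d" for i j d s
      proof -
        have "(\<lambda>p \<in> {0..d}. (\<lambda>x \<in> {0..n}. x) ` s p) = s"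
        proof (rule extensionalityI[of _ "{0..d}"])
          fix p assume "p \<in> {0..d}"
          then have "(\<lambda>x \<in> {0..n}. x) ` s p = (\<lambda>x. x) ` s p"
            using le[OF that(3)] that(2) by (intro image_cong) auto
          then show "(\<lambda>p \<in> {0..d}. (\<lambda>x \<in> {0..n}. x) ` s p) p = s p" using \<open>p \<in> {0..d}\<close> by simp
        qed (use that in \<open>simp_all add: cells_C\<close>)
        then show ?thesis using that by (simp add: snd_C_map)
      qed
    qed (simp_all add: C_map_def)
    show "C_map k m (compose {0..k} \<eta> \<theta>) = vf_comp (C_cat k) (C_map n m \<eta>) (C_map k n \<theta>)"
      if \<theta>: "\<theta> \<in> arr Delta k n" and \<eta>: "\<eta> \<in> arr Delta n m" for \<theta> k n \<eta> m
    proof (rule vf_eqI[of "C_cat k"])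
      note F = C_map_functor[OF \<theta>]
      show "fst (C_map k m (compose {0..k} \<eta> \<theta>)) i = fst (vf_comp (C_cat k) (C_map n m \<eta>) (C_map k n \<theta>)) i"
        if "i \<in> obj (C_cat k)" for i
        using that arr_DeltaD(1)[OF \<theta>] by (simp add: fst_C_map)
      show "snd (C_map k m (compose {0..k} \<eta> \<theta>)) i j d s =
          snd (vf_comp (C_cat k) (C_map n m \<eta>) (C_map k n \<theta>)) i j d s"
        if ij: "i \<in> obj (C_cat k)" "j \<in> obj (C_cat k)" and s: "s \<in> cells (hom (C_cat k) i j) d" for i j d s
      proof -
        have "(\<lambda>p \<in> {0..d}. compose {0..k} \<eta> \<theta> ` s p) = (\<lambda>p \<in> {0..d}. \<eta> ` (\<lambda>p \<in> {0..d}. \<theta> ` s p) p)"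
        proof (rule restrict_ext)
          fix p assume "p \<in> {0..d}"
          then have "compose {0..k} \<eta> \<theta> ` s p = (\<lambda>x. \<eta> (\<theta> x)) ` s p"
            using le[OF s] ij by (intro image_cong) auto
          then show "compose {0..k} \<eta> \<theta> ` s p = \<eta> ` (\<lambda>p \<in> {0..d}. \<theta> ` s p) p"
            using \<open>p \<in> {0..d}\<close> by (simp add: image_image)
        qed
        then show ?thesis
          using ij s vfunctorD(3)[OF F ij s] arr_DeltaD(1)[OF \<theta>]
          by (simp add: snd_C_map fst_C_map)
      qed
    qed (simp_all add: C_map_def)
qed


section \<open>The comparison on standard simplices\<close>

lemma vf_ext_comparison: "vf_ext (Lc_cat (W_cat n)) (cube_comparison n)"
  by (simp add: cube_comparison_def)

lemma obj_LW [simp]: "i \<in> obj (Lc_cat (W_cat n)) \<longleftrightarrow> i \<le> n"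
  by (simp add: obj_Lc_cat)

lemma fst_comparison: "i \<le> n \<Longrightarrow> fst (cube_comparison n) i = i"
  by (simp add: cube_comparison_def)

text \<open>The function under \<open>the_elem\<close> respects the coend relation by
  \<open>ipow_map_vert\<close>: restricting \<open>a\<close> along a cube arrow and pushing
  \<open>s\<close> forward along it lead to the same vertices.\<close>

lemma snd_comparison:
  assumes "i \<le> j" "j \<le> n" "cube_arr m (j - Suc i) a" "s \<in> cells (ipow m) k"
  shows "snd (cube_comparison n) i j k (Lc_class (hom (W_cat n) i j) k (m, a, s)) =
    (\<lambda>p \<in> {0..k}. sub i j (a (vert s p)))"
proof -
  let ?h = "\<lambda>(m, a, s). \<lambda>p \<in> {0..k}. {i, j} \<union> {i + 1 + l | l. l < j - i - 1 \<and> a (map (\<lambda>u. u p = 1) s) ! l}"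
  have h: "?h (m, a, s) = (\<lambda>p \<in> {0..k}. sub i j (a (vert s p)))" for m :: nat and a s
    by (simp add: sub_def vert_def)
  have "the_elem (?h ` Lc_class (hom (W_cat n) i j) k (m, a, s)) = ?h (m, a, s)"
  proof (rule Lc_the_elem[OF hom_W_presheaf])
    show "?h (m, act (hom (W_cat n) i j) m d f y, s) = ?h (d, y, ipow_map m d f k s)"
      if "cube_arr m d f" "y \<in> cells (hom (W_cat n) i j) d" "s \<in> cells (ipow m) k" for m d f y s
      unfolding h using that
      by (intro restrict_ext) (simp add: act_W assms(1) ipow_map_vert ipow_length)
  qed (use assms in simp_all)
  then have "the_elem (?h ` Lc_class (hom (W_cat n) i j) k (m, a, s)) = (\<lambda>p \<in> {0..k}. sub i j (a (vert s p)))"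
    unfolding h .
  moreover have "Lc_class (hom (W_cat n) i j) k (m, a, s) \<in> cells (hom (Lc_cat (W_cat n)) i j) k"
    using assms by (intro Lc_class_in_cat[OF vcategory_W]) simp_all
  ultimately show ?thesis
    using assms(1,2) by (simp add: cube_comparison_def)
qed

lemma LW_cellE:
  assumes "i \<le> n" "j \<le> n" "S \<in> cells (hom (Lc_cat (W_cat n)) i j) k"
  obtains m a s where "S = Lc_class (hom (W_cat n) i j) k (m, a, s)" "i \<le> j" "cube_arr m (j - Suc i) a"
    "s \<in> cells (ipow m) k"
proof (rule Lc_cat_cellE[OF vcategory_W _ _ assms(3)])
  show "i \<in> obj (Lc_cat (W_cat n))" "j \<in> obj (Lc_cat (W_cat n))" using assms(1,2) by simp_all
qed (use that in simp)

lemma sub_vert_cell: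
  assumes "i \<le> j" "cube_arr m (j - Suc i) a" "s \<in> cells (ipow m) k"
  shows "(\<lambda>p \<in> {0..k}. sub i j (a (vert s p))) \<in> cells (hom (C_cat n) i j) k"
proof -
  have "sub i j (a (vert s p)) \<subseteq> sub i j (a (vert s q))" if "p \<le> q" "q \<le> k" for p q
    using cube_arr_mono[OF assms(2) _ _ vert_mono[OF assms(3) that]] cube_arr_length[OF assms(2)]
      ipow_length[OF assms(3)] by (intro sub_mono) simp_all
  then show ?thesis using assms(1) sub_path[OF assms(1)] by (simp add: cells_C)
qed

lemma comparison_functor:
  "sfun (Lc_cat (W_cat n)) (C_cat n) (cube_comparison n)"
proof (rule vfunctorI[OF vf_ext_comparison])
  note [simp] = fst_comparison snd_comparison
  show "fst (cube_comparison n) x \<in> obj (C_cat n)" if "x \<in> obj (Lc_cat (W_cat n))" for x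
    using that by simp
  show "snd (cube_comparison n) x y k S \<in> cells (hom (C_cat n) (fst (cube_comparison n) x) (fst (cube_comparison n) y)) k"
    if "x \<in> obj (Lc_cat (W_cat n))" "y \<in> obj (Lc_cat (W_cat n))" "S \<in> cells (hom (Lc_cat (W_cat n)) x y) k" for x y S k
    by (rule LW_cellE[OF that[unfolded obj_LW]]) (use that in \<open>simp add: sub_vert_cell\<close>)
  show "snd (cube_comparison n) x y j (act (hom (Lc_cat (W_cat n)) x y) j k f S) =
      act (hom (C_cat n) (fst (cube_comparison n) x) (fst (cube_comparison n) y)) j k f (snd (cube_comparison n) x y k S)"
    if xy: "x \<in> obj (Lc_cat (W_cat n))" "y \<in> obj (Lc_cat (W_cat n))" and f: "f \<in> arr Delta j k"
      and S: "S \<in> cells (hom (Lc_cat (W_cat n)) x y) k" for x y f j k S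
  proof (rule LW_cellE[OF xy[unfolded obj_LW] S])
    fix m a s assume *: "S = Lc_class (hom (W_cat n) x y) k (m, a, s)" "x \<le> y" "cube_arr m (y - Suc x) a" "s \<in> cells (ipow m) k"
    have "(\<lambda>p \<in> {0..j}. sub x y (a (vert (act (ipow m) j k f s) p))) =
        compose {0..j} (\<lambda>p \<in> {0..k}. sub x y (a (vert s p))) f"
      using arr_DeltaD(1)[OF f] by (intro extensionalityI[of _ "{0..j}"]) (auto simp: vert_act)
    then show ?thesis
      using * xy f
      by (simp add: act_C hom_Lc_cat Lc_act[OF hom_W_presheaf] presheafD(1)[OF ipow_presheaf])
  qed
  show "snd (cube_comparison n) x x 0 (ident (Lc_cat (W_cat n)) x) = ident (C_cat n) (fst (cube_comparison n) x)"
    if "x \<in> obj (Lc_cat (W_cat n))" for x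
    using that by (simp add: ident_Lc_cat ident_W ident_C cube_id nil_in_ipow)
  show "snd (cube_comparison n) x z r (pcomp prod_pure (Lc_cat (W_cat n)) x y z p q r S T) =
      pcomp prod_pure (C_cat n) (fst (cube_comparison n) x) (fst (cube_comparison n) y) (fst (cube_comparison n) z) p q r
        (snd (cube_comparison n) x y p S) (snd (cube_comparison n) y z q T)"
    if o: "x \<in> obj (Lc_cat (W_cat n))" "y \<in> obj (Lc_cat (W_cat n))" "z \<in> obj (Lc_cat (W_cat n))"
      and j: "join Delta p q r" and S: "S \<in> cells (hom (Lc_cat (W_cat n)) x y) p"
      and T: "T \<in> cells (hom (Lc_cat (W_cat n)) y z) q" for x y z p q r S T
  proof -
    have e: "p = r" "q = r" using j by simp_all
    obtain m a s where S: "S = Lc_class (hom (W_cat n) x y) r (m, a, s)" "x \<le> y" "cube_arr m (y - Suc x) a" "s \<in> cells (ipow m) r"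
      using LW_cellE[OF o(1,2)[unfolded obj_LW] S[unfolded e]] .
    obtain l b t where T: "T = Lc_class (hom (W_cat n) y z) r (l, b, t)" "y \<le> z" "cube_arr l (z - Suc y) b" "t \<in> cells (ipow l) r"
      using LW_cellE[OF o(2,3)[unfolded obj_LW] T[unfolded e]] .
    have "(\<lambda>p \<in> {0..r}. sub x z (pcomp day_pure (W_cat n) x y z m l (m + l) a b (vert (s @ t) p))) =
        (\<lambda>p \<in> {0..r}. (\<lambda>p \<in> {0..r}. sub x y (a (vert s p))) p \<union> (\<lambda>p \<in> {0..r}. sub y z (b (vert t p))) p)"
      using S T by (intro restrict_ext)
        (simp add: sub_pcomp_W[of x y z m a l b] vert_append ipow_length)
    moreover have "pcomp prod_pure (Lc_cat (W_cat n)) x y z r r r S T =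
        Lc_class (hom (W_cat n) x z) r (m + l, pcomp day_pure (W_cat n) x y z m l (m + l) a b, s @ t)"
      unfolding S(1) T(1) using o S T by (intro pcomp_Lc_cat[OF vcategory_W]) simp_all
    moreover have "cube_arr (m + l) (z - Suc x) (pcomp day_pure (W_cat n) x y z m l (m + l) a b)"
      by (rule pcomp_W_arr[OF S(2) T(2) S(3) T(3)])
    ultimately show ?thesis
      using o S T sub_vert_cell[OF S(2-4), of n] sub_vert_cell[OF T(2-4), of n]
      by (simp add: e pcomp_C ipow_append)
  qed
qed

lemma comparison_bij:
  assumes ij: "i \<le> n" "j \<le> n"
  shows "bij_betw (snd (cube_comparison n) i j k) (cells (hom (Lc_cat (W_cat n)) i j) k) (cells (hom (C_cat n) i j) k)"
  unfolding bij_betw_def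
proof (intro conjI)
  \<comment> \<open>The co-Yoneda argument: \<open>a\<close> is the restriction of the identity cell
    along itself, so \<open>a\<close> can be transferred from the cell to the simplex.\<close>
  have rep: "\<exists>t. S = Lc_class (hom (W_cat n) i j) k (j - Suc i, \<lambda>v \<in> cube (j - Suc i). v, t) \<and>
      t \<in> cells (ipow (j - Suc i)) k \<and> i \<le> j" if S: "S \<in> cells (hom (Lc_cat (W_cat n)) i j) k" for S
  proof (rule LW_cellE[OF ij S])
    fix m a s assume *: "S = Lc_class (hom (W_cat n) i j) k (m, a, s)" "i \<le> j" "cube_arr m (j - Suc i) a" "s \<in> cells (ipow m) k"
    then have "S = Lc_class (hom (W_cat n) i j) k (j - Suc i, \<lambda>v \<in> cube (j - Suc i). v, ipow_map m (j - Suc i) a k s)"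
      using Lc_class_step[OF hom_W_presheaf *(3), of "\<lambda>v \<in> cube (j - Suc i). v" n i j s k]
      by (simp add: act_W cube_id compose_id_left)
    then show ?thesis using * ipow_map_in by blast
  qed
  have val: "snd (cube_comparison n) i j k (Lc_class (hom (W_cat n) i j) k (j - Suc i, \<lambda>v \<in> cube (j - Suc i). v, t)) =
      (\<lambda>p \<in> {0..k}. sub i j (vert t p))" if "i \<le> j" "t \<in> cells (ipow (j - Suc i)) k" for t
  proof -
    have "(\<lambda>p \<in> {0..k}. sub i j ((\<lambda>v \<in> cube (j - Suc i). v) (vert t p))) = (\<lambda>p \<in> {0..k}. sub i j (vert t p))"
      using ipow_length[OF that(2)] by (intro restrict_ext) simp
    then show ?thesis using that ij by (simp add: snd_comparison cube_id)
  qed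
  show "inj_on (snd (cube_comparison n) i j k) (cells (hom (Lc_cat (W_cat n)) i j) k)"
  proof (rule inj_onI)
    fix S S' assume S: "S \<in> cells (hom (Lc_cat (W_cat n)) i j) k" "S' \<in> cells (hom (Lc_cat (W_cat n)) i j) k"
      and eq: "snd (cube_comparison n) i j k S = snd (cube_comparison n) i j k S'"
    obtain t where t: "S = Lc_class (hom (W_cat n) i j) k (j - Suc i, \<lambda>v \<in> cube (j - Suc i). v, t)"
      "t \<in> cells (ipow (j - Suc i)) k" "i \<le> j" using rep[OF S(1)] by blast
    obtain t' where t': "S' = Lc_class (hom (W_cat n) i j) k (j - Suc i, \<lambda>v \<in> cube (j - Suc i). v, t')"
      "t' \<in> cells (ipow (j - Suc i)) k" using rep[OF S(2)] by blast
    have "t = t'"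
    proof (rule ipow_eqI[OF t(2) t'(2)])
      fix p assume p: "p \<le> k"
      have "sub i j (vert t p) = sub i j (vert t' p)"
        using fun_cong[OF eq, of p] val[OF t(3,2)] val[OF t(3) t'(2)] p t(1) t'(1) by simp
      then show "vert t p = vert t' p"
        by (rule sub_inj) (simp_all add: ipow_length[OF t(2)] ipow_length[OF t'(2)])
    qed
    then show "S = S'" using t(1) t'(1) by simp
  qed
  show "snd (cube_comparison n) i j k ` cells (hom (Lc_cat (W_cat n)) i j) k = cells (hom (C_cat n) i j) k"
  proof (intro subset_antisym subsetI)
    fix s assume "s \<in> snd (cube_comparison n) i j k ` cells (hom (Lc_cat (W_cat n)) i j) k"
    then show "s \<in> cells (hom (C_cat n) i j) k"
      using vfunctorD(3)[OF comparison_functor, of i n j _ k] ij by (auto simp: fst_comparison)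
  next
    fix s assume s: "s \<in> cells (hom (C_cat n) i j) k"
    then have ord: "i \<le> j" by (simp add: cells_C)
    \<comment> \<open>Each subset of the chain is translated into a vertex of the cube; the vertices
      increase and so form a simplex of the power.\<close>
    define t where "t = ipow_of (j - Suc i) k (\<lambda>p. unsub i j (s p))"
    have t: "t \<in> cells (ipow (j - Suc i)) k"
      unfolding t_def using s by (intro ipow_of_in unsub_mono) (auto simp: cells_C)
    have v: "sub i j (vert t p) = s p" if "p \<le> k" for p
      using that s by (simp add: t_def vert_ipow_of sub_unsub cells_C)
    have "(\<lambda>p \<in> {0..k}. sub i j (vert t p)) = s"
      using s v by (intro extensionalityI[of _ "{0..k}"]) (simp_all add: cells_C)
    then have "s = snd (cube_comparison n) i j k (Lc_class (hom (W_cat n) i j) k (j - Suc i, \<lambda>v \<in> cube (j - Suc i). v, t))"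
      using val[OF ord t] by (simp only:)
    moreover have "Lc_class (hom (W_cat n) i j) k (j - Suc i, \<lambda>v \<in> cube (j - Suc i). v, t)
        \<in> cells (hom (Lc_cat (W_cat n)) i j) k"
      using ij ord t cube_id[of "j - Suc i"] by (intro Lc_class_in_cat[OF vcategory_W]) simp_all
    ultimately show "s \<in> snd (cube_comparison n) i j k ` cells (hom (Lc_cat (W_cat n)) i j) k"
      by (rule image_eqI)
  qed
qed

text \<open>On vertices both composites give the direct image along \<theta> of the same chain of
  subsets, on one side by \<open>W_map_image\<close> and on the other by the definition of
  \<open>C_map\<close>.\<close>

lemma comparison_natural:
  assumes \<theta>: "\<theta> \<in> arr Delta n m"
  shows "vf_comp (Lc_cat (W_cat n)) (cube_comparison m) (Lc_fun (W_cat n) (W_cat m) (W_map n m \<theta>)) =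
    vf_comp (Lc_cat (W_cat n)) (C_map n m \<theta>) (cube_comparison n)"
proof (rule vf_eqI[of "Lc_cat (W_cat n)"])
  have F: "cfun (W_cat n) (W_cat m) (W_map n m \<theta>)"
    and F0: "\<And>i. i \<le> n \<Longrightarrow> fst (W_map n m \<theta>) i = \<theta> i"
    and F1: "\<And>i j d c v. i \<le> j \<Longrightarrow> j \<le> n \<Longrightarrow> cube_arr d (j - Suc i) c \<Longrightarrow> length v = d \<Longrightarrow>
        sub (\<theta> i) (\<theta> j) (snd (W_map n m \<theta>) i j d c v) = \<theta> ` sub i j (c v)"
    using W_map_image[OF \<theta>] by (auto simp: W_image_def)
  show "fst (vf_comp (Lc_cat (W_cat n)) (cube_comparison m) (Lc_fun (W_cat n) (W_cat m) (W_map n m \<theta>))) i =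
      fst (vf_comp (Lc_cat (W_cat n)) (C_map n m \<theta>) (cube_comparison n)) i" if "i \<in> obj (Lc_cat (W_cat n))" for i
    using that arr_DeltaD(1)[OF \<theta>]
    by (simp add: fst_comparison fst_C_map fst_Lc_fun F0)
  show "snd (vf_comp (Lc_cat (W_cat n)) (cube_comparison m) (Lc_fun (W_cat n) (W_cat m) (W_map n m \<theta>))) i j k S =
      snd (vf_comp (Lc_cat (W_cat n)) (C_map n m \<theta>) (cube_comparison n)) i j k S"
    if ij: "i \<in> obj (Lc_cat (W_cat n))" "j \<in> obj (Lc_cat (W_cat n))" and S: "S \<in> cells (hom (Lc_cat (W_cat n)) i j) k" for i j k S
  proof (rule LW_cellE[OF ij[unfolded obj_LW] S])
    fix d a s assume *: "S = Lc_class (hom (W_cat n) i j) k (d, a, s)" "i \<le> j" "cube_arr d (j - Suc i) a" "s \<in> cells (ipow d) k"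
    have o: "i \<le> n" "j \<le> n" using ij by simp_all
    have b: "\<theta> i \<le> \<theta> j \<and> cube_arr d (\<theta> j - Suc (\<theta> i)) (snd (W_map n m \<theta>) i j d a)"
      using vfunctorD(3)[OF F, of i j a d] o * by (simp add: F0)
    have L: "snd (Lc_fun (W_cat n) (W_cat m) (W_map n m \<theta>)) i j k S =
        Lc_class (hom (W_cat m) (\<theta> i) (\<theta> j)) k (d, snd (W_map n m \<theta>) i j d a, s)"
      using snd_Lc_fun[OF vcategory_W vcategory_W F, of i j a d s k] o * by (simp add: F0)
    have "(\<lambda>p \<in> {0..k}. sub (\<theta> i) (\<theta> j) (snd (W_map n m \<theta>) i j d a (vert s p))) =
        (\<lambda>p \<in> {0..k}. \<theta> ` (\<lambda>p \<in> {0..k}. sub i j (a (vert s p))) p)"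
      using F1[OF *(2) o(2) *(3)] ipow_length[OF *(4)] by (intro restrict_ext) simp
    then show ?thesis
      using S ij o * b arr_DeltaD(1)[OF \<theta>] sub_vert_cell[OF *(2-4), of n]
      by (simp add: L[unfolded *(1)] snd_comparison fst_comparison fst_Lc_fun F0 snd_C_map)
  qed
qed simp_all

section \<open>The two adjunctions\<close>

lemma kan_cat_W: "simplicial_set X \<Longrightarrow> kan_cat Cube day_pure W_cat W_map X day day_pure"
  by (intro kan_cat.intro kan_data.intro kan_data_axioms.intro cosimp_W tensor_day)

lemma kan_cat_C: "simplicial_set X \<Longrightarrow> kan_cat Delta prod_pure C_cat C_map X psh_prod prod_pure"
  by (intro kan_cat.intro kan_data.intro kan_data_axioms.intro cosimp_C tensor_prod)

lemma kan_pair_W: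
  "simplicial_set X \<Longrightarrow> simplicial_set Y \<Longrightarrow> simplicial_map X Y f \<Longrightarrow>
   kan_pair Cube day_pure W_cat W_map X day day_pure Y day day_pure f"
  by (intro kan_pair.intro kan_pair_axioms.intro kan_cat_W)

lemma kan_pair_C:
  "simplicial_set X \<Longrightarrow> simplicial_set Y \<Longrightarrow> simplicial_map X Y f \<Longrightarrow>
   kan_pair Delta prod_pure C_cat C_map X psh_prod prod_pure Y psh_prod prod_pure f"
  by (intro kan_pair.intro kan_pair_axioms.intro kan_cat_C)

lemmas Wc_vcategory = kan_cat.kan_vcategory[OF kan_cat_W, folded Wc_def]
lemmas Wc_in_functor = kan_cat.kin_functor[OF kan_cat_W, folded Wc_def Wc_in_def]
lemmas Wc_in_cocone = kan_cat.kin_cocone[OF kan_cat_W, folded Wc_def Wc_in_def]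
lemmas Wc_eqI = kan_cat.kan_functor_eqI[OF kan_cat_W, folded Wc_def Wc_in_def]
lemmas Wc_fun_functor = kan_pair.km_functor[OF kan_pair_W, folded Wc_def Wc_fun_def]
lemmas Wc_fun_in = kan_pair.km_kin[OF kan_pair_W, folded Wc_fun_def Wc_in_def]
lemmas Wc_fun_id = kan_cat.kan_map_id[OF kan_cat_W, folded Wc_def Wc_fun_def]
lemmas Wc_fun_comp = kan_map_comp[OF kan_pair_W kan_pair_W, folded Wc_def Wc_fun_def]

lemmas Rig_vcategory = kan_cat.kan_vcategory[OF kan_cat_C, folded Rig_def]
lemmas Rig_pcat = kan_cat.kan_pcat[OF kan_cat_C, folded Rig_def]
lemmas Rig_in_functor = kan_cat.kin_functor[OF kan_cat_C, folded Rig_def Rig_in_def]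
lemmas Rig_in_cocone = kan_cat.kin_cocone[OF kan_cat_C, folded Rig_def Rig_in_def]
lemmas Rig_eqI = kan_cat.kan_functor_eqI[OF kan_cat_C, folded Rig_def Rig_in_def]
lemmas Rig_fun_functor = kan_pair.km_functor[OF kan_pair_C, folded Rig_def Rig_fun_def]
lemmas Rig_fun_in = kan_pair.km_kin[OF kan_pair_C, folded Rig_fun_def Rig_in_def]
lemmas Rig_fun_id = kan_cat.kan_map_id[OF kan_cat_C, folded Rig_def Rig_fun_def]
lemmas Rig_fun_comp = kan_map_comp[OF kan_pair_C kan_pair_C, folded Rig_def Rig_fun_def]

lemma Wc_lift:
  assumes "simplicial_set X" "pcat Cube pD D"
    and "\<And>n x. x \<in> cells X n \<Longrightarrow> vfunctor Cube day_pure pD (W_cat n) D (G n x)"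
    and "\<And>n m \<theta> y. \<theta> \<in> arr Delta n m \<Longrightarrow> y \<in> cells X m \<Longrightarrow>
      G n (act X n m \<theta> y) = vf_comp (W_cat n) (G m y) (W_map n m \<theta>)"
  obtains F where "vfunctor Cube day_pure pD (Wc X) D F"
    "\<And>n x. x \<in> cells X n \<Longrightarrow> vf_comp (W_cat n) F (Wc_in X n x) = G n x"
proof -
  interpret kan_cocone Cube day_pure W_cat W_map X day day_pure pD D G
    by (intro kan_cocone.intro kan_cocone_axioms.intro kan_cat_W assms)
  show thesis
    using that[of lift] lift_functor lift_kin by (simp add: Wc_def Wc_in_def)
qed

lemma Rig_lift:
  assumes "simplicial_set X" "pcat Delta pD D"
    and "\<And>n x. x \<in> cells X n \<Longrightarrow> vfunctor Delta prod_pure pD (C_cat n) D (G n x)"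
    and "\<And>n m \<theta> y. \<theta> \<in> arr Delta n m \<Longrightarrow> y \<in> cells X m \<Longrightarrow>
      G n (act X n m \<theta> y) = vf_comp (C_cat n) (G m y) (C_map n m \<theta>)"
  obtains F where "vfunctor Delta prod_pure pD (Rig X) D F"
    "\<And>n x. x \<in> cells X n \<Longrightarrow> vf_comp (C_cat n) F (Rig_in X n x) = G n x"
proof -
  interpret kan_cocone Delta prod_pure C_cat C_map X psh_prod prod_pure pD D G
    by (intro kan_cocone.intro kan_cocone_axioms.intro kan_cat_C assms)
  show thesis
    using that[of lift] lift_functor lift_kin by (simp add: Rig_def Rig_in_def)
qed

lemma Nc_nerve: "Nc C = nerve Cube day_pure day_pure W_cat W_map C"
  by (simp add: Nc_def nerve_def cubical_functor_def)

lemma Nc_map_nerve: "Nc_map C G = nerve_map Cube day_pure day_pure W_cat W_map C G"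
  by (rule ext) (simp add: Nc_map_def nerve_map_def Nc_nerve)

lemma Nhc_nerve: "Nhc D = nerve Delta prod_pure prod_pure C_cat C_map D"
  by (simp add: Nhc_def nerve_def simplicial_functor_def)

lemma Nhc_map_nerve: "Nhc_map D G = nerve_map Delta prod_pure prod_pure C_cat C_map D G"
  by (rule ext) (simp add: Nhc_map_def nerve_map_def Nhc_nerve)

lemma simplicial_category_pcat: "simplicial_category D \<Longrightarrow> pcat Delta prod_pure D"
  unfolding simplicial_category_def by (rule tensor.vcategory_pcat[OF tensor_prod])

lemma CN_adjunction: "adjunction (CN_adj :: ('x, 'o, 'b, _, _, _) sadj)"
proof -
  let ?P = "CN_adj :: ('x, 'o, 'b, _, _, _) sadj"
  have l: "lobj ?P = Rig" "lmap ?P = Rig_fun"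
    and r: "robj ?P = nerve Delta prod_pure prod_pure C_cat C_map"
      "rmap ?P = (\<lambda>D E. nerve_map Delta prod_pure prod_pure C_cat C_map D)"
    and t: "transp ?P = (\<lambda>X D. nerve_transpose Delta prod_pure C_cat C_map X)"
    by (simp_all add: CN_adj_def Nhc_nerve[abs_def] Nhc_map_nerve[abs_def])
  have "left_functor ?P"
    unfolding left_functor_def l simplicial_category_def simplicial_functor_def
    by (intro conjI allI impI Rig_vcategory Rig_fun_id Rig_fun_functor Rig_fun_comp)
  moreover have "right_functor ?P"
    unfolding right_functor_def r simplicial_category_def simplicial_functor_def
    by (intro conjI allI impI cosimp.nerve_sset[OF cosimp_C] cosimp.nerve_map_id[OF cosimp_C]
        cosimp.nerve_map_psh[OF cosimp_C] cosimp.nerve_map_comp[OF cosimp_C])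
  moreover have "bij_betw (transp ?P X D) {F. simplicial_functor (lobj ?P X) D F} {g. simplicial_map X (robj ?P D) g}"
    if "simplicial_set X" "simplicial_category D" for X D
    using kan_cat.tr_bij[OF kan_cat_C[OF that(1)] simplicial_category_pcat[OF that(2)]]
    unfolding l r t simplicial_functor_def Rig_def .
  moreover have "transp ?P X D (vf_comp (lobj ?P X) F (lmap ?P X Y f)) = psh_comp X (transp ?P Y D F) f"
    if "simplicial_set X" "simplicial_set Y" "simplicial_map X Y f" "simplicial_functor (lobj ?P Y) D F" for X Y D f F
    using kan_pair.tr_pre[OF kan_pair_C[OF that(1-3)]] that(4)
    unfolding l r t simplicial_functor_def Rig_def Rig_fun_def by blast
  moreover have "transp ?P X E (vf_comp (lobj ?P X) H F) = psh_comp X (rmap ?P D E H) (transp ?P X D F)"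
    if "simplicial_set X" "simplicial_functor (lobj ?P X) D F" for X D E F H
    using kan_cat.tr_post[OF kan_cat_C[OF that(1)]] that(2)
    unfolding l r t simplicial_functor_def Rig_def by blast
  ultimately show ?thesis
    unfolding adjunction_def by blast
qed

text \<open>Two adjunctions are composed: the transposition is \<open>Lc_transpose\<close> followed
  by the nerve transposition for \<open>Wc\<close>, and its bijectivity and naturality are inherited
  from both.\<close>

lemma LW_adjunction: "adjunction (LW_adj :: ('x, 'o, 'b, _, _, _) sadj)"
proof -
  let ?P = "LW_adj :: ('x, 'o, 'b, _, _, _) sadj"
  let ?N = "nerve Cube day_pure day_pure W_cat W_map"
  let ?Nm = "nerve_map Cube day_pure day_pure W_cat W_map"
  let ?tr = "nerve_transpose Cube day_pure W_cat W_map"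
  have l: "lobj ?P = (\<lambda>X. Lc_cat (Wc X))" "lmap ?P = (\<lambda>X Y f. Lc_fun (Wc X) (Wc Y) (Wc_fun X Y f))"
    and r: "robj ?P = (\<lambda>D. ?N (Rc_cat D))" "rmap ?P = (\<lambda>D E H. ?Nm (Rc_cat D) (Rc_fun D H))"
    and t: "transp ?P = (\<lambda>X D F. ?tr X (Lc_transpose (Wc X) F))"
    by (simp_all add: LW_adj_def Nc_nerve[abs_def] Nc_map_nerve[abs_def])
  have "left_functor ?P"
    unfolding left_functor_def l simplicial_category_def simplicial_functor_def
  proof (intro conjI allI impI)
    fix X Y Z :: "'x sset" and f g
    assume X: "simplicial_set X"
    show "scategory (Lc_cat (Wc X))"
      by (rule vcategory_Lc_cat[OF Wc_vcategory[OF X]])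
    show "Lc_fun (Wc X) (Wc X) (Wc_fun X X (psh_id X)) = vf_id (Lc_cat (Wc X))"
      using Wc_fun_id[OF X] Lc_fun_id[OF Wc_vcategory[OF X]] by simp
    assume Y: "simplicial_set Y"
    {
      assume f: "simplicial_map X Y f"
      show "sfun (Lc_cat (Wc X)) (Lc_cat (Wc Y)) (Lc_fun (Wc X) (Wc Y) (Wc_fun X Y f))"
        by (rule Lc_fun_functor[OF Wc_vcategory[OF X] Wc_vcategory[OF Y] Wc_fun_functor[OF X Y f]])
    }
    assume Z: "simplicial_set Z" and f: "simplicial_map X Y f" and g: "simplicial_map Y Z g"
    show "Lc_fun (Wc X) (Wc Z) (Wc_fun X Z (psh_comp X g f)) =
        vf_comp (Lc_cat (Wc X)) (Lc_fun (Wc Y) (Wc Z) (Wc_fun Y Z g)) (Lc_fun (Wc X) (Wc Y) (Wc_fun X Y f))"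
      using Wc_fun_comp[OF X Y f Y Z g]
        Lc_fun_comp[OF Wc_vcategory[OF X] Wc_vcategory[OF Y] Wc_vcategory[OF Z] Wc_fun_functor[OF X Y f] Wc_fun_functor[OF Y Z g]]
      by simp
  qed
  moreover have "right_functor ?P"
    unfolding right_functor_def r simplicial_category_def simplicial_functor_def
  proof (intro conjI allI impI)
    fix D :: "('o, 'b) scat" assume D: "scategory D"
    show "simplicial_set (?N (Rc_cat D))" by (rule cosimp.nerve_sset[OF cosimp_W])
    show "?Nm (Rc_cat D) (Rc_fun D (vf_id D)) = psh_id (?N (Rc_cat D))"
      by (simp add: Rc_fun_id[OF D] cosimp.nerve_map_id[OF cosimp_W])
  next
    fix D E :: "('o, 'b) scat" and H
    assume "scategory D" "scategory E"
      "sfun D E H"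
    then show "simplicial_map (?N (Rc_cat D)) (?N (Rc_cat E)) (?Nm (Rc_cat D) (Rc_fun D H))"
      by (intro cosimp.nerve_map_psh[OF cosimp_W] Rc_fun_functor)
  next
    fix C D E :: "('o, 'b) scat" and G H
    assume *: "scategory C" "scategory D"
      "scategory E"
      "sfun C D G" "sfun D E H"
    show "?Nm (Rc_cat C) (Rc_fun C (vf_comp C H G)) =
        psh_comp (?N (Rc_cat C)) (?Nm (Rc_cat D) (Rc_fun D H)) (?Nm (Rc_cat C) (Rc_fun C G))"
      unfolding Rc_fun_comp[OF *(1,2,4)]
      by (rule cosimp.nerve_map_comp[OF cosimp_W Rc_fun_functor[OF *(1,2,4)]])
  qed
  moreover have "bij_betw (transp ?P X D) {F. simplicial_functor (lobj ?P X) D F} {g. simplicial_map X (robj ?P D) g}"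
    if X: "simplicial_set X" and D: "simplicial_category D" for X D
  proof -
    have D': "scategory D" using D by (simp add: simplicial_category_def)
    have "transp ?P X D = ?tr X \<circ> Lc_transpose (Wc X)" by (simp add: t fun_eq_iff)
    moreover have "bij_betw (?tr X) {G. cfun (Wc X) (Rc_cat D) G}
        {g. simplicial_map X (?N (Rc_cat D)) g}"
      using kan_cat.tr_bij[OF kan_cat_W[OF X] pcat_Rc_cat[OF D']] by (simp add: Wc_def)
    ultimately show ?thesis
      using bij_betw_trans[OF Lc_transpose_bij[OF Wc_vcategory[OF X] D']]
      by (simp add: l r simplicial_functor_def)
  qed
  moreover have "transp ?P X D (vf_comp (lobj ?P X) F (lmap ?P X Y f)) = psh_comp X (transp ?P Y D F) f"
    if X: "simplicial_set X" and Y: "simplicial_set Y" and D: "simplicial_category D"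
      and f: "simplicial_map X Y f" and F: "simplicial_functor (lobj ?P Y) D F" for X Y D f F
  proof -
    have D': "scategory D" using D by (simp add: simplicial_category_def)
    have F': "cfun (Wc Y) (Rc_cat D) (Lc_transpose (Wc Y) F)"
      using Lc_transpose_functor[OF Wc_vcategory[OF Y] D'] F by (simp add: l simplicial_functor_def)
    have "?tr X (vf_comp (Wc X) (Lc_transpose (Wc Y) F) (Wc_fun X Y f)) = psh_comp X (?tr Y (Lc_transpose (Wc Y) F)) f"
      using kan_pair.tr_pre[OF kan_pair_W[OF X Y f]] F' by (simp add: Wc_def Wc_fun_def)
    then show ?thesis
      by (simp add: l t Lc_transpose_pre[OF Wc_vcategory[OF X] Wc_vcategory[OF Y] Wc_fun_functor[OF X Y f]])
  qed
  moreover have "transp ?P X E (vf_comp (lobj ?P X) H F) = psh_comp X (rmap ?P D E H) (transp ?P X D F)"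
    if X: "simplicial_set X" and D: "simplicial_category D" and F: "simplicial_functor (lobj ?P X) D F" for X D E F H
  proof -
    have D': "scategory D" using D by (simp add: simplicial_category_def)
    have F0: "sfun (Lc_cat (Wc X)) D F"
      using F by (simp add: l simplicial_functor_def)
    have F': "cfun (Wc X) (Rc_cat D) (Lc_transpose (Wc X) F)"
      by (rule Lc_transpose_functor[OF Wc_vcategory[OF X] D' F0])
    have "?tr X (vf_comp (Wc X) (Rc_fun D H) (Lc_transpose (Wc X) F)) =
        psh_comp X (?Nm (Rc_cat D) (Rc_fun D H)) (?tr X (Lc_transpose (Wc X) F))"
      using kan_cat.tr_post[OF kan_cat_W[OF X]] F' by (simp add: Wc_def)
    then show ?thesis
      by (simp add: l r t Lc_transpose_post[OF Wc_vcategory[OF X] D' F0])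
  qed
  ultimately show ?thesis
    unfolding adjunction_def by blast
qed


section \<open>The comparison of the adjunctions\<close>

abbreviation "LW n \<equiv> Lc_cat (W_cat n)"
abbreviation "LW_in X n x \<equiv> Lc_fun (W_cat n) (Wc X) (Wc_in X n x)"
lemma pcat_LW: "pcat Delta prod_pure (LW n)"
  by (rule pcat_Lc_cat[OF vcategory_W])

lemma vcategory_LWc: "simplicial_set X \<Longrightarrow> scategory (Lc_cat (Wc X))"
  by (rule vcategory_Lc_cat[OF Wc_vcategory])

lemma pcat_LWc: "simplicial_set X \<Longrightarrow> pcat Delta prod_pure (Lc_cat (Wc X))"
  by (rule pcat_Lc_cat[OF Wc_vcategory])

lemma LW_in_functor: "simplicial_set X \<Longrightarrow> x \<in> cells X n \<Longrightarrow> sfun (LW n) (Lc_cat (Wc X)) (LW_in X n x)"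
  by (intro Lc_fun_functor vcategory_W Wc_vcategory Wc_in_functor)

lemma Lc_transpose_LW_in:
  assumes "simplicial_set X" "x \<in> cells X n"
  shows "vf_comp (W_cat n) (Lc_transpose (Wc X) F) (Wc_in X n x) =
    Lc_transpose (W_cat n) (vf_comp (LW n) F (LW_in X n x))"
  by (rule Lc_transpose_pre[symmetric, OF vcategory_W Wc_vcategory[OF assms(1)] Wc_in_functor[OF assms]])

lemma LW_map_functor: "\<theta> \<in> arr Delta n m \<Longrightarrow> sfun (LW n) (LW m) (Lc_fun (W_cat n) (W_cat m) (W_map n m \<theta>))"
  by (intro Lc_fun_functor vcategory_W cosimp.Am_functor[OF cosimp_W])

lemma LW_in_cocone:
  assumes "simplicial_set X" "\<theta> \<in> arr Delta n m" "y \<in> cells X m"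
  shows "LW_in X n (act X n m \<theta> y) = vf_comp (LW n) (LW_in X m y) (Lc_fun (W_cat n) (W_cat m) (W_map n m \<theta>))"
  unfolding Wc_in_cocone[OF assms]
  by (intro Lc_fun_comp vcategory_W Wc_vcategory cosimp.Am_functor[OF cosimp_W] Wc_in_functor assms)

lemma LW_eqI:
  assumes X: "simplicial_set X" and D: "scategory D"
    and F: "sfun (Lc_cat (Wc X)) D F" "sfun (Lc_cat (Wc X)) D F'"
    and eq: "\<And>n x. x \<in> cells X n \<Longrightarrow> vf_comp (LW n) F (LW_in X n x) = vf_comp (LW n) F' (LW_in X n x)"
  shows "F = F'"
proof (rule Lc_functor_eqI[OF Wc_vcategory[OF X] vfunctorD(7)[OF F(1)] vfunctorD(7)[OF F(2)]])
  show "Lc_transpose (Wc X) F = Lc_transpose (Wc X) F'"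
    by (rule Wc_eqI[OF X Lc_transpose_functor[OF Wc_vcategory[OF X] D F(1)]
          Lc_transpose_functor[OF Wc_vcategory[OF X] D F(2)]])
      (simp only: Lc_transpose_LW_in[OF X] eq)
qed

text \<open>Preservation of the colimit made explicit: the cocone is transposed to cubical
  categories, factored there through \<open>Wc X\<close>, and the factorisation is transposed back.
  \<open>Lc_transpose_pre\<close> carries the cocone condition across.\<close>

lemma LW_lift:
  assumes X: "simplicial_set X" and D: "scategory D"
    and G: "\<And>n x. x \<in> cells X n \<Longrightarrow> sfun (LW n) D (G n x)"
    and cocone: "\<And>n m \<theta> y. \<theta> \<in> arr Delta n m \<Longrightarrow> y \<in> cells X m \<Longrightarrow>
      G n (act X n m \<theta> y) = vf_comp (LW n) (G m y) (Lc_fun (W_cat n) (W_cat m) (W_map n m \<theta>))"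
  obtains F where "sfun (Lc_cat (Wc X)) D F"
    "\<And>n x. x \<in> cells X n \<Longrightarrow> vf_comp (LW n) F (LW_in X n x) = G n x"
proof -
  have 1: "cfun (W_cat n) (Rc_cat D) (Lc_transpose (W_cat n) (G n x))"
    if "x \<in> cells X n" for n x
    by (rule Lc_transpose_functor[OF vcategory_W D G[OF that]])
  have 2: "Lc_transpose (W_cat n) (G n (act X n m \<theta> y)) =
      vf_comp (W_cat n) (Lc_transpose (W_cat m) (G m y)) (W_map n m \<theta>)"
    if "\<theta> \<in> arr Delta n m" "y \<in> cells X m" for n m \<theta> y
    unfolding cocone[OF that]
    by (rule Lc_transpose_pre[OF vcategory_W vcategory_W cosimp.Am_functor[OF cosimp_W that(1)]])
  obtain F' where F': "cfun (Wc X) (Rc_cat D) F'"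
    "\<And>n x. x \<in> cells X n \<Longrightarrow> vf_comp (W_cat n) F' (Wc_in X n x) = Lc_transpose (W_cat n) (G n x)"
    using Wc_lift[OF X pcat_Rc_cat[OF D], of "\<lambda>n x. Lc_transpose (W_cat n) (G n x)", OF 1 2] by blast
  obtain F where F: "sfun (Lc_cat (Wc X)) D F" "Lc_transpose (Wc X) F = F'"
    using Lc_transpose_surj[OF Wc_vcategory[OF X] D F'(1)] by blast
  have "vf_comp (LW n) F (LW_in X n x) = G n x" if "x \<in> cells X n" for n x
  proof (rule Lc_functor_eqI[OF vcategory_W])
    show "Lc_transpose (W_cat n) (vf_comp (LW n) F (LW_in X n x)) = Lc_transpose (W_cat n) (G n x)"
      using Lc_transpose_LW_in[OF X that, of F] F'(2)[OF that] by (simp add: F(2))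
  qed (simp_all add: vfunctorD(7)[OF G[OF that]])
  with F(1) that show thesis by blast
qed

lemma comparison_inverse:
  obtains \<kappa> where "sfun (C_cat n) (LW n) \<kappa>" "vf_comp (LW n) \<kappa> (cube_comparison n) = vf_id (LW n)"
    "vf_comp (C_cat n) (cube_comparison n) \<kappa> = vf_id (C_cat n)"
proof (rule vfunctor_inverse[OF pcat_LW comparison_functor])
  have "{i. i \<le> n} = obj (LW n)" "{i. i \<le> n} = obj (C_cat n)" by auto
  then show "bij_betw (fst (cube_comparison n)) (obj (LW n)) (obj (C_cat n))"
    using bij_betw_cong[of "obj (LW n)" "fst (cube_comparison n)" "\<lambda>i. i" "obj (C_cat n)"]
    by (simp add: fst_comparison bij_betw_def)
  show "bij_betw (snd (cube_comparison n) x y k) (cells (hom (LW n) x y) k)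
      (cells (hom (C_cat n) (fst (cube_comparison n) x) (fst (cube_comparison n) y)) k)"
    if "x \<in> obj (LW n)" "y \<in> obj (LW n)" for x y k
    using comparison_bij[of x n y k] that by (simp add: fst_comparison)
qed (rule that)

text \<open>Naturality after composing with an arbitrary \<open>G\<close>. It yields both the cocone
  behind the left comparison and the simplicial naturality of the comparison of nerves.\<close>

lemma comparison_natural_comp:
  assumes X: "\<theta> \<in> arr Delta n m"
  shows "vf_comp (LW n) (vf_comp (C_cat n) G (C_map n m \<theta>)) (cube_comparison n) =
    vf_comp (LW n) (vf_comp (LW m) G (cube_comparison m)) (Lc_fun (W_cat n) (W_cat m) (W_map n m \<theta>))"
  by (simp only: vf_comp_assoc[OF comparison_functor, symmetric] comparison_natural[OF X, symmetric]
      vf_comp_assoc[OF LW_map_functor[OF X]])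

lemma left_comparison:
  assumes X: "simplicial_set X"
  obtains F where "sfun (Lc_cat (Wc X)) (Rig X) F"
    "\<And>n x. x \<in> cells X n \<Longrightarrow> vf_comp (LW n) F (LW_in X n x) = vf_comp (LW n) (Rig_in X n x) (cube_comparison n)"
proof (rule LW_lift[OF X Rig_vcategory[OF X], of "\<lambda>n x. vf_comp (LW n) (Rig_in X n x) (cube_comparison n)"])
  show "sfun (LW n) (Rig X) (vf_comp (LW n) (Rig_in X n x) (cube_comparison n))" if "x \<in> cells X n" for n x
    by (rule vfunctor_comp[OF pcat_LW comparison_functor Rig_in_functor[OF X that]])
  show "vf_comp (LW n) (Rig_in X n (act X n m \<theta> y)) (cube_comparison n) =
      vf_comp (LW n) (vf_comp (LW m) (Rig_in X m y) (cube_comparison m)) (Lc_fun (W_cat n) (W_cat m) (W_map n m \<theta>))"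
    if "\<theta> \<in> arr Delta n m" "y \<in> cells X m" for n m \<theta> y
    unfolding Rig_in_cocone[OF X that] by (rule comparison_natural_comp[OF that(1)])
qed (rule that)

text \<open>The chosen functor is the only one with this property when \<open>X\<close> is a
  simplicial set, by \<open>LW_eqI\<close>; the choice operator merely names it.\<close>

definition left_iso :: "'x sset \<Rightarrow> ('x w_obj, 'x c_obj, 'x w_hom Lc_cell, 'x c_hom) efun" where
  "left_iso X = (SOME F. sfun (Lc_cat (Wc X)) (Rig X) F \<and>
     (\<forall>n x. x \<in> cells X n \<longrightarrow>
        vf_comp (LW n) F (LW_in X n x) = vf_comp (LW n) (Rig_in X n x) (cube_comparison n)))"

lemma
  assumes X: "simplicial_set X"
  shows left_iso_functor: "sfun (Lc_cat (Wc X)) (Rig X) (left_iso X)"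
    and left_iso_in: "x \<in> cells X n \<Longrightarrow>
      vf_comp (LW n) (left_iso X) (LW_in X n x) = vf_comp (LW n) (Rig_in X n x) (cube_comparison n)"
proof -
  have "\<exists>F. sfun (Lc_cat (Wc X)) (Rig X) F \<and> (\<forall>n x. x \<in> cells X n \<longrightarrow>
      vf_comp (LW n) F (LW_in X n x) = vf_comp (LW n) (Rig_in X n x) (cube_comparison n))"
    by (rule left_comparison[OF X]) blast
  from someI_ex[OF this, folded left_iso_def]
  show "sfun (Lc_cat (Wc X)) (Rig X) (left_iso X)"
    and "x \<in> cells X n \<Longrightarrow>
      vf_comp (LW n) (left_iso X) (LW_in X n x) = vf_comp (LW n) (Rig_in X n x) (cube_comparison n)"
    by blast+
qed

text \<open>The inverses of the comparisons on standard simplices are again compatible with the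
  cosimplicial structure, so they induce a functor in the opposite direction. Both composites
  restrict to the cocones themselves and hence are identities.\<close>

lemma left_iso_inverse:
  assumes X: "simplicial_set X"
  obtains G where "sfun (Rig X) (Lc_cat (Wc X)) G"
    "vf_comp (Lc_cat (Wc X)) G (left_iso X) = vf_id (Lc_cat (Wc X))"
    "vf_comp (Rig X) (left_iso X) G = vf_id (Rig X)"
proof -
  have "\<exists>\<kappa>. \<forall>n. sfun (C_cat n) (LW n) (\<kappa> n) \<and> vf_comp (LW n) (\<kappa> n) (cube_comparison n) = vf_id (LW n) \<and>
      vf_comp (C_cat n) (cube_comparison n) (\<kappa> n) = vf_id (C_cat n)"
    by (rule choice, rule allI) (rule comparison_inverse, blast)
  then obtain \<kappa> where \<kappa>: "\<And>n. sfun (C_cat n) (LW n) (\<kappa> n)"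
    "\<And>n. vf_comp (LW n) (\<kappa> n) (cube_comparison n) = vf_id (LW n)"
    "\<And>n. vf_comp (C_cat n) (cube_comparison n) (\<kappa> n) = vf_id (C_cat n)" by blast
  note L = LW_in_functor[OF X] and R = Rig_in_functor[OF X]
  let ?G = "\<lambda>n x. vf_comp (C_cat n) (LW_in X n x) (\<kappa> n)"
  have 1: "sfun (C_cat n) (Lc_cat (Wc X)) (?G n x)" if "x \<in> cells X n" for n x
    by (rule vfunctor_comp[OF pcat_C \<kappa>(1) L[OF that]])
  have 2: "?G n (act X n m \<theta> y) = vf_comp (C_cat n) (?G m y) (C_map n m \<theta>)"
    if \<theta>: "\<theta> \<in> arr Delta n m" and y: "y \<in> cells X m" for n m \<theta> y
  proof -
    note T = LW_map_functor[OF \<theta>] and Cm = C_map_functor[OF \<theta>]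
    let ?T = "Lc_fun (W_cat n) (W_cat m) (W_map n m \<theta>)"
    \<comment> \<open>Naturality of the inverse by conjugation: insert the identity as \<kappa> m
      after the comparison, apply \<open>comparison_natural\<close>, and cancel the comparison
      against \<kappa> n.\<close>
    have "vf_comp (C_cat n) ?T (\<kappa> n) = vf_comp (C_cat n) (vf_comp (LW n) (vf_id (LW m)) ?T) (\<kappa> n)"
      by (simp only: vf_comp_id_left[OF T])
    also have "\<dots> = vf_comp (C_cat n) (vf_comp (LW n) (\<kappa> m) (vf_comp (LW n) (cube_comparison m) ?T)) (\<kappa> n)"
      by (simp only: \<kappa>(2)[symmetric] vf_comp_assoc[OF T])
    also have "\<dots> = vf_comp (C_cat n) (\<kappa> m) (vf_comp (C_cat n) (C_map n m \<theta>) (vf_comp (C_cat n) (cube_comparison n) (\<kappa> n)))"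
      by (simp only: comparison_natural[OF \<theta>] vf_comp_assoc[OF \<kappa>(1)] vf_comp_assoc[OF comparison_functor]
          vf_comp_assoc[OF vfunctor_comp[OF pcat_C \<kappa>(1) comparison_functor]])
    also have "\<dots> = vf_comp (C_cat n) (\<kappa> m) (C_map n m \<theta>)"
      by (simp only: \<kappa>(3) vf_comp_id_right[OF vfunctorD(7)[OF Cm]])
    finally have "vf_comp (C_cat n) ?T (\<kappa> n) = vf_comp (C_cat n) (\<kappa> m) (C_map n m \<theta>)" .
    then show ?thesis
      by (simp only: LW_in_cocone[OF X \<theta> y] vf_comp_assoc[OF \<kappa>(1), symmetric] vf_comp_assoc[OF Cm, symmetric])
  qed
  obtain G where G: "sfun (Rig X) (Lc_cat (Wc X)) G"
    "\<And>n x. x \<in> cells X n \<Longrightarrow> vf_comp (C_cat n) G (Rig_in X n x) = ?G n x"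
    using Rig_lift[OF X pcat_LWc[OF X], of ?G, OF 1 2] by blast
  have "vf_comp (Lc_cat (Wc X)) G (left_iso X) = vf_id (Lc_cat (Wc X))"
  proof (rule LW_eqI[OF X vcategory_LWc[OF X] vfunctor_comp[OF pcat_LWc[OF X] left_iso_functor[OF X] G(1)]
        vfunctor_id[OF pcat_LWc[OF X]]])
    fix n x assume x: "x \<in> cells X n"
    have "vf_comp (LW n) (vf_comp (Lc_cat (Wc X)) G (left_iso X)) (LW_in X n x) =
        vf_comp (LW n) (vf_comp (C_cat n) G (Rig_in X n x)) (cube_comparison n)"
      by (simp only: vf_comp_assoc[OF L[OF x], symmetric] left_iso_in[OF X x] vf_comp_assoc[OF comparison_functor])
    also have "\<dots> = vf_comp (LW n) (LW_in X n x) (vf_comp (LW n) (\<kappa> n) (cube_comparison n))"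
      by (simp only: G(2)[OF x] vf_comp_assoc[OF comparison_functor])
    also have "\<dots> = vf_comp (LW n) (vf_id (Lc_cat (Wc X))) (LW_in X n x)"
      by (simp only: \<kappa>(2) vf_comp_id_right[OF vfunctorD(7)[OF L[OF x]]] vf_comp_id_left[OF L[OF x]])
    finally show "vf_comp (LW n) (vf_comp (Lc_cat (Wc X)) G (left_iso X)) (LW_in X n x) =
        vf_comp (LW n) (vf_id (Lc_cat (Wc X))) (LW_in X n x)" .
  qed
  moreover have "vf_comp (Rig X) (left_iso X) G = vf_id (Rig X)"
  proof (rule Rig_eqI[OF X vfunctor_comp[OF Rig_pcat[OF X] G(1) left_iso_functor[OF X]] vfunctor_id[OF Rig_pcat[OF X]]])
    fix n x assume x: "x \<in> cells X n"
    have "vf_comp (C_cat n) (vf_comp (Rig X) (left_iso X) G) (Rig_in X n x) =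
        vf_comp (C_cat n) (left_iso X) (vf_comp (C_cat n) (LW_in X n x) (\<kappa> n))"
      by (simp only: vf_comp_assoc[OF R[OF x], symmetric] G(2)[OF x])
    also have "\<dots> = vf_comp (C_cat n) (vf_comp (LW n) (Rig_in X n x) (cube_comparison n)) (\<kappa> n)"
      by (simp only: vf_comp_assoc[OF \<kappa>(1)] left_iso_in[OF X x])
    also have "\<dots> = vf_comp (C_cat n) (vf_id (Rig X)) (Rig_in X n x)"
      by (simp only: vf_comp_assoc[OF \<kappa>(1), symmetric] \<kappa>(3) vf_comp_id_right[OF vfunctorD(7)[OF R[OF x]]]
          vf_comp_id_left[OF R[OF x]])
    finally show "vf_comp (C_cat n) (vf_comp (Rig X) (left_iso X) G) (Rig_in X n x) =
        vf_comp (C_cat n) (vf_id (Rig X)) (Rig_in X n x)" .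
  qed
  ultimately show thesis using G(1) that by blast
qed

lemma left_iso_natural:
  assumes X: "simplicial_set X" and Y: "simplicial_set Y" and f: "simplicial_map X Y f"
  shows "vf_comp (Lc_cat (Wc X)) (Rig_fun X Y f) (left_iso X) =
    vf_comp (Lc_cat (Wc X)) (left_iso Y) (Lc_fun (Wc X) (Wc Y) (Wc_fun X Y f))"
proof -
  let ?f = "Lc_fun (Wc X) (Wc Y) (Wc_fun X Y f)"
  have Lf: "sfun (Lc_cat (Wc X)) (Lc_cat (Wc Y)) ?f"
    by (rule Lc_fun_functor[OF Wc_vcategory[OF X] Wc_vcategory[OF Y] Wc_fun_functor[OF X Y f]])
  show ?thesis
  proof (rule LW_eqI[OF X Rig_vcategory[OF Y]
        vfunctor_comp[OF pcat_LWc[OF X] left_iso_functor[OF X] Rig_fun_functor[OF X Y f]]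
        vfunctor_comp[OF pcat_LWc[OF X] Lf left_iso_functor[OF Y]]])
    fix n x assume x: "x \<in> cells X n"
    note L = LW_in_functor[OF X x] and fx = psh_mapD(1)[OF f x]
    have in_f: "vf_comp (LW n) ?f (LW_in X n x) = LW_in Y n (f n x)"
      using Lc_fun_comp[OF vcategory_W Wc_vcategory[OF X] Wc_vcategory[OF Y] Wc_in_functor[OF X x] Wc_fun_functor[OF X Y f]]
      by (simp only: Wc_fun_in[OF X Y f x])
    have "vf_comp (LW n) (vf_comp (Lc_cat (Wc X)) (Rig_fun X Y f) (left_iso X)) (LW_in X n x) =
        vf_comp (LW n) (vf_comp (C_cat n) (Rig_fun X Y f) (Rig_in X n x)) (cube_comparison n)"
      by (simp only: vf_comp_assoc[OF L, symmetric] left_iso_in[OF X x] vf_comp_assoc[OF comparison_functor])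
    also have "\<dots> = vf_comp (LW n) (vf_comp (Lc_cat (Wc X)) (left_iso Y) ?f) (LW_in X n x)"
      by (simp only: vf_comp_assoc[OF L, symmetric] in_f left_iso_in[OF Y fx] Rig_fun_in[OF X Y f x])
    finally show "vf_comp (LW n) (vf_comp (Lc_cat (Wc X)) (Rig_fun X Y f) (left_iso X)) (LW_in X n x) =
        vf_comp (LW n) (vf_comp (Lc_cat (Wc X)) (left_iso Y) ?f) (LW_in X n x)" .
  qed
qed

text \<open>The mate of \<open>left_iso\<close>, written out: an \<open>n\<close>-simplex of the
  coherent nerve is a functor on \<open>C_cat n\<close>; it is precomposed with the comparison and
  then transposed along triangulation.\<close>

definition right_iso ::
  "('o, 'b) scat \<Rightarrow> nat \<Rightarrow> (nat, 'o, nat \<Rightarrow> nat set, 'b) efun \<Rightarrow> (nat, 'o, cmap, nat \<Rightarrow> isimp \<Rightarrow> 'b) efun" where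
  "right_iso D n = (\<lambda>G \<in> cells (Nhc D) n. Lc_transpose (W_cat n) (vf_comp (LW n) G (cube_comparison n)))"

lemma cells_Nhc: "G \<in> cells (Nhc D) n \<longleftrightarrow> sfun (C_cat n) D G"
  by (simp add: Nhc_def simplicial_functor_def)

lemma cells_Nc: "G \<in> cells (Nc C) n \<longleftrightarrow> cfun (W_cat n) C G"
  by (simp add: Nc_def cubical_functor_def)

lemma sset_iso_if_bij:
  assumes X: "presheaf Delta X" and \<phi>: "psh_map Delta X Y \<phi>"
    and b: "\<And>n. bij_betw (\<phi> n) (cells X n) (cells Y n)"
  shows "sset_iso X Y \<phi>"
proof -
  define \<psi> where "\<psi> = (\<lambda>n. \<lambda>y \<in> cells Y n. inv_into (cells X n) (\<phi> n) y)"
  have \<psi>: "\<psi> n y \<in> cells X n" "\<phi> n (\<psi> n y) = y" if "y \<in> cells Y n" for n y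
    using that bij_betw_imp_surj_on[OF b[of n]]
    by (auto simp: \<psi>_def intro: inv_into_into f_inv_into_f)
  have \<psi>\<phi>: "\<psi> n (\<phi> n x) = x" if "x \<in> cells X n" for n x
    using that bij_betw_imp_inj_on[OF b[of n]] psh_mapD(1)[OF \<phi> that] by (simp add: \<psi>_def)
  have "psh_map Delta Y X \<psi>"
  proof (rule psh_mapI)
    show "\<psi> m (act Y m n f y) = act X m n f (\<psi> n y)" if "f \<in> arr Delta m n" "y \<in> cells Y n" for m n f y
      using \<psi>\<phi>[OF presheafD(1)[OF X that(1) \<psi>(1)[OF that(2)]]]
      by (simp add: psh_mapD(3)[OF \<phi> that(1) \<psi>(1)[OF that(2)]] \<psi>(2)[OF that(2)])
  qed (simp_all add: \<psi>(1), simp add: \<psi>_def)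
  moreover have "psh_comp X \<psi> \<phi> = psh_id X"
    by (rule psh_map_eqI[of _ X]) (simp_all add: \<psi>\<phi>)
  moreover have "psh_comp Y \<phi> \<psi> = psh_id Y"
    by (rule psh_map_eqI[of _ Y]) (simp_all add: \<psi>)
  ultimately show ?thesis
    unfolding sset_iso_def using \<phi> by blast
qed

lemma right_iso_apply:
  "sfun (C_cat n) D G \<Longrightarrow> right_iso D n G = Lc_transpose (W_cat n) (vf_comp (LW n) G (cube_comparison n))"
  by (simp add: right_iso_def cells_Nhc)

lemma right_iso_map:
  assumes D: "scategory D"
  shows "simplicial_map (Nhc D) (Nc (Rc_cat D)) (right_iso D)"
proof (rule psh_mapI)
  show "right_iso D n G \<in> cells (Nc (Rc_cat D)) n" if "G \<in> cells (Nhc D) n" for n G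
    using that Lc_transpose_functor[OF vcategory_W D vfunctor_comp[OF pcat_LW comparison_functor]]
    by (simp add: cells_Nhc cells_Nc right_iso_apply)
  show "right_iso D n \<in> extensional (cells (Nhc D) n)" for n by (simp add: right_iso_def)
  show "right_iso D n (act (Nhc D) n m \<theta> G) = act (Nc (Rc_cat D)) n m \<theta> (right_iso D m G)"
    if \<theta>: "\<theta> \<in> arr Delta n m" and G: "G \<in> cells (Nhc D) m" for n m \<theta> G
  proof -
    have G': "sfun (C_cat m) D G" using G by (simp add: cells_Nhc)
    have "right_iso D n (vf_comp (C_cat n) G (C_map n m \<theta>)) =
        vf_comp (W_cat n) (right_iso D m G) (W_map n m \<theta>)"
      unfolding right_iso_apply[OF vfunctor_comp[OF pcat_C C_map_functor[OF \<theta>] G']] right_iso_apply[OF G']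
        comparison_natural_comp[OF \<theta>]
      by (rule Lc_transpose_pre[OF vcategory_W vcategory_W cosimp.Am_functor[OF cosimp_W \<theta>]])
    then show ?thesis by (simp add: Nhc_def Nc_def)
  qed
qed

text \<open>In each dimension the map is a composite of two bijections: precomposition with the
  comparison, undone by precomposition with its inverse, and the transposition bijection.\<close>

lemma right_iso_iso:
  assumes D: "scategory D"
  shows "sset_iso (Nhc D) (Nc (Rc_cat D)) (right_iso D)"
proof (rule sset_iso_if_bij[OF _ right_iso_map[OF D]])
  show "simplicial_set (Nhc D)" unfolding Nhc_nerve by (rule cosimp.nerve_sset[OF cosimp_C])
  fix n
  obtain \<kappa> where \<kappa>: "sfun (C_cat n) (LW n) \<kappa>" "vf_comp (LW n) \<kappa> (cube_comparison n) = vf_id (LW n)"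
    "vf_comp (C_cat n) (cube_comparison n) \<kappa> = vf_id (C_cat n)" using comparison_inverse .
  have "bij_betw (\<lambda>G. vf_comp (LW n) G (cube_comparison n)) {G. sfun (C_cat n) D G} {F. sfun (LW n) D F}"
  proof (rule bij_betw_byWitness[where f' = "\<lambda>F. vf_comp (C_cat n) F \<kappa>"])
    show "\<forall>G \<in> {G. sfun (C_cat n) D G}. vf_comp (C_cat n) (vf_comp (LW n) G (cube_comparison n)) \<kappa> = G"
      by (simp add: vf_comp_assoc[OF \<kappa>(1), symmetric] \<kappa>(3) vf_comp_id_right[OF vfunctorD(7)])
    show "\<forall>F \<in> {F. sfun (LW n) D F}. vf_comp (LW n) (vf_comp (C_cat n) F \<kappa>) (cube_comparison n) = F"
      by (simp add: vf_comp_assoc[OF comparison_functor, symmetric] \<kappa>(2) vf_comp_id_right[OF vfunctorD(7)])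
    show "(\<lambda>G. vf_comp (LW n) G (cube_comparison n)) ` {G. sfun (C_cat n) D G} \<subseteq> {F. sfun (LW n) D F}"
      using vfunctor_comp[OF pcat_LW comparison_functor] by blast
    show "(\<lambda>F. vf_comp (C_cat n) F \<kappa>) ` {F. sfun (LW n) D F} \<subseteq> {G. sfun (C_cat n) D G}"
      using vfunctor_comp[OF pcat_C \<kappa>(1)] by blast
  qed
  from bij_betw_trans[OF this Lc_transpose_bij[OF vcategory_W D]]
  have "bij_betw (\<lambda>G. Lc_transpose (W_cat n) (vf_comp (LW n) G (cube_comparison n)))
      (cells (Nhc D) n) (cells (Nc (Rc_cat D)) n)"
    by (simp add: comp_def Nhc_def Nc_def simplicial_functor_def cubical_functor_def)
  then show "bij_betw (right_iso D n) (cells (Nhc D) n) (cells (Nc (Rc_cat D)) n)"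
    by (rule bij_betw_cong[THEN iffD1, rotated]) (simp add: right_iso_def)
qed

lemma right_iso_natural:
  assumes D: "scategory D" and E: "scategory E" and J: "sfun D E J"
  shows "psh_comp (Nhc D) (Nc_map (Rc_cat D) (Rc_fun D J)) (right_iso D) =
    psh_comp (Nhc D) (right_iso E) (Nhc_map D J)"
proof (rule psh_map_eqI[of _ "Nhc D"])
  fix n G assume G: "G \<in> cells (Nhc D) n"
  then have G': "sfun (C_cat n) D G" by (simp add: cells_Nhc)
  have "Lc_transpose (W_cat n) (vf_comp (LW n) (vf_comp (C_cat n) J G) (cube_comparison n)) =
      vf_comp (W_cat n) (Rc_fun D J) (Lc_transpose (W_cat n) (vf_comp (LW n) G (cube_comparison n)))"
    by (simp only: vf_comp_assoc[OF comparison_functor, symmetric]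
        Lc_transpose_post[OF vcategory_W D vfunctor_comp[OF pcat_LW comparison_functor G']])
  then show "psh_comp (Nhc D) (Nc_map (Rc_cat D) (Rc_fun D J)) (right_iso D) n G =
      psh_comp (Nhc D) (right_iso E) (Nhc_map D J) n G"
    using G G' psh_mapD(1)[OF right_iso_map[OF D] G]
    by (simp add: Nc_map_def Nhc_map_def right_iso_apply vfunctor_comp[OF pcat_C G' J])
qed simp_all

text \<open>At a simplex \<open>x\<close> both sides are the transpose of the comparison followed by
  \<open>Rig_in X n x\<close> and \<open>F\<close>; the defining property \<open>left_iso_in\<close>
  brings the left side into this form.\<close>

lemma mates:
  assumes X: "simplicial_set X" and D: "scategory D" and F: "sfun (Rig X) D F"
  shows "nerve_transpose Cube day_pure W_cat W_map X
      (Lc_transpose (Wc X) (vf_comp (Lc_cat (Wc X)) F (left_iso X))) =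
    psh_comp X (right_iso D) (nerve_transpose Delta prod_pure C_cat C_map X F)"
proof (rule psh_map_eqI[of _ X])
  fix n x assume x: "x \<in> cells X n"
  note L = LW_in_functor[OF X x]
  have "vf_comp (W_cat n) (Lc_transpose (Wc X) (vf_comp (Lc_cat (Wc X)) F (left_iso X))) (Wc_in X n x) =
      Lc_transpose (W_cat n) (vf_comp (LW n) (vf_comp (Lc_cat (Wc X)) F (left_iso X)) (LW_in X n x))"
    by (rule Lc_transpose_LW_in[OF X x])
  also have "\<dots> = Lc_transpose (W_cat n) (vf_comp (LW n) (vf_comp (C_cat n) F (Rig_in X n x)) (cube_comparison n))"
    by (simp only: vf_comp_assoc[OF L, symmetric] left_iso_in[OF X x] vf_comp_assoc[OF comparison_functor])
  also have "\<dots> = right_iso D n (vf_comp (C_cat n) F (Rig_in X n x))"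
    by (simp only: right_iso_apply[OF vfunctor_comp[OF pcat_C Rig_in_functor[OF X x] F]])
  finally show "nerve_transpose Cube day_pure W_cat W_map X
      (Lc_transpose (Wc X) (vf_comp (Lc_cat (Wc X)) F (left_iso X))) n x =
    psh_comp X (right_iso D) (nerve_transpose Delta prod_pure C_cat C_map X F) n x"
    using x by (simp add: nerve_transpose_def Wc_in_def Rig_in_def)
qed (simp_all add: nerve_transpose_def)

text \<open>The last conjunct makes precise that the isomorphism is canonical: on every simplex it
  restricts to the standard comparison. By \<open>LW_eqI\<close> this determines \<Phi> on
  simplicial sets.\<close>

theorem proposition22:
  "adjunction (LW_adj :: ('x, 'o, 'b, _, _, _) sadj) \<and>
   adjunction (CN_adj :: ('x, 'o, 'b, _, _, _) sadj) \<and>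
   (\<exists>\<Phi> \<Psi>.
      adjunction_iso (LW_adj :: ('x, 'o, 'b, _, _, _) sadj) CN_adj \<Phi> \<Psi> \<and>
      (\<forall>(X :: 'x sset) n x. simplicial_set X \<longrightarrow> x \<in> cells X n \<longrightarrow>
         vf_comp (Lc_cat (W_cat n)) (\<Phi> X) (Lc_fun (W_cat n) (Wc X) (Wc_in X n x)) =
         vf_comp (Lc_cat (W_cat n)) (Rig_in X n x) (cube_comparison n)))"
proof (intro conjI LW_adjunction CN_adjunction exI[of _ left_iso] exI[of _ right_iso])
  show "adjunction_iso (LW_adj :: ('x, 'o, 'b, _, _, _) sadj) CN_adj left_iso right_iso"
    unfolding adjunction_iso_def
  proof (intro conjI)
    show "left_nat_iso (LW_adj :: ('x, 'o, 'b, _, _, _) sadj) (CN_adj :: ('x, 'o, 'b, _, _, _) sadj) left_iso"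
      unfolding left_nat_iso_def
    proof (intro conjI allI impI)
      fix X :: "'x sset" assume X: "simplicial_set X"
      show "scat_iso (lobj (LW_adj :: ('x, 'o, 'b, _, _, _) sadj) X) (lobj (CN_adj :: ('x, 'o, 'b, _, _, _) sadj) X) (left_iso X)"
        by (rule left_iso_inverse[OF X])
          (auto simp: scat_iso_def LW_adj_def CN_adj_def simplicial_functor_def left_iso_functor[OF X])
    next
      fix X Y :: "'x sset" and f assume "simplicial_set X" "simplicial_set Y" "simplicial_map X Y f"
      from left_iso_natural[OF this]
      show "vf_comp (lobj (LW_adj :: ('x, 'o, 'b, _, _, _) sadj) X)
          (lmap (CN_adj :: ('x, 'o, 'b, _, _, _) sadj) X Y f) (left_iso X) =
        vf_comp (lobj (LW_adj :: ('x, 'o, 'b, _, _, _) sadj) X) (left_iso Y)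
          (lmap (LW_adj :: ('x, 'o, 'b, _, _, _) sadj) X Y f)"
        by (simp add: LW_adj_def CN_adj_def)
    qed
    show "right_nat_iso (LW_adj :: ('x, 'o, 'b, _, _, _) sadj) (CN_adj :: ('x, 'o, 'b, _, _, _) sadj) right_iso"
      unfolding right_nat_iso_def simplicial_category_def simplicial_functor_def
      using right_iso_iso right_iso_natural
      by (auto simp: LW_adj_def CN_adj_def simp del: split_paired_All)
    show "\<forall>X D F. simplicial_set X \<longrightarrow> simplicial_category D \<longrightarrow>
        simplicial_functor (lobj (CN_adj :: ('x, 'o, 'b, _, _, _) sadj) X) D F \<longrightarrow>
        transp (LW_adj :: ('x, 'o, 'b, _, _, _) sadj) X D
          (vf_comp (lobj (LW_adj :: ('x, 'o, 'b, _, _, _) sadj) X) F (left_iso X)) =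
        psh_comp X (right_iso D) (transp (CN_adj :: ('x, 'o, 'b, _, _, _) sadj) X D F)"
      unfolding simplicial_category_def simplicial_functor_def
      using mates by (auto simp: LW_adj_def CN_adj_def simp del: split_paired_All)
  qed
  show "\<forall>(X :: 'x sset) n x. simplicial_set X \<longrightarrow> x \<in> cells X n \<longrightarrow>
         vf_comp (Lc_cat (W_cat n)) (left_iso X) (Lc_fun (W_cat n) (Wc X) (Wc_in X n x)) =
         vf_comp (Lc_cat (W_cat n)) (Rig_in X n x) (cube_comparison n)"
    by (intro allI impI left_iso_in)
qed

end
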